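(* Let $M$ be an $n$-dimensional smooth manifold and let $(\mathcal{E},\phi,\nabla^{\mathcal{E}})$ be a coherent tangent bundle over $M$ with $\operatorname{rank}\phi\ge 3$ almost everywhere on $M$. Suppose that $\operatorname{tr}\{\eta\mapsto R^{\nabla^{\mathcal{E}}}(X,Y)\eta\}=0$ for all $X,Y\in\Gamma(TM)$ (trace over $\eta\in\mathcal{E}$). Then the following conditions are equivalent: (i) the coherent tangent bundle $(\mathcal{E},\phi,\nabla^{\mathcal{E}})$ is projectively flat; (ii) there exists a tensor field $A\in\Gamma(T^*M\otimes\mathcal{E}^* )$ such that, for all $X,Y\in\Gamma(TM)$ and $\eta\in\Gamma(\mathcal{E})$, $$R^{\nabla^{\mathcal{E}}}(X,Y)\eta=\frac{1}{n-1}\{A(Y,\eta)\phi(X)-A(X,\eta)\phi(Y)\}.$$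
   Context: All objects are $C^\infty$. $R^{\nabla}(X,Y)=\nabla_X\nabla_Y-\nabla_Y\nabla_X-\nabla_{[X,Y]}$ is the curvature of a connection on a vector bundle. Let $\mathcal{E}$ be a rank $n$ vector bundle over $M$ and $\phi:TM\to\mathcal{E}$ a bundle map over $\mathrm{id}_M$ (fiberwise linear; the rank of $\phi_p$ may vary with $p$). A connection $\nabla^{\mathcal{E}}$ on $\mathcal{E}$ is relatively torsion-free with respect to $\phi$ if $\nabla^{\mathcal{E}}_X\phi(Y)-\nabla^{\mathcal{E}}_Y\phi(X)-\phi([X,Y])=0$ for all $X,Y\in\Gamma(TM)$; then $(\mathcal{E},\phi,\nabla^{\mathcal{E}})$ is called a coherent tangent bundle. Two connections $\nabla^{\mathcal{E}},\widehat\nabla^{\mathcal{E}}$, both relatively torsion-free with respect to $\phi$, are projectively equivalent with respect to $\phi$ if there is $\rho\in\Gamma(\mathcal{E}^* )$ with $\widehat\nabla^{\mathcal{E}}_X\eta=\nabla^{\mathcal{E}}_X\eta+\rho(\phi(X))\eta+\rho(\eta)\phi(X)$ for all $X\in\Gamma(TM)$, $\eta\in\Gamma(\mathcal{E})$. $\nabla^{\mathcal{E}}$ (equivalently, the coherent tangent bundle $(\mathcal{E},\phi,\nabla^{\mathcal{E}})$) is projectively flat if every point of $M$ has a neighborhood on which $\nabla^{\mathcal{E}}$ is projectively equivalent with respect to $\phi$ to a connection with vanishing curvature. *)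

theory Defs
  imports "HOL-Analysis.Analysis" "HOL-Library.Function_Algebras"
begin

text \<open>Tangent vectors are functionals on functions, so function spaces are made real vector
  spaces under the pointwise operations.\<close>

instantiation "fun" :: (type, real_vector) real_vector
begin

definition scaleR_fun :: "real \<Rightarrow> ('a \<Rightarrow> 'b) \<Rightarrow> 'a \<Rightarrow> 'b"
  where "scaleR_fun c f = (\<lambda>x. c *\<^sub>R f x)"

instance
  by standard (auto simp: scaleR_fun_def fun_eq_iff scaleR_add_right scaleR_add_left)

end

section \<open>Smooth functions and smooth manifolds\<close>

primrec Ck_on :: "nat \<Rightarrow> 'a::real_normed_vector set \<Rightarrow> ('a \<Rightarrow> 'b::real_normed_vector) \<Rightarrow> bool" where
  "Ck_on 0 S f \<longleftrightarrow> continuous_on S f"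
| "Ck_on (Suc k) S f \<longleftrightarrow>
     (\<forall>x\<in>S. f differentiable (at x)) \<and> (\<forall>v. Ck_on k S (\<lambda>x. frechet_derivative f (at x) v))"

text \<open>Only meant for open \<open>S\<close> in a finite-dimensional space.\<close>

definition smooth_on :: "'a::real_normed_vector set \<Rightarrow> ('a \<Rightarrow> 'b::real_normed_vector) \<Rightarrow> bool"
  where "smooth_on S f \<longleftrightarrow> (\<forall>k. Ck_on k S f)"

text \<open>A chart is a domain together with a coordinate map; values of the coordinate map outside the
  domain carry no information.  The point set of the manifold is the whole type \<open>'m\<close>, its
  dimension is \<open>CARD('n)\<close>.  An atlas need not be maximal: all notions below depend only on the
  smooth structure it generates.\<close>

type_synonym ('m, 'n) chart = "'m set \<times> ('m \<Rightarrow> real ^ 'n)"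

definition is_chart :: "('m::topological_space, 'n::finite) chart \<Rightarrow> bool"
  where "is_chart c \<longleftrightarrow> (case c of (U, x) \<Rightarrow>
    open U \<and> open (x ` U) \<and> (\<exists>y. homeomorphism U (x ` U) x y))"

definition smooth_manifold ::
  "('m::{t2_space, second_countable_topology}, 'n::finite) chart set \<Rightarrow> bool"
  where "smooth_manifold \<A> \<longleftrightarrow>
    (\<forall>c\<in>\<A>. is_chart c) \<and> \<Union>(fst ` \<A>) = UNIV \<and>
    (\<forall>(U, x)\<in>\<A>. \<forall>(V, y)\<in>\<A>. smooth_on (x ` (U \<inter> V)) (y \<circ> inv_into U x))"

definition smooth_fun_on ::
  "('m::topological_space, 'n::finite) chart set \<Rightarrow> 'm set \<Rightarrow> ('m \<Rightarrow> 'b::real_normed_vector) \<Rightarrow> bool"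
  where "smooth_fun_on \<A> W f \<longleftrightarrow>
    (\<forall>(U, x)\<in>\<A>. smooth_on (x ` (U \<inter> W)) (f \<circ> inv_into U x))"

definition smooth_near ::
  "('m::topological_space, 'n::finite) chart set \<Rightarrow> 'm \<Rightarrow> ('m \<Rightarrow> 'b::real_normed_vector) \<Rightarrow> bool"
  where "smooth_near \<A> p f \<longleftrightarrow> (\<exists>W. open W \<and> p \<in> W \<and> smooth_fun_on \<A> W f)"

definition manifold_ae ::
  "('m::topological_space, 'n::finite) chart set \<Rightarrow> ('m \<Rightarrow> bool) \<Rightarrow> bool"
  where "manifold_ae \<A> P \<longleftrightarrow> (\<forall>(U, x)\<in>\<A>. negligible (x ` {p\<in>U. \<not> P p}))"

section \<open>Vector bundles\<close>

definition linear_on_space ::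
  "'a::real_vector set \<Rightarrow> ('a \<Rightarrow> 'b::real_vector) \<Rightarrow> bool"
  where "linear_on_space V f \<longleftrightarrow>
    (\<forall>u\<in>V. \<forall>v\<in>V. f (u + v) = f u + f v) \<and> (\<forall>c. \<forall>v\<in>V. f (c *\<^sub>R v) = c *\<^sub>R f v)"

text \<open>A vector bundle of rank \<open>CARD('n)\<close> is a family of fibres with a set of local trivializations
  \<open>(U, \<theta>)\<close>, where \<open>\<theta> p\<close> maps the fibre over \<open>p \<in> U\<close> isomorphically onto \<open>real ^ 'n\<close>.  The fibres
  are subspaces of one ambient vector space type, which only supplies the vector operations: their
  mutual position in it is irrelevant, and the smooth structure of the total space is the one
  defined by the trivializations.\<close>

record ('m, 'e, 'n) vbundle =
  fibre :: "'m \<Rightarrow> 'e set"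
  trivs :: "('m set \<times> ('m \<Rightarrow> 'e \<Rightarrow> real ^ 'n)) set"

definition vector_bundle ::
  "('m::topological_space, 'n::finite) chart set \<Rightarrow> ('m, 'e::real_vector, 'n) vbundle \<Rightarrow> bool"
  where "vector_bundle \<A> E \<longleftrightarrow>
    (\<forall>p. subspace (fibre E p)) \<and>
    \<Union>(fst ` trivs E) = UNIV \<and>
    (\<forall>(U, \<theta>)\<in>trivs E. open U \<and>
       (\<forall>p\<in>U. linear_on_space (fibre E p) (\<theta> p) \<and> bij_betw (\<theta> p) (fibre E p) UNIV)) \<and>
    (\<forall>(U, \<theta>)\<in>trivs E. \<forall>(V, \<theta>')\<in>trivs E. \<forall>w.
       smooth_fun_on \<A> (U \<inter> V) (\<lambda>p. \<theta>' p (inv_into (fibre E p) (\<theta> p) w)))"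

text \<open>A section over an open set \<open>W\<close> is represented by its extension by zero, so that
  \<open>sections \<A> E W\<close> is in bijection with the smooth sections of the restriction of \<open>E\<close> to \<open>W\<close>.\<close>

definition sections ::
  "('m::topological_space, 'n::finite) chart set \<Rightarrow> ('m, 'e::real_vector, 'n) vbundle
    \<Rightarrow> 'm set \<Rightarrow> ('m \<Rightarrow> 'e) set"
  where "sections \<A> E W = {s.
    (\<forall>p\<in>W. s p \<in> fibre E p) \<and> (\<forall>p. p \<notin> W \<longrightarrow> s p = 0) \<and>
    (\<forall>(U, \<theta>)\<in>trivs E. smooth_fun_on \<A> (U \<inter> W) (\<lambda>p. \<theta> p (s p)))}"

definition restrict_section :: "'m set \<Rightarrow> ('m \<Rightarrow> 'e::zero) \<Rightarrow> 'm \<Rightarrow> 'e"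
  where "restrict_section W s = (\<lambda>p. if p \<in> W then s p else 0)"

text \<open>Smooth bundle maps over the identity, and smooth sections over \<open>W\<close> of \<open>E\<^sup>*\<close> and of
  \<open>F\<^sup>* \<otimes> E\<^sup>*\<close>; smoothness means smooth components with respect to the local trivializations.\<close>

definition bundle_map ::
  "('m::topological_space, 'n::finite) chart set \<Rightarrow> ('m, 'f::real_vector, 'n) vbundle
    \<Rightarrow> ('m, 'e::real_vector, 'n) vbundle \<Rightarrow> ('m \<Rightarrow> 'f \<Rightarrow> 'e) \<Rightarrow> bool"
  where "bundle_map \<A> F E \<phi> \<longleftrightarrow>
    (\<forall>p. linear_on_space (fibre F p) (\<phi> p) \<and> \<phi> p ` fibre F p \<subseteq> fibre E p) \<and>
    (\<forall>(U, \<tau>)\<in>trivs F. \<forall>(V, \<theta>)\<in>trivs E. \<forall>w.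
       smooth_fun_on \<A> (U \<inter> V) (\<lambda>p. \<theta> p (\<phi> p (inv_into (fibre F p) (\<tau> p) w))))"

definition dual_section ::
  "('m::topological_space, 'n::finite) chart set \<Rightarrow> ('m, 'e::real_vector, 'n) vbundle
    \<Rightarrow> 'm set \<Rightarrow> ('m \<Rightarrow> 'e \<Rightarrow> real) \<Rightarrow> bool"
  where "dual_section \<A> E W \<rho> \<longleftrightarrow>
    (\<forall>p\<in>W. linear_on_space (fibre E p) (\<rho> p)) \<and>
    (\<forall>(U, \<theta>)\<in>trivs E. \<forall>w.
       smooth_fun_on \<A> (U \<inter> W) (\<lambda>p. \<rho> p (inv_into (fibre E p) (\<theta> p) w)))"

definition dual_tensor_section ::
  "('m::topological_space, 'n::finite) chart set \<Rightarrow> ('m, 'f::real_vector, 'n) vbundle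
    \<Rightarrow> ('m, 'e::real_vector, 'n) vbundle \<Rightarrow> 'm set \<Rightarrow> ('m \<Rightarrow> 'f \<Rightarrow> 'e \<Rightarrow> real) \<Rightarrow> bool"
  where "dual_tensor_section \<A> F E W A \<longleftrightarrow>
    (\<forall>p\<in>W. (\<forall>v\<in>fibre F p. linear_on_space (fibre E p) (\<lambda>e. A p v e)) \<and>
            (\<forall>e\<in>fibre E p. linear_on_space (fibre F p) (\<lambda>v. A p v e))) \<and>
    (\<forall>(U, \<tau>)\<in>trivs F. \<forall>(V, \<theta>)\<in>trivs E. \<forall>w z.
       smooth_fun_on \<A> (U \<inter> V \<inter> W)
         (\<lambda>p. A p (inv_into (fibre F p) (\<tau> p) w) (inv_into (fibre E p) (\<theta> p) z)))"

text \<open>The trace of an endomorphism of a fibre; it does not depend on the chosen trivialization.\<close>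

definition fibre_trace ::
  "('m, 'e::real_vector, 'n::finite) vbundle \<Rightarrow> 'm \<Rightarrow> ('e \<Rightarrow> 'e) \<Rightarrow> real"
  where "fibre_trace E p L =
    (let (U, \<theta>) = (SOME t. t \<in> trivs E \<and> p \<in> fst t)
     in trace (matrix (\<lambda>w. \<theta> p (L (inv_into (fibre E p) (\<theta> p) w)))))"

section \<open>The tangent bundle\<close>

type_synonym 'm tangent = "('m \<Rightarrow> real) \<Rightarrow> real"

text \<open>Tangent vectors at \<open>p\<close> are the derivations on functions smooth near \<open>p\<close>, with value \<open>0\<close> on all
  other functions.  They are automatically local: if \<open>f = g\<close> near \<open>p\<close>, then \<open>f - g = h (f - g)\<close>
  with \<open>h = 0\<close> near \<open>p\<close>, so \<open>v f = v g\<close>.  Hence these are exactly the derivations of germs.\<close>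

definition tangent_space ::
  "('m::topological_space, 'n::finite) chart set \<Rightarrow> 'm \<Rightarrow> 'm tangent set"
  where "tangent_space \<A> p = {v.
    (\<forall>f. \<not> smooth_near \<A> p f \<longrightarrow> v f = 0) \<and>
    (\<forall>f g. smooth_near \<A> p f \<longrightarrow> smooth_near \<A> p g \<longrightarrow>
       v (\<lambda>q. f q + g q) = v f + v g) \<and>
    (\<forall>c f. smooth_near \<A> p f \<longrightarrow> v (\<lambda>q. c * f q) = c * v f) \<and>
    (\<forall>f g. smooth_near \<A> p f \<longrightarrow> smooth_near \<A> p g \<longrightarrow>
       v (\<lambda>q. f q * g q) = v f * g p + f p * v g)}"

definition tangent_bundle ::
  "('m::topological_space, 'n::finite) chart set \<Rightarrow> ('m, 'm tangent, 'n) vbundle"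
  where "tangent_bundle \<A> = \<lparr>
    fibre = tangent_space \<A>,
    trivs = (\<lambda>(U, x). (U, \<lambda>p v. \<chi> i. v (\<lambda>q. x q $ i))) ` \<A>\<rparr>"

abbreviation vector_fields ::
  "('m::topological_space, 'n::finite) chart set \<Rightarrow> 'm set \<Rightarrow> ('m \<Rightarrow> 'm tangent) set"
  where "vector_fields \<A> W \<equiv> sections \<A> (tangent_bundle \<A>) W"

definition lie_bracket ::
  "('m::topological_space, 'n::finite) chart set
    \<Rightarrow> ('m \<Rightarrow> 'm tangent) \<Rightarrow> ('m \<Rightarrow> 'm tangent) \<Rightarrow> 'm \<Rightarrow> 'm tangent"
  where "lie_bracket \<A> X Y = (\<lambda>p f.
    if smooth_near \<A> p f then X p (\<lambda>q. Y q f) - Y p (\<lambda>q. X q f) else 0)"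

section \<open>Connections\<close>

type_synonym ('m, 'e) connection = "('m \<Rightarrow> 'm tangent) \<Rightarrow> ('m \<Rightarrow> 'e) \<Rightarrow> 'm \<Rightarrow> 'e"

text \<open>A connection on the restriction of \<open>E\<close> to an open set \<open>W\<close>, as an operator on sections over \<open>W\<close>;
  \<open>W = UNIV\<close> gives connections on \<open>E\<close>.\<close>

definition connection_on ::
  "('m::topological_space, 'n::finite) chart set \<Rightarrow> ('m, 'e::real_vector, 'n) vbundle
    \<Rightarrow> 'm set \<Rightarrow> ('m, 'e) connection \<Rightarrow> bool"
  where "connection_on \<A> E W D \<longleftrightarrow>
    (\<forall>X\<in>vector_fields \<A> W. \<forall>\<eta>\<in>sections \<A> E W. D X \<eta> \<in> sections \<A> E W) \<and>
    (\<forall>X\<in>vector_fields \<A> W. \<forall>Y\<in>vector_fields \<A> W. \<forall>\<eta>\<in>sections \<A> E W.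
       D (\<lambda>p. X p + Y p) \<eta> = (\<lambda>p. D X \<eta> p + D Y \<eta> p)) \<and>
    (\<forall>f. \<forall>X\<in>vector_fields \<A> W. \<forall>\<eta>\<in>sections \<A> E W. smooth_fun_on \<A> W f \<longrightarrow>
       D (\<lambda>p. f p *\<^sub>R X p) \<eta> = (\<lambda>p. f p *\<^sub>R D X \<eta> p)) \<and>
    (\<forall>X\<in>vector_fields \<A> W. \<forall>\<eta>\<in>sections \<A> E W. \<forall>\<zeta>\<in>sections \<A> E W.
       D X (\<lambda>p. \<eta> p + \<zeta> p) = (\<lambda>p. D X \<eta> p + D X \<zeta> p)) \<and>
    (\<forall>f. \<forall>X\<in>vector_fields \<A> W. \<forall>\<eta>\<in>sections \<A> E W. smooth_fun_on \<A> W f \<longrightarrow>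
       D X (\<lambda>p. f p *\<^sub>R \<eta> p) = (\<lambda>p. X p f *\<^sub>R \<eta> p + f p *\<^sub>R D X \<eta> p))"

definition restricts_to ::
  "('m::topological_space, 'n::finite) chart set \<Rightarrow> ('m, 'e::real_vector, 'n) vbundle
    \<Rightarrow> 'm set \<Rightarrow> ('m, 'e) connection \<Rightarrow> ('m, 'e) connection \<Rightarrow> bool"
  where "restricts_to \<A> E W D D' \<longleftrightarrow>
    connection_on \<A> E W D' \<and>
    (\<forall>X\<in>vector_fields \<A> UNIV. \<forall>\<eta>\<in>sections \<A> E UNIV.
       D' (restrict_section W X) (restrict_section W \<eta>) = restrict_section W (D X \<eta>))"

definition curvature ::
  "('m::topological_space, 'n::finite) chart set \<Rightarrow> ('m, 'e::real_vector) connection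
    \<Rightarrow> ('m \<Rightarrow> 'm tangent) \<Rightarrow> ('m \<Rightarrow> 'm tangent) \<Rightarrow> ('m \<Rightarrow> 'e) \<Rightarrow> 'm \<Rightarrow> 'e"
  where "curvature \<A> D X Y \<eta> =
    (\<lambda>p. D X (D Y \<eta>) p - D Y (D X \<eta>) p - D (lie_bracket \<A> X Y) \<eta> p)"

definition flat_on ::
  "('m::topological_space, 'n::finite) chart set \<Rightarrow> ('m, 'e::real_vector, 'n) vbundle
    \<Rightarrow> 'm set \<Rightarrow> ('m, 'e) connection \<Rightarrow> bool"
  where "flat_on \<A> E W D \<longleftrightarrow>
    (\<forall>X\<in>vector_fields \<A> W. \<forall>Y\<in>vector_fields \<A> W. \<forall>\<eta>\<in>sections \<A> E W.
       curvature \<A> D X Y \<eta> = (\<lambda>p. 0))"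

text \<open>The endomorphism \<open>\<eta> \<mapsto> R(X,Y)\<eta>\<close> of the fibre over \<open>p\<close>: since the curvature of a connection on
  \<open>E\<close> is tensorial, the value at \<open>p\<close> does not depend on the section extending \<open>e\<close>.\<close>

definition curvature_endo ::
  "('m::topological_space, 'n::finite) chart set \<Rightarrow> ('m, 'e::real_vector, 'n) vbundle
    \<Rightarrow> ('m, 'e) connection \<Rightarrow> ('m \<Rightarrow> 'm tangent) \<Rightarrow> ('m \<Rightarrow> 'm tangent) \<Rightarrow> 'm \<Rightarrow> 'e \<Rightarrow> 'e"
  where "curvature_endo \<A> E D X Y p e =
    curvature \<A> D X Y (SOME \<eta>. \<eta> \<in> sections \<A> E UNIV \<and> \<eta> p = e) p"

section \<open>Coherent tangent bundles and projective flatness\<close>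

definition rel_torsion_free_on ::
  "('m::topological_space, 'n::finite) chart set \<Rightarrow> 'm set
    \<Rightarrow> ('m \<Rightarrow> 'm tangent \<Rightarrow> 'e::real_vector) \<Rightarrow> ('m, 'e) connection \<Rightarrow> bool"
  where "rel_torsion_free_on \<A> W \<phi> D \<longleftrightarrow>
    (\<forall>X\<in>vector_fields \<A> W. \<forall>Y\<in>vector_fields \<A> W.
       (\<lambda>p. D X (\<lambda>q. \<phi> q (Y q)) p - D Y (\<lambda>q. \<phi> q (X q)) p - \<phi> p (lie_bracket \<A> X Y p))
         = (\<lambda>p. 0))"

definition coherent_tangent_bundle ::
  "('m::topological_space, 'n::finite) chart set \<Rightarrow> ('m, 'e::real_vector, 'n) vbundle
    \<Rightarrow> ('m \<Rightarrow> 'm tangent \<Rightarrow> 'e) \<Rightarrow> ('m, 'e) connection \<Rightarrow> bool"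
  where "coherent_tangent_bundle \<A> E \<phi> D \<longleftrightarrow>
    vector_bundle \<A> E \<and> bundle_map \<A> (tangent_bundle \<A>) E \<phi> \<and>
    connection_on \<A> E UNIV D \<and> rel_torsion_free_on \<A> UNIV \<phi> D"

definition rank_at ::
  "('m::topological_space, 'n::finite) chart set
    \<Rightarrow> ('m \<Rightarrow> 'm tangent \<Rightarrow> 'e::real_vector) \<Rightarrow> 'm \<Rightarrow> nat"
  where "rank_at \<A> \<phi> p = dim (\<phi> p ` tangent_space \<A> p)"

definition projectively_equivalent_on ::
  "('m::topological_space, 'n::finite) chart set \<Rightarrow> ('m, 'e::real_vector, 'n) vbundle \<Rightarrow> 'm set
    \<Rightarrow> ('m \<Rightarrow> 'm tangent \<Rightarrow> 'e) \<Rightarrow> ('m, 'e) connection \<Rightarrow> ('m, 'e) connection \<Rightarrow> bool"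
  where "projectively_equivalent_on \<A> E W \<phi> D D' \<longleftrightarrow>
    connection_on \<A> E W D \<and> rel_torsion_free_on \<A> W \<phi> D \<and>
    connection_on \<A> E W D' \<and> rel_torsion_free_on \<A> W \<phi> D' \<and>
    (\<exists>\<rho>. dual_section \<A> E W \<rho> \<and>
      (\<forall>X\<in>vector_fields \<A> W. \<forall>\<eta>\<in>sections \<A> E W. \<forall>p\<in>W.
         D' X \<eta> p = D X \<eta> p + \<rho> p (\<phi> p (X p)) *\<^sub>R \<eta> p + \<rho> p (\<eta> p) *\<^sub>R \<phi> p (X p)))"

text \<open>The connection \<open>DU\<close> below is the (unique) restriction of \<open>D\<close> to \<open>U\<close>.\<close>

definition projectively_flat ::
  "('m::topological_space, 'n::finite) chart set \<Rightarrow> ('m, 'e::real_vector, 'n) vbundle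
    \<Rightarrow> ('m \<Rightarrow> 'm tangent \<Rightarrow> 'e) \<Rightarrow> ('m, 'e) connection \<Rightarrow> bool"
  where "projectively_flat \<A> E \<phi> D \<longleftrightarrow>
    (\<forall>p. \<exists>U. open U \<and> p \<in> U \<and>
      (\<exists>DU D'. restricts_to \<A> E U D DU \<and>
         projectively_equivalent_on \<A> E U \<phi> DU D' \<and> flat_on \<A> E U D'))"

end

theory Submission
  imports Defs "HOL-Computational_Algebra.Polynomial"
begin

text \<open>
  Let \<open>\<nabla>'\<close> arise from \<open>\<nabla>\<close> by the projective change with \<open>\<rho>\<close>.  Its curvature is
  \<open>R'(X,Y)\<eta> = R(X,Y)\<eta> + d(\<rho> \<circ> \<phi>)(X,Y) \<eta> + P(X,\<eta>) \<phi>(Y) - P(Y,\<eta>) \<phi>(X)\<close>,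
  where \<open>P(X,\<eta>) = (\<nabla>\<^sub>X \<rho>)(\<eta>) - \<rho>(\<phi>(X)) \<rho>(\<eta>)\<close> is called the Schouten tensor of \<open>\<rho>\<close> below
  (\<open>curv_proj_change\<close>); relative torsion-freeness removes the derivatives of \<open>\<phi>\<close>.

  If \<open>R' = 0\<close>, the trace over \<open>\<eta>\<close> shows, with \<open>tr R = 0\<close>, that \<open>d(\<rho> \<circ> \<phi>) = 0\<close>, so \<open>R\<close> has the required form
  with \<open>A = (n - 1) P\<close> (\<open>curv_of_flat_proj_change\<close>, \<open>local_tensor\<close>).  Where \<open>\<phi>\<close> has rank at least \<open>2\<close> the tensor
  is determined by \<open>R\<close>; such points are dense, so the local tensors agree and glue (\<open>tensor_unique\<close>).

  Conversely let \<open>A\<close> be given and put \<open>B = A / (n - 1)\<close>.  It suffices to solve \<open>P = B\<close> for \<open>\<rho>\<close> near each point.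
  This is an overdetermined Riccati system.  Writing \<open>\<rho> = \<tau> / s\<close> makes it linear: \<open>(\<tau>, s)\<close> has to be parallel
  for the tractor connection on the sum of the dual bundle and a trivial line bundle.  This connection is
  flat (\<open>tractor_flat\<close>), for two reasons.  The trace condition makes \<open>B(X, \<phi>(Y))\<close> symmetric.  The second
  Bianchi identity, with \<open>R\<close> of the given form, leaves a relation
  \<open>C(X,Y,\<eta>) \<phi>(Z) + C(Y,Z,\<eta>) \<phi>(X) + C(Z,X,\<eta>) \<phi>(Y) = 0\<close>, where \<open>C\<close> is the exterior covariant derivative of
  \<open>B\<close>; at points of rank at least \<open>3\<close> one can choose \<open>Z\<close> such that \<open>\<phi>(Z)\<close> is not a combination of \<open>\<phi>(X)\<close> and
  \<open>\<phi>(Y)\<close>, so that \<open>C = 0\<close> there, and everywhere by continuity (\<open>codazzi_zero\<close>).  A flat connection has a parallel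
  section with any prescribed value at a point, defined near it (\<open>flat_imp_parallel_section\<close>), here \<open>(0, 1)\<close>, and
  \<open>\<rho> = \<tau> / s\<close> is defined where \<open>s > 0\<close> (\<open>exists_flat_proj_change\<close>).

  These arguments take place on open subsets of Euclidean space.  They reach the manifold through
  connection forms: in a chart and a trivialization every connection is \<open>\<eta> \<mapsto> d\<eta>(X) + \<Gamma>(X) \<eta>\<close>
  with smooth \<open>\<Gamma>\<close> (\<open>exists_representation\<close>), and conversely every smooth \<open>\<Gamma>\<close> defines a connection over the
  coordinate neighbourhood (\<open>connection_on_conn_of\<close>).  Since vector fields and sections are given over the whole
  domain of the connection, cut-off functions are needed to pass between local and global ones.
\<close>

section \<open>Calculus of smooth functions\<close>

lemma frechet_derivative_cong_open:
  assumes "open S" "x \<in> S" "\<And>y. y \<in> S \<Longrightarrow> f y = g y"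
  shows "frechet_derivative f (at x) = frechet_derivative g (at x)"
proof -
  have "(f has_derivative d) (at x) \<longleftrightarrow> (g has_derivative d) (at x)" for d
    using has_derivative_transform_within_open[OF _ assms(1,2), of f d UNIV g]
      has_derivative_transform_within_open[OF _ assms(1,2), of g d UNIV f] assms(3) by auto
  then show ?thesis unfolding frechet_derivative_def by simp
qed

lemma differentiable_cong_open:
  assumes "open S" "x \<in> S" "\<And>y. y \<in> S \<Longrightarrow> f y = g y"
  shows "f differentiable (at x) \<longleftrightarrow> g differentiable (at x)"
  unfolding differentiable_def
  using has_derivative_transform_within_open[OF _ assms(1,2), of f _ UNIV g]
    has_derivative_transform_within_open[OF _ assms(1,2), of g _ UNIV f] assms(3) by auto

lemma Ck_on_cong:
  assumes "open S" "\<And>x. x \<in> S \<Longrightarrow> f x = g x"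
  shows "Ck_on k S f \<longleftrightarrow> Ck_on k S g"
  using assms(2)
proof (induction k arbitrary: f g)
  case 0
  then show ?case by (simp cong: continuous_on_cong)
next
  case (Suc k)
  have "Ck_on k S (\<lambda>x. frechet_derivative f (at x) v) \<longleftrightarrow>
        Ck_on k S (\<lambda>x. frechet_derivative g (at x) v)" for v
    by (rule Suc.IH) (use frechet_derivative_cong_open[OF assms(1)] Suc.prems in metis)
  moreover have "f differentiable (at x) \<longleftrightarrow> g differentiable (at x)" if "x \<in> S" for x
    using differentiable_cong_open[OF assms(1) that] Suc.prems by blast
  ultimately show ?case unfolding Ck_on.simps by blast
qed

lemma Ck_on_subset: "Ck_on k S f \<Longrightarrow> T \<subseteq> S \<Longrightarrow> Ck_on k T f"
proof (induction k arbitrary: f)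
  case 0
  then show ?case unfolding Ck_on.simps by (rule continuous_on_subset)
next
  case (Suc k)
  then show ?case unfolding Ck_on.simps by blast
qed

lemma Ck_on_Suc_imp: "Ck_on (Suc k) S f \<Longrightarrow> Ck_on k S f"
proof (induction k arbitrary: f)
  case 0
  then show ?case
    by (simp add: differentiable_at_imp_differentiable_on differentiable_imp_continuous_on)
next
  case (Suc k)
  then show ?case by (metis Ck_on.simps(2))
qed

lemma Ck_on_continuous_on: "Ck_on k S f \<Longrightarrow> continuous_on S f"
proof (induction k)
  case (Suc k)
  then show ?case by (blast dest: Ck_on_Suc_imp)
qed simp

lemma Ck_on_SucI:
  assumes "open S" "\<And>x. x \<in> S \<Longrightarrow> (f has_derivative f' x) (at x)"
    "\<And>v. Ck_on k S (\<lambda>x. f' x v)"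
  shows "Ck_on (Suc k) S f"
proof -
  have "Ck_on k S (\<lambda>x. frechet_derivative f (at x) v)" for v
  proof -
    have "f' x v = frechet_derivative f (at x) v" if "x \<in> S" for x
      using frechet_derivative_at[OF assms(2)[OF that]] by simp
    then show ?thesis by (rule Ck_on_cong[OF assms(1), THEN iffD1, OF _ assms(3)])
  qed
  then show ?thesis using assms(2) unfolding Ck_on.simps differentiable_def by blast
qed

lemma Ck_on_has_derivative:
  "Ck_on (Suc k) S f \<Longrightarrow> x \<in> S \<Longrightarrow> (f has_derivative frechet_derivative f (at x)) (at x)"
  by (simp add: frechet_derivative_works)

lemma Ck_on_Union:
  assumes "\<And>N. N \<in> \<N> \<Longrightarrow> open N \<and> Ck_on k N f"
  shows "Ck_on k (\<Union>\<N>) f"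
  using assms
proof (induction k arbitrary: f)
  case 0
  then show ?case by (simp add: continuous_on_open_Union)
next
  case (Suc k)
  have "Ck_on k (\<Union>\<N>) (\<lambda>x. frechet_derivative f (at x) v)" for v
    by (rule Suc.IH) (use Suc.prems in simp)
  moreover have "f differentiable (at x)" if "x \<in> \<Union>\<N>" for x
    using Suc.prems that by (meson Ck_on.simps(2) UnionE)
  ultimately show ?case by simp
qed

lemma Ck_on_const:
  assumes "open S" shows "Ck_on k S (\<lambda>x. c)"
proof (induction k arbitrary: c)
  case (Suc k)
  have "Ck_on k S (\<lambda>x. 0 :: 'b)" by (rule Suc.IH)
  then show ?case
    by (intro Ck_on_SucI[where f'="\<lambda>x v. 0"] assms) simp_all
qed simp

lemma Ck_on_bounded_linear:
  assumes "open S" "bounded_linear L" "Ck_on k S f"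
  shows "Ck_on k S (\<lambda>x. L (f x))"
  using assms(3)
proof (induction k arbitrary: f)
  case 0
  then show ?case using bounded_linear.continuous_on[OF assms(2)] by (simp only: Ck_on.simps)
next
  case (Suc k)
  show ?case
  proof (rule Ck_on_SucI[where f'="\<lambda>x v. L (frechet_derivative f (at x) v)", OF assms(1)])
    show "((\<lambda>x. L (f x)) has_derivative (\<lambda>v. L (frechet_derivative f (at x) v))) (at x)" if "x \<in> S" for x
      by (rule bounded_linear.has_derivative[OF assms(2) Ck_on_has_derivative[OF Suc.prems that]])
    show "Ck_on k S (\<lambda>x. L (frechet_derivative f (at x) v))" for v
      by (rule Suc.IH) (use Suc.prems in simp)
  qed
qed

lemma Ck_on_id:
  assumes "open S" shows "Ck_on k S (\<lambda>x. x)"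
proof (cases k)
  case (Suc m)
  have "Ck_on m S (\<lambda>x. v)" for v :: 'a by (rule Ck_on_const[OF assms])
  then show ?thesis unfolding Suc
    by (intro Ck_on_SucI[where f'="\<lambda>x v. v"] assms has_derivative_ident)
next
  case 0
  show ?thesis unfolding 0 by (simp only: Ck_on.simps continuous_on_id)
qed

lemma Ck_on_add:
  assumes "open S" "Ck_on k S f" "Ck_on k S g"
  shows "Ck_on k S (\<lambda>x. f x + g x)"
  using assms(2,3)
proof (induction k arbitrary: f g)
  case 0
  then show ?case using continuous_on_add by (simp only: Ck_on.simps) blast
next
  case (Suc k)
  show ?case
  proof (rule Ck_on_SucI[where f'="\<lambda>x v. frechet_derivative f (at x) v + frechet_derivative g (at x) v", OF assms(1)])
    show "((\<lambda>x. f x + g x) has_derivative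
        (\<lambda>v. frechet_derivative f (at x) v + frechet_derivative g (at x) v)) (at x)" if "x \<in> S" for x
      using Suc.prems that by (intro has_derivative_add Ck_on_has_derivative)
    show "Ck_on k S (\<lambda>x. frechet_derivative f (at x) v + frechet_derivative g (at x) v)" for v
      by (rule Suc.IH) (use Suc.prems in simp_all)
  qed
qed

lemma (in bounded_bilinear) Ck_on_prod:
  assumes "open S" "Ck_on k S f" "Ck_on k S g"
  shows "Ck_on k S (\<lambda>x. prod (f x) (g x))"
  using assms(2,3)
proof (induction k arbitrary: f g)
  case 0
  then show ?case using continuous_on by (simp only: Ck_on.simps)
next
  case (Suc k)
  have f: "Ck_on k S f" and g: "Ck_on k S g" using Suc.prems Ck_on_Suc_imp by blast+
  show ?case
  proof (rule Ck_on_SucI[where f'="\<lambda>x v. prod (f x) (frechet_derivative g (at x) v) +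
        prod (frechet_derivative f (at x) v) (g x)", OF assms(1)])
    show "((\<lambda>x. prod (f x) (g x)) has_derivative (\<lambda>v. prod (f x) (frechet_derivative g (at x) v) +
        prod (frechet_derivative f (at x) v) (g x))) (at x)" if "x \<in> S" for x
      using Suc.prems that by (intro FDERIV Ck_on_has_derivative)
    show "Ck_on k S (\<lambda>x. prod (f x) (frechet_derivative g (at x) v) +
        prod (frechet_derivative f (at x) v) (g x))" for v
      by (intro Ck_on_add Suc.IH assms f g) (use Suc.prems in simp_all)
  qed
qed

lemma Ck_on_sum:
  assumes "open S" "finite I" "\<And>i. i \<in> I \<Longrightarrow> Ck_on k S (f i)"
  shows "Ck_on k S (\<lambda>x. \<Sum>i\<in>I. f i x)"
  using assms(2,3)
  by (induction I rule: finite_induct) (auto intro!: Ck_on_add Ck_on_const assms(1))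

lemma linear_sum_Basis:
  fixes f' :: "'a::euclidean_space \<Rightarrow> 'b::real_vector"
  assumes "linear f'"
  shows "f' v = (\<Sum>b\<in>Basis. (v \<bullet> b) *\<^sub>R f' b)"
proof -
  have "f' v = f' (\<Sum>b\<in>Basis. (v \<bullet> b) *\<^sub>R b)" by (simp add: euclidean_representation)
  then show ?thesis by (simp add: linear_sum[OF assms] linear_cmul[OF assms])
qed

text \<open>The order of \<open>f\<close> is lowered by one in each step, while \<open>g\<close> is replaced by its partial derivatives
  along the basis; the induction therefore runs over all \<open>g\<close>.\<close>

lemma Ck_on_compose:
  fixes f :: "'a::real_normed_vector \<Rightarrow> 'b::euclidean_space" and g :: "'b \<Rightarrow> 'c::real_normed_vector"
  assumes "open S" "open T" "f ` S \<subseteq> T" "Ck_on k S f" "Ck_on k T g"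
  shows "Ck_on k S (\<lambda>x. g (f x))"
  using assms(4,5)
proof (induction k arbitrary: g)
  case 0
  then show ?case using assms(3) continuous_on_compose2[of T g S f] by simp
next
  case (Suc k)
  have f: "Ck_on k S f" and g: "Ck_on k T g" using Suc.prems Ck_on_Suc_imp by blast+
  have fd: "(f has_derivative frechet_derivative f (at x)) (at x)" if "x \<in> S" for x
    using Ck_on_has_derivative Suc.prems that by blast
  have gd: "(g has_derivative frechet_derivative g (at y)) (at y)" if "y \<in> T" for y
    using Ck_on_has_derivative Suc.prems that by blast
  show ?case
  proof (rule Ck_on_SucI[where f'="\<lambda>x v. \<Sum>b\<in>Basis. (frechet_derivative f (at x) v \<bullet> b) *\<^sub>R
        frechet_derivative g (at (f x)) b"])
    fix x assume x: "x \<in> S"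
    have "((\<lambda>x. g (f x)) has_derivative (\<lambda>v. frechet_derivative g (at (f x)) (frechet_derivative f (at x) v))) (at x)"
      using x assms(3) by (intro has_derivative_compose[OF fd gd]) auto
    moreover have "frechet_derivative g (at (f x)) (frechet_derivative f (at x) v) =
      (\<Sum>b\<in>Basis. (frechet_derivative f (at x) v \<bullet> b) *\<^sub>R frechet_derivative g (at (f x)) b)" for v
      by (rule linear_sum_Basis[OF has_derivative_linear[OF gd]]) (use x assms(3) in blast)
    ultimately show "((\<lambda>x. g (f x)) has_derivative
      (\<lambda>v. \<Sum>b\<in>Basis. (frechet_derivative f (at x) v \<bullet> b) *\<^sub>R frechet_derivative g (at (f x)) b)) (at x)"
      by simp
  next
    fix v
    show "Ck_on k S (\<lambda>x. \<Sum>b\<in>Basis. (frechet_derivative f (at x) v \<bullet> b) *\<^sub>R frechet_derivative g (at (f x)) b)"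
      using Suc.prems
      by (intro Ck_on_sum assms bounded_bilinear.Ck_on_prod[OF bounded_bilinear_scaleR]
          Ck_on_bounded_linear[OF _ bounded_linear_inner_left] Suc.IH f) auto
  qed (rule assms)
qed

lemma smooth_on_cong:
  "open S \<Longrightarrow> (\<And>x. x \<in> S \<Longrightarrow> f x = g x) \<Longrightarrow> smooth_on S f \<longleftrightarrow> smooth_on S g"
  unfolding smooth_on_def using Ck_on_cong by blast

lemma smooth_on_subset: "smooth_on S f \<Longrightarrow> T \<subseteq> S \<Longrightarrow> smooth_on T f"
  unfolding smooth_on_def using Ck_on_subset by blast

lemma smooth_on_continuous_on: "smooth_on S f \<Longrightarrow> continuous_on S f"
  unfolding smooth_on_def using Ck_on_continuous_on by blast

lemma smooth_on_has_derivative: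
  "smooth_on S f \<Longrightarrow> x \<in> S \<Longrightarrow> (f has_derivative frechet_derivative f (at x)) (at x)"
  unfolding smooth_on_def using Ck_on_has_derivative by blast

lemma smooth_on_frechet: "smooth_on S f \<Longrightarrow> smooth_on S (\<lambda>x. frechet_derivative f (at x) v)"
  unfolding smooth_on_def by (metis Ck_on.simps(2))

lemma smooth_on_Union:
  "(\<And>N. N \<in> \<N> \<Longrightarrow> open N \<and> smooth_on N f) \<Longrightarrow> smooth_on (\<Union>\<N>) f"
  unfolding smooth_on_def by (meson Ck_on_Union)

lemma smooth_on_locallyI:
  assumes "\<And>x. x \<in> S \<Longrightarrow> \<exists>N. open N \<and> x \<in> N \<and> smooth_on N f"
  shows "smooth_on S f"
proof -
  have "smooth_on (\<Union>{N. open N \<and> smooth_on N f}) f" by (rule smooth_on_Union) auto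
  then show ?thesis by (rule smooth_on_subset) (use assms in blast)
qed

lemma smooth_on_const: "open S \<Longrightarrow> smooth_on S (\<lambda>x. c)"
  and smooth_on_id: "open S \<Longrightarrow> smooth_on S (\<lambda>x. x)"
  unfolding smooth_on_def by (auto intro: Ck_on_const Ck_on_id)

lemma smooth_on_add: "open S \<Longrightarrow> smooth_on S f \<Longrightarrow> smooth_on S g \<Longrightarrow> smooth_on S (\<lambda>x. f x + g x)"
  and smooth_on_bounded_linear: "open S \<Longrightarrow> bounded_linear L \<Longrightarrow> smooth_on S f \<Longrightarrow> smooth_on S (\<lambda>x. L (f x))"
  and smooth_on_sum: "open S \<Longrightarrow> finite I \<Longrightarrow> (\<And>i. i \<in> I \<Longrightarrow> smooth_on S (h i)) \<Longrightarrow>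
    smooth_on S (\<lambda>x. \<Sum>i\<in>I. h i x)"
  unfolding smooth_on_def by (auto intro: Ck_on_add Ck_on_bounded_linear Ck_on_sum)

lemma smooth_on_scaleR: "open S \<Longrightarrow> smooth_on S f \<Longrightarrow> smooth_on S g \<Longrightarrow> smooth_on S (\<lambda>x. f x *\<^sub>R g x)"
  unfolding smooth_on_def by (auto intro: bounded_bilinear.Ck_on_prod[OF bounded_bilinear_scaleR])

lemma smooth_on_mult:
  fixes f g :: "'a::real_normed_vector \<Rightarrow> real"
  shows "open S \<Longrightarrow> smooth_on S f \<Longrightarrow> smooth_on S g \<Longrightarrow> smooth_on S (\<lambda>x. f x * g x)"
  unfolding smooth_on_def by (auto intro: bounded_bilinear.Ck_on_prod[OF bounded_bilinear_mult])

lemma smooth_on_uminus: "open S \<Longrightarrow> smooth_on S f \<Longrightarrow> smooth_on S (\<lambda>x. - f x)"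
  by (rule smooth_on_bounded_linear[OF _ bounded_linear_minus[OF bounded_linear_ident]])

lemma smooth_on_diff: "open S \<Longrightarrow> smooth_on S f \<Longrightarrow> smooth_on S g \<Longrightarrow> smooth_on S (\<lambda>x. f x - g x)"
  using smooth_on_add[OF _ _ smooth_on_uminus, of S f g] by simp

lemma smooth_on_compose:
  fixes f :: "'a::real_normed_vector \<Rightarrow> 'b::euclidean_space" and g :: "'b \<Rightarrow> 'c::real_normed_vector"
  assumes "open S" "open T" "f ` S \<subseteq> T" "smooth_on S f" "smooth_on T g"
  shows "smooth_on S (\<lambda>x. g (f x))"
  using assms unfolding smooth_on_def by (blast intro: Ck_on_compose)

lemma smooth_on_inverse:
  fixes f :: "'a::real_normed_vector \<Rightarrow> real"
  assumes "open S" "smooth_on S f" "\<And>x. x \<in> S \<Longrightarrow> f x \<noteq> 0"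
  shows "smooth_on S (\<lambda>x. inverse (f x))"
  unfolding smooth_on_def
proof
  fix k show "Ck_on k S (\<lambda>x. inverse (f x))"
  proof (induction k)
    case 0
    show ?case using assms smooth_on_continuous_on[OF assms(2)] by (auto intro!: continuous_on_inverse)
  next
    case (Suc k)
    show ?case
    proof (rule Ck_on_SucI[where f'="\<lambda>x v. - (inverse (f x) * frechet_derivative f (at x) v * inverse (f x))"])
      fix x assume "x \<in> S"
      then show "((\<lambda>x. inverse (f x)) has_derivative
          (\<lambda>v. - (inverse (f x) * frechet_derivative f (at x) v * inverse (f x)))) (at x)"
        using assms smooth_on_has_derivative[OF assms(2)] by (intro Deriv.has_derivative_inverse) auto
    next
      fix v show "Ck_on k S (\<lambda>x. - (inverse (f x) * frechet_derivative f (at x) v * inverse (f x)))"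
        using smooth_on_frechet[OF assms(2)]
        by (intro Ck_on_bounded_linear[OF _ bounded_linear_minus[OF bounded_linear_ident]] assms
            bounded_bilinear.Ck_on_prod[OF bounded_bilinear_mult] Suc) (auto simp: smooth_on_def)
    qed (rule assms)
  qed
qed

text \<open>Bootstrapping: if the derivative of \<open>f\<close> is as regular as \<open>f\<close> itself, as for a solution of
  \<open>Df = M f\<close> with smooth \<open>M\<close>, every differentiation can be repeated.\<close>

lemma smooth_onI_derivative:
  assumes "open S" "\<And>x. x \<in> S \<Longrightarrow> (f has_derivative f' x) (at x)"
    and "\<And>k v. Ck_on k S f \<Longrightarrow> Ck_on k S (\<lambda>x. f' x v)"
  shows "smooth_on S f"
  unfolding smooth_on_def
proof
  fix k show "Ck_on k S f"
  proof (induction k)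
    case 0
    show ?case unfolding Ck_on.simps
      using assms(2) has_derivative_continuous continuous_at_imp_continuous_on by blast
  next
    case (Suc k)
    then show ?case by (intro Ck_on_SucI[OF assms(1,2)] assms(3))
  qed
qed

section \<open>Integrals along rays\<close>

lemma segment_in_convex:
  fixes y w :: "'a::real_vector"
  assumes "convex S" "y \<in> S" "y + w \<in> S" "t \<in> {0..1}"
  shows "y + t *\<^sub>R w \<in> S"
proof -
  have "y + t *\<^sub>R w = (1 - t) *\<^sub>R y + t *\<^sub>R (y + w)" by (simp add: algebra_simps)
  then show ?thesis using convexD_alt[OF assms(1,2,3), of t] assms(4) by auto
qed

text \<open>Differentiation under the integral sign, with the derivative of the integrand given through its
  directional values: in finite dimension their continuity makes it a continuous family of bounded
  linear maps.\<close>

lemma has_derivative_parameter_integral: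
  fixes f :: "'a::euclidean_space \<Rightarrow> real \<Rightarrow> 'b::euclidean_space"
  assumes "open U" "convex U" "x0 \<in> U"
    and der: "\<And>x t. x \<in> U \<Longrightarrow> t \<in> {0..1} \<Longrightarrow> ((\<lambda>x. f x t) has_derivative f' x t) (at x)"
    and cont: "\<And>x. x \<in> U \<Longrightarrow> continuous_on {0..1} (f x)"
    and cont': "\<And>v. continuous_on (U \<times> {0..1}) (\<lambda>(x, t). f' x t v)"
  shows "((\<lambda>x. integral {0..1} (f x)) has_derivative (\<lambda>v. integral {0..1} (\<lambda>t. f' x0 t v))) (at x0)"
proof -
  define fx where "fx = (\<lambda>x t. Blinfun (f' x t))"
  have app: "blinfun_apply (fx x t) = f' x t" if "x \<in> U" "t \<in> {0..1}" for x t
    unfolding fx_def by (rule bounded_linear_Blinfun_apply[OF has_derivative_bounded_linear[OF der[OF that]]])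
  have c: "continuous_on (U \<times> {0..1}) (\<lambda>(x, t). fx x t)"
  proof (rule continuous_on_blinfun_componentwise)
    fix i :: 'a
    have "(case z of (x, t) \<Rightarrow> f' x t i) = blinfun_apply (case z of (x, t) \<Rightarrow> fx x t) i"
      if "z \<in> U \<times> {0..1}" for z using app that by auto
    then show "continuous_on (U \<times> {0..1}) (\<lambda>z. blinfun_apply (case z of (x, t) \<Rightarrow> fx x t) i)"
      by (rule continuous_on_cong[OF refl, THEN iffD1, OF _ cont'[of i]])
  qed
  have "((\<lambda>x. integral (cbox 0 1) (f x)) has_derivative integral (cbox 0 1) (fx x0)) (at x0 within U)"
  proof (rule leibniz_rule)
    show "((\<lambda>x. f x t) has_derivative blinfun_apply (fx x t)) (at x within U)"
      if "x \<in> U" "t \<in> cbox 0 1" for x t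
      using der[of x t] that app[of x t] by (simp add: has_derivative_at_withinI)
  qed (use c cont assms in \<open>auto intro: integrable_continuous_real\<close>)
  moreover have "fx x0 integrable_on {0..1}"
  proof (rule integrable_continuous_real)
    have "continuous_on {0..1} (\<lambda>t. (\<lambda>(x, t). fx x t) (x0, t))"
      by (rule continuous_on_compose2[OF c]) (use assms(3) in \<open>auto intro!: continuous_intros\<close>)
    then show "continuous_on {0..1} (fx x0)" by simp
  qed
  then have "blinfun_apply (integral {0..1} (fx x0)) v = integral {0..1} (\<lambda>t. f' x0 t v)" for v
    using app[OF assms(3)] by (subst blinfun_apply_integral) (auto intro!: integral_cong)
  then have "blinfun_apply (integral {0..1} (fx x0)) = (\<lambda>v. integral {0..1} (\<lambda>t. f' x0 t v))" by (rule ext)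
  ultimately show ?thesis using assms(1,3) by (simp add: at_within_open[of x0 U])
qed

lemma increment_eq_integral:
  fixes F :: "'a::real_normed_vector \<Rightarrow> 'b::banach"
  assumes "convex S" "y \<in> S" "y + w \<in> S"
    and "\<And>x. x \<in> S \<Longrightarrow> (F has_derivative F' x) (at x)"
  shows "((\<lambda>t. F' (y + t *\<^sub>R w) w) has_integral (F (y + w) - F y)) {0..1}"
proof -
  have "((\<lambda>t. F' (y + t *\<^sub>R w) w) has_integral (F (y + 1 *\<^sub>R w) - F (y + 0 *\<^sub>R w))) {0..1}"
  proof (rule fundamental_theorem_of_calculus)
    fix t :: real assume t: "t \<in> {0..1}"
    have d: "((\<lambda>t. y + t *\<^sub>R w) has_derivative (\<lambda>s. s *\<^sub>R w)) (at t)"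
      by (auto intro!: derivative_eq_intros)
    have "((\<lambda>t. F (y + t *\<^sub>R w)) has_derivative (\<lambda>s. F' (y + t *\<^sub>R w) (s *\<^sub>R w))) (at t)"
      by (rule has_derivative_compose[OF d assms(4)]) (rule segment_in_convex[OF assms(1-3) t])
    moreover have "F' (y + t *\<^sub>R w) (s *\<^sub>R w) = s *\<^sub>R F' (y + t *\<^sub>R w) w" for s
      using assms(4)[OF segment_in_convex[OF assms(1-3) t]] has_derivative_linear linear_cmul by blast
    ultimately have "((\<lambda>t. F (y + t *\<^sub>R w)) has_vector_derivative F' (y + t *\<^sub>R w) w) (at t)"
      by (simp add: has_vector_derivative_def)
    then show "((\<lambda>t. F (y + t *\<^sub>R w)) has_vector_derivative F' (y + t *\<^sub>R w) w) (at t within {0..1})"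
      by (rule has_vector_derivative_at_within)
  qed simp
  then show ?thesis by simp
qed

text \<open>Differentiating \<open>z \<mapsto> F(z0 + t(z - z0))\<close> brings out one factor \<open>t\<close>, so the weights \<open>t^m\<close> make these
  means closed under differentiation.\<close>

definition ray_mean :: "'a::real_vector \<Rightarrow> nat \<Rightarrow> ('a \<Rightarrow> 'b::euclidean_space) \<Rightarrow> 'a \<Rightarrow> 'b"
  where "ray_mean z0 m F z = integral {0..1} (\<lambda>t. t ^ m *\<^sub>R F (z0 + t *\<^sub>R (z - z0)))"

lemma continuous_on_ray:
  fixes F :: "'a::real_normed_vector \<Rightarrow> 'b::real_normed_vector"
  assumes "convex S" "z0 \<in> S" "continuous_on S F"
  shows "continuous_on (S \<times> {0..1}) (\<lambda>(z, t). t ^ m *\<^sub>R F (z0 + t *\<^sub>R (z - z0)))"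
proof -
  have "continuous_on (S \<times> {0..1}) (\<lambda>p. F (z0 + snd p *\<^sub>R (fst p - z0)))"
  proof (rule continuous_on_compose2[OF assms(3)])
    show "(\<lambda>p. z0 + snd p *\<^sub>R (fst p - z0)) ` (S \<times> {0..1}) \<subseteq> S"
      using segment_in_convex[OF assms(1,2)] by force
  qed (auto intro!: continuous_intros)
  then show ?thesis unfolding case_prod_unfold by (auto intro!: continuous_intros)
qed

lemma continuous_on_ray_section:
  fixes F :: "'a::real_normed_vector \<Rightarrow> 'b::real_normed_vector"
  assumes "convex S" "z0 \<in> S" "continuous_on S F" "z \<in> S"
  shows "continuous_on {0..1} (\<lambda>t. t ^ m *\<^sub>R F (z0 + t *\<^sub>R (z - z0)))"
proof -
  have "continuous_on {0..1} (\<lambda>t. (\<lambda>(z, t). t ^ m *\<^sub>R F (z0 + t *\<^sub>R (z - z0))) (z, t))"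
    by (rule continuous_on_compose2[OF continuous_on_ray[OF assms(1-3)]])
      (use assms(4) in \<open>auto intro!: continuous_on_Pair continuous_on_const continuous_on_id\<close>)
  then show ?thesis by simp
qed

lemma has_derivative_ray_mean:
  fixes F :: "'a::euclidean_space \<Rightarrow> 'b::euclidean_space"
  assumes "open S" "convex S" "z0 \<in> S" "z \<in> S"
    and der: "\<And>x. x \<in> S \<Longrightarrow> (F has_derivative F' x) (at x)"
    and cont: "\<And>v. continuous_on S (\<lambda>x. F' x v)"
  shows "(ray_mean z0 m F has_derivative (\<lambda>v. ray_mean z0 (Suc m) (\<lambda>x. F' x v) z)) (at z)"
  unfolding ray_mean_def[abs_def]
proof (rule has_derivative_parameter_integral[where
      f'="\<lambda>z t v. t ^ Suc m *\<^sub>R F' (z0 + t *\<^sub>R (z - z0)) v", OF assms(1,2,4)])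
  have Fc: "continuous_on S F"
    using der has_derivative_continuous continuous_at_imp_continuous_on by blast
  show "continuous_on {0..1} (\<lambda>t. t ^ m *\<^sub>R F (z0 + t *\<^sub>R (x - z0)))" if "x \<in> S" for x
    by (rule continuous_on_ray_section[OF assms(2,3) Fc that])
  show "continuous_on (S \<times> {0..1}) (\<lambda>(z, t). t ^ Suc m *\<^sub>R F' (z0 + t *\<^sub>R (z - z0)) v)" for v
    by (rule continuous_on_ray[OF assms(2,3) cont])
  show "((\<lambda>x. t ^ m *\<^sub>R F (z0 + t *\<^sub>R (x - z0))) has_derivative
      (\<lambda>v. t ^ Suc m *\<^sub>R F' (z0 + t *\<^sub>R (x - z0)) v)) (at x)" if "x \<in> S" "t \<in> {0..1}" for x t
  proof -
    have in_S: "z0 + t *\<^sub>R (x - z0) \<in> S"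
      using segment_in_convex[OF assms(2,3), of "x - z0" t] that by simp
    have "((\<lambda>x. z0 + t *\<^sub>R (x - z0)) has_derivative (\<lambda>v. t *\<^sub>R v)) (at x)"
      by (auto intro!: derivative_eq_intros)
    then have "((\<lambda>x. F (z0 + t *\<^sub>R (x - z0))) has_derivative (\<lambda>v. F' (z0 + t *\<^sub>R (x - z0)) (t *\<^sub>R v))) (at x)"
      by (rule has_derivative_compose) (rule der[OF in_S])
    then have "((\<lambda>x. t ^ m *\<^sub>R F (z0 + t *\<^sub>R (x - z0))) has_derivative
        (\<lambda>v. t ^ m *\<^sub>R F' (z0 + t *\<^sub>R (x - z0)) (t *\<^sub>R v))) (at x)"
      by (rule has_derivative_scaleR_right)
    then show ?thesis using linear_cmul[OF has_derivative_linear[OF der[OF in_S]]] by (simp add: mult.commute)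
  qed
qed

lemma Ck_on_ray_mean:
  fixes F :: "'a::euclidean_space \<Rightarrow> 'b::euclidean_space"
  assumes "open S" "convex S" "z0 \<in> S" "Ck_on k S F"
  shows "Ck_on k S (ray_mean z0 m F)"
  using assms(4)
proof (induction k arbitrary: F m)
  case 0
  then have c: "continuous_on S F" by simp
  have "continuous_on S (\<lambda>z. integral (cbox 0 1) (\<lambda>t. t ^ m *\<^sub>R F (z0 + t *\<^sub>R (z - z0))))"
    by (rule integral_continuous_on_param) (use continuous_on_ray[OF assms(2,3) c] in simp)
  then show ?case by (simp add: ray_mean_def[abs_def])
next
  case (Suc k)
  have D: "Ck_on k S (\<lambda>x. frechet_derivative F (at x) v)" for v using Suc.prems by simp
  show ?case
  proof (rule Ck_on_SucI[where f'="\<lambda>z v. ray_mean z0 (Suc m) (\<lambda>x. frechet_derivative F (at x) v) z", OF assms(1)])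
    show "(ray_mean z0 m F has_derivative (\<lambda>v. ray_mean z0 (Suc m) (\<lambda>x. frechet_derivative F (at x) v) z)) (at z)"
      if "z \<in> S" for z
      by (rule has_derivative_ray_mean[OF assms(1-3) that Ck_on_has_derivative[OF Suc.prems] Ck_on_continuous_on[OF D]])
    show "Ck_on k S (ray_mean z0 (Suc m) (\<lambda>x. frechet_derivative F (at x) v))" for v
      by (rule Suc.IH[OF D])
  qed
qed

lemma smooth_on_ray_mean:
  fixes F :: "'a::euclidean_space \<Rightarrow> 'b::euclidean_space"
  assumes "open S" "convex S" "z0 \<in> S" "smooth_on S F"
  shows "smooth_on S (ray_mean z0 m F)"
  using Ck_on_ray_mean[OF assms(1-3)] assms(4) unfolding smooth_on_def by blast

text \<open>The increment of \<open>F\<close> is the integral of its derivative along the ray from \<open>z0\<close> to \<open>z\<close>; the direction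
  \<open>z - z0\<close> is constant on the ray, so its components can be taken out.\<close>

lemma hadamard:
  fixes F :: "'a::euclidean_space \<Rightarrow> 'b::euclidean_space"
  assumes "open S" "convex S" "z0 \<in> S" "z \<in> S" "smooth_on S F"
  shows "F z = F z0 + (\<Sum>b\<in>Basis. ((z - z0) \<bullet> b) *\<^sub>R ray_mean z0 0 (\<lambda>x. frechet_derivative F (at x) b) z)"
proof -
  let ?w = "z - z0"
  have inS: "z0 + t *\<^sub>R ?w \<in> S" if "t \<in> {0..1}" for t
    using segment_in_convex[OF assms(2,3), of ?w t] assms(4) that by simp
  have "((\<lambda>t. frechet_derivative F (at (z0 + t *\<^sub>R ?w)) ?w) has_integral F (z0 + ?w) - F z0) {0..1}"
    by (rule increment_eq_integral[OF assms(2,3) _ smooth_on_has_derivative[OF assms(5)]]) (use assms in auto)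
  then have "F z - F z0 = integral {0..1} (\<lambda>t. frechet_derivative F (at (z0 + t *\<^sub>R ?w)) ?w)"
    by (simp add: integral_unique)
  also have "\<dots> = integral {0..1} (\<lambda>t. \<Sum>b\<in>Basis. (?w \<bullet> b) *\<^sub>R frechet_derivative F (at (z0 + t *\<^sub>R ?w)) b)"
    using linear_sum_Basis[OF has_derivative_linear[OF smooth_on_has_derivative[OF assms(5) inS]]]
    by (intro integral_cong)
  also have "\<dots> = (\<Sum>b\<in>Basis. integral {0..1} (\<lambda>t. (?w \<bullet> b) *\<^sub>R frechet_derivative F (at (z0 + t *\<^sub>R ?w)) b))"
  proof (rule integral_sum)
    fix b :: 'a
    have "continuous_on {0..1} (\<lambda>t. t ^ 0 *\<^sub>R frechet_derivative F (at (z0 + t *\<^sub>R ?w)) b)"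
      by (rule continuous_on_ray_section[OF assms(2,3) smooth_on_continuous_on[OF smooth_on_frechet[OF assms(5)]] assms(4)])
    then show "(\<lambda>t. (?w \<bullet> b) *\<^sub>R frechet_derivative F (at (z0 + t *\<^sub>R ?w)) b) integrable_on {0..1}"
      by (intro integrable_continuous_real continuous_intros) simp
  qed simp
  finally have "F z - F z0 = (\<Sum>b\<in>Basis. (?w \<bullet> b) *\<^sub>R ray_mean z0 0 (\<lambda>x. frechet_derivative F (at x) b) z)"
    by (simp add: ray_mean_def)
  then show ?thesis by (metis add.commute diff_add_cancel)
qed

lemma ray_mean_center: "ray_mean z0 0 F z0 = F z0"
  by (simp add: ray_mean_def)

text \<open>Schwarz's theorem: both iterated derivatives, averaged over a short segment from \<open>x\<close> in
  direction \<open>u\<close>, equal the increment of \<open>D\<^sub>v F\<close> along it, and the segment may be shrunk.\<close>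

lemma frechet_derivative_symmetric:
  fixes F :: "'a::euclidean_space \<Rightarrow> 'b::euclidean_space"
  assumes "open S" "x \<in> S" "smooth_on S F"
  shows "frechet_derivative (\<lambda>y. frechet_derivative F (at y) u) (at x) v =
         frechet_derivative (\<lambda>y. frechet_derivative F (at y) v) (at x) u"
proof -
  \<comment> \<open>\<open>H w w'\<close> differentiates first along \<open>w\<close>, then along \<open>w'\<close>.\<close>
  define G where "G = (\<lambda>w y. frechet_derivative F (at y) w)"
  define H where "H = (\<lambda>w w' y. frechet_derivative (G w) (at y) w')"
  have Gs: "smooth_on S (G w)" for w unfolding G_def by (rule smooth_on_frechet[OF assms(3)])
  have Hs: "smooth_on S (H w w')" for w w' unfolding H_def by (rule smooth_on_frechet[OF Gs])
  have Gd: "(G w has_derivative (\<lambda>w'. H w w' y)) (at y)" if "y \<in> S" for w y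
    unfolding H_def by (rule smooth_on_has_derivative[OF Gs that])
  have Fd: "(F has_derivative (\<lambda>w. G w y)) (at y)" if "y \<in> S" for y
    unfolding G_def by (rule smooth_on_has_derivative[OF assms(3) that])
  obtain r where r: "r > 0" "ball x (2 * r) \<subseteq> S"
    using assms(1,2) openE by (metis field_sum_of_halves half_gt_zero mult_2)
  have small: "integral {0..1} (\<lambda>t. H u v (x + t *\<^sub>R w) - H v u (x + t *\<^sub>R w)) = 0"
    if w: "w = s *\<^sub>R u" "norm w < r" "s \<noteq> 0" for w s
  proof -
    let ?B = "ball x r"
    have inS: "y + t *\<^sub>R w \<in> ball x (2 * r)" if "y \<in> ?B" "t \<in> {0..1}" for y t
    proof -
      have "dist x (y + t *\<^sub>R w) \<le> dist x y + norm (t *\<^sub>R w)"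
        by (metis add_diff_cancel_left' dist_norm dist_triangle norm_minus_commute)
      moreover have "norm (t *\<^sub>R w) \<le> 1 * norm w" unfolding norm_scaleR using that by (intro mult_right_mono) auto
      ultimately show ?thesis using that w by simp
    qed
    have inS1: "y + w \<in> ball x (2 * r)" if "y \<in> ?B" for y using inS[OF that, of 1] by simp
    have yS: "y \<in> ball x (2 * r)" if "y \<in> ?B" for y using inS[OF that, of 0] by simp
    have incr: "F (y + w) - F y = integral {0..1} (\<lambda>t. s *\<^sub>R G u (y + t *\<^sub>R w))" if y: "y \<in> ?B" for y
    proof -
      have "((\<lambda>t. G w (y + t *\<^sub>R w)) has_integral (F (y + w) - F y)) {0..1}"
        by (rule increment_eq_integral[OF convex_ball yS[OF y] inS1[OF y] Fd]) (use r in auto)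
      moreover have "G w (y + t *\<^sub>R w) = s *\<^sub>R G u (y + t *\<^sub>R w)" if "t \<in> {0..1}" for t
        unfolding w(1) using linear_cmul[OF has_derivative_linear[OF Fd]] inS[OF y that] r(2) unfolding w(1) by blast
      ultimately have "((\<lambda>t. s *\<^sub>R G u (y + t *\<^sub>R w)) has_integral (F (y + w) - F y)) {0..1}"
        by (rule has_integral_eq[rotated])
      then show ?thesis by (rule integral_unique[symmetric])
    qed
    have "((\<lambda>y. integral {0..1} (\<lambda>t. s *\<^sub>R G u (y + t *\<^sub>R w))) has_derivative
        (\<lambda>v. integral {0..1} (\<lambda>t. s *\<^sub>R H u v (x + t *\<^sub>R w)))) (at x)"
    proof (rule has_derivative_parameter_integral[where f'="\<lambda>y t v. s *\<^sub>R H u v (y + t *\<^sub>R w)" and U="?B"])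
      show "((\<lambda>y. s *\<^sub>R G u (y + t *\<^sub>R w)) has_derivative (\<lambda>v. s *\<^sub>R H u v (y + t *\<^sub>R w))) (at y)"
        if "y \<in> ?B" "t \<in> {0..1}" for y t
      proof -
        have "((\<lambda>y. y + t *\<^sub>R w) has_derivative (\<lambda>v. v)) (at y)" by (auto intro!: derivative_eq_intros)
        then have "((\<lambda>y. G u (y + t *\<^sub>R w)) has_derivative (\<lambda>v. H u v (y + t *\<^sub>R w))) (at y)"
          by (rule has_derivative_compose) (rule Gd, use inS that r in blast)
        then show ?thesis by (rule has_derivative_scaleR_right)
      qed
      show "continuous_on {0..1} (\<lambda>t. s *\<^sub>R G u (y + t *\<^sub>R w))" if "y \<in> ?B" for y
        by (intro continuous_intros continuous_on_compose2[OF smooth_on_continuous_on[OF Gs]])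
          (use inS[OF that] r in auto)
      show "continuous_on (?B \<times> {0..1}) (\<lambda>(y, t). s *\<^sub>R H u v (y + t *\<^sub>R w))" for v
        unfolding case_prod_unfold
        by (intro continuous_intros continuous_on_compose2[OF smooth_on_continuous_on[OF Hs]])
          (use inS r in auto)
    qed (use r in auto)
    then have "((\<lambda>y. F (y + w) - F y) has_derivative
        (\<lambda>v. integral {0..1} (\<lambda>t. s *\<^sub>R H u v (x + t *\<^sub>R w)))) (at x)"
      by (rule has_derivative_transform_within_open[where s="?B"]) (simp_all add: incr r)
    moreover have "((\<lambda>y. F (y + w) - F y) has_derivative (\<lambda>v. G v (x + w) - G v x)) (at x)"
    proof -
      have "((\<lambda>y. y + w) has_derivative (\<lambda>v. v)) (at x)" by (auto intro!: derivative_eq_intros)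
      then have "((\<lambda>y. F (y + w)) has_derivative (\<lambda>v. G v (x + w))) (at x)"
        by (rule has_derivative_compose) (rule Fd, use inS1[of x] r in auto)
      then show ?thesis by (intro has_derivative_diff Fd) (use assms in auto)
    qed
    ultimately have "G v (x + w) - G v x = integral {0..1} (\<lambda>t. s *\<^sub>R H u v (x + t *\<^sub>R w))"
      by (rule has_derivative_unique[THEN fun_cong, symmetric])
    moreover have "G v (x + w) - G v x = integral {0..1} (\<lambda>t. s *\<^sub>R H v u (x + t *\<^sub>R w))"
    proof -
      have xB: "x \<in> ?B" using r by simp
      have "((\<lambda>t. H v w (x + t *\<^sub>R w)) has_integral (G v (x + w) - G v x)) {0..1}"
        by (rule increment_eq_integral[OF convex_ball yS[OF xB] inS1[OF xB] Gd]) (use r in auto)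
      moreover have "H v w (x + t *\<^sub>R w) = s *\<^sub>R H v u (x + t *\<^sub>R w)" if "t \<in> {0..1}" for t
        unfolding w(1) using linear_cmul[OF has_derivative_linear[OF Gd]] inS[OF xB that] r(2) unfolding w(1) by blast
      ultimately have "((\<lambda>t. s *\<^sub>R H v u (x + t *\<^sub>R w)) has_integral (G v (x + w) - G v x)) {0..1}"
        by (rule has_integral_eq[rotated])
      then show ?thesis by (rule integral_unique[symmetric])
    qed
    moreover have "continuous_on {0..1} (\<lambda>t. H a b (x + t *\<^sub>R w))" for a b
      by (intro continuous_intros continuous_on_compose2[OF smooth_on_continuous_on[OF Hs]])
        (use inS[of x] r in auto)
    ultimately show ?thesis using w(3)
      by (simp add: integral_diff integrable_continuous_real)
  qed
  let ?E = "\<lambda>y. H u v y - H v u y"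
  let ?\<psi> = "\<lambda>s. integral (cbox 0 1) (\<lambda>t. ?E (x + t *\<^sub>R s *\<^sub>R u))"
  define \<delta> where "\<delta> = r / (norm u + 1)"
  have \<delta>: "\<delta> > 0" "norm (s *\<^sub>R u) < r" if "\<bar>s\<bar> < \<delta>" for s
  proof -
    show "\<delta> > 0" using r by (simp add: \<delta>_def add_nonneg_pos)
    have "\<bar>s\<bar> * norm u \<le> \<delta> * norm u" using that by (intro mult_right_mono) auto
    also have "\<dots> < \<delta> * (norm u + 1)" using \<open>\<delta> > 0\<close> by simp
    also have "\<dots> = r" by (simp add: \<delta>_def add_nonneg_eq_0_iff)
    finally show "norm (s *\<^sub>R u) < r" by simp
  qed
  have \<delta>0: "\<delta> > 0" using r by (simp add: \<delta>_def add_nonneg_pos)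
  have inS: "x + t *\<^sub>R s *\<^sub>R u \<in> S" if "\<bar>s\<bar> < \<delta>" "t \<in> {0..1}" for s t
  proof -
    have "norm (t *\<^sub>R s *\<^sub>R u) \<le> 1 * norm (s *\<^sub>R u)" unfolding norm_scaleR[of t]
      using that by (intro mult_right_mono) auto
    then have "x + t *\<^sub>R s *\<^sub>R u \<in> ball x (2 * r)" using \<delta>(2)[OF that(1)] r(1) by (simp add: dist_norm)
    then show ?thesis using r by blast
  qed
  have "continuous_on {-\<delta><..<\<delta>} ?\<psi>"
  proof (rule integral_continuous_on_param)
    show "continuous_on ({-\<delta><..<\<delta>} \<times> cbox 0 1) (\<lambda>(s, t). ?E (x + t *\<^sub>R s *\<^sub>R u))"
      unfolding case_prod_unfold
      by (intro continuous_intros continuous_on_compose2[OF smooth_on_continuous_on[OF Hs]])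
        (use inS in \<open>auto simp del: scaleR_scaleR\<close>)
  qed
  then have "isCont ?\<psi> 0" using \<delta>0 by (simp add: continuous_on_eq_continuous_at)
  moreover have "eventually (\<lambda>s. ?\<psi> s = 0) (at 0)"
    unfolding eventually_at using small[OF refl] \<delta>(2) \<delta>0
    by (intro exI[of _ \<delta>]) (auto simp: dist_norm)
  ultimately have "?\<psi> 0 = 0"
    by (intro LIM_unique[of ?\<psi> "?\<psi> 0" 0 0]) (simp only: isCont_def, rule tendsto_eventually)
  then show ?thesis unfolding H_def G_def by simp
qed

section \<open>Cut-off functions\<close>

text \<open>For a polynomial \<open>p\<close> the functions \<open>t \<mapsto> p(1/t) exp(-1/t)\<close>, extended by \<open>0\<close> to \<open>t \<le> 0\<close>, are closed
  under differentiation and therefore smooth.\<close>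

definition flat_exp :: "real poly \<Rightarrow> real \<Rightarrow> real"
  where "flat_exp p t = (if t > 0 then poly p (1 / t) * exp (- (1 / t)) else 0)"

lemma poly_times_exp_tendsto_0: "((\<lambda>s. poly p s * exp (- s)) \<longlongrightarrow> (0::real)) at_top"
proof -
  have "((\<lambda>s. \<Sum>i\<le>degree p. coeff p i * (s ^ i / exp s)) \<longlongrightarrow> (\<Sum>i\<le>degree p. coeff p i * 0)) at_top"
    by (intro tendsto_intros tendsto_power_div_exp_0)
  then show ?thesis
    by (simp add: poly_altdef sum_distrib_right exp_minus divide_inverse mult.assoc)
qed

lemma flat_exp_has_derivative:
  "(flat_exp p has_real_derivative flat_exp ([:0, 0, 1:] * (p - pderiv p)) t) (at t)"
proof -
  consider "t > 0" | "t < 0" | "t = 0" by linarith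
  then show ?thesis
  proof cases
    case 1
    have "((\<lambda>t. poly p (1 / t) * exp (- (1 / t))) has_real_derivative
        flat_exp ([:0, 0, 1:] * (p - pderiv p)) t) (at t)"
      using 1 unfolding flat_exp_def
      by (auto intro!: derivative_eq_intros DERIV_chain2[OF poly_DERIV]
          simp: field_simps power2_eq_square)
    then show ?thesis
      by (rule has_field_derivative_transform_within_open[where S="{0<..}"]) (use 1 in \<open>auto simp: flat_exp_def\<close>)
  next
    case 2
    have "((\<lambda>t. 0) has_real_derivative 0) (at t)" by simp
    then have "(flat_exp p has_real_derivative 0) (at t)"
      by (rule has_field_derivative_transform_within_open[where S="{..<0}"]) (use 2 in \<open>auto simp: flat_exp_def\<close>)
    then show ?thesis using 2 by (simp add: flat_exp_def)
  next
    case 3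
    have "((\<lambda>h. flat_exp p h / h) \<longlongrightarrow> 0) (at_right 0)"
    proof -
      have "((\<lambda>h. poly ([:0, 1:] * p) (inverse h) * exp (- inverse h)) \<longlongrightarrow> 0) (at_right 0)"
        by (rule filterlim_compose[OF poly_times_exp_tendsto_0 filterlim_inverse_at_top_right])
      then show ?thesis
        by (rule Lim_transform_eventually)
          (auto simp: eventually_at_right_field flat_exp_def divide_inverse intro!: exI[of _ 1])
    qed
    moreover have "((\<lambda>h. flat_exp p h / h) \<longlongrightarrow> 0) (at_left 0)"
      by (rule tendsto_eventually) (auto simp: eventually_at_left_field flat_exp_def intro!: exI[of _ "-1"])
    ultimately have "((\<lambda>h. flat_exp p h / h) \<longlongrightarrow> 0) (at 0)"
      by (simp add: filterlim_split_at)
    then show ?thesis unfolding 3 has_field_derivative_iff by (simp add: flat_exp_def)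
  qed
qed

lemma smooth_on_flat_exp: "smooth_on UNIV (flat_exp p)"
  unfolding smooth_on_def
proof
  fix k show "Ck_on k UNIV (flat_exp p)"
  proof (induction k arbitrary: p)
    case 0
    show ?case unfolding Ck_on.simps
      by (rule DERIV_continuous_on) (rule has_field_derivative_at_within[OF flat_exp_has_derivative])
  next
    case (Suc k)
    show ?case
    proof (rule Ck_on_SucI[where f'="\<lambda>t v. flat_exp ([:0, 0, 1:] * (p - pderiv p)) t * v"])
      show "(flat_exp p has_derivative (\<lambda>v. flat_exp ([:0, 0, 1:] * (p - pderiv p)) t * v)) (at t)" for t
        using flat_exp_has_derivative[of p t] by (simp add: has_field_derivative_def)
      show "Ck_on k UNIV (\<lambda>t. flat_exp ([:0, 0, 1:] * (p - pderiv p)) t * v)" for v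
        by (rule Ck_on_bounded_linear[OF open_UNIV bounded_linear_mult_left Suc])
    qed simp
  qed
qed

text \<open>At every point one of \<open>r\<^sup>2 - s\<close> and \<open>s - r\<^sup>2/4\<close>, with \<open>s\<close> the squared distance from \<open>z0\<close>, is positive;
  hence the quotient below has a positive denominator.  It is \<open>1\<close> where the second is nonpositive and
  \<open>0\<close> where the first is.\<close>

lemma bump_euclidean:
  fixes z0 :: "'a::euclidean_space"
  assumes "r > 0"
  obtains \<beta> :: "'a \<Rightarrow> real" where "smooth_on UNIV \<beta>" "\<forall>z\<in>ball z0 (r / 2). \<beta> z = 1"
    "\<forall>z. z \<notin> ball z0 r \<longrightarrow> \<beta> z = 0"
proof -
  define h where "h = flat_exp 1"
  have h0: "h t = 0" if "t \<le> 0" for t using that by (simp add: h_def flat_exp_def)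
  have h1: "h t > 0" if "t > 0" for t using that by (simp add: h_def flat_exp_def)
  have h_nonneg: "h t \<ge> 0" for t by (simp add: h_def flat_exp_def)
  define s where "s = (\<lambda>z. (z - z0) \<bullet> (z - z0))"
  define \<beta> where "\<beta> = (\<lambda>z. h (r\<^sup>2 - s z) * inverse (h (r\<^sup>2 - s z) + h (s z - r\<^sup>2 / 4)))"
  have s: "s z = (dist z0 z)\<^sup>2" for z
    by (simp add: s_def dist_norm norm_minus_commute[of z0] flip: power2_norm_eq_inner)
  have "smooth_on UNIV (\<lambda>z. z - z0)" by (intro smooth_on_diff smooth_on_id smooth_on_const open_UNIV)
  then have ss: "smooth_on UNIV s"
    unfolding s_def smooth_on_def
    by (intro allI bounded_bilinear.Ck_on_prod[OF bounded_bilinear_inner open_UNIV]) simp_all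
  have hs: "smooth_on UNIV (\<lambda>z. h (g z))" if "smooth_on UNIV g" for g :: "'a \<Rightarrow> real"
    unfolding h_def by (rule smooth_on_compose[OF open_UNIV open_UNIV _ that smooth_on_flat_exp]) simp
  have pos: "h (r\<^sup>2 - s z) + h (s z - r\<^sup>2 / 4) > 0" for z
  proof (cases "r\<^sup>2 - s z > 0")
    case True
    then show ?thesis using h1 h_nonneg by (simp add: add_pos_nonneg)
  next
    case False
    have "r\<^sup>2 > 0" using assms by simp
    then have "s z - r\<^sup>2 / 4 > 0" using False by linarith
    then show ?thesis using h1 h_nonneg by (simp add: add_nonneg_pos)
  qed
  have "smooth_on UNIV \<beta>" unfolding \<beta>_def
    by (intro smooth_on_mult smooth_on_inverse smooth_on_add hs smooth_on_diff smooth_on_const ss open_UNIV)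
      (use pos in \<open>auto simp: less_imp_neq[symmetric]\<close>)
  moreover have "\<beta> z = 1" if "z \<in> ball z0 (r / 2)" for z
  proof -
    have "(dist z0 z)\<^sup>2 \<le> (r / 2)\<^sup>2" using that by (intro power_mono) auto
    then have "h (s z - r\<^sup>2 / 4) = 0" by (intro h0) (simp add: s power_divide)
    then show ?thesis using pos[of z] by (simp add: \<beta>_def)
  qed
  moreover have "\<beta> z = 0" if "z \<notin> ball z0 r" for z
  proof -
    have "r\<^sup>2 \<le> (dist z0 z)\<^sup>2" using that assms by (intro power_mono) auto
    then show ?thesis by (simp add: \<beta>_def s h0)
  qed
  ultimately show thesis using that[of \<beta>] by simp
qed

lemma zero_of_dense_zero:
  fixes f :: "'a::topological_space \<Rightarrow> 'b::{t1_space, zero}"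
  assumes "open S" "continuous_on S f" "S \<subseteq> closure G" "\<And>y. y \<in> G \<Longrightarrow> f y = 0" "z \<in> S"
  shows "f z = 0"
proof (rule ccontr)
  assume n: "f z \<noteq> 0"
  let ?O = "S \<inter> f -` (- {0})"
  have "open ?O" by (rule continuous_open_preimage[OF assms(2,1)]) auto
  moreover have "z \<in> ?O \<inter> closure G" using assms n by auto
  ultimately have "?O \<inter> G \<noteq> {}" using open_Int_closure_eq_empty[of ?O G] by auto
  then show False using assms(4) by auto
qed

section \<open>Connections and their curvature in coordinates\<close>

abbreviation dd :: "('a::real_normed_vector \<Rightarrow> 'b::real_normed_vector) \<Rightarrow> 'a \<Rightarrow> 'a \<Rightarrow> 'b"
  where "dd f z u \<equiv> frechet_derivative f (at z) u"

lemma dd_eqI: "(f has_derivative f') (at z) \<Longrightarrow> dd f z u = f' u"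
  by (simp add: frechet_derivative_at[symmetric])

context
  fixes S :: "'a::euclidean_space set" and z :: 'a
  assumes S: "open S" and z: "z \<in> S"
begin

lemma linear_dd: "smooth_on S f \<Longrightarrow> linear (dd f z)"
  by (rule has_derivative_linear[OF smooth_on_has_derivative[OF _ z]])

lemma dd_add: "smooth_on S f \<Longrightarrow> smooth_on S g \<Longrightarrow> dd (\<lambda>y. f y + g y) z u = dd f z u + dd g z u"
  by (rule dd_eqI[OF has_derivative_add[OF smooth_on_has_derivative[OF _ z] smooth_on_has_derivative[OF _ z]]])

lemma dd_diff: "smooth_on S f \<Longrightarrow> smooth_on S g \<Longrightarrow> dd (\<lambda>y. f y - g y) z u = dd f z u - dd g z u"
  by (rule dd_eqI[OF has_derivative_diff[OF smooth_on_has_derivative[OF _ z] smooth_on_has_derivative[OF _ z]]])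

lemma dd_scaleR: "smooth_on S f \<Longrightarrow> smooth_on S g \<Longrightarrow>
    dd (\<lambda>y. f y *\<^sub>R g y) z u = f z *\<^sub>R dd g z u + dd f z u *\<^sub>R g z"
  by (rule dd_eqI[OF has_derivative_scaleR[OF smooth_on_has_derivative[OF _ z] smooth_on_has_derivative[OF _ z]]])

lemma dd_cong: "(\<And>y. y \<in> S \<Longrightarrow> f y = g y) \<Longrightarrow> dd f z u = dd g z u"
  using frechet_derivative_cong_open[OF S z, of f g] by simp

lemma dd_const: "dd (\<lambda>y. c) z u = 0"
  by (rule dd_eqI[OF has_derivative_const])

end

text \<open>Families of linear and bilinear maps depending smoothly on a point: bundle maps and
  connection forms read in coordinates.\<close>

definition smooth_linear :: "'a::real_normed_vector set \<Rightarrow> ('a \<Rightarrow> 'b::real_vector \<Rightarrow> 'c::real_normed_vector) \<Rightarrow> bool"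
  where "smooth_linear S T \<longleftrightarrow> (\<forall>z\<in>S. linear (T z)) \<and> (\<forall>w. smooth_on S (\<lambda>z. T z w))"

definition smooth_bilinear ::
  "'a::real_normed_vector set \<Rightarrow> ('a \<Rightarrow> 'b::real_vector \<Rightarrow> 'c::real_vector \<Rightarrow> 'd::real_normed_vector) \<Rightarrow> bool"
  where "smooth_bilinear S T \<longleftrightarrow> (\<forall>z\<in>S. bilinear (T z)) \<and> (\<forall>v w. smooth_on S (\<lambda>z. T z v w))"

lemma smooth_linearD:
  "smooth_linear S T \<Longrightarrow> z \<in> S \<Longrightarrow> linear (T z)" "smooth_linear S T \<Longrightarrow> smooth_on S (\<lambda>z. T z w)"
  by (auto simp: smooth_linear_def)

lemma smooth_bilinearD:
  "smooth_bilinear S T \<Longrightarrow> z \<in> S \<Longrightarrow> bilinear (T z)" "smooth_bilinear S T \<Longrightarrow> smooth_on S (\<lambda>z. T z v w)"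
  by (auto simp: smooth_bilinear_def)

lemma smooth_linear_subset: "smooth_linear S T \<Longrightarrow> S' \<subseteq> S \<Longrightarrow> smooth_linear S' T"
  unfolding smooth_linear_def using smooth_on_subset by blast

lemma smooth_bilinear_subset: "smooth_bilinear S T \<Longrightarrow> S' \<subseteq> S \<Longrightarrow> smooth_bilinear S' T"
  unfolding smooth_bilinear_def using smooth_on_subset by blast

lemma smooth_bilinear_linear:
  "smooth_bilinear S T \<Longrightarrow> smooth_linear S (\<lambda>z v. T z v w)"
  "smooth_bilinear S T \<Longrightarrow> smooth_linear S (\<lambda>z. T z v)"
  by (auto simp: smooth_bilinear_def smooth_linear_def bilinear_def)

text \<open>The product rule for \<open>T(f)\<close>: after expansion of \<open>f\<close> in a basis the products are those of scalar functions
  with the values of \<open>T\<close> on fixed vectors.\<close>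

lemma smooth_linear_apply:
  fixes T :: "'a::euclidean_space \<Rightarrow> 'b::euclidean_space \<Rightarrow> 'c::real_normed_vector"
  assumes S: "open S" and T: "smooth_linear S T" and f: "smooth_on S f"
  shows "smooth_on S (\<lambda>z. T z (f z))"
    and "z \<in> S \<Longrightarrow> dd (\<lambda>y. T y (f y)) z h = dd (\<lambda>y. T y (f z)) z h + T z (dd f z h)"
proof -
  have fb: "smooth_on S (\<lambda>y. f y \<bullet> b)" for b
    by (rule smooth_on_bounded_linear[where L="\<lambda>y. y \<bullet> b", OF S bounded_linear_inner_left f])
  have Tb: "smooth_on S (\<lambda>y. T y b)" for b by (rule smooth_linearD[OF T])
  have sm: "smooth_on S (\<lambda>y. (f y \<bullet> b) *\<^sub>R T y b)" for b by (rule smooth_on_scaleR[OF S fb Tb])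
  have sc: "smooth_on S (\<lambda>y. c *\<^sub>R T y b)" for b c by (rule smooth_on_scaleR[OF S smooth_on_const[OF S] Tb])
  have eq: "T y w = (\<Sum>b\<in>Basis. (w \<bullet> b) *\<^sub>R T y b)" if "y \<in> S" for y w
    by (rule linear_sum_Basis[OF smooth_linearD(1)[OF T that]])
  have "smooth_on S (\<lambda>y. \<Sum>b\<in>Basis. (f y \<bullet> b) *\<^sub>R T y b)" by (rule smooth_on_sum[OF S finite_Basis sm])
  then show "smooth_on S (\<lambda>z. T z (f z))"
    by (rule smooth_on_cong[OF S, THEN iffD1, rotated]) (use eq in simp)
  assume z: "z \<in> S"
  have fd: "(f has_derivative dd f z) (at z)" by (rule smooth_on_has_derivative[OF f z])
  have d: "((\<lambda>y. (f y \<bullet> b) *\<^sub>R T y b) has_derivative (\<lambda>h. (f z \<bullet> b) *\<^sub>R dd (\<lambda>y. T y b) z h + (dd f z h \<bullet> b) *\<^sub>R T z b)) (at z)" for b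
    by (rule has_derivative_scaleR[OF has_derivative_inner_left[OF fd] smooth_on_has_derivative[OF Tb z]])
  have "dd (\<lambda>y. T y (f y)) z h = dd (\<lambda>y. \<Sum>b\<in>Basis. (f y \<bullet> b) *\<^sub>R T y b) z h"
    by (rule dd_cong[OF S z]) (rule eq)
  also have "\<dots> = (\<Sum>b\<in>Basis. (f z \<bullet> b) *\<^sub>R dd (\<lambda>y. T y b) z h + (dd f z h \<bullet> b) *\<^sub>R T z b)"
    by (rule dd_eqI[OF has_derivative_sum[OF d]])
  also have "\<dots> = (\<Sum>b\<in>Basis. (f z \<bullet> b) *\<^sub>R dd (\<lambda>y. T y b) z h) + T z (dd f z h)"
    using eq[OF z, of "dd f z h"] by (simp add: sum.distrib)
  also have "(\<Sum>b\<in>Basis. (f z \<bullet> b) *\<^sub>R dd (\<lambda>y. T y b) z h) = dd (\<lambda>y. \<Sum>b\<in>Basis. (f z \<bullet> b) *\<^sub>R T y b) z h"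
    by (rule sym, rule dd_eqI[OF has_derivative_sum[OF has_derivative_scaleR_right[OF smooth_on_has_derivative[OF Tb z]]]])
  also have "\<dots> = dd (\<lambda>y. T y (f z)) z h"
    by (rule dd_cong[OF S z]) (rule eq[symmetric])
  finally show "dd (\<lambda>y. T y (f y)) z h = dd (\<lambda>y. T y (f z)) z h + T z (dd f z h)" .
qed

lemma smooth_bilinear_apply:
  fixes T :: "'a::euclidean_space \<Rightarrow> 'b::euclidean_space \<Rightarrow> 'c::euclidean_space \<Rightarrow> 'd::real_normed_vector"
  assumes S: "open S" and T: "smooth_bilinear S T" and f: "smooth_on S f" and g: "smooth_on S g"
  shows "smooth_on S (\<lambda>z. T z (f z) (g z))"
    and "z \<in> S \<Longrightarrow> dd (\<lambda>y. T y (f y) (g y)) z h =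
      dd (\<lambda>y. T y (f z) (g z)) z h + T z (dd f z h) (g z) + T z (f z) (dd g z h)"
proof -
  have T': "smooth_linear S (\<lambda>y. T y (f y))"
    unfolding smooth_linear_def
    using smooth_bilinearD(1)[OF T] smooth_linear_apply(1)[OF S smooth_bilinear_linear(1)[OF T] f]
    by (auto simp: bilinear_def)
  show "smooth_on S (\<lambda>z. T z (f z) (g z))" by (rule smooth_linear_apply(1)[OF S T' g])
  assume z: "z \<in> S"
  show "dd (\<lambda>y. T y (f y) (g y)) z h =
      dd (\<lambda>y. T y (f z) (g z)) z h + T z (dd f z h) (g z) + T z (f z) (dd g z h)"
    using smooth_linear_apply(2)[OF S T' g z, of h]
      smooth_linear_apply(2)[OF S smooth_bilinear_linear(1)[OF T] f z, of "g z" h] by simp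
qed

lemma smooth_linear_dd: "open S \<Longrightarrow> smooth_on S f \<Longrightarrow> smooth_linear S (dd f)"
  for S :: "'a::euclidean_space set"
  unfolding smooth_linear_def using linear_dd smooth_on_frechet by blast

text \<open>A connection form \<open>\<Gamma>\<close> stands for the operator \<open>\<nabla>\<^sub>X \<eta> = d\<eta>(X) + \<Gamma>(X) \<eta>\<close>.\<close>

definition cov ::
  "('a::euclidean_space \<Rightarrow> 'a \<Rightarrow> 'b::euclidean_space \<Rightarrow> 'b) \<Rightarrow> ('a \<Rightarrow> 'a) \<Rightarrow> ('a \<Rightarrow> 'b) \<Rightarrow> 'a \<Rightarrow> 'b"
  where "cov \<Gamma> X \<eta> z = dd \<eta> z (X z) + \<Gamma> z (X z) (\<eta> z)"

definition curv ::
  "('a::euclidean_space \<Rightarrow> 'a \<Rightarrow> 'b::euclidean_space \<Rightarrow> 'b) \<Rightarrow> 'a \<Rightarrow> 'a \<Rightarrow> 'a \<Rightarrow> 'b \<Rightarrow> 'b"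
  where "curv \<Gamma> z u v e = dd (\<lambda>y. \<Gamma> y v e) z u - dd (\<lambda>y. \<Gamma> y u e) z v
    + \<Gamma> z u (\<Gamma> z v e) - \<Gamma> z v (\<Gamma> z u e)"

definition torsion_free ::
  "'a set \<Rightarrow> ('a::euclidean_space \<Rightarrow> 'a \<Rightarrow> 'b::euclidean_space) \<Rightarrow> ('a \<Rightarrow> 'a \<Rightarrow> 'b \<Rightarrow> 'b) \<Rightarrow> bool"
  where "torsion_free S \<phi> \<Gamma> \<longleftrightarrow> (\<forall>z\<in>S. \<forall>u v.
    dd (\<lambda>y. \<phi> y v) z u + \<Gamma> z u (\<phi> z v) = dd (\<lambda>y. \<phi> y u) z v + \<Gamma> z v (\<phi> z u))"

lemmas bilinear_simps = bilinear_ladd bilinear_radd bilinear_lsub bilinear_rsub bilinear_lmul bilinear_rmul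
lemmas linear_map_simps = linear_add linear_diff linear_cmul

context
  fixes S :: "'a::euclidean_space set" and \<Gamma> :: "'a \<Rightarrow> 'a \<Rightarrow> 'b::euclidean_space \<Rightarrow> 'b"
  assumes S: "open S" and \<Gamma>: "smooth_bilinear S \<Gamma>"
begin

lemma smooth_cov:
  assumes "smooth_on S X" "smooth_on S \<eta>" shows "smooth_on S (cov \<Gamma> X \<eta>)"
  unfolding cov_def[abs_def]
  by (rule smooth_on_add[OF S smooth_linear_apply(1)[OF S smooth_linear_dd[OF S assms(2)] assms(1)]
        smooth_bilinear_apply(1)[OF S \<Gamma> assms]])

text \<open>The second derivatives of \<open>\<eta>\<close> cancel by symmetry, and the derivatives of \<open>X\<close> and \<open>Y\<close> combine to the
  bracket \<open>L\<close>.\<close>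

lemma cov_curvature:
  assumes X: "smooth_on S X" and Y: "smooth_on S Y" and \<eta>: "smooth_on S \<eta>" and z: "z \<in> S"
    and L: "L z = dd Y z (X z) - dd X z (Y z)"
  shows "cov \<Gamma> X (cov \<Gamma> Y \<eta>) z - cov \<Gamma> Y (cov \<Gamma> X \<eta>) z - cov \<Gamma> L \<eta> z = curv \<Gamma> z (X z) (Y z) (\<eta> z)"
proof -
  have D: "dd (cov \<Gamma> Y \<eta>) z h = dd (\<lambda>y. dd \<eta> y (Y z)) z h + dd \<eta> z (dd Y z h) +
      (dd (\<lambda>y. \<Gamma> y (Y z) (\<eta> z)) z h + \<Gamma> z (dd Y z h) (\<eta> z) + \<Gamma> z (Y z) (dd \<eta> z h))"
    if Y: "smooth_on S Y" for Y h
  proof -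
    have \<eta>1: "smooth_linear S (dd \<eta>)" by (rule smooth_linear_dd[OF S \<eta>])
    show ?thesis unfolding cov_def[abs_def]
      using dd_add[OF S z smooth_linear_apply(1)[OF S \<eta>1 Y] smooth_bilinear_apply(1)[OF S \<Gamma> Y \<eta>], of h]
        smooth_linear_apply(2)[OF S \<eta>1 Y z, of h] smooth_bilinear_apply(2)[OF S \<Gamma> Y \<eta> z, of h] by simp
  qed
  have l: "linear (dd \<eta> z)" by (rule linear_dd[OF S z \<eta>])
  have b: "bilinear (\<Gamma> z)" by (rule smooth_bilinearD(1)[OF \<Gamma> z])
  have s: "dd (\<lambda>y. dd \<eta> y (Y z)) z (X z) = dd (\<lambda>y. dd \<eta> y (X z)) z (Y z)"
    by (rule frechet_derivative_symmetric[OF S z \<eta>])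
  show ?thesis
    unfolding cov_def[of \<Gamma> X "cov \<Gamma> Y \<eta>"] cov_def[of \<Gamma> Y "cov \<Gamma> X \<eta>"] D[OF X] D[OF Y] s
    unfolding cov_def L curv_def
    by (simp add: linear_map_simps[OF l] bilinear_simps[OF b] algebra_simps)
qed

text \<open>The second Bianchi identity.  The second derivatives of \<open>\<Gamma>\<close> cancel in the cyclic sum by symmetry, the
  remaining terms by bilinearity.\<close>

lemma bianchi:
  fixes e :: 'b
  assumes z: "z \<in> S"
  defines "N \<equiv> \<lambda>w u v. dd (\<lambda>y. curv \<Gamma> y u v e) z w + \<Gamma> z w (curv \<Gamma> z u v e) - curv \<Gamma> z u v (\<Gamma> z w e)"
  shows "N w u v + N u v w + N v w u = 0"
proof -
  have g: "smooth_on S (\<lambda>y. \<Gamma> y u e)" for u e by (rule smooth_bilinearD(2)[OF \<Gamma>])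
  have g1: "smooth_on S (\<lambda>y. dd (\<lambda>y. \<Gamma> y u e) y v)" for u e v by (rule smooth_on_frechet[OF g])
  have lin: "smooth_linear S (\<lambda>y. \<Gamma> y u)" for u by (rule smooth_bilinear_linear(2)[OF \<Gamma>])
  have gg: "smooth_on S (\<lambda>y. \<Gamma> y u (\<Gamma> y v e))" for u v e by (rule smooth_linear_apply(1)[OF S lin g])
  have dgg: "dd (\<lambda>y. \<Gamma> y u (\<Gamma> y v e)) z w = dd (\<lambda>y. \<Gamma> y u (\<Gamma> z v e)) z w + \<Gamma> z u (dd (\<lambda>y. \<Gamma> y v e) z w)" for u v w
    by (rule smooth_linear_apply(2)[OF S lin g z])
  have D: "dd (\<lambda>y. curv \<Gamma> y u v e) z w =
      dd (\<lambda>y. dd (\<lambda>y. \<Gamma> y v e) y u) z w - dd (\<lambda>y. dd (\<lambda>y. \<Gamma> y u e) y v) z w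
      + (dd (\<lambda>y. \<Gamma> y u (\<Gamma> z v e)) z w + \<Gamma> z u (dd (\<lambda>y. \<Gamma> y v e) z w))
      - (dd (\<lambda>y. \<Gamma> y v (\<Gamma> z u e)) z w + \<Gamma> z v (dd (\<lambda>y. \<Gamma> y u e) z w))" for u v w
    unfolding curv_def
    by (simp add: dd_diff[OF S z smooth_on_add[OF S smooth_on_diff[OF S g1 g1] gg] gg]
        dd_add[OF S z smooth_on_diff[OF S g1 g1] gg] dd_diff[OF S z g1 g1] dgg)
  have sym: "dd (\<lambda>y. dd (\<lambda>y. \<Gamma> y a e) y u) z v = dd (\<lambda>y. dd (\<lambda>y. \<Gamma> y a e) y v) z u" for a u v
    by (rule frechet_derivative_symmetric[OF S z g])
  have b: "bilinear (\<Gamma> z)" by (rule smooth_bilinearD(1)[OF \<Gamma> z])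
  show ?thesis
    unfolding N_def D unfolding curv_def
    using sym[of v u w] sym[of u v w] sym[of w u v]
    by (simp add: bilinear_simps[OF b] algebra_simps)
qed

end

section \<open>Projective changes of a connection\<close>

definition proj_change ::
  "('a \<Rightarrow> 'a \<Rightarrow> 'b) \<Rightarrow> ('a \<Rightarrow> 'b \<Rightarrow> real) \<Rightarrow> ('a \<Rightarrow> 'a \<Rightarrow> 'b \<Rightarrow> 'b) \<Rightarrow> 'a \<Rightarrow> 'a \<Rightarrow> 'b \<Rightarrow> 'b::real_vector"
  where "proj_change \<phi> \<rho> \<Gamma> z u e = \<Gamma> z u e + \<rho> z (\<phi> z u) *\<^sub>R e + \<rho> z e *\<^sub>R \<phi> z u"

text \<open>The covariant derivative of a section of the dual bundle.\<close>

definition dual_cov ::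
  "('a::real_normed_vector \<Rightarrow> 'a \<Rightarrow> 'b \<Rightarrow> 'b) \<Rightarrow> ('a \<Rightarrow> 'b \<Rightarrow> real) \<Rightarrow> 'a \<Rightarrow> 'a \<Rightarrow> 'b \<Rightarrow> real"
  where "dual_cov \<Gamma> \<rho> z u e = dd (\<lambda>y. \<rho> y e) z u - \<rho> z (\<Gamma> z u e)"

text \<open>The second-order datum of \<open>\<rho>\<close> by which the curvature changes, an analogue of the projective Schouten
  tensor.\<close>

definition schouten ::
  "('a::real_normed_vector \<Rightarrow> 'a \<Rightarrow> 'b) \<Rightarrow> ('a \<Rightarrow> 'b \<Rightarrow> real) \<Rightarrow> ('a \<Rightarrow> 'a \<Rightarrow> 'b \<Rightarrow> 'b) \<Rightarrow> 'a \<Rightarrow> 'a \<Rightarrow> 'b \<Rightarrow> real"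
  where "schouten \<phi> \<rho> \<Gamma> z u e = dual_cov \<Gamma> \<rho> z u e - \<rho> z (\<phi> z u) * \<rho> z e"

text \<open>The exterior covariant derivative of \<open>B\<close>, as a one-form with values in the dual bundle.\<close>

definition codazzi ::
  "('a::real_normed_vector \<Rightarrow> 'a \<Rightarrow> 'b \<Rightarrow> 'b) \<Rightarrow> ('a \<Rightarrow> 'a \<Rightarrow> 'b \<Rightarrow> real) \<Rightarrow> 'a \<Rightarrow> 'a \<Rightarrow> 'a \<Rightarrow> 'b \<Rightarrow> real"
  where "codazzi \<Gamma> B z u v e =
    dd (\<lambda>y. B y v e) z u - dd (\<lambda>y. B y u e) z v - B z v (\<Gamma> z u e) + B z u (\<Gamma> z v e)"

context
  fixes S :: "'a::euclidean_space set" and \<Gamma> :: "'a \<Rightarrow> 'a \<Rightarrow> 'b::euclidean_space \<Rightarrow> 'b"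
    and \<phi> :: "'a \<Rightarrow> 'a \<Rightarrow> 'b"
  assumes S: "open S" and \<Gamma>: "smooth_bilinear S \<Gamma>" and \<phi>: "smooth_linear S \<phi>"
    and tf: "torsion_free S \<phi> \<Gamma>"
begin

lemma smooth_bilinear_proj_change:
  assumes \<rho>: "smooth_linear S \<rho>" shows "smooth_bilinear S (proj_change \<phi> \<rho> \<Gamma>)"
  unfolding smooth_bilinear_def
proof safe
  fix z assume z: "z \<in> S"
  show "bilinear (proj_change \<phi> \<rho> \<Gamma> z)"
    unfolding bilinear_def proj_change_def
    by (intro conjI allI linearI) (simp_all add: bilinear_simps[OF smooth_bilinearD(1)[OF \<Gamma> z]]
        linear_map_simps[OF smooth_linearD(1)[OF \<phi> z]] linear_map_simps[OF smooth_linearD(1)[OF \<rho> z]] algebra_simps)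
next
  fix u e
  show "smooth_on S (\<lambda>z. proj_change \<phi> \<rho> \<Gamma> z u e)" unfolding proj_change_def
    by (intro smooth_on_add smooth_on_scaleR S smooth_bilinearD(2)[OF \<Gamma>] smooth_linearD(2)[OF \<rho>]
        smooth_linearD(2)[OF \<phi>] smooth_linear_apply(1)[OF S \<rho>] smooth_on_const[OF S])
qed

lemma torsion_free_proj_change: "torsion_free S \<phi> (proj_change \<phi> \<rho> \<Gamma>)"
  using tf unfolding torsion_free_def proj_change_def by (simp add: algebra_simps)

text \<open>The derivative of \<open>\<phi>\<close> enters only through the skew combination \<open>D\<^sub>u \<phi>(v) - D\<^sub>v \<phi>(u)\<close>, which torsion-freeness
  expresses by \<open>\<Gamma>\<close>; the quadratic terms in \<open>\<rho>\<close> are absorbed into the Schouten tensor.\<close>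

lemma curv_proj_change:
  assumes \<rho>: "smooth_linear S \<rho>" and z: "z \<in> S"
  shows "curv (proj_change \<phi> \<rho> \<Gamma>) z u v e = curv \<Gamma> z u v e
    + (dual_cov \<Gamma> \<rho> z u (\<phi> z v) - dual_cov \<Gamma> \<rho> z v (\<phi> z u)) *\<^sub>R e
    + schouten \<phi> \<rho> \<Gamma> z u e *\<^sub>R \<phi> z v - schouten \<phi> \<rho> \<Gamma> z v e *\<^sub>R \<phi> z u"
proof -
  have g: "smooth_on S (\<lambda>y. \<Gamma> y u e)" for u e by (rule smooth_bilinearD(2)[OF \<Gamma>])
  have r: "smooth_on S (\<lambda>y. \<rho> y e)" for e by (rule smooth_linearD(2)[OF \<rho>])
  have f: "smooth_on S (\<lambda>y. \<phi> y u)" for u by (rule smooth_linearD(2)[OF \<phi>])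
  have rf: "smooth_on S (\<lambda>y. \<rho> y (\<phi> y u))" for u by (rule smooth_linear_apply(1)[OF S \<rho> f])
  have c: "smooth_on S (\<lambda>y. e)" for e :: 'b by (rule smooth_on_const[OF S])
  have drf: "dd (\<lambda>y. \<rho> y (\<phi> y v)) z u = dd (\<lambda>y. \<rho> y (\<phi> z v)) z u + \<rho> z (dd (\<lambda>y. \<phi> y v) z u)" for u v
    by (rule smooth_linear_apply(2)[OF S \<rho> f z])
  have D: "dd (\<lambda>y. proj_change \<phi> \<rho> \<Gamma> y v e) z u = dd (\<lambda>y. \<Gamma> y v e) z u
      + (dd (\<lambda>y. \<rho> y (\<phi> z v)) z u + \<rho> z (dd (\<lambda>y. \<phi> y v) z u)) *\<^sub>R e
      + (\<rho> z e *\<^sub>R dd (\<lambda>y. \<phi> y v) z u + dd (\<lambda>y. \<rho> y e) z u *\<^sub>R \<phi> z v)" for u v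
    unfolding proj_change_def
    by (simp add: dd_add[OF S z smooth_on_add[OF S g smooth_on_scaleR[OF S rf c]] smooth_on_scaleR[OF S r f]]
        dd_add[OF S z g smooth_on_scaleR[OF S rf c]] dd_scaleR[OF S z rf c] dd_scaleR[OF S z r f] drf dd_const[OF S z])
  have t: "dd (\<lambda>y. \<phi> y v) z u = dd (\<lambda>y. \<phi> y u) z v + \<Gamma> z v (\<phi> z u) - \<Gamma> z u (\<phi> z v)"
    using tf z unfolding torsion_free_def by (metis add_diff_cancel_right')
  show ?thesis
    unfolding curv_def D unfolding t
    unfolding proj_change_def schouten_def dual_cov_def
    by (simp add: bilinear_simps[OF smooth_bilinearD(1)[OF \<Gamma> z]]
        linear_map_simps[OF smooth_linearD(1)[OF \<phi> z]] linear_map_simps[OF smooth_linearD(1)[OF \<rho> z]] algebra_simps)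
      (simp only: mult_2 scaleR_add_left add_ac)
qed

section \<open>The Codazzi equation\<close>

text \<open>If \<open>R(u,v)e = B(v,e)\<phi>(u) - B(u,e)\<phi>(v)\<close>, then the Bianchi identity and the symmetry of \<open>\<nabla>\<phi>\<close>
  leave a linear relation between \<open>\<phi>(u)\<close>, \<open>\<phi>(v)\<close>, \<open>\<phi>(w)\<close> whose coefficients are the components of
  the exterior covariant derivative of \<open>B\<close>.\<close>

context
  fixes B
  assumes B: "smooth_bilinear S B"
    and R: "\<And>z u v e. z \<in> S \<Longrightarrow> curv \<Gamma> z u v e = B z v e *\<^sub>R \<phi> z u - B z u e *\<^sub>R \<phi> z v"
begin

lemma codazzi_relation:
  assumes z: "z \<in> S"
  shows "codazzi \<Gamma> B z w v e *\<^sub>R \<phi> z u + codazzi \<Gamma> B z u w e *\<^sub>R \<phi> z v + codazzi \<Gamma> B z v u e *\<^sub>R \<phi> z w = 0"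
proof -
  have bs: "smooth_on S (\<lambda>y. B y u e)" for u e by (rule smooth_bilinearD(2)[OF B])
  have f: "smooth_on S (\<lambda>y. \<phi> y u)" for u by (rule smooth_linearD(2)[OF \<phi>])
  have "dd (\<lambda>y. curv \<Gamma> y u v e) z w = dd (\<lambda>y. B y v e *\<^sub>R \<phi> y u - B y u e *\<^sub>R \<phi> y v) z w" for u v w
    by (rule dd_cong[OF S z]) (rule R)
  then have D: "dd (\<lambda>y. curv \<Gamma> y u v e) z w =
      (B z v e *\<^sub>R dd (\<lambda>y. \<phi> y u) z w + dd (\<lambda>y. B y v e) z w *\<^sub>R \<phi> z u)
      - (B z u e *\<^sub>R dd (\<lambda>y. \<phi> y v) z w + dd (\<lambda>y. B y u e) z w *\<^sub>R \<phi> z v)" for u v w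
    by (simp add: dd_diff[OF S z smooth_on_scaleR[OF S bs f] smooth_on_scaleR[OF S bs f]] dd_scaleR[OF S z bs f])
  have t: "dd (\<lambda>y. \<phi> y v) z u = dd (\<lambda>y. \<phi> y u) z v + \<Gamma> z v (\<phi> z u) - \<Gamma> z u (\<phi> z v)" for u v
    using tf z unfolding torsion_free_def by (metis add_diff_cancel_right')
  show ?thesis
    using bianchi[OF S \<Gamma> z, where e=e and w=w and u=u and v=v]
    unfolding D R[OF z] codazzi_def
    unfolding t[of u w] t[of v u] t[of w v]
    by (simp add: bilinear_simps[OF smooth_bilinearD(1)[OF \<Gamma> z]]
        linear_map_simps[OF smooth_linearD(1)[OF \<phi> z]] bilinear_simps[OF smooth_bilinearD(1)[OF B z]] algebra_simps)
qed

text \<open>For \<open>\<phi>(w)\<close> outside the span of \<open>\<phi>(u)\<close> and \<open>\<phi>(v)\<close>, its coefficient in the linear relation has to vanish.\<close>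

lemma codazzi_zero_of_rank:
  assumes z: "z \<in> S" and w: "\<phi> z w \<notin> span {\<phi> z u, \<phi> z v}"
  shows "codazzi \<Gamma> B z v u e = 0"
proof (rule ccontr)
  let ?c = "codazzi \<Gamma> B z v u e"
  assume c: "?c \<noteq> 0"
  have "?c *\<^sub>R \<phi> z w = - (codazzi \<Gamma> B z w v e *\<^sub>R \<phi> z u) - codazzi \<Gamma> B z u w e *\<^sub>R \<phi> z v"
    using codazzi_relation[OF z, of w v e u] by (simp add: algebra_simps eq_neg_iff_add_eq_0)
  also have "\<dots> \<in> span {\<phi> z u, \<phi> z v}" by (intro span_diff span_neg span_scale span_base) auto
  finally have "(1 / ?c) *\<^sub>R ?c *\<^sub>R \<phi> z w \<in> span {\<phi> z u, \<phi> z v}" by (rule span_scale)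
  then show False using c w by simp
qed

lemma codazzi_zero:
  assumes dense: "S \<subseteq> closure G" "G \<subseteq> S"
    and G: "\<And>z u v. z \<in> G \<Longrightarrow> \<exists>w. \<phi> z w \<notin> span {\<phi> z u, \<phi> z v}"
    and z: "z \<in> S"
  shows "codazzi \<Gamma> B z u v e = 0"
proof -
  have "smooth_on S (\<lambda>z. codazzi \<Gamma> B z u v e)" unfolding codazzi_def
    by (intro smooth_on_add smooth_on_diff S smooth_on_frechet smooth_bilinearD(2)[OF B]
        smooth_linear_apply(1)[OF S smooth_bilinear_linear(2)[OF B]] smooth_bilinearD(2)[OF \<Gamma>])
  then have c: "continuous_on S (\<lambda>z. codazzi \<Gamma> B z u v e)" by (rule smooth_on_continuous_on)
  show ?thesis
    by (rule zero_of_dense_zero[OF S c dense(1) _ z])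
      (use codazzi_zero_of_rank dense(2) G in blast)
qed
end

end

section \<open>Parallel sections of flat connections\<close>

lemma smooth_linear_dd_family:
  fixes G :: "'a::euclidean_space \<Rightarrow> 'b::euclidean_space \<Rightarrow> 'c::euclidean_space"
  assumes S: "open S" and G: "smooth_linear S G"
  shows "smooth_linear S (\<lambda>y b. dd (\<lambda>y. G y b) y h)"
  unfolding smooth_linear_def
proof safe
  fix z assume z: "z \<in> S"
  have g: "smooth_on S (\<lambda>y. G y b)" for b by (rule smooth_linearD(2)[OF G])
  show "linear (\<lambda>b. dd (\<lambda>y. G y b) z h)"
  proof (rule linearI)
    fix a b
    have "dd (\<lambda>y. G y (a + b)) z h = dd (\<lambda>y. G y a + G y b) z h"
      by (rule dd_cong[OF S z]) (rule linear_add[OF smooth_linearD(1)[OF G]])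
    then show "dd (\<lambda>y. G y (a + b)) z h = dd (\<lambda>y. G y a) z h + dd (\<lambda>y. G y b) z h"
      using dd_add[OF S z g g, of a b h] by simp
  next
    fix c b
    have "dd (\<lambda>y. G y (c *\<^sub>R b)) z h = dd (\<lambda>y. c *\<^sub>R G y b) z h"
      by (rule dd_cong[OF S z]) (rule linear_cmul[OF smooth_linearD(1)[OF G]])
    also have "\<dots> = c *\<^sub>R dd (\<lambda>y. G y b) z h"
      by (rule dd_eqI[OF has_derivative_scaleR_right[OF smooth_on_has_derivative[OF g z]]])
    finally show "dd (\<lambda>y. G y (c *\<^sub>R b)) z h = c *\<^sub>R dd (\<lambda>y. G y b) z h" .
  qed
next
  fix b show "smooth_on S (\<lambda>y. dd (\<lambda>y. G y b) y h)"
    by (rule smooth_on_frechet[OF smooth_linearD(2)[OF G]])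
qed

context
  fixes S :: "'a::euclidean_space set" and z0 :: 'a
  assumes S: "open S" "convex S" "z0 \<in> S"
begin

lemma ray_integrable:
  fixes F :: "'a \<Rightarrow> 'b::euclidean_space"
  assumes "continuous_on S F" "z \<in> S"
  shows "(\<lambda>t. t ^ m *\<^sub>R F (z0 + t *\<^sub>R (z - z0))) integrable_on {0..1}"
  by (rule integrable_continuous_real[OF continuous_on_ray_section[OF S(2,3) assms]])

lemma ray_point: "z \<in> S \<Longrightarrow> t \<in> {0..1} \<Longrightarrow> z0 + t *\<^sub>R (z - z0) \<in> S"
  using segment_in_convex[OF S(2,3), of "z - z0" t] by simp

lemma ray_mean_diff:
  fixes F G :: "'a \<Rightarrow> 'b::euclidean_space"
  assumes "continuous_on S F" "continuous_on S G" "z \<in> S"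
  shows "ray_mean z0 m (\<lambda>y. F y - G y) z = ray_mean z0 m F z - ray_mean z0 m G z"
  using integral_diff[OF ray_integrable[OF assms(1,3)] ray_integrable[OF assms(2,3)], of m m]
  by (simp only: ray_mean_def scaleR_diff_right[of _ "F _" "G _"])

lemma ray_mean_cong:
  assumes "\<And>y. y \<in> S \<Longrightarrow> F y = G y" "z \<in> S"
  shows "ray_mean z0 m F z = ray_mean z0 m G z"
  unfolding ray_mean_def by (rule integral_cong) (use assms ray_point in simp)

lemma norm_ray_mean_le:
  fixes F :: "'a \<Rightarrow> 'b::euclidean_space"
  assumes "continuous_on S F" "z \<in> S" "\<And>y. y \<in> S \<Longrightarrow> norm (F y) \<le> b"
  shows "norm (ray_mean z0 m F z) \<le> b"
proof -
  have "norm (integral {0..1} (\<lambda>t. t ^ m *\<^sub>R F (z0 + t *\<^sub>R (z - z0)))) \<le> b * (1 - 0)"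
  proof (rule integral_bound)
    show "continuous_on {0..1} (\<lambda>t. t ^ m *\<^sub>R F (z0 + t *\<^sub>R (z - z0)))"
      by (rule continuous_on_ray_section[OF S(2,3) assms(1,2)])
    fix t :: real assume t: "t \<in> {0..1}"
    have "norm (t ^ m *\<^sub>R F (z0 + t *\<^sub>R (z - z0))) \<le> 1 * norm (F (z0 + t *\<^sub>R (z - z0)))"
      unfolding norm_scaleR using t by (intro mult_right_mono) (auto simp: power_le_one)
    also have "\<dots> \<le> b" using assms(3)[OF ray_point[OF assms(2) t]] by simp
    finally show "norm (t ^ m *\<^sub>R F (z0 + t *\<^sub>R (z - z0))) \<le> b" .
  qed simp
  then show ?thesis by (simp add: ray_mean_def)
qed

lemma ray_mean_linear:
  fixes G :: "'a \<Rightarrow> 'c::euclidean_space \<Rightarrow> 'b::euclidean_space"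
  assumes G: "smooth_linear S G" and z: "z \<in> S"
  shows "ray_mean z0 m (\<lambda>y. G y v) z = (\<Sum>b\<in>Basis. (v \<bullet> b) *\<^sub>R ray_mean z0 m (\<lambda>y. G y b) z)"
proof -
  have "ray_mean z0 m (\<lambda>y. G y v) z = integral {0..1} (\<lambda>t. \<Sum>b\<in>Basis. (v \<bullet> b) *\<^sub>R (t ^ m *\<^sub>R G (z0 + t *\<^sub>R (z - z0)) b))"
    unfolding ray_mean_def
  proof (rule integral_cong)
    fix t :: real assume "t \<in> {0..1}"
    from linear_sum_Basis[OF smooth_linearD(1)[OF G ray_point[OF z this]], of v]
    show "t ^ m *\<^sub>R G (z0 + t *\<^sub>R (z - z0)) v = (\<Sum>b\<in>Basis. (v \<bullet> b) *\<^sub>R (t ^ m *\<^sub>R G (z0 + t *\<^sub>R (z - z0)) b))"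
      by (simp add: scaleR_sum_right mult.commute)
  qed
  also have "\<dots> = (\<Sum>b\<in>Basis. integral {0..1} (\<lambda>t. (v \<bullet> b) *\<^sub>R (t ^ m *\<^sub>R G (z0 + t *\<^sub>R (z - z0)) b)))"
    by (rule integral_sum[OF finite_Basis integrable_cmul[OF ray_integrable[OF
        smooth_on_continuous_on[OF smooth_linearD(2)[OF G]] z]]])
  finally show ?thesis by (simp only: ray_mean_def integral_cmul)
qed

text \<open>The derivative of \<open>t f(z0 + t(z - z0))\<close>, integrated over \<open>[0,1]\<close>.\<close>

lemma ray_mean_ftc:
  fixes f :: "'a \<Rightarrow> 'b::euclidean_space"
  assumes f: "smooth_on S f" and z: "z \<in> S"
  shows "f z = ray_mean z0 0 f z + ray_mean z0 1 (\<lambda>y. dd f y (z - z0)) z"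
proof -
  let ?y = "\<lambda>t. z0 + t *\<^sub>R (z - z0)"
  have "((\<lambda>t. f (?y t) + t *\<^sub>R dd f (?y t) (z - z0)) has_integral (1 *\<^sub>R f (?y 1) - 0 *\<^sub>R f (?y 0))) {0..1}"
  proof (rule fundamental_theorem_of_calculus)
    fix t :: real assume t: "t \<in> {0..1}"
    have fd: "(f has_derivative dd f (?y t)) (at (?y t))"
      by (rule smooth_on_has_derivative[OF f ray_point[OF z t]])
    have "(?y has_derivative (\<lambda>s. s *\<^sub>R (z - z0))) (at t)" by (auto intro!: derivative_eq_intros)
    then have "((\<lambda>t. f (?y t)) has_derivative (\<lambda>s. dd f (?y t) (s *\<^sub>R (z - z0)))) (at t)"
      by (rule has_derivative_compose) (rule fd)
    then have "((\<lambda>t. f (?y t)) has_vector_derivative dd f (?y t) (z - z0)) (at t)"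
      by (simp add: has_vector_derivative_def linear_cmul[OF has_derivative_linear[OF fd]])
    then have "((\<lambda>t. t *\<^sub>R f (?y t)) has_vector_derivative (t *\<^sub>R dd f (?y t) (z - z0) + 1 *\<^sub>R f (?y t))) (at t)"
      by (intro has_vector_derivative_scaleR) (auto intro!: derivative_eq_intros)
    then show "((\<lambda>t. t *\<^sub>R f (?y t)) has_vector_derivative (f (?y t) + t *\<^sub>R dd f (?y t) (z - z0))) (at t within {0..1})"
      by (simp add: has_vector_derivative_at_within add.commute)
  qed simp
  then have "f z = integral {0..1} (\<lambda>t. f (?y t) + t *\<^sub>R dd f (?y t) (z - z0))"
    by (simp add: integral_unique)
  also have "\<dots> = integral {0..1} (\<lambda>t. f (?y t)) + integral {0..1} (\<lambda>t. t *\<^sub>R dd f (?y t) (z - z0))"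
    using ray_integrable[OF smooth_on_continuous_on[OF f] z, of 0]
      ray_integrable[OF smooth_on_continuous_on[OF smooth_on_frechet[OF f]] z, of 1 "z - z0"]
    by (intro integral_add) simp_all
  finally show ?thesis by (simp add: ray_mean_def)
qed

text \<open>The homotopy formula of the Poincare lemma for the one-form \<open>G\<close>: the integral of \<open>G\<close> along rays is a
  primitive up to a term with the exterior derivative of \<open>G\<close>.  It follows by comparing the derivative of
  the integral with the preceding identity for \<open>z \<mapsto> G z h\<close>.\<close>

lemma homotopy_formula:
  fixes G :: "'a \<Rightarrow> 'a \<Rightarrow> 'b::euclidean_space"
  assumes G: "smooth_linear S G" and z: "z \<in> S"
  shows "((\<lambda>z. ray_mean z0 0 (\<lambda>y. G y (z - z0)) z) has_derivative
    (\<lambda>h. G z h + ray_mean z0 1 (\<lambda>y. dd (\<lambda>y. G y (z - z0)) y h - dd (\<lambda>y. G y h) y (z - z0)) z)) (at z)"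
    and "smooth_on S (\<lambda>z. ray_mean z0 0 (\<lambda>y. G y (z - z0)) z)"
proof -
  have g: "smooth_on S (\<lambda>y. G y b)" for b by (rule smooth_linearD(2)[OF G])
  have m: "smooth_on S (ray_mean z0 0 (\<lambda>y. G y b))" for b by (rule smooth_on_ray_mean[OF S g])
  have l: "smooth_on S (\<lambda>z. (z - z0) \<bullet> b)" for b
    by (rule smooth_on_bounded_linear[where L="\<lambda>y. y \<bullet> b", OF S(1) bounded_linear_inner_left
          smooth_on_diff[OF S(1) smooth_on_id[OF S(1)] smooth_on_const[OF S(1)]]])
  have "smooth_on S (\<lambda>z. \<Sum>b\<in>Basis. ((z - z0) \<bullet> b) *\<^sub>R ray_mean z0 0 (\<lambda>y. G y b) z)"
    by (rule smooth_on_sum[OF S(1) finite_Basis smooth_on_scaleR[OF S(1) l m]])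
  then show "smooth_on S (\<lambda>z. ray_mean z0 0 (\<lambda>y. G y (z - z0)) z)"
    by (rule smooth_on_cong[OF S(1), THEN iffD1, rotated]) (rule ray_mean_linear[OF G, symmetric])
  have "((\<lambda>z. \<Sum>b\<in>Basis. ((z - z0) \<bullet> b) *\<^sub>R ray_mean z0 0 (\<lambda>y. G y b) z) has_derivative
     (\<lambda>h. \<Sum>b\<in>Basis. ((z - z0) \<bullet> b) *\<^sub>R ray_mean z0 (Suc 0) (\<lambda>y. dd (\<lambda>y. G y b) y h) z
       + (h \<bullet> b) *\<^sub>R ray_mean z0 0 (\<lambda>y. G y b) z)) (at z)"
  proof (rule has_derivative_sum)
    fix b :: 'a
    have "((\<lambda>z. (z - z0) \<bullet> b) has_derivative (\<lambda>h. h \<bullet> b)) (at z)" by (auto intro!: derivative_eq_intros)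
    then show "((\<lambda>z. ((z - z0) \<bullet> b) *\<^sub>R ray_mean z0 0 (\<lambda>y. G y b) z) has_derivative
     (\<lambda>h. ((z - z0) \<bullet> b) *\<^sub>R ray_mean z0 (Suc 0) (\<lambda>y. dd (\<lambda>y. G y b) y h) z
       + (h \<bullet> b) *\<^sub>R ray_mean z0 0 (\<lambda>y. G y b) z)) (at z)"
      by (rule has_derivative_scaleR[OF _ has_derivative_ray_mean[OF S z smooth_on_has_derivative[OF g]
          smooth_on_continuous_on[OF smooth_on_frechet[OF g]]]])
  qed
  moreover have "(\<Sum>b\<in>Basis. ((z - z0) \<bullet> b) *\<^sub>R ray_mean z0 (Suc 0) (\<lambda>y. dd (\<lambda>y. G y b) y h) z
       + (h \<bullet> b) *\<^sub>R ray_mean z0 0 (\<lambda>y. G y b) z) =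
     G z h + ray_mean z0 1 (\<lambda>y. dd (\<lambda>y. G y (z - z0)) y h - dd (\<lambda>y. G y h) y (z - z0)) z" for h
  proof -
    have "(\<Sum>b\<in>Basis. ((z - z0) \<bullet> b) *\<^sub>R ray_mean z0 (Suc 0) (\<lambda>y. dd (\<lambda>y. G y b) y h) z
       + (h \<bullet> b) *\<^sub>R ray_mean z0 0 (\<lambda>y. G y b) z) =
      ray_mean z0 1 (\<lambda>y. dd (\<lambda>y. G y (z - z0)) y h) z + ray_mean z0 0 (\<lambda>y. G y h) z"
      unfolding ray_mean_linear[OF smooth_linear_dd_family[OF S(1) G] z, of 1 "z - z0"]
        ray_mean_linear[OF G z, of 0 h] by (simp add: sum.distrib)
    moreover have "ray_mean z0 1 (\<lambda>y. dd (\<lambda>y. G y (z - z0)) y h - dd (\<lambda>y. G y h) y (z - z0)) z =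
       ray_mean z0 1 (\<lambda>y. dd (\<lambda>y. G y (z - z0)) y h) z - ray_mean z0 1 (\<lambda>y. dd (\<lambda>y. G y h) y (z - z0)) z"
      by (rule ray_mean_diff[OF smooth_on_continuous_on[OF smooth_on_frechet[OF g]]
          smooth_on_continuous_on[OF smooth_on_frechet[OF g]] z])
    ultimately show ?thesis using ray_mean_ftc[OF g z, of h] by simp
  qed
  ultimately have "((\<lambda>z. \<Sum>b\<in>Basis. ((z - z0) \<bullet> b) *\<^sub>R ray_mean z0 0 (\<lambda>y. G y b) z) has_derivative
    (\<lambda>h. G z h + ray_mean z0 1 (\<lambda>y. dd (\<lambda>y. G y (z - z0)) y h - dd (\<lambda>y. G y h) y (z - z0)) z)) (at z)"
    by simp
  then show "((\<lambda>z. ray_mean z0 0 (\<lambda>y. G y (z - z0)) z) has_derivative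
    (\<lambda>h. G z h + ray_mean z0 1 (\<lambda>y. dd (\<lambda>y. G y (z - z0)) y h - dd (\<lambda>y. G y h) y (z - z0)) z)) (at z)"
    by (rule has_derivative_transform_within_open[OF _ S(1) z]) (rule ray_mean_linear[OF G, symmetric])
qed

end

text \<open>Only the finitely many values on pairs of basis vectors have to be bounded, and these are continuous.\<close>

lemma bilinear_uniform_bound:
  fixes \<Gamma> :: "'a::euclidean_space \<Rightarrow> 'b::euclidean_space \<Rightarrow> 'c::euclidean_space \<Rightarrow> 'd::real_normed_vector"
  assumes "compact C" "C \<subseteq> S" and \<Gamma>: "smooth_bilinear S \<Gamma>"
  obtains K where "K > 0" "\<forall>z\<in>C. \<forall>u e. norm (\<Gamma> z u e) \<le> K * norm u * norm e"
proof -
  have "\<exists>k. \<forall>z\<in>C. norm (\<Gamma> z b c) \<le> k" for b c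
  proof -
    have "continuous_on C (\<lambda>z. norm (\<Gamma> z b c))"
      by (intro continuous_on_norm continuous_on_subset[OF smooth_on_continuous_on[OF smooth_bilinearD(2)[OF \<Gamma>]] assms(2)])
    then have "bounded ((\<lambda>z. norm (\<Gamma> z b c)) ` C)"
      by (rule compact_imp_bounded[OF compact_continuous_image[OF _ assms(1)]])
    then show ?thesis by (auto simp: bounded_iff)
  qed
  then obtain k where k: "\<And>b c z. z \<in> C \<Longrightarrow> norm (\<Gamma> z b c) \<le> k b c" by metis
  define K where "K = 1 + (\<Sum>b\<in>Basis. \<Sum>c\<in>Basis. \<bar>k b c\<bar>)"
  have "K > 0" unfolding K_def by (intro add_pos_nonneg sum_nonneg) auto
  moreover have "norm (\<Gamma> z u e) \<le> K * norm u * norm e" if z: "z \<in> C" for z u e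
  proof -
    have b: "bilinear (\<Gamma> z)" using smooth_bilinearD(1)[OF \<Gamma>] z assms(2) by blast
    have "\<Gamma> z u e = (\<Sum>b\<in>Basis. (u \<bullet> b) *\<^sub>R \<Gamma> z b e)"
      using b linear_sum_Basis[of "\<lambda>u. \<Gamma> z u e" u] by (simp add: bilinear_def)
    also have "\<dots> = (\<Sum>b\<in>Basis. (u \<bullet> b) *\<^sub>R (\<Sum>c\<in>Basis. (e \<bullet> c) *\<^sub>R \<Gamma> z b c))"
      using b linear_sum_Basis[of "\<Gamma> z _" e] by (simp add: bilinear_def)
    finally have "norm (\<Gamma> z u e) \<le> (\<Sum>b\<in>Basis. norm ((u \<bullet> b) *\<^sub>R (\<Sum>c\<in>Basis. (e \<bullet> c) *\<^sub>R \<Gamma> z b c)))"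
      using norm_sum by metis
    also have "\<dots> \<le> (\<Sum>b\<in>Basis. norm u * (\<Sum>c\<in>Basis. norm e * \<bar>k b c\<bar>))"
    proof (rule sum_mono)
      fix b :: 'b assume b: "b \<in> Basis"
      have "norm (\<Sum>c\<in>Basis. (e \<bullet> c) *\<^sub>R \<Gamma> z b c) \<le> (\<Sum>c\<in>Basis. norm ((e \<bullet> c) *\<^sub>R \<Gamma> z b c))" by (rule norm_sum)
      also have "\<dots> \<le> (\<Sum>c\<in>Basis. norm e * \<bar>k b c\<bar>)"
        unfolding norm_scaleR
      proof (rule sum_mono, rule mult_mono)
        fix c :: 'c assume "c \<in> Basis"
        then show "\<bar>e \<bullet> c\<bar> \<le> norm e" by (rule Basis_le_norm)
        show "norm (\<Gamma> z b c) \<le> \<bar>k b c\<bar>" using k[OF z, of b c] by simp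
      qed auto
      finally show "norm ((u \<bullet> b) *\<^sub>R (\<Sum>c\<in>Basis. (e \<bullet> c) *\<^sub>R \<Gamma> z b c)) \<le> norm u * (\<Sum>c\<in>Basis. norm e * \<bar>k b c\<bar>)"
        unfolding norm_scaleR using Basis_le_norm[OF b, of u] by (intro mult_mono) auto
    qed
    also have "\<dots> = (\<Sum>b\<in>Basis. \<Sum>c\<in>Basis. \<bar>k b c\<bar>) * (norm u * norm e)"
      by (simp add: sum_distrib_left sum_distrib_right mult_ac)
    also have "\<dots> \<le> K * (norm u * norm e)" unfolding K_def by (intro mult_right_mono) auto
    finally show ?thesis by (simp add: mult.assoc)
  qed
  ultimately show thesis using that by blast
qed

lemma Ck_on_linear_apply:
  fixes T :: "'a::euclidean_space \<Rightarrow> 'b::euclidean_space \<Rightarrow> 'c::real_normed_vector"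
  assumes S: "open S" and T: "smooth_linear S T" and f: "Ck_on k S f"
  shows "Ck_on k S (\<lambda>z. T z (f z))"
proof -
  have "Ck_on k S (\<lambda>z. \<Sum>b\<in>Basis. (f z \<bullet> b) *\<^sub>R T z b)"
  proof (rule Ck_on_sum[OF S finite_Basis])
    fix b :: 'b
    have "Ck_on k S (\<lambda>z. f z \<bullet> b)"
      by (rule Ck_on_bounded_linear[where L="\<lambda>y. y \<bullet> b", OF S bounded_linear_inner_left f])
    moreover have "Ck_on k S (\<lambda>z. T z b)" using smooth_linearD(2)[OF T] unfolding smooth_on_def by blast
    ultimately show "Ck_on k S (\<lambda>z. (f z \<bullet> b) *\<^sub>R T z b)"
      by (rule bounded_bilinear.Ck_on_prod[OF bounded_bilinear_scaleR S])
  qed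
  then show ?thesis
    by (rule Ck_on_cong[OF S, THEN iffD1, rotated])
      (rule linear_sum_Basis[OF smooth_linearD(1)[OF T], symmetric])
qed

text \<open>The parallel section with value \<open>w0\<close> at \<open>z0\<close> is the fixed point of integration along rays.
  On a small ball this operator contracts, and by the homotopy formula together with flatness it also
  contracts the covariant derivative \<open>\<nabla>u\<close>, up to the distance to the next iterate; hence \<open>\<nabla>u = 0\<close> in the limit.\<close>

theorem flat_imp_parallel_section:
  fixes \<Gamma> :: "'a::euclidean_space \<Rightarrow> 'a \<Rightarrow> 'b::euclidean_space \<Rightarrow> 'b"
  assumes S: "open S" "z0 \<in> S" and \<Gamma>: "smooth_bilinear S \<Gamma>"
    and flat: "\<And>z u v e. z \<in> S \<Longrightarrow> curv \<Gamma> z u v e = 0"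
  obtains r u where "r > 0" "ball z0 r \<subseteq> S" "smooth_on (ball z0 r) u" "u z0 = w0"
    "\<forall>z\<in>ball z0 r. \<forall>h. dd u z h = - \<Gamma> z h (u z)"
proof -
  obtain r0 where r0: "r0 > 0" "cball z0 r0 \<subseteq> S" using open_contains_cball[THEN iffD1, OF S(1)] S(2) by blast
  obtain K where K: "K > 0" "\<forall>z\<in>cball z0 r0. \<forall>u e. norm (\<Gamma> z u e) \<le> K * norm u * norm e"
    by (rule bilinear_uniform_bound[OF compact_cball r0(2) \<Gamma>]) blast
  \<comment> \<open>For this radius the bounds below, for the distance of successive iterates and for their covariant
    derivatives, halve in each step.\<close>
  define r where "r = min r0 (1 / (8 * K))"
  define B where "B = ball z0 r"
  have r: "r > 0" "r \<le> r0" "K * r \<le> 1 / 8" using r0 K(1) by (auto simp: r_def min_def field_simps)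
  have B: "open B" "convex B" "z0 \<in> B" using r by (auto simp: B_def)
  have BS: "B \<subseteq> S" using r r0 by (auto simp: B_def)
  note \<Gamma>B = smooth_bilinear_subset[OF \<Gamma> BS]
  have bnd: "norm (\<Gamma> z u e) \<le> K * norm u * norm e" if "z \<in> B" for z u e
    using K(2) that r by (auto simp: B_def)
  have \<zeta>: "norm (z - z0) \<le> r" if "z \<in> B" for z using that by (simp add: B_def dist_norm norm_minus_commute)
  have bnd\<zeta>: "norm (\<Gamma> y (z - z0) e) \<le> norm e / 8" if "y \<in> B" "z \<in> B" for y z e
  proof -
    have "norm (\<Gamma> y (z - z0) e) \<le> K * norm (z - z0) * norm e" by (rule bnd[OF that(1)])
    also have "\<dots> \<le> K * r * norm e" using \<zeta>[OF that(2)] K(1) by (intro mult_right_mono mult_left_mono) auto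
    also have "\<dots> \<le> 1 / 8 * norm e" using r(3) by (intro mult_right_mono) auto
    finally show ?thesis by simp
  qed
  define T where "T = (\<lambda>w z. w0 - ray_mean z0 0 (\<lambda>y. \<Gamma> y (z - z0) (w y)) z)"
  \<comment> \<open>The covariant derivative of \<open>w\<close>; a fixed point of \<open>T\<close> need only be continuous, so \<open>\<nu>\<close> is followed
    along the smooth iterates instead.\<close>
  define \<nu> where "\<nu> = (\<lambda>w z h. dd w z h + \<Gamma> z h (w z))"
  have G: "smooth_linear B (\<lambda>y v. \<Gamma> y v (w y))" if "smooth_on B w" for w
    unfolding smooth_linear_def
    using smooth_bilinearD(1)[OF \<Gamma>B] smooth_linear_apply(1)[OF B(1) smooth_bilinear_linear(2)[OF \<Gamma>B] that]
    by (auto simp: bilinear_def)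
  have Ts: "smooth_on B (T w)" if "smooth_on B w" for w
    unfolding T_def using homotopy_formula(2)[OF B G[OF that] B(3)]
    by (intro smooth_on_diff B(1) smooth_on_const[OF B(1)])
  have T0: "T w z0 = w0" if "smooth_on B w" for w
    using smooth_bilinearD(1)[OF \<Gamma>B B(3)] by (simp add: T_def ray_mean_def bilinear_lzero)
  have Tdiff: "norm (T w z - T w' z) \<le> b / 8"
    if w: "smooth_on B w" "smooth_on B w'" and b: "\<And>y. y \<in> B \<Longrightarrow> norm (w y - w' y) \<le> b" and z: "z \<in> B" for w w' b z
  proof -
    have "T w' z - T w z = ray_mean z0 0 (\<lambda>y. \<Gamma> y (z - z0) (w y) - \<Gamma> y (z - z0) (w' y)) z"
      unfolding T_def
      using ray_mean_diff[OF B smooth_on_continuous_on[OF smooth_linearD(2)[OF G[OF w(1)]]]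
          smooth_on_continuous_on[OF smooth_linearD(2)[OF G[OF w(2)]]] z, of 0 "z - z0" "z - z0"] by simp
    moreover have "norm (ray_mean z0 0 (\<lambda>y. \<Gamma> y (z - z0) (w y) - \<Gamma> y (z - z0) (w' y)) z) \<le> b / 8"
    proof (rule norm_ray_mean_le[OF B _ z])
      show "continuous_on B (\<lambda>y. \<Gamma> y (z - z0) (w y) - \<Gamma> y (z - z0) (w' y))"
        by (rule continuous_on_diff[OF smooth_on_continuous_on[OF smooth_linearD(2)[OF G[OF w(1)]]]
          smooth_on_continuous_on[OF smooth_linearD(2)[OF G[OF w(2)]]]])
      fix y assume y: "y \<in> B"
      have "\<Gamma> y (z - z0) (w y) - \<Gamma> y (z - z0) (w' y) = \<Gamma> y (z - z0) (w y - w' y)"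
        by (rule bilinear_rsub[OF smooth_bilinearD(1)[OF \<Gamma>B y], symmetric])
      then show "norm (\<Gamma> y (z - z0) (w y) - \<Gamma> y (z - z0) (w' y)) \<le> b / 8"
        using bnd\<zeta>[OF y z, of "w y - w' y"] b[OF y] by simp
    qed
    ultimately show ?thesis by (metis norm_minus_commute)
  qed
  have TD: "norm (\<nu> (T w) z h) \<le> g / 4 * norm h + K * norm h * a"
    if w: "smooth_on B w" and g: "\<And>y h. y \<in> B \<Longrightarrow> norm (\<nu> w y h) \<le> g * norm h"
      and a: "\<And>y. y \<in> B \<Longrightarrow> norm (T w y - w y) \<le> a" and z: "z \<in> B" for w g a z h
  proof -
    let ?\<zeta> = "z - z0"
    let ?I = "\<lambda>y. dd (\<lambda>y. \<Gamma> y ?\<zeta> (w y)) y h - dd (\<lambda>y. \<Gamma> y h (w y)) y ?\<zeta>"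
    have Gs: "smooth_on B (\<lambda>y. \<Gamma> y v (w y))" for v by (rule smooth_linearD(2)[OF G[OF w]])
    have Ic: "continuous_on B ?I"
      by (rule continuous_on_diff[OF smooth_on_continuous_on[OF smooth_on_frechet[OF Gs]]
            smooth_on_continuous_on[OF smooth_on_frechet[OF Gs]]])
    have "(T w has_derivative (\<lambda>h. 0 - (\<Gamma> z h (w z) +
        ray_mean z0 1 (\<lambda>y. dd (\<lambda>y. \<Gamma> y ?\<zeta> (w y)) y h - dd (\<lambda>y. \<Gamma> y h (w y)) y ?\<zeta>) z))) (at z)"
      unfolding T_def by (rule has_derivative_diff[OF has_derivative_const homotopy_formula(1)[OF B G[OF w] z]])
    from dd_eqI[OF this, of h] have "dd (T w) z h = - \<Gamma> z h (w z) - ray_mean z0 1 ?I z" by simp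
    then have eq: "\<nu> (T w) z h = \<Gamma> z h (T w z - w z) - ray_mean z0 1 ?I z"
      unfolding \<nu>_def by (simp add: bilinear_rsub[OF smooth_bilinearD(1)[OF \<Gamma>B z]])
    have "norm (ray_mean z0 1 ?I z) \<le> g / 4 * norm h"
    proof (rule norm_ray_mean_le[OF B Ic z])
      fix y assume y: "y \<in> B"
      have b: "bilinear (\<Gamma> y)" by (rule smooth_bilinearD(1)[OF \<Gamma>B y])
      have ap: "dd (\<lambda>y. \<Gamma> y u (w y)) y v = dd (\<lambda>x. \<Gamma> x u (w y)) y v + \<Gamma> y u (dd w y v)" for u v
        by (rule smooth_linear_apply(2)[OF B(1) smooth_bilinear_linear(2)[OF \<Gamma>B] w y])
      have "?I y = \<Gamma> y ?\<zeta> (\<nu> w y h) - \<Gamma> y h (\<nu> w y ?\<zeta>)"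
        using flat[of y h ?\<zeta> "w y"] y BS unfolding ap \<nu>_def curv_def
        by (auto simp: bilinear_radd[OF b] algebra_simps)
      then have "norm (?I y) \<le> norm (\<Gamma> y ?\<zeta> (\<nu> w y h)) + norm (\<Gamma> y h (\<nu> w y ?\<zeta>))"
        by (simp add: norm_triangle_ineq4)
      also have "norm (\<Gamma> y ?\<zeta> (\<nu> w y h)) \<le> (g * norm h) / 8"
        using bnd\<zeta>[OF y z, of "\<nu> w y h"] g[OF y, of h] by simp
      also have "norm (\<Gamma> y h (\<nu> w y ?\<zeta>)) \<le> (g * norm h) / 8"
      proof -
        have g0: "0 \<le> g * norm ?\<zeta>" using g[OF y, of ?\<zeta>] norm_ge_zero order_trans by blast
        have "norm (\<Gamma> y h (\<nu> w y ?\<zeta>)) \<le> K * norm h * norm (\<nu> w y ?\<zeta>)" by (rule bnd[OF y])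
        also have "\<dots> \<le> K * norm h * (g * norm ?\<zeta>)" using g[OF y] K(1) by (intro mult_left_mono) auto
        also have "\<dots> \<le> (g * norm h) * (K * r)"
        proof (cases "?\<zeta> = 0 \<or> h = 0")
          case True
          have "0 \<le> g * norm h" using g[OF y, of h] norm_ge_zero order_trans by blast
          moreover have "0 \<le> K * r" using K(1) r(1) by simp
          ultimately have "0 \<le> (g * norm h) * (K * r)" by (rule mult_nonneg_nonneg)
          then show ?thesis using True by auto
        next
          case False
          then have "g \<ge> 0" using g0 by (simp add: zero_le_mult_iff)
          then have "(g * norm h * K) * norm ?\<zeta> \<le> (g * norm h * K) * r"
            using \<zeta>[OF z] K(1) by (intro mult_left_mono) auto
          then show ?thesis by (simp add: mult_ac)
        qed
        also have "\<dots> \<le> (g * norm h) * (1 / 8)"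
          using r(3) g[OF y, of h] norm_ge_zero order_trans by (intro mult_left_mono) blast+
        finally show ?thesis by simp
      qed
      finally show "norm (?I y) \<le> g / 4 * norm h" by (simp add: field_simps)
    qed
    moreover have "norm (\<Gamma> z h (T w z - w z)) \<le> K * norm h * a"
    proof -
      have "norm (\<Gamma> z h (T w z - w z)) \<le> K * norm h * norm (T w z - w z)" by (rule bnd[OF z])
      also have "\<dots> \<le> K * norm h * a" using a[OF z] K(1) by (intro mult_left_mono) auto
      finally show ?thesis .
    qed
    ultimately show ?thesis unfolding eq
      using norm_triangle_ineq4[of "\<Gamma> z h (T w z - w z)" "ray_mean z0 1 ?I z"] by linarith
  qed
  define f where "f = (\<lambda>n. (T ^^ n) (\<lambda>_. w0))"
  have f_Suc: "f (Suc n) = T (f n)" for n by (simp add: f_def)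
  have fs: "smooth_on B (f n)" for n
  proof (induction n)
    case 0
    have "smooth_on B (\<lambda>_. w0)" by (rule smooth_on_const[OF B(1)])
    then show ?case by (simp add: f_def)
  next
    case (Suc n)
    then show ?case unfolding f_Suc by (rule Ts)
  qed
  have f0: "f n z0 = w0" for n
    by (cases n) (simp add: f_def, simp add: f_Suc T0[OF fs])
  define A where "A = norm w0"
  have A: "A \<ge> 0" by (simp add: A_def)
  have step: "norm (f (Suc n) z - f n z) \<le> A * (1 / 2) ^ n" if z: "z \<in> B" for n z
    using z
  proof (induction n arbitrary: z)
    case 0
    have z: "z \<in> B" by (rule 0)
    have "smooth_on B (\<lambda>y. 0 :: 'b)" by (rule smooth_on_const[OF B(1)])
    from Tdiff[OF fs[of 0] this, of A z] 0
    have "norm (T (f 0) z - T (\<lambda>y. 0) z) \<le> A / 8" by (simp add: f_def A_def)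
    moreover have "T (\<lambda>y. 0) z = w0"
    proof -
      have "ray_mean z0 0 (\<lambda>y. \<Gamma> y (z - z0) 0) z = ray_mean z0 0 (\<lambda>y. 0) z"
        by (rule ray_mean_cong[OF B bilinear_rzero[OF smooth_bilinearD(1)[OF \<Gamma>B]] z])
      then show ?thesis by (simp add: T_def ray_mean_def)
    qed
    moreover have "f (Suc 0) z = T (f 0) z" by (simp add: f_Suc)
    moreover have "f 0 z = w0" by (simp add: f_def)
    ultimately show ?case using A by simp
  next
    case (Suc n)
    have "norm (T (f (Suc n)) z - T (f n) z) \<le> A * (1 / 2) ^ n / 8"
      by (rule Tdiff[OF fs fs Suc.IH Suc.prems])
    also have "\<dots> \<le> A * (1 / 2) ^ Suc n" using A by (simp add: field_simps)
    finally show ?case unfolding f_Suc[of "Suc n"] f_Suc[of n, symmetric] .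
  qed
  \<comment> \<open>This constant satisfies \<open>C / 4 + K A = C / 2\<close>, which closes the recursion for \<open>\<nu>\<close>.\<close>
  define C where "C = 4 * K * A"
  have der: "norm (\<nu> (f n) z h) \<le> C * (1 / 2) ^ n * norm h" if "z \<in> B" for n z h
    using that
  proof (induction n arbitrary: z h)
    case 0
    have "dd (f 0) z h = 0" unfolding f_def by (simp add: dd_const[OF B(1) 0])
    then have "norm (\<nu> (f 0) z h) \<le> K * norm h * A" using bnd[OF 0, of h w0] by (simp add: \<nu>_def f_def A_def)
    also have "\<dots> \<le> 4 * (K * norm h * A)" using K(1) A by simp
    finally show ?case by (simp add: C_def mult_ac)
  next
    case (Suc n)
    have "norm (\<nu> (T (f n)) z h) \<le> (C * (1 / 2) ^ n) / 4 * norm h + K * norm h * (A * (1 / 2) ^ n)"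
    proof (rule TD[OF fs Suc.IH _ Suc.prems])
      show "norm (T (f n) y - f n y) \<le> A * (1 / 2) ^ n" if "y \<in> B" for y
        using step[OF that, of n] by (simp add: f_Suc)
    qed
    also have "\<dots> = C * (1 / 2) ^ Suc n * norm h" by (simp add: C_def algebra_simps)
    finally show ?case by (simp add: f_Suc)
  qed
  have tele: "norm (f (n + k) z - f n z) \<le> 2 * A * (1 / 2) ^ n - 2 * A * (1 / 2) ^ (n + k)" if z: "z \<in> B" for n k z
  proof (induction k)
    case (Suc k)
    have "norm (f (n + Suc k) z - f n z) \<le> norm (f (Suc (n + k)) z - f (n + k) z) + norm (f (n + k) z - f n z)"
      using norm_triangle_ineq[of "f (Suc (n + k)) z - f (n + k) z" "f (n + k) z - f n z"] by simp
    then show ?case using Suc step[OF z, of "n + k"] by (simp add: algebra_simps)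
  qed simp
  have cau: "norm (f m z - f n z) \<le> 2 * A * (1 / 2) ^ n" if "z \<in> B" "m \<ge> n" for m n z
  proof -
    have "0 \<le> 2 * A * (1 / 2) ^ m" using A by simp
    then show ?thesis using tele[OF that(1), of n "m - n"] that(2) by simp
  qed
  have lim0: "(\<lambda>n. c * (1 / 2) ^ n) \<longlonglongrightarrow> 0" for c :: real
    by (intro tendsto_mult_right_zero LIMSEQ_power_zero) simp
  have "convergent (\<lambda>n. f n z)" if z: "z \<in> B" for z
  proof (rule Cauchy_convergent, rule metric_CauchyI)
    fix e :: real assume "e > 0"
    then obtain N where N: "\<forall>n\<ge>N. norm (2 * (2 * A) * (1 / 2) ^ n) < e"
      using lim0[of "2 * (2 * A)"] unfolding LIMSEQ_iff by auto
    have "dist (f m z) (f n z) < e" if "m \<ge> N" "n \<ge> N" for m n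
    proof -
      have "dist (f m z) (f n z) \<le> norm (f m z - f N z) + norm (f n z - f N z)"
        unfolding dist_norm by (metis norm_triangle_ineq4 diff_diff_eq2 diff_add_cancel add_diff_cancel_right)
      also have "\<dots> \<le> 2 * A * (1 / 2) ^ N + 2 * A * (1 / 2) ^ N" using cau[OF z] that by (intro add_mono) auto
      also have "\<dots> = 2 * (2 * A) * (1 / 2) ^ N" by simp
      also have "\<dots> < e" using N[rule_format, of N] A by (simp add: abs_mult)
      finally show ?thesis .
    qed
    then show "\<exists>M. \<forall>m\<ge>M. \<forall>n\<ge>M. dist (f m z) (f n z) < e" by blast
  qed
  define u where "u = (\<lambda>z. lim (\<lambda>n. f n z))"
  have lim: "(\<lambda>n. f n z) \<longlonglongrightarrow> u z" if "z \<in> B" for z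
    unfolding u_def using \<open>\<And>z. z \<in> B \<Longrightarrow> convergent (\<lambda>n. f n z)\<close>[OF that] by (simp add: convergent_LIMSEQ_iff)
  have u_f: "norm (u z - f n z) \<le> 2 * A * (1 / 2) ^ n" if z: "z \<in> B" for z n
  proof (rule Lim_norm_ubound[OF trivial_limit_sequentially])
    show "(\<lambda>m. f m z - f n z) \<longlonglongrightarrow> u z - f n z" by (intro tendsto_diff lim z tendsto_const)
    show "eventually (\<lambda>m. norm (f m z - f n z) \<le> 2 * A * (1 / 2) ^ n) sequentially"
      using cau[OF z] by (intro eventually_sequentiallyI[of n]) auto
  qed
  have "\<exists>g. \<forall>x\<in>B. (\<lambda>n. f n x) \<longlonglongrightarrow> g x \<and> (g has_derivative (\<lambda>h. - \<Gamma> x h (u x))) (at x within B)"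
  proof (rule has_derivative_sequence[OF B(2) _ _ B(3)])
    show "(f n has_derivative dd (f n) x) (at x within B)" if "x \<in> B" for n x
      by (rule has_derivative_at_withinI[OF smooth_on_has_derivative[OF fs that]])
    show "(\<lambda>n. f n z0) \<longlonglongrightarrow> w0" unfolding f0 by simp
    fix e :: real assume "e > 0"
    then obtain N where N: "\<forall>n\<ge>N. norm ((C + K * (2 * A)) * (1 / 2) ^ n) < e"
      using lim0[of "C + K * (2 * A)"] unfolding LIMSEQ_iff by auto
    have "norm (dd (f n) x h - - \<Gamma> x h (u x)) \<le> e * norm h" if n: "n \<ge> N" and x: "x \<in> B" for n x h
    proof -
      have "dd (f n) x h - - \<Gamma> x h (u x) = \<nu> (f n) x h + \<Gamma> x h (u x - f n x)"
        by (simp add: \<nu>_def bilinear_rsub[OF smooth_bilinearD(1)[OF \<Gamma>B x]])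
      also have "norm \<dots> \<le> norm (\<nu> (f n) x h) + norm (\<Gamma> x h (u x - f n x))" by (rule norm_triangle_ineq)
      also have "\<dots> \<le> C * (1 / 2) ^ n * norm h + K * norm h * (2 * A * (1 / 2) ^ n)"
      proof (rule add_mono[OF der[OF x]])
        have "norm (\<Gamma> x h (u x - f n x)) \<le> K * norm h * norm (u x - f n x)" by (rule bnd[OF x])
        also have "\<dots> \<le> K * norm h * (2 * A * (1 / 2) ^ n)"
          using u_f[OF x] K(1) by (intro mult_left_mono) auto
        finally show "norm (\<Gamma> x h (u x - f n x)) \<le> K * norm h * (2 * A * (1 / 2) ^ n)" .
      qed
      also have "\<dots> = ((C + K * (2 * A)) * (1 / 2) ^ n) * norm h" by (simp add: algebra_simps)
      also have "\<dots> \<le> e * norm h"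
        using N[rule_format, OF n] abs_ge_self[of "(C + K * (2 * A)) * (1 / 2) ^ n"]
        by (intro mult_right_mono) (simp_all only: real_norm_def norm_ge_zero)
      finally show ?thesis .
    qed
    then show "\<forall>\<^sub>F n in sequentially. \<forall>x\<in>B. \<forall>h. norm (dd (f n) x h - - \<Gamma> x h (u x)) \<le> e * norm h"
      by (intro eventually_sequentiallyI[of N]) blast
  qed
  then obtain g where g: "\<forall>x\<in>B. (\<lambda>n. f n x) \<longlonglongrightarrow> g x \<and> (g has_derivative (\<lambda>h. - \<Gamma> x h (u x))) (at x within B)"
    by blast
  have gu: "g x = u x" if "x \<in> B" for x using g lim[OF that] that LIMSEQ_unique by blast
  have du: "(u has_derivative (\<lambda>h. - \<Gamma> x h (u x))) (at x)" if x: "x \<in> B" for x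
  proof -
    have "(g has_derivative (\<lambda>h. - \<Gamma> x h (u x))) (at x)"
      using bspec[OF g x] by (simp only: at_within_open[OF x B(1)])
    then show ?thesis by (rule has_derivative_transform_within_open[OF _ B(1) x]) (rule gu)
  qed
  have us: "smooth_on B u"
  proof (rule smooth_onI_derivative[OF B(1) du])
    fix k v assume "Ck_on k B u"
    then have "Ck_on k B (\<lambda>x. \<Gamma> x v (u x))"
      by (rule Ck_on_linear_apply[OF B(1) smooth_bilinear_linear(2)[OF \<Gamma>B]])
    then show "Ck_on k B (\<lambda>x. - \<Gamma> x v (u x))"
      by (rule Ck_on_bounded_linear[OF B(1) bounded_linear_minus[OF bounded_linear_ident]])
  qed
  have "u z0 = w0" using LIMSEQ_unique[OF lim[OF B(3)]] f0 by simp
  then show thesis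
    using that[of r u] r(1) BS us dd_eqI[OF du] unfolding B_def by blast
qed

section \<open>Flatness up to a projective change\<close>

text \<open>The vector whose inner product with \<open>e\<close> is \<open>l e\<close>, for linear \<open>l\<close>.\<close>

definition form_vector :: "('b::euclidean_space \<Rightarrow> real) \<Rightarrow> 'b"
  where "form_vector l = (\<Sum>b\<in>Basis. l b *\<^sub>R b)"

lemma sum_linear_form:
  fixes l :: "'b::euclidean_space \<Rightarrow> real"
  assumes "linear l" shows "(\<Sum>b\<in>Basis. l b * (w \<bullet> b)) = l w"
  using linear_sum_Basis[OF assms, of w] by (simp add: mult.commute)

lemma inner_form_vector: "linear l \<Longrightarrow> form_vector l \<bullet> e = l e"
proof -
  assume l: "linear l"
  have "form_vector l \<bullet> e = (\<Sum>b\<in>Basis. l b * (b \<bullet> e))"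
    by (simp only: form_vector_def inner_sum_left inner_scaleR_left)
  then show ?thesis using sum_linear_form[OF l, of e] by (simp add: inner_commute)
qed

lemma has_derivative_form_vector:
  assumes "\<And>b. b \<in> Basis \<Longrightarrow> (f b has_derivative f' b) F"
  shows "((\<lambda>y. form_vector (\<lambda>b. f b y)) has_derivative (\<lambda>h. form_vector (\<lambda>b. f' b h))) F"
  unfolding form_vector_def using assms by (intro has_derivative_sum has_derivative_scaleR_left)

text \<open>The requirement that the Schouten tensor of \<open>\<rho>\<close> equals \<open>B\<close> is a Riccati equation.  Writing \<open>\<rho> = \<tau> / s\<close>,
  it becomes the linear system \<open>\<nabla>\<^sub>u \<tau> = s B(u, -)\<close>, \<open>\<partial>\<^sub>u s = - \<tau>(\<phi>(u))\<close>.  Its connection form on pairs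
  \<open>(\<tau>, s)\<close>, the projective tractor connection, is the following one.\<close>

definition tractor ::
  "('a \<Rightarrow> 'a \<Rightarrow> 'b) \<Rightarrow> ('a \<Rightarrow> 'a \<Rightarrow> 'b \<Rightarrow> real) \<Rightarrow> ('a \<Rightarrow> 'a \<Rightarrow> 'b \<Rightarrow> 'b) \<Rightarrow> 'a \<Rightarrow> 'a \<Rightarrow> 'b::euclidean_space \<times> real \<Rightarrow> 'b \<times> real"
  where "tractor \<phi> B \<Gamma> z u q =
    (- form_vector (\<lambda>b. fst q \<bullet> \<Gamma> z u b + snd q * B z u b), fst q \<bullet> \<phi> z u)"

context
  fixes S :: "'a::euclidean_space set" and \<Gamma> :: "'a \<Rightarrow> 'a \<Rightarrow> 'b::euclidean_space \<Rightarrow> 'b"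
    and \<phi> :: "'a \<Rightarrow> 'a \<Rightarrow> 'b"
  assumes S: "open S" and \<Gamma>: "smooth_bilinear S \<Gamma>" and \<phi>: "smooth_linear S \<phi>"
    and tf: "torsion_free S \<phi> \<Gamma>"
begin

context
  fixes B :: "'a \<Rightarrow> 'a \<Rightarrow> 'b \<Rightarrow> real"
  assumes B: "smooth_bilinear S B"
    and R: "\<And>z u v e. z \<in> S \<Longrightarrow> curv \<Gamma> z u v e = B z v e *\<^sub>R \<phi> z u - B z u e *\<^sub>R \<phi> z v"
    and sym: "\<And>z u v. z \<in> S \<Longrightarrow> B z u (\<phi> z v) = B z v (\<phi> z u)"
    and cod: "\<And>z u v e. z \<in> S \<Longrightarrow> codazzi \<Gamma> B z u v e = 0"
begin

lemma tractor_form_linear: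
  assumes "z \<in> S" shows "linear (\<lambda>e. t \<bullet> \<Gamma> z u e + s * B z u e)"
  by (rule linearI) (simp_all add: bilinear_simps[OF smooth_bilinearD(1)[OF \<Gamma> assms]]
      bilinear_simps[OF smooth_bilinearD(1)[OF B assms]] inner_add_right algebra_simps)

lemma smooth_bilinear_tractor: "smooth_bilinear S (tractor \<phi> B \<Gamma>)"
  unfolding smooth_bilinear_def
proof safe
  fix z assume z: "z \<in> S"
  show "bilinear (tractor \<phi> B \<Gamma> z)"
    unfolding bilinear_def tractor_def form_vector_def
    by (intro conjI allI linearI) (simp_all add: bilinear_simps[OF smooth_bilinearD(1)[OF \<Gamma> z]]
      bilinear_simps[OF smooth_bilinearD(1)[OF B z]] linear_map_simps[OF smooth_linearD(1)[OF \<phi> z]]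
      inner_add_right inner_add_left algebra_simps sum.distrib scaleR_sum_right)
next
  fix u and t :: 'b and s :: real
  have "smooth_on S (\<lambda>z. t \<bullet> \<Gamma> z u b + s * B z u b)" for b
  proof (rule smooth_on_add[OF S])
    show "smooth_on S (\<lambda>z. t \<bullet> \<Gamma> z u b)"
      by (rule smooth_on_bounded_linear[where L="\<lambda>y. t \<bullet> y", OF S bounded_linear_inner_right smooth_bilinearD(2)[OF \<Gamma>]])
    show "smooth_on S (\<lambda>z. s * B z u b)"
      by (rule smooth_on_mult[OF S smooth_on_const[OF S] smooth_bilinearD(2)[OF B]])
  qed
  then have 1: "smooth_on S (\<lambda>z. form_vector (\<lambda>b. t \<bullet> \<Gamma> z u b + s * B z u b))"
    unfolding form_vector_def by (intro smooth_on_sum smooth_on_scaleR S finite_Basis smooth_on_const[OF S])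
  have 2: "smooth_on S (\<lambda>z. t \<bullet> \<phi> z u)"
    by (rule smooth_on_bounded_linear[where L="\<lambda>y. t \<bullet> y", OF S bounded_linear_inner_right smooth_linearD(2)[OF \<phi>]])
  have "smooth_on S (\<lambda>z. (\<lambda>y. (y, 0 :: real)) (- form_vector (\<lambda>b. t \<bullet> \<Gamma> z u b + s * B z u b)) + (\<lambda>y. (0, y)) (t \<bullet> \<phi> z u))"
    by (intro smooth_on_add S smooth_on_bounded_linear[where L="\<lambda>y. (y, 0 :: real)", OF S _ smooth_on_uminus[OF S 1]]
        smooth_on_bounded_linear[where L="\<lambda>y. (0 :: 'b, y)", OF S _ 2]
        bounded_linear_Pair bounded_linear_ident bounded_linear_zero)
  then show "smooth_on S (\<lambda>z. tractor \<phi> B \<Gamma> z u (t, s))" by (simp add: tractor_def)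
qed

text \<open>The component of the curvature along \<open>b\<close> combines the given form of the curvature of \<open>\<Gamma>\<close> with the
  Codazzi equation; its scalar component combines torsion-freeness with the symmetry of \<open>B(u, \<phi>(v))\<close>.\<close>

lemma tractor_flat:
  assumes z: "z \<in> S" shows "curv (tractor \<phi> B \<Gamma>) z u v (t, s) = 0"
proof -
  let ?l = "\<lambda>u e. t \<bullet> \<Gamma> z u e + s * B z u e"
  have lin: "linear (?l u)" for u by (rule tractor_form_linear[OF z])
  have D: "dd (\<lambda>y. tractor \<phi> B \<Gamma> y v (t, s)) z u =
    (- form_vector (\<lambda>b. t \<bullet> dd (\<lambda>y. \<Gamma> y v b) z u + s * dd (\<lambda>y. B y v b) z u), t \<bullet> dd (\<lambda>y. \<phi> y v) z u)" for u v
  proof (rule dd_eqI)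
    have g: "((\<lambda>y. \<Gamma> y v b) has_derivative dd (\<lambda>y. \<Gamma> y v b) z) (at z)" for b
      by (rule smooth_on_has_derivative[OF smooth_bilinearD(2)[OF \<Gamma>] z])
    have bb: "((\<lambda>y. B y v b) has_derivative dd (\<lambda>y. B y v b) z) (at z)" for b
      by (rule smooth_on_has_derivative[OF smooth_bilinearD(2)[OF B] z])
    have f: "((\<lambda>y. \<phi> y v) has_derivative dd (\<lambda>y. \<phi> y v) z) (at z)"
      by (rule smooth_on_has_derivative[OF smooth_linearD(2)[OF \<phi>] z])
    show "((\<lambda>y. tractor \<phi> B \<Gamma> y v (t, s)) has_derivative (\<lambda>u.
      (- form_vector (\<lambda>b. t \<bullet> dd (\<lambda>y. \<Gamma> y v b) z u + s * dd (\<lambda>y. B y v b) z u), t \<bullet> dd (\<lambda>y. \<phi> y v) z u))) (at z)"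
      unfolding tractor_def fst_conv snd_conv
      by (intro has_derivative_Pair has_derivative_minus has_derivative_form_vector has_derivative_add
          has_derivative_inner_right has_derivative_mult_right g bb f)
  qed
  have inn: "fst (tractor \<phi> B \<Gamma> z v (t, s)) \<bullet> e = - ?l v e" for v e
    using inner_form_vector[OF lin] by (simp add: tractor_def)
  have t: "dd (\<lambda>y. \<phi> y v) z u = dd (\<lambda>y. \<phi> y u) z v + \<Gamma> z v (\<phi> z u) - \<Gamma> z u (\<phi> z v)"
    using tf z unfolding torsion_free_def by (metis add_diff_cancel_right')
  have "snd (curv (tractor \<phi> B \<Gamma>) z u v (t, s)) = 0"
    unfolding curv_def D using inn[of v "\<phi> z u"] inn[of u "\<phi> z v"] sym[OF z, of u v]
    by (simp add: tractor_def[of _ _ _ z u "tractor \<phi> B \<Gamma> z v (t, s)"]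
        tractor_def[of _ _ _ z v "tractor \<phi> B \<Gamma> z u (t, s)"] t inner_add_right inner_diff_right)
  moreover have "fst (curv (tractor \<phi> B \<Gamma>) z u v (t, s)) \<bullet> b = 0" if b: "b \<in> Basis" for b
  proof -
    have fv: "form_vector l \<bullet> b = l b" for l :: "'b \<Rightarrow> real"
      using b by (simp add: form_vector_def inner_sum_left inner_Basis if_distrib sum.delta cong: if_cong)
    have s2: "snd (tractor \<phi> B \<Gamma> z v (t, s)) = t \<bullet> \<phi> z v" for v by (simp add: tractor_def)
    have ff: "fst (tractor \<phi> B \<Gamma> z u q) \<bullet> b = - (fst q \<bullet> \<Gamma> z u b + snd q * B z u b)" for u q
      by (simp add: tractor_def fv)
    have "fst (curv (tractor \<phi> B \<Gamma>) z u v (t, s)) \<bullet> b =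
       - (t \<bullet> curv \<Gamma> z u v b) - s * codazzi \<Gamma> B z u v b + t \<bullet> (B z v b *\<^sub>R \<phi> z u - B z u b *\<^sub>R \<phi> z v)"
      unfolding curv_def[of "tractor \<phi> B \<Gamma>"] D
      by (simp add: inner_diff_left inner_add_left ff fv s2 inn curv_def codazzi_def inner_add_right inner_diff_right algebra_simps)
    then show ?thesis using cod[OF z] R[OF z] by simp
  qed
  then have "fst (curv (tractor \<phi> B \<Gamma>) z u v (t, s)) = 0"
    by (metis euclidean_all_zero_iff)
  ultimately show ?thesis by (simp add: prod_eq_iff)
qed

text \<open>A parallel section \<open>(\<tau>, s)\<close> of the tractor connection with value \<open>(0, 1)\<close> at \<open>z0\<close> keeps \<open>s\<close> positive near
  \<open>z0\<close>, and \<open>\<rho> = \<tau> / s\<close> has Schouten tensor \<open>B\<close>.\<close>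

theorem exists_flat_proj_change:
  assumes z0: "z0 \<in> S"
  obtains r \<rho> where "r > 0" "ball z0 r \<subseteq> S" "smooth_linear (ball z0 r) \<rho>"
    "\<forall>z\<in>ball z0 r. \<forall>u v e. curv (proj_change \<phi> \<rho> \<Gamma>) z u v e = 0"
proof -
  obtain r q where r: "r > 0" "ball z0 r \<subseteq> S" and q: "smooth_on (ball z0 r) q" "q z0 = (0, 1)"
    "\<forall>z\<in>ball z0 r. \<forall>h. dd q z h = - tractor \<phi> B \<Gamma> z h (q z)"
    using flat_imp_parallel_section[OF S z0 smooth_bilinear_tractor, of "(0, 1)"] tractor_flat
    by (metis prod.collapse)
  let ?O = "ball z0 r \<inter> (snd \<circ> q) -` {0<..}"
  have "continuous_on (ball z0 r) (snd \<circ> q)"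
    unfolding o_def by (intro continuous_on_snd smooth_on_continuous_on q(1))
  then have "open ?O" by (rule continuous_open_preimage) auto
  moreover have "z0 \<in> ?O" using q(2) r by simp
  ultimately obtain r' where r': "r' > 0" "ball z0 r' \<subseteq> ?O" using openE by blast
  let ?B = "ball z0 r'"
  have Br: "?B \<subseteq> ball z0 r" and BS: "?B \<subseteq> S" using r r' by auto
  define s where "s = (\<lambda>z. snd (q z))"
  define t where "t = (\<lambda>z. fst (q z))"
  have spos: "s z > 0" if "z \<in> ?B" for z using that r'(2) by (auto simp: s_def)
  have qB: "smooth_on ?B q" by (rule smooth_on_subset[OF q(1) Br])
  have ss: "smooth_on ?B s" unfolding s_def
    by (rule smooth_on_bounded_linear[OF open_ball bounded_linear_snd qB])
  have ts: "smooth_on ?B t" unfolding t_def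
    by (rule smooth_on_bounded_linear[OF open_ball bounded_linear_fst qB])
  have tes: "smooth_on ?B (\<lambda>z. t z \<bullet> e)" for e
    by (rule smooth_on_bounded_linear[where L="\<lambda>y. y \<bullet> e", OF open_ball bounded_linear_inner_left ts])
  have qd: "(q has_derivative (\<lambda>h. - tractor \<phi> B \<Gamma> z h (q z))) (at z)" if "z \<in> ?B" for z
  proof -
    have "dd q z = (\<lambda>h. - tractor \<phi> B \<Gamma> z h (q z))" using q(3) that Br by (auto simp: fun_eq_iff)
    then show ?thesis using smooth_on_has_derivative[OF qB that] by simp
  qed
  have sd: "(s has_derivative (\<lambda>h. - (t z \<bullet> \<phi> z h))) (at z)" if "z \<in> ?B" for z
    using bounded_linear.has_derivative[OF bounded_linear_snd qd[OF that]] by (simp add: s_def t_def tractor_def)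
  have td: "((\<lambda>z. t z \<bullet> e) has_derivative (\<lambda>h. t z \<bullet> \<Gamma> z h e + s z * B z h e)) (at z)" if z: "z \<in> ?B" for z e
  proof -
    have "((\<lambda>z. t z \<bullet> e) has_derivative (\<lambda>h. fst (- tractor \<phi> B \<Gamma> z h (q z)) \<bullet> e)) (at z)"
      unfolding t_def by (intro has_derivative_inner_left bounded_linear.has_derivative[OF bounded_linear_fst] qd[OF z])
    moreover have "fst (- tractor \<phi> B \<Gamma> z h (q z)) \<bullet> e = t z \<bullet> \<Gamma> z h e + s z * B z h e" for h
      using inner_form_vector[OF tractor_form_linear[of z "t z" h "s z"], of e] z BS
      by (auto simp: tractor_def t_def s_def)
    ultimately show ?thesis by simp
  qed
  define \<rho> where "\<rho> = (\<lambda>z e. (t z \<bullet> e) * inverse (s z))"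
  have \<rho>: "smooth_linear ?B \<rho>" unfolding smooth_linear_def
  proof safe
    show "linear (\<rho> z)" for z by (rule linearI) (simp_all add: \<rho>_def inner_add_right algebra_simps)
    show "smooth_on ?B (\<lambda>z. \<rho> z e)" for e unfolding \<rho>_def
    proof (rule smooth_on_mult[OF open_ball tes smooth_on_inverse[OF open_ball ss]])
      show "s z \<noteq> 0" if "z \<in> ?B" for z using spos[OF that] by simp
    qed
  qed
  have dual: "dual_cov \<Gamma> \<rho> z u e = B z u e + \<rho> z (\<phi> z u) * \<rho> z e" if z: "z \<in> ?B" for z u e
  proof -
    have "((\<lambda>z. \<rho> z e) has_derivative (\<lambda>h. (t z \<bullet> e) * (- (inverse (s z) * (- (t z \<bullet> \<phi> z h)) * inverse (s z)))
        + (t z \<bullet> \<Gamma> z h e + s z * B z h e) * inverse (s z))) (at z)"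
      unfolding \<rho>_def using spos[OF z]
      by (intro has_derivative_mult td[OF z] Deriv.has_derivative_inverse sd[OF z]) simp
    from dd_eqI[OF this, of u] show ?thesis
      unfolding dual_cov_def using spos[OF z] by (simp add: \<rho>_def field_simps)
  qed
  have "curv (proj_change \<phi> \<rho> \<Gamma>) z u v e = 0" if z: "z \<in> ?B" for z u v e
  proof -
    have zS: "z \<in> S" using z BS by blast
    have "torsion_free ?B \<phi> \<Gamma>" using tf BS unfolding torsion_free_def by blast
    from curv_proj_change[OF open_ball smooth_bilinear_subset[OF \<Gamma> BS] smooth_linear_subset[OF \<phi> BS] this \<rho> z]
    show ?thesis
      using R[OF zS] sym[OF zS, of u v] by (simp add: schouten_def dual[OF z])
  qed
  then show thesis using that[OF r'(1) BS \<rho>] by blast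
qed

end

lemma smooth_bilinear_schouten:
  assumes \<rho>: "smooth_linear S \<rho>" shows "smooth_bilinear S (schouten \<phi> \<rho> \<Gamma>)"
  unfolding smooth_bilinear_def
proof safe
  fix z assume z: "z \<in> S"
  have r: "smooth_on S (\<lambda>y. \<rho> y e)" for e by (rule smooth_linearD(2)[OF \<rho>])
  have l1: "linear (dd (\<lambda>y. \<rho> y e) z)" for e by (rule linear_dd[OF S z r])
  have l2: "linear (\<lambda>e. dd (\<lambda>y. \<rho> y e) z h)" for h
    using smooth_linearD(1)[OF smooth_linear_dd_family[OF S \<rho>] z] .
  show "bilinear (schouten \<phi> \<rho> \<Gamma> z)"
    unfolding bilinear_def schouten_def dual_cov_def
    by (intro conjI allI linearI) (simp_all add: bilinear_simps[OF smooth_bilinearD(1)[OF \<Gamma> z]]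
        linear_map_simps[OF smooth_linearD(1)[OF \<phi> z]] linear_map_simps[OF smooth_linearD(1)[OF \<rho> z]]
        linear_map_simps[OF l1] linear_map_simps[OF l2] algebra_simps)
next
  fix u e
  have r: "smooth_on S (\<lambda>y. \<rho> y e)" for e by (rule smooth_linearD(2)[OF \<rho>])
  show "smooth_on S (\<lambda>z. schouten \<phi> \<rho> \<Gamma> z u e)"
    unfolding schouten_def dual_cov_def
    by (intro smooth_on_diff smooth_on_mult S smooth_on_frechet r smooth_linear_apply(1)[OF S \<rho>]
        smooth_bilinearD(2)[OF \<Gamma>] smooth_linearD(2)[OF \<phi>])
qed

text \<open>Comparing traces in the transformation rule of the curvature shows that its scalar part vanishes.\<close>

lemma curv_of_flat_proj_change:
  assumes \<rho>: "smooth_linear S \<rho>" and z: "z \<in> S"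
    and flat: "\<And>e. curv (proj_change \<phi> \<rho> \<Gamma>) z u v e = 0"
    and tr: "(\<Sum>b\<in>Basis. curv \<Gamma> z u v b \<bullet> b) = 0"
  shows "curv \<Gamma> z u v e = schouten \<phi> \<rho> \<Gamma> z v e *\<^sub>R \<phi> z u - schouten \<phi> \<rho> \<Gamma> z u e *\<^sub>R \<phi> z v"
proof -
  define c where "c = dual_cov \<Gamma> \<rho> z u (\<phi> z v) - dual_cov \<Gamma> \<rho> z v (\<phi> z u)"
  let ?P = "schouten \<phi> \<rho> \<Gamma> z"
  have c: "c = ?P u (\<phi> z v) - ?P v (\<phi> z u)" by (simp add: c_def schouten_def)
  have b: "bilinear ?P" by (rule smooth_bilinearD(1)[OF smooth_bilinear_schouten[OF \<rho>] z])
  have eq: "curv \<Gamma> z u v e = - (c *\<^sub>R e) - ?P u e *\<^sub>R \<phi> z v + ?P v e *\<^sub>R \<phi> z u" for e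
    using curv_proj_change[OF S \<Gamma> \<phi> tf \<rho> z, of u v e] flat[of e] unfolding c_def[symmetric]
    by (simp add: algebra_simps eq_neg_iff_add_eq_0 add_eq_0_iff2)
  have "0 = (\<Sum>b\<in>Basis. (- (c *\<^sub>R b) - ?P u b *\<^sub>R \<phi> z v + ?P v b *\<^sub>R \<phi> z u) \<bullet> b)"
    using tr unfolding eq by simp
  also have "\<dots> = (\<Sum>b\<in>Basis. - c * (b \<bullet> b) - ?P u b * (\<phi> z v \<bullet> b) + ?P v b * (\<phi> z u \<bullet> b))"
    by (intro sum.cong) (simp_all add: inner_diff_left inner_add_left)
  also have "\<dots> = - c * real DIM('b) - ?P u (\<phi> z v) + ?P v (\<phi> z u)"
  proof -
    have "linear (?P u)" "linear (?P v)" using b by (auto simp: bilinear_def)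
    then show ?thesis by (simp add: sum.distrib sum_subtractf sum_linear_form sum_negf)
  qed
  also have "\<dots> = - c * (real DIM('b) + 1)" using c by (simp add: algebra_simps)
  finally have "c = 0" by (simp add: add_nonneg_eq_0_iff)
  then show ?thesis using eq by simp
qed

end

section \<open>Smooth functions on manifolds\<close>

locale manifold =
  fixes \<A> :: "('m::{t2_space, second_countable_topology}, 'n::finite) chart set"
  assumes mfd: "smooth_manifold \<A>"
begin

lemma chart_open: "(U, x) \<in> \<A> \<Longrightarrow> open U"
  using mfd unfolding smooth_manifold_def is_chart_def by force

lemma chart_homeomorphism:
  assumes "(U, x) \<in> \<A>" shows "homeomorphism U (x ` U) x (inv_into U x)"
proof -
  have "is_chart (U, x)" using mfd assms unfolding smooth_manifold_def by blast
  then obtain y where y: "homeomorphism U (x ` U) x y" unfolding is_chart_def by auto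
  then have "inj_on x U" by (metis homeomorphism_apply1 inj_onI)
  then have "inv_into U x z = y z" if "z \<in> x ` U" for z
    using that y by (metis homeomorphism_apply1 imageE inv_into_f_f)
  then show ?thesis using homeomorphism_cong[OF y refl refl] by simp
qed

lemma chart_inv: "(U, x) \<in> \<A> \<Longrightarrow> p \<in> U \<Longrightarrow> inv_into U x (x p) = p"
  using chart_homeomorphism homeomorphism_apply1 by blast

lemma chart_open_image:
  assumes "(U, x) \<in> \<A>" "open N" "N \<subseteq> U" shows "open (x ` N)"
proof -
  have "is_chart (U, x)" using mfd assms unfolding smooth_manifold_def by blast
  then have "open (x ` U)" unfolding is_chart_def by auto
  moreover have "openin (top_of_set (x ` U)) (x ` N)"
    by (rule homeomorphism_imp_open_map[OF chart_homeomorphism[OF assms(1)]])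
      (use assms chart_open openin_open_eq in blast)
  ultimately show ?thesis using openin_open_trans by blast
qed

lemma chart_cover: obtains U x where "(U, x) \<in> \<A>" "p \<in> U"
proof -
  have "p \<in> \<Union>(fst ` \<A>)" using mfd unfolding smooth_manifold_def by simp
  then show thesis using that by auto
qed

lemma chart_transition:
  "(U, x) \<in> \<A> \<Longrightarrow> (V, y) \<in> \<A> \<Longrightarrow> smooth_on (x ` (U \<inter> V)) (y \<circ> inv_into U x)"
  using mfd unfolding smooth_manifold_def by blast

abbreviation (input) in_chart :: "'m set \<Rightarrow> ('m \<Rightarrow> real ^ 'n) \<Rightarrow> ('m \<Rightarrow> 'b) \<Rightarrow> real ^ 'n \<Rightarrow> 'b"
  where "in_chart U x f \<equiv> (\<lambda>z. f (inv_into U x z))"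

lemma smooth_fun_onD:
  assumes "smooth_fun_on \<A> W f" "(U, x) \<in> \<A>" "N \<subseteq> U \<inter> W"
  shows "smooth_on (x ` N) (in_chart U x f)"
proof -
  have "smooth_on (x ` (U \<inter> W)) (in_chart U x f)"
    using assms(1,2) unfolding smooth_fun_on_def o_def by blast
  then show ?thesis by (rule smooth_on_subset[OF _ image_mono[OF assms(3)]])
qed

lemma smooth_fun_onI:
  assumes "\<And>U x. (U, x) \<in> \<A> \<Longrightarrow> smooth_on (x ` (U \<inter> W)) (in_chart U x f)"
  shows "smooth_fun_on \<A> W f"
  using assms unfolding smooth_fun_on_def o_def by blast

text \<open>Smoothness in one chart suffices, since the expressions in two charts differ by a smooth transition map.\<close>

lemma smooth_fun_on_chartI:
  fixes f :: "'m \<Rightarrow> 'b::real_normed_vector"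
  assumes U: "(U, x) \<in> \<A>" and N: "open N" "N \<subseteq> U" and f: "smooth_on (x ` N) (in_chart U x f)"
  shows "smooth_fun_on \<A> N f"
proof (rule smooth_fun_onI)
  fix V y assume V: "(V, y) \<in> \<A>"
  have o: "open (y ` (V \<inter> N))" using chart_open_image[OF V] chart_open[OF V] N(1) by blast
  have "smooth_on (y ` (V \<inter> N)) (\<lambda>z. in_chart U x f (in_chart V y x z))"
  proof (rule smooth_on_compose[OF o chart_open_image[OF U N] _ _ f])
    show "in_chart V y x ` y ` (V \<inter> N) \<subseteq> x ` N" using chart_inv[OF V] by auto
    show "smooth_on (y ` (V \<inter> N)) (in_chart V y x)"
      using smooth_on_subset[OF chart_transition[OF V U], of "y ` (V \<inter> N)"] N(2) by (auto simp: o_def)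
  qed
  then show "smooth_on (y ` (V \<inter> N)) (in_chart V y f)"
    by (rule smooth_on_cong[OF o, THEN iffD1, rotated])
      (use chart_inv[OF V] chart_inv[OF U] N(2) in auto)
qed

lemma smooth_fun_on_subset: "smooth_fun_on \<A> W f \<Longrightarrow> N \<subseteq> W \<Longrightarrow> smooth_fun_on \<A> N f"
  by (rule smooth_fun_onI) (auto intro: smooth_fun_onD)

lemma smooth_fun_on_locallyI:
  assumes "\<And>p. p \<in> W \<Longrightarrow> \<exists>N. open N \<and> p \<in> N \<and> smooth_fun_on \<A> N f"
  shows "smooth_fun_on \<A> W f"
proof (rule smooth_fun_onI)
  fix U x assume U: "(U, x) \<in> \<A>"
  show "smooth_on (x ` (U \<inter> W)) (in_chart U x f)"
  proof (rule smooth_on_locallyI)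
    fix z assume "z \<in> x ` (U \<inter> W)"
    then obtain p where p: "p \<in> U" "p \<in> W" "z = x p" by blast
    then obtain N where N: "open N" "p \<in> N" "smooth_fun_on \<A> N f" using assms by blast
    have "open (x ` (U \<inter> N))" using chart_open_image[OF U] chart_open[OF U] N(1) by blast
    moreover have "smooth_on (x ` (U \<inter> N)) (in_chart U x f)" by (rule smooth_fun_onD[OF N(3) U subset_refl])
    moreover have "z \<in> x ` (U \<inter> N)" using p N by blast
    ultimately show "\<exists>N. open N \<and> z \<in> N \<and> smooth_on N (in_chart U x f)" by (intro exI conjI)
  qed
qed

lemma open_chart_inter: "(U, x) \<in> \<A> \<Longrightarrow> open W \<Longrightarrow> open (x ` (U \<inter> W))"
  by (rule chart_open_image) (auto simp: chart_open open_Int)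

lemma smooth_fun_on_cong:
  assumes "open W" "\<And>p. p \<in> W \<Longrightarrow> f p = g p" "smooth_fun_on \<A> W f"
  shows "smooth_fun_on \<A> W g"
proof (rule smooth_fun_onI)
  fix U x assume U: "(U, x) \<in> \<A>"
  have "smooth_on (x ` (U \<inter> W)) (in_chart U x f)" by (rule smooth_fun_onD[OF assms(3) U subset_refl])
  then show "smooth_on (x ` (U \<inter> W)) (in_chart U x g)"
    by (rule smooth_on_cong[OF open_chart_inter[OF U assms(1)], THEN iffD1, rotated])
      (use chart_inv[OF U] assms(2) in auto)
qed

lemma smooth_fun_on_const: "open W \<Longrightarrow> smooth_fun_on \<A> W (\<lambda>p. c)"
  by (intro smooth_fun_onI smooth_on_const open_chart_inter)

lemma smooth_fun_on_add:
  "open W \<Longrightarrow> smooth_fun_on \<A> W f \<Longrightarrow> smooth_fun_on \<A> W g \<Longrightarrow> smooth_fun_on \<A> W (\<lambda>p. f p + g p)"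
  by (intro smooth_fun_onI smooth_on_add open_chart_inter) (assumption | rule smooth_fun_onD subset_refl)+

lemma smooth_fun_on_scaleR:
  "open W \<Longrightarrow> smooth_fun_on \<A> W f \<Longrightarrow> smooth_fun_on \<A> W g \<Longrightarrow> smooth_fun_on \<A> W (\<lambda>p. f p *\<^sub>R g p)"
  by (intro smooth_fun_onI smooth_on_scaleR open_chart_inter) (assumption | rule smooth_fun_onD subset_refl)+

lemma smooth_fun_on_mult:
  fixes f g :: "'m \<Rightarrow> real"
  shows "open W \<Longrightarrow> smooth_fun_on \<A> W f \<Longrightarrow> smooth_fun_on \<A> W g \<Longrightarrow> smooth_fun_on \<A> W (\<lambda>p. f p * g p)"
  using smooth_fun_on_scaleR[of W f g] by simp

lemma smooth_fun_on_bounded_linear: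
  "open W \<Longrightarrow> bounded_linear L \<Longrightarrow> smooth_fun_on \<A> W f \<Longrightarrow> smooth_fun_on \<A> W (\<lambda>p. L (f p))"
  by (rule smooth_fun_onI, rule smooth_on_bounded_linear[where L=L])
    (assumption | rule open_chart_inter smooth_fun_onD subset_refl)+

lemma smooth_fun_on_sum:
  assumes "open W" "finite I" "\<And>i. i \<in> I \<Longrightarrow> smooth_fun_on \<A> W (f i)"
  shows "smooth_fun_on \<A> W (\<lambda>p. \<Sum>i\<in>I. f i p)"
  using assms(2,3)
  by (induction I rule: finite_induct) (simp_all add: smooth_fun_on_const smooth_fun_on_add assms(1))

lemma smooth_fun_on_nth: "open W \<Longrightarrow> smooth_fun_on \<A> W f \<Longrightarrow> smooth_fun_on \<A> W (\<lambda>p. f p $ i)"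
  by (rule smooth_fun_on_bounded_linear[OF _ bounded_linear_vec_nth])

lemma smooth_fun_on_chart:
  assumes "(U, x) \<in> \<A>" shows "smooth_fun_on \<A> U x"
proof (rule smooth_fun_on_chartI[OF assms chart_open[OF assms] subset_refl])
  have o: "open (x ` U)" using chart_open_image[OF assms chart_open[OF assms]] by simp
  show "smooth_on (x ` U) (in_chart U x x)"
    by (rule smooth_on_cong[OF o, THEN iffD1, OF _ smooth_on_id[OF o]]) (use chart_inv[OF assms] in auto)
qed

text \<open>A bump function in a chart is extended by \<open>0\<close>.  Its support \<open>K\<close> is compact, hence closed because the
  manifold is Hausdorff, and the complement of \<open>K\<close> together with the chart domain covers the manifold.\<close>

lemma bump_manifold:
  assumes "open W" "p \<in> W"
  obtains \<kappa> :: "'m \<Rightarrow> real" and N K where "smooth_fun_on \<A> UNIV \<kappa>" "open N" "p \<in> N" "N \<subseteq> K"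
    "closed K" "K \<subseteq> W" "\<forall>q\<in>N. \<kappa> q = 1" "\<forall>q. q \<notin> K \<longrightarrow> \<kappa> q = 0"
proof -
  obtain U x where U: "(U, x) \<in> \<A>" "p \<in> U" by (rule chart_cover)
  let ?y = "inv_into U x"
  have o: "open (x ` (U \<inter> W))" by (rule open_chart_inter[OF U(1) assms(1)])
  obtain r where r: "r > 0" "cball (x p) r \<subseteq> x ` (U \<inter> W)"
    using open_contains_cball[THEN iffD1, OF o] U(2) assms(2) by blast
  obtain \<beta> :: "real ^ 'n \<Rightarrow> real" where "smooth_on UNIV \<beta>" "\<forall>z\<in>ball (x p) (r / 2). \<beta> z = 1"
    "\<forall>z. z \<notin> ball (x p) r \<longrightarrow> \<beta> z = 0"
    by (rule bump_euclidean[OF r(1), of "x p"]) blast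
  then have \<beta>: "smooth_on UNIV \<beta>" "\<And>z. z \<in> ball (x p) (r / 2) \<Longrightarrow> \<beta> z = 1"
    "\<And>z. z \<notin> ball (x p) r \<Longrightarrow> \<beta> z = 0" by blast+
  define \<kappa> where "\<kappa> = (\<lambda>q. if q \<in> U then \<beta> (x q) else 0)"
  define K where "K = ?y ` cball (x p) r"
  define N where "N = ?y ` ball (x p) (r / 2)"
  have y: "?y z \<in> U \<inter> W" "x (?y z) = z" if "z \<in> cball (x p) r" for z
    using that r(2) chart_inv[OF U(1)] by auto
  have xK: "q \<in> K" if "q \<in> U" "x q \<in> ball (x p) r" for q
    unfolding K_def using that chart_inv[OF U(1) that(1)] by (intro image_eqI[of _ _ "x q"]) auto
  have "compact K" unfolding K_def
  proof (rule compact_continuous_image)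
    have "continuous_on (x ` U) ?y" using chart_homeomorphism[OF U(1)] by (simp add: homeomorphism_def)
    then show "continuous_on (cball (x p) r) ?y" by (rule continuous_on_subset) (use r in blast)
  qed simp
  then have "closed K" by (rule compact_imp_closed)
  have KW: "K \<subseteq> U \<inter> W" unfolding K_def using y by blast
  have "open N"
  proof -
    have "homeomorphism (x ` U) U ?y x" by (rule homeomorphism_symD[OF chart_homeomorphism[OF U(1)]])
    moreover have "ball (x p) (r / 2) \<subseteq> cball (x p) r" using r(1) by auto
    then have "openin (top_of_set (x ` U)) (ball (x p) (r / 2))"
      using r(2) by (intro open_subset) auto
    ultimately have "openin (top_of_set U) N" unfolding N_def by (rule homeomorphism_imp_open_map)
    then show ?thesis using chart_open[OF U(1)] openin_open_trans by blast
  qed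
  have "smooth_fun_on \<A> UNIV \<kappa>"
  proof (rule smooth_fun_on_locallyI)
    fix q
    show "\<exists>N. open N \<and> q \<in> N \<and> smooth_fun_on \<A> N \<kappa>"
    proof (cases "q \<in> U")
      case True
      have oU: "open (x ` U)" by (rule chart_open_image[OF U(1) chart_open[OF U(1)] subset_refl])
      have "smooth_fun_on \<A> U \<kappa>"
      proof (rule smooth_fun_on_chartI[OF U(1) chart_open[OF U(1)] subset_refl])
        show "smooth_on (x ` U) (in_chart U x \<kappa>)"
          by (rule smooth_on_cong[OF oU, THEN iffD1, OF _ smooth_on_subset[OF \<beta>(1) subset_UNIV]])
            (use chart_inv[OF U(1)] in \<open>auto simp: \<kappa>_def\<close>)
      qed
      then show ?thesis using True chart_open[OF U(1)] by blast
    next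
      case False
      have "smooth_fun_on \<A> (- K) \<kappa>"
      proof (rule smooth_fun_on_cong[OF _ _ smooth_fun_on_const])
        show "0 = \<kappa> q" if "q \<in> - K" for q using xK[of q] that \<beta>(3)[of "x q"] by (auto simp: \<kappa>_def)
      qed (use \<open>closed K\<close> in auto)
      then show ?thesis using False \<open>closed K\<close> KW by (intro exI[of _ "- K"]) auto
    qed
  qed
  moreover have "p \<in> N" unfolding N_def using chart_inv[OF U] r by (auto intro!: image_eqI[of _ _ "x p"])
  moreover have "N \<subseteq> K" unfolding N_def K_def using r by (intro image_mono) auto
  moreover have "\<kappa> q = 1" if qN: "q \<in> N" for q
  proof -
    obtain z where z: "z \<in> ball (x p) (r / 2)" "q = ?y z" using qN unfolding N_def by blast
    then have "z \<in> cball (x p) r" using r by auto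
    then show ?thesis using y[of z] \<beta>(2)[OF z(1)] z(2) by (simp add: \<kappa>_def)
  qed
  moreover have "\<kappa> q = 0" if "q \<notin> K" for q
    using xK[of q] that \<beta>(3)[of "x q"] by (auto simp: \<kappa>_def)
  ultimately show thesis using that[of \<kappa> N K] \<open>open N\<close> \<open>closed K\<close> KW by blast
qed

section \<open>Tangent vectors\<close>

lemma smooth_nearI: "smooth_fun_on \<A> W f \<Longrightarrow> open W \<Longrightarrow> p \<in> W \<Longrightarrow> smooth_near \<A> p f"
  unfolding smooth_near_def by blast

lemma smooth_near_cong:
  assumes "open N" "p \<in> N" "\<And>q. q \<in> N \<Longrightarrow> f q = g q" "smooth_near \<A> p f"
  shows "smooth_near \<A> p g"
proof -
  obtain W where W: "open W" "p \<in> W" "smooth_fun_on \<A> W f" using assms(4) unfolding smooth_near_def by blast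
  have "smooth_fun_on \<A> (W \<inter> N) g"
    by (rule smooth_fun_on_cong[OF _ _ smooth_fun_on_subset[OF W(3)]]) (use W assms in auto)
  then show ?thesis using W assms by (intro smooth_nearI[of "W \<inter> N"]) auto
qed

lemma smooth_near_const: "smooth_near \<A> p (\<lambda>q. c)"
  using smooth_nearI[OF smooth_fun_on_const[OF open_UNIV]] by simp

lemma smooth_near_binop:
  fixes f g :: "'m \<Rightarrow> real"
  assumes "smooth_near \<A> p f" "smooth_near \<A> p g"
  shows "smooth_near \<A> p (\<lambda>q. f q + g q)" "smooth_near \<A> p (\<lambda>q. f q * g q)"
proof -
  obtain W V where W: "open W" "p \<in> W" "smooth_fun_on \<A> W f" and V: "open V" "p \<in> V" "smooth_fun_on \<A> V g"
    using assms unfolding smooth_near_def by blast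
  have f: "smooth_fun_on \<A> (W \<inter> V) f" and g: "smooth_fun_on \<A> (W \<inter> V) g"
    using smooth_fun_on_subset[OF W(3)] smooth_fun_on_subset[OF V(3)] by auto
  have o: "open (W \<inter> V)" using W V by blast
  have p: "p \<in> W \<inter> V" using W V by blast
  show "smooth_near \<A> p (\<lambda>q. f q + g q)" "smooth_near \<A> p (\<lambda>q. f q * g q)"
    by (rule smooth_nearI[OF smooth_fun_on_add[OF o f g] o p], rule smooth_nearI[OF smooth_fun_on_mult[OF o f g] o p])
qed

lemma smooth_near_sum:
  fixes f :: "'i \<Rightarrow> 'm \<Rightarrow> real"
  assumes "finite I" "\<And>i. i \<in> I \<Longrightarrow> smooth_near \<A> p (f i)"
  shows "smooth_near \<A> p (\<lambda>q. \<Sum>i\<in>I. f i q)"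
  using assms by (induction I rule: finite_induct) (simp_all add: smooth_near_const smooth_near_binop)

lemma smooth_near_chart: "(U, x) \<in> \<A> \<Longrightarrow> p \<in> U \<Longrightarrow> smooth_near \<A> p (\<lambda>q. x q $ i)"
  by (rule smooth_nearI[OF smooth_fun_on_nth[OF _ smooth_fun_on_chart]]) (auto simp: chart_open)

lemma tangent_nonsmooth: "v \<in> tangent_space \<A> p \<Longrightarrow> \<not> smooth_near \<A> p f \<Longrightarrow> v f = 0"
  and tangent_add: "v \<in> tangent_space \<A> p \<Longrightarrow> smooth_near \<A> p f \<Longrightarrow> smooth_near \<A> p g \<Longrightarrow>
    v (\<lambda>q. f q + g q) = v f + v g"
  and tangent_cmul: "v \<in> tangent_space \<A> p \<Longrightarrow> smooth_near \<A> p f \<Longrightarrow> v (\<lambda>q. c * f q) = c * v f"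
  and tangent_mult: "v \<in> tangent_space \<A> p \<Longrightarrow> smooth_near \<A> p f \<Longrightarrow> smooth_near \<A> p g \<Longrightarrow>
    v (\<lambda>q. f q * g q) = v f * g p + f p * v g"
  unfolding tangent_space_def by blast+

lemma tangent_const:
  assumes "v \<in> tangent_space \<A> p" shows "v (\<lambda>q. c) = 0"
proof -
  have "v (\<lambda>q. 1 * 1) = v (\<lambda>q. 1) * 1 + 1 * v (\<lambda>q. 1)"
    by (rule tangent_mult[OF assms smooth_near_const smooth_near_const])
  then have "v (\<lambda>q. 1) = 0" by simp
  then show ?thesis using tangent_cmul[OF assms smooth_near_const, of c 1] by simp
qed

lemma tangent_sum:
  assumes "v \<in> tangent_space \<A> p" "finite I" "\<And>i. i \<in> I \<Longrightarrow> smooth_near \<A> p (f i)"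
  shows "v (\<lambda>q. \<Sum>i\<in>I. f i q) = (\<Sum>i\<in>I. v (f i))"
  using assms(2,3)
  by (induction I rule: finite_induct)
    (simp_all add: tangent_const[OF assms(1)] tangent_add[OF assms(1)] smooth_near_sum)

text \<open>Tangent vectors are local operators: the difference of two functions that agree near \<open>p\<close>
  is unchanged by multiplication with \<open>1 - \<kappa>\<close>, where the cut-off \<open>\<kappa>\<close> is \<open>1\<close> at \<open>p\<close>.\<close>

lemma tangent_local:
  assumes v: "v \<in> tangent_space \<A> p" and N: "open N" "p \<in> N" "\<And>q. q \<in> N \<Longrightarrow> f q = g q"
  shows "v f = v g"
proof (cases "smooth_near \<A> p f")
  case True
  then have g: "smooth_near \<A> p g" using smooth_near_cong N by blast
  obtain \<kappa> :: "'m \<Rightarrow> real" and M K where \<kappa>: "smooth_fun_on \<A> UNIV \<kappa>" "open M" "p \<in> M" "M \<subseteq> K" "closed K" "K \<subseteq> N"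
      "\<forall>q\<in>M. \<kappa> q = 1" "\<forall>q. q \<notin> K \<longrightarrow> \<kappa> q = 0"
    by (rule bump_manifold[OF N(1,2)]) blast
  let ?h = "\<lambda>q. f q + (-1) * g q" and ?k = "\<lambda>q. 1 + (-1) * \<kappa> q"
  have sg: "smooth_near \<A> p (\<lambda>q. (-1) * g q)" by (rule smooth_near_binop(2)[OF smooth_near_const g])
  have h: "smooth_near \<A> p ?h" by (rule smooth_near_binop(1)[OF True sg])
  have k: "smooth_near \<A> p ?k"
    by (intro smooth_near_binop smooth_near_const smooth_nearI[OF \<kappa>(1)]) auto
  have "?h = (\<lambda>q. ?k q * ?h q)"
  proof
    fix q show "?h q = ?k q * ?h q" using N(3)[of q] \<kappa>(6) \<kappa>(8) by (cases "q \<in> N") auto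
  qed
  then have "v ?h = v (\<lambda>q. ?k q * ?h q)" by (rule arg_cong)
  also have "\<dots> = v ?k * ?h p + ?k p * v ?h" by (rule tangent_mult[OF v k h])
  also have "\<dots> = 0" using N \<kappa> by simp
  finally have "v ?h = 0" .
  moreover have "v ?h = v f + v (\<lambda>q. (-1) * g q)" by (rule tangent_add[OF v True sg])
  moreover have "v (\<lambda>q. (-1) * g q) = (-1) * v g" by (rule tangent_cmul[OF v g])
  ultimately show ?thesis by simp
next
  case False
  then have "\<not> smooth_near \<A> p g" using smooth_near_cong[of N p g f] N by metis
  then show ?thesis using False tangent_nonsmooth[OF v] by simp
qed

text \<open>The second definition differentiates the expression of \<open>f\<close> in the chart \<open>(U, x)\<close>; it is meaningful if \<open>f\<close> is
  smooth near \<open>p\<close>.\<close>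

definition comps :: "('m \<Rightarrow> real ^ 'n) \<Rightarrow> 'm tangent \<Rightarrow> real ^ 'n"
  where "comps x v = (\<chi> i. v (\<lambda>q. x q $ i))"

definition chart_deriv :: "'m set \<Rightarrow> ('m \<Rightarrow> real ^ 'n) \<Rightarrow> 'm \<Rightarrow> ('m \<Rightarrow> 'b::real_normed_vector) \<Rightarrow> real ^ 'n \<Rightarrow> 'b"
  where "chart_deriv U x p f w = frechet_derivative (in_chart U x f) (at (x p)) w"

lemma smooth_near_chartD:
  assumes "(U, x) \<in> \<A>" "p \<in> U" "smooth_near \<A> p f"
  obtains N where "open N" "p \<in> N" "N \<subseteq> U" "smooth_on (x ` N) (in_chart U x f)" "open (x ` N)"
proof -
  obtain W where W: "open W" "p \<in> W" "smooth_fun_on \<A> W f" using assms(3) unfolding smooth_near_def by blast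
  show thesis
    by (rule that[of "U \<inter> W"])
      (use W assms chart_open[OF assms(1)] open_chart_inter[OF assms(1) W(1)]
        smooth_fun_onD[OF W(3) assms(1)] in auto)
qed

lemma chart_deriv_works:
  assumes "(U, x) \<in> \<A>" "p \<in> U" "smooth_near \<A> p f"
  shows "(in_chart U x f has_derivative chart_deriv U x p f) (at (x p))"
proof -
  obtain N where N: "open N" "p \<in> N" "N \<subseteq> U" "smooth_on (x ` N) (in_chart U x f)" "open (x ` N)"
    using smooth_near_chartD[OF assms] .
  have "chart_deriv U x p f = frechet_derivative (in_chart U x f) (at (x p))"
    by (simp add: chart_deriv_def fun_eq_iff)
  then show ?thesis using smooth_on_has_derivative[OF N(4)] N(2) by simp
qed

text \<open>By Hadamard's lemma a derivation is determined by its values on the coordinates.\<close>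

lemma tangent_eq_chart_deriv:
  fixes f :: "'m \<Rightarrow> real"
  assumes U: "(U, x) \<in> \<A>" "p \<in> U" and v: "v \<in> tangent_space \<A> p" and f: "smooth_near \<A> p f"
  shows "v f = chart_deriv U x p f (comps x v)"
proof -
  obtain N where N: "open N" "p \<in> N" "N \<subseteq> U" "smooth_on (x ` N) (in_chart U x f)" "open (x ` N)"
    using smooth_near_chartD[OF U f] .
  obtain r where r: "r > 0" "ball (x p) r \<subseteq> x ` N" using openE[OF N(5)] N(2) by blast
  let ?B = "ball (x p) r" and ?F = "in_chart U x f"
  define M where "M = N \<inter> x -` ?B"
  have "continuous_on N x"
    using chart_homeomorphism[OF U(1)] N(3) by (auto simp: homeomorphism_def intro: continuous_on_subset)
  then have M: "open M" "p \<in> M" "M \<subseteq> U" "x ` M \<subseteq> ?B"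
    using continuous_open_preimage[OF _ N(1) open_ball] N r unfolding M_def by auto
  have F: "smooth_on ?B ?F" by (rule smooth_on_subset[OF N(4) r(2)])
  define G where "G = (\<lambda>b. ray_mean (x p) 0 (\<lambda>z. frechet_derivative ?F (at z) b))"
  have G: "smooth_on ?B (G b)" for b unfolding G_def
    by (rule smooth_on_ray_mean[OF open_ball convex_ball _ smooth_on_frechet[OF F]]) (use r in simp)
  have Gx: "smooth_near \<A> p (\<lambda>q. G b (x q))" for b
  proof (rule smooth_nearI[OF smooth_fun_on_chartI[OF U(1) M(1,3)] M(1,2)])
    have o: "open (x ` M)" by (rule chart_open_image[OF U(1) M(1,3)])
    show "smooth_on (x ` M) (in_chart U x (\<lambda>q. G b (x q)))"
      by (rule smooth_on_cong[OF o, THEN iffD1, OF _ smooth_on_subset[OF G[of b] M(4)]])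
        (use chart_inv[OF U(1)] M(3) in auto)
  qed
  define b :: "'n \<Rightarrow> real ^ 'n" where "b = (\<lambda>i. axis i 1)"
  let ?t = "\<lambda>i q. (x q $ i + (- (x p $ i))) * G (b i) (x q)"
  have xi: "smooth_near \<A> p (\<lambda>q. x q $ i + (- (x p $ i)))" for i
    by (intro smooth_near_binop smooth_near_chart[OF U] smooth_near_const)
  have ti: "smooth_near \<A> p (?t i)" for i by (intro smooth_near_binop(2) xi Gx)
  have "f q = f p + (\<Sum>i\<in>UNIV. ?t i q)" if "q \<in> M" for q
  proof -
    have "?F (x q) = ?F (x p) + (\<Sum>c\<in>Basis. ((x q - x p) \<bullet> c) *\<^sub>R G c (x q))"
      unfolding G_def by (rule hadamard[OF open_ball convex_ball _ _ F]) (use r M that in auto)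
    also have "(\<Sum>c\<in>Basis. ((x q - x p) \<bullet> c) *\<^sub>R G c (x q)) = (\<Sum>i\<in>UNIV. ?t i q)"
    proof (rule sum.reindex_cong[of b])
      show "inj b" by (auto simp: b_def inj_def axis_eq_axis)
      show "Basis = range b" by (auto simp: b_def Basis_vec_def)
    qed (simp add: b_def inner_axis)
    finally show ?thesis using that M chart_inv[OF U(1)] U(2) by auto
  qed
  then have "v f = v (\<lambda>q. f p + (\<Sum>i\<in>UNIV. ?t i q))" by (rule tangent_local[OF v M(1,2)])
  also have "\<dots> = (\<Sum>i\<in>UNIV. v (?t i))"
    using ti by (simp add: tangent_add[OF v] smooth_near_const smooth_near_sum tangent_const[OF v] tangent_sum[OF v])
  also have "\<dots> = (\<Sum>i\<in>UNIV. v (\<lambda>q. x q $ i) * frechet_derivative ?F (at (x p)) (b i))"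
  proof (rule sum.cong[OF refl])
    fix i
    have "v (?t i) = v (\<lambda>q. x q $ i + (- (x p $ i))) * G (b i) (x p)"
      using tangent_mult[OF v xi Gx, of i "b i"] by simp
    also have "v (\<lambda>q. x q $ i + (- (x p $ i))) = v (\<lambda>q. x q $ i)"
      using tangent_add[OF v smooth_near_chart[OF U] smooth_near_const, of i "- (x p $ i)"] tangent_const[OF v] by simp
    finally show "v (?t i) = v (\<lambda>q. x q $ i) * frechet_derivative ?F (at (x p)) (b i)"
      by (simp add: G_def ray_mean_center)
  qed
  also have "\<dots> = (\<Sum>i\<in>UNIV. comps x v $ i *\<^sub>R frechet_derivative ?F (at (x p)) (b i))"
    by (simp add: comps_def)
  also have "\<dots> = chart_deriv U x p f (comps x v)"
  proof -
    have l: "linear (chart_deriv U x p f)" by (rule has_derivative_linear[OF chart_deriv_works[OF U f]])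
    have "comps x v = (\<Sum>i\<in>UNIV. comps x v $ i *\<^sub>R b i)"
      using basis_expansion[of "comps x v"] by (simp add: b_def scalar_mult_eq_scaleR)
    then have "chart_deriv U x p f (comps x v) = chart_deriv U x p f (\<Sum>i\<in>UNIV. comps x v $ i *\<^sub>R b i)"
      by (rule arg_cong)
    also have "\<dots> = (\<Sum>i\<in>UNIV. comps x v $ i *\<^sub>R chart_deriv U x p f (b i))"
      by (simp only: linear_sum[OF l] linear_cmul[OF l])
    finally show ?thesis by (simp add: chart_deriv_def)
  qed
  finally show ?thesis .
qed

text \<open>The derivation \<open>f \<mapsto> d(f \<circ> x\<^sup>-\<^sup>1)(w)\<close>, with the value \<open>0\<close> that is required of tangent vectors on
  functions not smooth near \<open>p\<close>.\<close>

definition chart_vector :: "'m set \<Rightarrow> ('m \<Rightarrow> real ^ 'n) \<Rightarrow> 'm \<Rightarrow> real ^ 'n \<Rightarrow> 'm tangent"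
  where "chart_vector U x p w f = (if smooth_near \<A> p f then chart_deriv U x p f w else 0)"

lemma chart_vector_tangent:
  assumes U: "(U, x) \<in> \<A>" "p \<in> U" shows "chart_vector U x p w \<in> tangent_space \<A> p"
proof -
  have D: "(in_chart U x f has_derivative chart_deriv U x p f) (at (x p))" if "smooth_near \<A> p f" for f :: "'m \<Rightarrow> real"
    by (rule chart_deriv_works[OF U that])
  have u: "chart_deriv U x p f = d" if "(in_chart U x f has_derivative d) (at (x p))" for f :: "'m \<Rightarrow> real" and d
    using frechet_derivative_at[OF that] by (simp add: chart_deriv_def fun_eq_iff)
  have "chart_deriv U x p (\<lambda>q. f q + g q) w = chart_deriv U x p f w + chart_deriv U x p g w"
    if "smooth_near \<A> p f" "smooth_near \<A> p g" for f g :: "'m \<Rightarrow> real"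
    using u[OF has_derivative_add[OF D[OF that(1)] D[OF that(2)]]] by simp
  moreover have "chart_deriv U x p (\<lambda>q. c * f q) w = c * chart_deriv U x p f w"
    if "smooth_near \<A> p f" for f :: "'m \<Rightarrow> real" and c
    using u[OF has_derivative_mult_right[OF D[OF that]], of c] by simp
  moreover have "chart_deriv U x p (\<lambda>q. f q * g q) w = chart_deriv U x p f w * g p + f p * chart_deriv U x p g w"
    if "smooth_near \<A> p f" "smooth_near \<A> p g" for f g :: "'m \<Rightarrow> real"
    using u[OF has_derivative_mult[OF D[OF that(1)] D[OF that(2)]]] chart_inv[OF U] by simp
  ultimately show ?thesis
    unfolding tangent_space_def chart_vector_def
    using smooth_near_binop smooth_near_binop(2)[OF smooth_near_const] by simp
qed

lemma comps_chart_vector: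
  assumes U: "(U, x) \<in> \<A>" "p \<in> U" shows "comps x (chart_vector U x p w) = w"
proof -
  have o: "open (x ` U)" "x p \<in> x ` U"
    using chart_open_image[OF U(1) chart_open[OF U(1)] subset_refl] U by auto
  have "chart_deriv U x p (\<lambda>q. x q $ i) w = w $ i" for i
  proof -
    have "((\<lambda>z. z $ i) has_derivative (\<lambda>w. w $ i)) (at (x p))"
      by (rule bounded_linear_imp_has_derivative[OF bounded_linear_vec_nth])
    then have "(in_chart U x (\<lambda>q. x q $ i) has_derivative (\<lambda>w. w $ i)) (at (x p))"
      by (rule has_derivative_transform_within_open[OF _ o]) (use chart_inv[OF U(1)] in auto)
    from frechet_derivative_at[OF this, symmetric] show ?thesis by (simp add: chart_deriv_def)
  qed
  then show ?thesis using smooth_near_chart[OF U] by (simp add: comps_def chart_vector_def vec_eq_iff)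
qed

lemma chart_vector_comps:
  assumes "(U, x) \<in> \<A>" "p \<in> U" "v \<in> tangent_space \<A> p"
  shows "chart_vector U x p (comps x v) = v"
  using tangent_eq_chart_deriv[OF assms] tangent_nonsmooth[OF assms(3)] by (auto simp: chart_vector_def fun_eq_iff)

lemma comps_bij_betw:
  assumes "(U, x) \<in> \<A>" "p \<in> U"
  shows "bij_betw (comps x) (tangent_space \<A> p) UNIV"
  by (rule bij_betw_byWitness[where f'="chart_vector U x p"])
    (use chart_vector_comps[OF assms] comps_chart_vector[OF assms] chart_vector_tangent[OF assms] in auto)

lemma comps_inv:
  assumes "(U, x) \<in> \<A>" "p \<in> U"
  shows "inv_into (tangent_space \<A> p) (comps x) w = chart_vector U x p w"
  using comps_bij_betw[OF assms] chart_vector_tangent[OF assms] comps_chart_vector[OF assms]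
  by (metis bij_betw_imp_inj_on inv_into_f_f)

lemma smooth_chart_deriv:
  fixes f :: "'m \<Rightarrow> 'b::real_normed_vector"
  assumes U: "(U, x) \<in> \<A>" and N: "open N" "N \<subseteq> U" "smooth_fun_on \<A> N f"
  shows "smooth_fun_on \<A> N (\<lambda>p. chart_deriv U x p f w)"
proof (rule smooth_fun_on_chartI[OF U N(1,2)])
  have o: "open (x ` N)" by (rule chart_open_image[OF U N(1,2)])
  have "smooth_on (x ` N) (in_chart U x f)" by (rule smooth_fun_onD[OF N(3) U]) (use N in blast)
  then have "smooth_on (x ` N) (\<lambda>z. frechet_derivative (in_chart U x f) (at z) w)" by (rule smooth_on_frechet)
  then show "smooth_on (x ` N) (in_chart U x (\<lambda>p. chart_deriv U x p f w))"
    by (rule smooth_on_cong[OF o, THEN iffD1, rotated]) (use chart_inv[OF U] N in \<open>auto simp: chart_deriv_def\<close>)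
qed

lemma subspace_tangent_space: "subspace (tangent_space \<A> p)"
  unfolding subspace_def tangent_space_def
  by (auto simp: scaleR_fun_def plus_fun_def zero_fun_def algebra_simps)

text \<open>The transition between the trivializations of two charts is the derivative of the coordinate change.\<close>

lemma vector_bundle_tangent: "vector_bundle \<A> (tangent_bundle \<A>)"
proof -
  have "linear_on_space (tangent_space \<A> p) (comps x)" for p x
    by (auto simp: linear_on_space_def comps_def vec_eq_iff plus_fun_def scaleR_fun_def)
  moreover have "smooth_fun_on \<A> (U \<inter> V) (\<lambda>p. comps y (inv_into (tangent_space \<A> p) (comps x) w))"
    if U: "(U, x) \<in> \<A>" and V: "(V, y) \<in> \<A>" for U x V y w
  proof -
    have o: "open (U \<inter> V)" using chart_open U V by blast
    have "smooth_fun_on \<A> (U \<inter> V) (\<lambda>p. chart_deriv U x p y w)"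
      by (rule smooth_chart_deriv[OF U o _ smooth_fun_on_subset[OF smooth_fun_on_chart[OF V]]]) auto
    then show ?thesis
    proof (rule smooth_fun_on_cong[OF o, rotated])
      fix p assume p: "p \<in> U \<inter> V"
      have "((\<lambda>z. in_chart U x y z $ i) has_derivative (\<lambda>w. chart_deriv U x p y w $ i)) (at (x p))" for i
        by (rule bounded_linear.has_derivative[OF bounded_linear_vec_nth chart_deriv_works[OF U]])
          (use p smooth_nearI[OF smooth_fun_on_chart[OF V] chart_open[OF V]] in auto)
      from frechet_derivative_at[OF this]
      have "chart_deriv U x p (\<lambda>q. y q $ i) w = chart_deriv U x p y w $ i" for i
        by (simp add: chart_deriv_def fun_eq_iff)
      then show "chart_deriv U x p y w = comps y (inv_into (tangent_space \<A> p) (comps x) w)"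
        using p smooth_near_chart[OF V] by (simp add: comps_inv[OF U] comps_def vec_eq_iff chart_vector_def)
    qed
  qed
  moreover have "\<Union>(fst ` \<A>) = UNIV" using mfd unfolding smooth_manifold_def by blast
  moreover have triv: "t \<in> trivs (tangent_bundle \<A>) \<longleftrightarrow> (\<exists>U x. (U, x) \<in> \<A> \<and> t = (U, \<lambda>p. comps x))" for t
    by (auto simp: tangent_bundle_def comps_def[abs_def])
  moreover have "fst ` trivs (tangent_bundle \<A>) = fst ` \<A>"
    by (force simp: tangent_bundle_def)
  moreover have "fibre (tangent_bundle \<A>) = tangent_space \<A>" by (simp add: tangent_bundle_def)
  ultimately show ?thesis
    unfolding vector_bundle_def
    using subspace_tangent_space chart_open comps_bij_betw by auto
qed

lemma tangent_bundle_simps: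
  "fibre (tangent_bundle \<A>) = tangent_space \<A>"
  "(U, x) \<in> \<A> \<Longrightarrow> (U, \<lambda>p. comps x) \<in> trivs (tangent_bundle \<A>)"
  by (auto simp: tangent_bundle_def comps_def[abs_def])

end

section \<open>Vector bundles and their sections\<close>

locale smooth_bundle = manifold \<A>
  for \<A> :: "('m::{t2_space, second_countable_topology}, 'n::finite) chart set" +
  fixes F :: "('m, 'e::real_vector, 'n) vbundle"
  assumes vb: "vector_bundle \<A> F"
begin

abbreviation lift :: "('m \<Rightarrow> 'e \<Rightarrow> real ^ 'n) \<Rightarrow> 'm \<Rightarrow> real ^ 'n \<Rightarrow> 'e"
  where "lift \<theta> p w \<equiv> inv_into (fibre F p) (\<theta> p) w"

lemma fibre_subspace: "subspace (fibre F p)"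
  using vb unfolding vector_bundle_def by blast

lemma triv_cover: obtains V \<theta> where "(V, \<theta>) \<in> trivs F" "p \<in> V"
proof -
  have "p \<in> \<Union>(fst ` trivs F)" using vb unfolding vector_bundle_def by simp
  then show thesis using that by auto
qed

lemma triv_props:
  assumes "(V, \<theta>) \<in> trivs F"
  shows "open V" "p \<in> V \<Longrightarrow> linear_on_space (fibre F p) (\<theta> p)" "p \<in> V \<Longrightarrow> bij_betw (\<theta> p) (fibre F p) UNIV"
  using vb assms unfolding vector_bundle_def by blast+

lemma transition_smooth:
  "(V, \<theta>) \<in> trivs F \<Longrightarrow> (V', \<theta>') \<in> trivs F \<Longrightarrow> smooth_fun_on \<A> (V \<inter> V') (\<lambda>p. \<theta>' p (lift \<theta> p w))"
  using vb unfolding vector_bundle_def by blast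

context
  fixes V \<theta> p assumes V: "(V, \<theta>) \<in> trivs F" and p: "p \<in> V"
begin

lemma triv_add: "a \<in> fibre F p \<Longrightarrow> b \<in> fibre F p \<Longrightarrow> \<theta> p (a + b) = \<theta> p a + \<theta> p b"
  and triv_scaleR: "a \<in> fibre F p \<Longrightarrow> \<theta> p (c *\<^sub>R a) = c *\<^sub>R \<theta> p a"
  using triv_props(2)[OF V p] unfolding linear_on_space_def by blast+

lemma lift_in: "lift \<theta> p w \<in> fibre F p"
  using triv_props(3)[OF V p] by (metis UNIV_I bij_betw_def inv_into_into)

lemma triv_lift: "\<theta> p (lift \<theta> p w) = w"
  using triv_props(3)[OF V p] by (metis UNIV_I bij_betw_inv_into_right)

lemma lift_triv: "a \<in> fibre F p \<Longrightarrow> lift \<theta> p (\<theta> p a) = a"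
  using triv_props(3)[OF V p] by (metis bij_betw_inv_into_left)

lemma triv_inject: "a \<in> fibre F p \<Longrightarrow> b \<in> fibre F p \<Longrightarrow> \<theta> p a = \<theta> p b \<Longrightarrow> a = b"
  using lift_triv by metis

lemma triv_zero: "\<theta> p 0 = 0"
  using triv_scaleR[of 0 0] subspace_0[OF fibre_subspace] by simp

lemma lift_add: "lift \<theta> p (a + b) = lift \<theta> p a + lift \<theta> p b"
  by (rule triv_inject) (auto simp: lift_in triv_lift triv_add intro!: subspace_add fibre_subspace)

lemma lift_scaleR: "lift \<theta> p (c *\<^sub>R a) = c *\<^sub>R lift \<theta> p a"
  by (rule triv_inject) (auto simp: lift_in triv_lift triv_scaleR intro!: subspace_scale fibre_subspace)

lemma linear_lift: "linear (lift \<theta> p)"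
  by (rule linearI) (simp_all add: lift_add lift_scaleR)

lemma triv_diff: "a \<in> fibre F p \<Longrightarrow> b \<in> fibre F p \<Longrightarrow> \<theta> p (a - b) = \<theta> p a - \<theta> p b"
  using triv_add[of a "- b"] triv_scaleR[of b "-1"] subspace_neg[OF fibre_subspace] by simp

end

lemma change_triv_smooth:
  assumes V: "(V, \<theta>) \<in> trivs F" and V': "(V', \<theta>') \<in> trivs F" and N: "open N" "N \<subseteq> V"
    and f: "smooth_fun_on \<A> N f"
  shows "smooth_fun_on \<A> (V' \<inter> N) (\<lambda>q. \<theta>' q (lift \<theta> q (f q)))"
proof -
  have o: "open (V' \<inter> N)" using triv_props(1)[OF V'] N by blast
  have "smooth_fun_on \<A> (V' \<inter> N) (\<lambda>q. \<Sum>b\<in>Basis. (f q \<bullet> b) *\<^sub>R \<theta>' q (lift \<theta> q b))"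
  proof (intro smooth_fun_on_sum smooth_fun_on_scaleR o)
    show "smooth_fun_on \<A> (V' \<inter> N) (\<lambda>q. f q \<bullet> b)" for b
      by (rule smooth_fun_on_bounded_linear[where L="\<lambda>y. y \<bullet> b", OF o bounded_linear_inner_left
          smooth_fun_on_subset[OF f]]) blast
    show "smooth_fun_on \<A> (V' \<inter> N) (\<lambda>q. \<theta>' q (lift \<theta> q b))" for b
      by (rule smooth_fun_on_subset[OF transition_smooth[OF V V']]) (use N in blast)
  qed simp
  then show ?thesis
  proof (rule smooth_fun_on_cong[OF o, rotated])
    fix q assume q: "q \<in> V' \<inter> N"
    then have qV: "q \<in> V" and qV': "q \<in> V'" using N by auto
    have "linear (\<lambda>w. \<theta>' q (lift \<theta> q w))"
      by (rule linearI) (simp_all add: lift_add[OF V qV] lift_scaleR[OF V qV] triv_add[OF V' qV']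
          triv_scaleR[OF V' qV'] lift_in[OF V qV])
    from linear_sum_Basis[OF this, of "f q"]
    show "(\<Sum>b\<in>Basis. (f q \<bullet> b) *\<^sub>R \<theta>' q (lift \<theta> q b)) = \<theta>' q (lift \<theta> q (f q))" by simp
  qed
qed

lemma sec_fibre: "s \<in> sections \<A> F W \<Longrightarrow> p \<in> W \<Longrightarrow> s p \<in> fibre F p"
  and sec_off: "s \<in> sections \<A> F W \<Longrightarrow> p \<notin> W \<Longrightarrow> s p = 0"
  unfolding sections_def by blast+

lemma sec_fibre': "s \<in> sections \<A> F W \<Longrightarrow> s p \<in> fibre F p"
  by (cases "p \<in> W") (simp_all add: sec_fibre sec_off subspace_0[OF fibre_subspace])

lemma sec_smooth:
  assumes "s \<in> sections \<A> F W" "(V, \<theta>) \<in> trivs F" "N \<subseteq> V \<inter> W"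
  shows "smooth_fun_on \<A> N (\<lambda>p. \<theta> p (s p))"
proof -
  have "smooth_fun_on \<A> (V \<inter> W) (\<lambda>p. \<theta> p (s p))" using assms(1,2) unfolding sections_def by blast
  then show ?thesis by (rule smooth_fun_on_subset[OF _ assms(3)])
qed

text \<open>Smoothness needs to be checked in one trivialization around each point only, because the transition
  functions are smooth.\<close>

lemma sectionsI:
  assumes "\<And>p. p \<in> W \<Longrightarrow> s p \<in> fibre F p" "\<And>p. p \<notin> W \<Longrightarrow> s p = 0"
    and loc: "\<And>p. p \<in> W \<Longrightarrow> \<exists>N V \<theta>. open N \<and> p \<in> N \<and> (V, \<theta>) \<in> trivs F \<and> N \<subseteq> V \<inter> W \<and>
      smooth_fun_on \<A> N (\<lambda>q. \<theta> q (s q))"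
  shows "s \<in> sections \<A> F W"
proof -
  have "smooth_fun_on \<A> (V' \<inter> W) (\<lambda>p. \<theta>' p (s p))" if V': "(V', \<theta>') \<in> trivs F" for V' \<theta>'
  proof (rule smooth_fun_on_locallyI)
    fix p assume p: "p \<in> V' \<inter> W"
    then obtain N V \<theta> where N: "open N" "p \<in> N" "(V, \<theta>) \<in> trivs F" "N \<subseteq> V \<inter> W"
      "smooth_fun_on \<A> N (\<lambda>q. \<theta> q (s q))" using loc[of p] by auto
    have o: "open (V' \<inter> N)" using triv_props(1)[OF V'] N by blast
    have "smooth_fun_on \<A> (V' \<inter> N) (\<lambda>q. \<theta>' q (lift \<theta> q (\<theta> q (s q))))"
      by (rule change_triv_smooth[OF N(3) V' N(1) _ N(5)]) (use N in blast)
    then have "smooth_fun_on \<A> (V' \<inter> N) (\<lambda>q. \<theta>' q (s q))"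
    proof (rule smooth_fun_on_cong[OF o, rotated])
      fix q assume "q \<in> V' \<inter> N"
      then have "q \<in> V" "q \<in> W" using N(4) by auto
      then show "\<theta>' q (lift \<theta> q (\<theta> q (s q))) = \<theta>' q (s q)" using lift_triv[OF N(3)] assms(1) by simp
    qed
    then show "\<exists>N. open N \<and> p \<in> N \<and> smooth_fun_on \<A> N (\<lambda>p. \<theta>' p (s p))" using o p N by blast
  qed
  then show ?thesis using assms(1,2) unfolding sections_def by auto
qed

lemma triv_nbhd:
  assumes "open W" "p \<in> W"
  obtains N V \<theta> where "open N" "p \<in> N" "(V, \<theta>) \<in> trivs F" "N \<subseteq> V \<inter> W"
proof -
  obtain V \<theta> where "(V, \<theta>) \<in> trivs F" "p \<in> V" by (rule triv_cover)
  then show thesis using that[of "V \<inter> W" V \<theta>] triv_props(1) assms by blast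
qed

lemma sections_local_eqI:
  assumes "\<And>p. p \<notin> W \<Longrightarrow> s p = 0"
    and "\<And>p. p \<in> W \<Longrightarrow> \<exists>N W' s'. open N \<and> p \<in> N \<and> N \<subseteq> W \<inter> W' \<and> s' \<in> sections \<A> F W' \<and> (\<forall>q\<in>N. s q = s' q)"
  shows "s \<in> sections \<A> F W"
proof (rule sectionsI)
  fix p assume "p \<in> W"
  then obtain N W' s' where N: "open N" "p \<in> N" "N \<subseteq> W \<inter> W'" "s' \<in> sections \<A> F W'" "\<forall>q\<in>N. s q = s' q"
    using assms(2) by metis
  then show "s p \<in> fibre F p" using sec_fibre by auto
  obtain M V \<theta> where M: "open M" "p \<in> M" "(V, \<theta>) \<in> trivs F" "M \<subseteq> V \<inter> N"
    using triv_nbhd[OF N(1,2)] by blast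
  have "smooth_fun_on \<A> M (\<lambda>q. \<theta> q (s q))"
    by (rule smooth_fun_on_cong[OF M(1) _ sec_smooth[OF N(4) M(3)]]) (use M N in auto)
  then show "\<exists>N V \<theta>. open N \<and> p \<in> N \<and> (V, \<theta>) \<in> trivs F \<and> N \<subseteq> V \<inter> W \<and> smooth_fun_on \<A> N (\<lambda>q. \<theta> q (s q))"
    using M N by blast
qed (rule assms(1))

lemma sections_zero:
  assumes "open W" shows "(\<lambda>p. 0) \<in> sections \<A> F W"
proof (rule sectionsI)
  fix p assume "p \<in> W"
  then obtain M V \<theta> where M: "open M" "p \<in> M" "(V, \<theta>) \<in> trivs F" "M \<subseteq> V \<inter> W"
    using triv_nbhd[OF assms] by blast
  have "smooth_fun_on \<A> M (\<lambda>q. 0 :: real ^ 'n)" by (rule smooth_fun_on_const[OF M(1)])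
  then have "smooth_fun_on \<A> M (\<lambda>q. \<theta> q 0)"
  proof (rule smooth_fun_on_cong[OF M(1), rotated])
    fix q assume "q \<in> M"
    then show "0 = \<theta> q 0" using M(4) triv_zero[OF M(3), of q] by auto
  qed
  then show "\<exists>N V \<theta>. open N \<and> p \<in> N \<and> (V, \<theta>) \<in> trivs F \<and> N \<subseteq> V \<inter> W \<and> smooth_fun_on \<A> N (\<lambda>q. \<theta> q 0)"
    using M by blast
qed (simp_all add: subspace_0[OF fibre_subspace])

lemma sections_add:
  assumes "open W" "s \<in> sections \<A> F W" "t \<in> sections \<A> F W"
  shows "(\<lambda>p. s p + t p) \<in> sections \<A> F W"
proof (rule sectionsI)
  fix p assume "p \<in> W"
  then obtain M V \<theta> where M: "open M" "p \<in> M" "(V, \<theta>) \<in> trivs F" "M \<subseteq> V \<inter> W"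
    using triv_nbhd[OF assms(1)] by blast
  have "smooth_fun_on \<A> M (\<lambda>q. \<theta> q (s q) + \<theta> q (t q))"
    by (rule smooth_fun_on_add[OF M(1) sec_smooth[OF assms(2) M(3,4)] sec_smooth[OF assms(3) M(3,4)]])
  then have "smooth_fun_on \<A> M (\<lambda>q. \<theta> q (s q + t q))"
  proof (rule smooth_fun_on_cong[OF M(1), rotated])
    fix q assume "q \<in> M"
    then have "q \<in> V" using M(4) by blast
    then show "\<theta> q (s q) + \<theta> q (t q) = \<theta> q (s q + t q)"
      by (rule triv_add[OF M(3) _ sec_fibre'[OF assms(2)] sec_fibre'[OF assms(3)], symmetric])
  qed
  then show "\<exists>N V \<theta>. open N \<and> p \<in> N \<and> (V, \<theta>) \<in> trivs F \<and> N \<subseteq> V \<inter> W \<and> smooth_fun_on \<A> N (\<lambda>q. \<theta> q (s q + t q))"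
    using M by blast
qed (simp_all add: sec_fibre[OF assms(2)] sec_fibre[OF assms(3)] sec_off[OF assms(2)] sec_off[OF assms(3)]
    subspace_add[OF fibre_subspace])

lemma sections_scaleR:
  assumes "open W" "s \<in> sections \<A> F W" "smooth_fun_on \<A> W f"
  shows "(\<lambda>p. f p *\<^sub>R s p) \<in> sections \<A> F W"
proof (rule sectionsI)
  fix p assume "p \<in> W"
  then obtain M V \<theta> where M: "open M" "p \<in> M" "(V, \<theta>) \<in> trivs F" "M \<subseteq> V \<inter> W"
    using triv_nbhd[OF assms(1)] by blast
  have MW: "M \<subseteq> W" using M(4) by blast
  have "smooth_fun_on \<A> M (\<lambda>q. f q *\<^sub>R \<theta> q (s q))"
    by (rule smooth_fun_on_scaleR[OF M(1) smooth_fun_on_subset[OF assms(3) MW] sec_smooth[OF assms(2) M(3,4)]])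
  then have "smooth_fun_on \<A> M (\<lambda>q. \<theta> q (f q *\<^sub>R s q))"
  proof (rule smooth_fun_on_cong[OF M(1), rotated])
    fix q assume "q \<in> M"
    then have "q \<in> V" using M(4) by blast
    then show "f q *\<^sub>R \<theta> q (s q) = \<theta> q (f q *\<^sub>R s q)"
      by (rule triv_scaleR[OF M(3) _ sec_fibre'[OF assms(2)], symmetric])
  qed
  then show "\<exists>N V \<theta>. open N \<and> p \<in> N \<and> (V, \<theta>) \<in> trivs F \<and> N \<subseteq> V \<inter> W \<and> smooth_fun_on \<A> N (\<lambda>q. \<theta> q (f q *\<^sub>R s q))"
    using M by blast
qed (simp_all add: sec_fibre[OF assms(2)] sec_off[OF assms(2)] subspace_scale[OF fibre_subspace])

lemma sections_diff:
  assumes "open W" "s \<in> sections \<A> F W" "t \<in> sections \<A> F W"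
  shows "(\<lambda>p. s p - t p) \<in> sections \<A> F W"
proof -
  have "smooth_fun_on \<A> W (\<lambda>p. - 1 :: real)" by (rule smooth_fun_on_const[OF assms(1)])
  from sections_add[OF assms(1,2) sections_scaleR[OF assms(1,3) this]] show ?thesis by simp
qed

lemma sections_restrict:
  assumes "s \<in> sections \<A> F S" "open W" "W \<subseteq> S"
  shows "restrict_section W s \<in> sections \<A> F W"
proof (rule sections_local_eqI)
  fix p assume "p \<in> W"
  then show "\<exists>N W' s'. open N \<and> p \<in> N \<and> N \<subseteq> W \<inter> W' \<and> s' \<in> sections \<A> F W' \<and> (\<forall>q\<in>N. restrict_section W s q = s' q)"
    using assms by (intro exI[of _ W] exI[of _ S] exI[of _ s]) (auto simp: restrict_section_def)
qed (simp add: restrict_section_def)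

lemma sections_of_coords:
  assumes V: "(V, \<theta>) \<in> trivs F" and W: "open W" "W \<subseteq> V" and f: "smooth_fun_on \<A> W f"
  shows "restrict_section W (\<lambda>p. lift \<theta> p (f p)) \<in> sections \<A> F W"
proof (rule sectionsI)
  fix p assume p: "p \<in> W"
  show "restrict_section W (\<lambda>p. lift \<theta> p (f p)) p \<in> fibre F p"
    using p W lift_in[OF V] by (auto simp: restrict_section_def)
  have "smooth_fun_on \<A> W (\<lambda>q. \<theta> q (restrict_section W (\<lambda>p. lift \<theta> p (f p)) q))"
    by (rule smooth_fun_on_cong[OF W(1) _ f]) (use W triv_lift[OF V] in \<open>auto simp: restrict_section_def\<close>)
  then show "\<exists>N V \<theta>'. open N \<and> p \<in> N \<and> (V, \<theta>') \<in> trivs F \<and> N \<subseteq> V \<inter> W \<and>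
      smooth_fun_on \<A> N (\<lambda>q. \<theta>' q (restrict_section W (\<lambda>p. lift \<theta> p (f p)) q))"
    using V W p by blast
qed (simp add: restrict_section_def)

text \<open>The section is multiplied by a cut-off; outside the support of the latter the product is zero, hence smooth.\<close>

lemma section_extension:
  assumes s: "s \<in> sections \<A> F W" and W: "open W" "p \<in> W" and S: "open S" "W \<subseteq> S"
  obtains s' N where "s' \<in> sections \<A> F S" "open N" "p \<in> N" "N \<subseteq> W" "\<forall>q\<in>N. s' q = s q"
proof -
  obtain \<kappa> :: "'m \<Rightarrow> real" and N K where \<kappa>: "smooth_fun_on \<A> UNIV \<kappa>" "open N" "p \<in> N" "N \<subseteq> K" "closed K" "K \<subseteq> W"
      "\<forall>q\<in>N. \<kappa> q = 1" "\<forall>q. q \<notin> K \<longrightarrow> \<kappa> q = 0"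
    by (rule bump_manifold[OF W]) blast
  let ?s = "\<lambda>q. \<kappa> q *\<^sub>R s q"
  have "?s \<in> sections \<A> F S"
  proof (rule sections_local_eqI)
    show "?s q = 0" if "q \<notin> S" for q using that S(2) sec_off[OF s] by auto
    fix q assume q: "q \<in> S"
    show "\<exists>N W' s'. open N \<and> q \<in> N \<and> N \<subseteq> S \<inter> W' \<and> s' \<in> sections \<A> F W' \<and> (\<forall>q\<in>N. ?s q = s' q)"
    proof (cases "q \<in> W")
      case True
      have "?s \<in> sections \<A> F W" by (rule sections_scaleR[OF W(1) s smooth_fun_on_subset[OF \<kappa>(1)]]) simp
      then show ?thesis using True W S by (intro exI[of _ W] exI[of _ ?s]) auto
    next
      case False
      have "open (S - K)" using S(1) \<kappa>(5) by blast
      moreover have "q \<in> S - K" using q False \<kappa>(6) by blast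
      ultimately show ?thesis using \<kappa>(8) sections_zero[OF S(1)]
        by (intro exI[of _ "S - K"] exI[of _ S] exI[of _ "\<lambda>_. 0"]) auto
    qed
  qed
  then show thesis using that[of ?s N] \<kappa> by auto
qed

lemma section_through:
  assumes V: "(V, \<theta>) \<in> trivs F" and S: "open S" "p \<in> S" "p \<in> V"
  obtains s N where "s \<in> sections \<A> F S" "open N" "p \<in> N" "N \<subseteq> S \<inter> V" "\<forall>q\<in>N. \<theta> q (s q) = w"
proof -
  let ?W = "S \<inter> V" and ?s = "restrict_section (S \<inter> V) (\<lambda>q. lift \<theta> q w)"
  have W: "open ?W" "p \<in> ?W" using S triv_props(1)[OF V] by auto
  have "?s \<in> sections \<A> F ?W"
    using sections_of_coords[OF V W(1), of "\<lambda>q. w"] smooth_fun_on_const[OF W(1), of w] by simp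
  from section_extension[OF this W S(1)]
  obtain s' N where "s' \<in> sections \<A> F S" "open N" "p \<in> N" "N \<subseteq> ?W" "\<forall>q\<in>N. s' q = ?s q" by blast
  moreover have "\<forall>q\<in>N. \<theta> q (s' q) = w"
  proof
    fix q assume "q \<in> N"
    then have "q \<in> ?W" "s' q = ?s q" using calculation by auto
    then show "\<theta> q (s' q) = w" using triv_lift[OF V, of q w] by (simp add: restrict_section_def)
  qed
  ultimately show thesis using that by blast
qed

end

section \<open>Vector fields and the Lie bracket\<close>

context manifold
begin

interpretation TM: smooth_bundle \<A> "tangent_bundle \<A>"
  by unfold_locales (rule vector_bundle_tangent)

lemma vf_tangent: "X \<in> vector_fields \<A> S \<Longrightarrow> X p \<in> tangent_space \<A> p"
  using TM.sec_fibre' by (simp add: tangent_bundle_simps)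

lemma vf_comps_smooth:
  "X \<in> vector_fields \<A> S \<Longrightarrow> (U, x) \<in> \<A> \<Longrightarrow> N \<subseteq> U \<inter> S \<Longrightarrow> smooth_fun_on \<A> N (\<lambda>p. comps x (X p))"
  by (rule TM.sec_smooth[OF _ tangent_bundle_simps(2)])

lemma chart_deriv_nth:
  assumes "(U, x) \<in> \<A>" "p \<in> U" "smooth_near \<A> p f"
  shows "chart_deriv U x p (\<lambda>q. f q $ i) w = chart_deriv U x p f w $ i"
  using frechet_derivative_at[OF bounded_linear.has_derivative[OF bounded_linear_vec_nth[of i]
      chart_deriv_works[OF assms]]]
  by (simp add: chart_deriv_def fun_eq_iff)

lemma vf_apply:
  fixes f :: "'m \<Rightarrow> real"
  assumes "X \<in> vector_fields \<A> S" "(U, x) \<in> \<A>" "p \<in> U" "smooth_near \<A> p f"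
  shows "X p f = chart_deriv U x p f (comps x (X p))"
  by (rule tangent_eq_chart_deriv[OF assms(2,3) vf_tangent[OF assms(1)] assms(4)])

lemma vf_apply_smooth:
  fixes f :: "'m \<Rightarrow> real"
  assumes X: "X \<in> vector_fields \<A> S" and N: "open N" "N \<subseteq> S" and f: "smooth_fun_on \<A> N f"
  shows "smooth_fun_on \<A> N (\<lambda>q. X q f)"
proof (rule smooth_fun_on_locallyI)
  fix p assume p: "p \<in> N"
  obtain U x where U: "(U, x) \<in> \<A>" "p \<in> U" by (rule chart_cover)
  have o: "open (U \<inter> N)" using chart_open[OF U(1)] N by blast
  have "smooth_fun_on \<A> (U \<inter> N) (\<lambda>q. \<Sum>b\<in>Basis. (comps x (X q) \<bullet> b) *\<^sub>R chart_deriv U x q f b)"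
  proof (intro smooth_fun_on_sum smooth_fun_on_scaleR o)
    show "smooth_fun_on \<A> (U \<inter> N) (\<lambda>q. comps x (X q) \<bullet> b)" for b
      by (rule smooth_fun_on_bounded_linear[where L="\<lambda>y. y \<bullet> b", OF o bounded_linear_inner_left
          vf_comps_smooth[OF X U(1)]]) (use N in blast)
    show "smooth_fun_on \<A> (U \<inter> N) (\<lambda>q. chart_deriv U x q f b)" for b
      by (rule smooth_chart_deriv[OF U(1) o _ smooth_fun_on_subset[OF f]]) auto
  qed simp
  then have "smooth_fun_on \<A> (U \<inter> N) (\<lambda>q. X q f)"
  proof (rule smooth_fun_on_cong[OF o, rotated])
    fix q assume q: "q \<in> U \<inter> N"
    then have sn: "smooth_near \<A> q f" using smooth_nearI[OF f N(1)] by blast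
    have "linear (chart_deriv U x q f)"
      by (rule has_derivative_linear[OF chart_deriv_works[OF U(1) _ sn]]) (use q in blast)
    from linear_sum_Basis[OF this, of "comps x (X q)"]
    show "(\<Sum>b\<in>Basis. (comps x (X q) \<bullet> b) *\<^sub>R chart_deriv U x q f b) = X q f"
      using vf_apply[OF X U(1) _ sn] q by simp
  qed
  then show "\<exists>M. open M \<and> p \<in> M \<and> smooth_fun_on \<A> M (\<lambda>q. X q f)" using o p U by blast
qed

lemma vf_apply_smooth_near:
  fixes f :: "'m \<Rightarrow> real"
  assumes "X \<in> vector_fields \<A> S" "open S" "p \<in> S" "smooth_near \<A> p f"
  shows "smooth_near \<A> p (\<lambda>q. X q f)"
proof -
  obtain W where W: "open W" "p \<in> W" "smooth_fun_on \<A> W f" using assms(4) unfolding smooth_near_def by blast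
  have o: "open (W \<inter> S)" using W assms by blast
  show ?thesis
    by (rule smooth_nearI[OF vf_apply_smooth[OF assms(1) o _ smooth_fun_on_subset[OF W(3)]] o]) (use W assms in auto)
qed

text \<open>In \<open>X(Y(fg)) - Y(X(fg))\<close> the mixed products of first derivatives cancel.  The derivation rules for the
  inner field hold in a neighbourhood of \<open>p\<close> only, so the locality of tangent vectors enters.\<close>

lemma lie_bracket_tangent:
  assumes X: "X \<in> vector_fields \<A> S" and Y: "Y \<in> vector_fields \<A> S" and S: "open S" "p \<in> S"
  shows "lie_bracket \<A> X Y p \<in> tangent_space \<A> p"
proof -
  have XT: "X q \<in> tangent_space \<A> q" and YT: "Y q \<in> tangent_space \<A> q" for q using vf_tangent X Y by auto
  have sX: "smooth_near \<A> p (\<lambda>q. X q f)" and sY: "smooth_near \<A> p (\<lambda>q. Y q f)"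
    if "smooth_near \<A> p f" for f using vf_apply_smooth_near S X Y that by auto
  have ev: "\<exists>N. open N \<and> p \<in> N \<and> (\<forall>q\<in>N. smooth_near \<A> q f)" if "smooth_near \<A> p f" for f :: "'m \<Rightarrow> real"
    using that unfolding smooth_near_def by blast
  have "v (\<lambda>q. w q (\<lambda>q. f q + g q)) = v (\<lambda>q. w q f) + v (\<lambda>q. w q g)"
    if f: "smooth_near \<A> p f" and g: "smooth_near \<A> p g" and v: "v \<in> tangent_space \<A> p"
      and w: "\<And>q. w q \<in> tangent_space \<A> q" and sw: "\<And>f. smooth_near \<A> p f \<Longrightarrow> smooth_near \<A> p (\<lambda>q. w q f)"
    for f g v w
  proof -
    obtain N M where N: "open N" "p \<in> N" "\<forall>q\<in>N. smooth_near \<A> q f" and M: "open M" "p \<in> M" "\<forall>q\<in>M. smooth_near \<A> q g"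
      using ev[OF f] ev[OF g] by blast
    have "v (\<lambda>q. w q (\<lambda>q. f q + g q)) = v (\<lambda>q. w q f + w q g)"
      by (rule tangent_local[OF v, of "N \<inter> M"]) (use N M tangent_add[OF w] in auto)
    also have "\<dots> = v (\<lambda>q. w q f) + v (\<lambda>q. w q g)" by (rule tangent_add[OF v sw[OF f] sw[OF g]])
    finally show ?thesis .
  qed
  note add = this
  have "v (\<lambda>q. w q (\<lambda>q. c * f q)) = c * v (\<lambda>q. w q f)"
    if f: "smooth_near \<A> p f" and v: "v \<in> tangent_space \<A> p"
      and w: "\<And>q. w q \<in> tangent_space \<A> q" and sw: "\<And>f. smooth_near \<A> p f \<Longrightarrow> smooth_near \<A> p (\<lambda>q. w q f)"
    for f v w c
  proof -
    obtain N where N: "open N" "p \<in> N" "\<forall>q\<in>N. smooth_near \<A> q f" using ev[OF f] by blast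
    have "v (\<lambda>q. w q (\<lambda>q. c * f q)) = v (\<lambda>q. c * w q f)"
      by (rule tangent_local[OF v, of N]) (use N tangent_cmul[OF w] in auto)
    also have "\<dots> = c * v (\<lambda>q. w q f)" by (rule tangent_cmul[OF v sw[OF f]])
    finally show ?thesis .
  qed
  note cmul = this
  have "v (\<lambda>q. w q (\<lambda>q. f q * g q)) = v (\<lambda>q. w q f) * g p + w p f * v g + v f * w p g + f p * v (\<lambda>q. w q g)"
    if f: "smooth_near \<A> p f" and g: "smooth_near \<A> p g" and v: "v \<in> tangent_space \<A> p"
      and w: "\<And>q. w q \<in> tangent_space \<A> q" and sw: "\<And>f. smooth_near \<A> p f \<Longrightarrow> smooth_near \<A> p (\<lambda>q. w q f)"
    for f g v w
  proof -
    obtain N M where N: "open N" "p \<in> N" "\<forall>q\<in>N. smooth_near \<A> q f" and M: "open M" "p \<in> M" "\<forall>q\<in>M. smooth_near \<A> q g"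
      using ev[OF f] ev[OF g] by blast
    have "v (\<lambda>q. w q (\<lambda>q. f q * g q)) = v (\<lambda>q. w q f * g q + f q * w q g)"
      by (rule tangent_local[OF v, of "N \<inter> M"]) (use N M tangent_mult[OF w] in auto)
    also have "\<dots> = v (\<lambda>q. w q f * g q) + v (\<lambda>q. f q * w q g)"
      by (intro tangent_add[OF v] smooth_near_binop f g sw)
    finally show ?thesis
      using tangent_mult[OF v sw[OF f] g] tangent_mult[OF v f sw[OF g]] by simp
  qed
  note mult = this
  show ?thesis
    unfolding tangent_space_def lie_bracket_def
    using smooth_near_binop smooth_near_binop(2)[OF smooth_near_const]
      add[OF _ _ XT YT sY] add[OF _ _ YT XT sX] cmul[OF _ XT YT sY] cmul[OF _ YT XT sX]
      mult[OF _ _ XT YT sY] mult[OF _ _ YT XT sX]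
    by (simp add: algebra_simps)
qed

text \<open>Applied to the coordinate functions, the definition of the bracket differentiates the components of one
  field along the other.\<close>

lemma comps_lie_bracket:
  assumes X: "X \<in> vector_fields \<A> S" and Y: "Y \<in> vector_fields \<A> S" and S: "open S" "p \<in> S"
    and U: "(U, x) \<in> \<A>" "p \<in> U"
  shows "comps x (lie_bracket \<A> X Y p) =
    chart_deriv U x p (\<lambda>q. comps x (Y q)) (comps x (X p)) - chart_deriv U x p (\<lambda>q. comps x (X q)) (comps x (Y p))"
proof -
  have *: "Z p (\<lambda>q. Z' q (\<lambda>q. x q $ i)) = chart_deriv U x p (\<lambda>q. comps x (Z' q)) (comps x (Z p)) $ i"
    if Z: "Z \<in> vector_fields \<A> S" and Z': "Z' \<in> vector_fields \<A> S" for Z Z' i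
  proof -
    have o: "open (U \<inter> S)" using chart_open[OF U(1)] S by blast
    have sn: "smooth_near \<A> p (\<lambda>q. comps x (Z' q))"
      by (rule smooth_nearI[OF vf_comps_smooth[OF Z' U(1)] o]) (use S U in auto)
    have "Z p (\<lambda>q. Z' q (\<lambda>q. x q $ i)) = chart_deriv U x p (\<lambda>q. Z' q (\<lambda>q. x q $ i)) (comps x (Z p))"
      by (rule vf_apply[OF Z U vf_apply_smooth_near[OF Z' S smooth_near_chart[OF U]]])
    also have "\<dots> = chart_deriv U x p (\<lambda>q. comps x (Z' q) $ i) (comps x (Z p))"
      by (simp add: comps_def)
    finally show ?thesis using chart_deriv_nth[OF U sn] by simp
  qed
  have "comps x (lie_bracket \<A> X Y p) $ i = X p (\<lambda>q. Y q (\<lambda>q. x q $ i)) - Y p (\<lambda>q. X q (\<lambda>q. x q $ i))" for i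
    using smooth_near_chart[OF U, of i] by (simp add: comps_def lie_bracket_def)
  then show ?thesis
    using *[OF X Y] *[OF Y X] by (simp add: vec_eq_iff)
qed

lemma smooth_chart_deriv_dir:
  assumes U: "(U, x) \<in> \<A>" and N: "open N" "N \<subseteq> U" and f: "smooth_fun_on \<A> N (f :: 'm \<Rightarrow> 'b::real_normed_vector)"
    and w: "smooth_fun_on \<A> N w"
  shows "smooth_fun_on \<A> N (\<lambda>q. chart_deriv U x q f (w q))"
proof -
  have "smooth_fun_on \<A> N (\<lambda>q. \<Sum>b\<in>Basis. (w q \<bullet> b) *\<^sub>R chart_deriv U x q f b)"
  proof (intro smooth_fun_on_sum smooth_fun_on_scaleR N)
    show "smooth_fun_on \<A> N (\<lambda>q. w q \<bullet> b)" for b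
      by (rule smooth_fun_on_bounded_linear[where L="\<lambda>y. y \<bullet> b", OF N(1) bounded_linear_inner_left w])
    show "smooth_fun_on \<A> N (\<lambda>q. chart_deriv U x q f b)" for b
      by (rule smooth_chart_deriv[OF U N f])
  qed simp
  then show ?thesis
  proof (rule smooth_fun_on_cong[OF N(1), rotated])
    fix q assume q: "q \<in> N"
    have "linear (chart_deriv U x q f)"
      by (rule has_derivative_linear[OF chart_deriv_works[OF U _ smooth_nearI[OF f N(1) q]]]) (use q N in blast)
    from linear_sum_Basis[OF this, of "w q"]
    show "(\<Sum>b\<in>Basis. (w q \<bullet> b) *\<^sub>R chart_deriv U x q f b) = chart_deriv U x q f (w q)" by simp
  qed
qed

lemma lie_bracket_vf:
  assumes X: "X \<in> vector_fields \<A> S" and Y: "Y \<in> vector_fields \<A> S" and S: "open S"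
  shows "lie_bracket \<A> X Y \<in> vector_fields \<A> S"
proof (rule TM.sectionsI)
  show "lie_bracket \<A> X Y p \<in> fibre (tangent_bundle \<A>) p" if "p \<in> S" for p
    using lie_bracket_tangent[OF X Y S that] by (simp add: tangent_bundle_simps)
  show "lie_bracket \<A> X Y p = 0" if "p \<notin> S" for p
    using TM.sec_off[OF X that] TM.sec_off[OF Y that] by (simp add: lie_bracket_def fun_eq_iff)
  fix p assume p: "p \<in> S"
  obtain U x where U: "(U, x) \<in> \<A>" "p \<in> U" by (rule chart_cover)
  have o: "open (U \<inter> S)" using chart_open[OF U(1)] S by blast
  have cX: "smooth_fun_on \<A> (U \<inter> S) (\<lambda>q. comps x (X q))" and cY: "smooth_fun_on \<A> (U \<inter> S) (\<lambda>q. comps x (Y q))"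
    using vf_comps_smooth X Y U by auto
  have "smooth_fun_on \<A> (U \<inter> S) (\<lambda>q. chart_deriv U x q (\<lambda>q. comps x (Y q)) (comps x (X q)) +
      (-1) *\<^sub>R chart_deriv U x q (\<lambda>q. comps x (X q)) (comps x (Y q)))"
    by (intro smooth_fun_on_add smooth_fun_on_scaleR smooth_fun_on_const smooth_chart_deriv_dir U cX cY o) auto
  then have "smooth_fun_on \<A> (U \<inter> S) (\<lambda>q. comps x (lie_bracket \<A> X Y q))"
    by (rule smooth_fun_on_cong[OF o, rotated]) (use comps_lie_bracket[OF X Y S _ U(1)] in auto)
  then show "\<exists>N V \<theta>. open N \<and> p \<in> N \<and> (V, \<theta>) \<in> trivs (tangent_bundle \<A>) \<and> N \<subseteq> V \<inter> S \<and>
      smooth_fun_on \<A> N (\<lambda>q. \<theta> q (lie_bracket \<A> X Y q))"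
    using o U p tangent_bundle_simps(2)[OF U(1)] by blast
qed

end

section \<open>Connections read in a chart and a trivialization\<close>

context smooth_bundle
begin

sublocale TM: smooth_bundle \<A> "tangent_bundle \<A>"
  by unfold_locales (rule vector_bundle_tangent)

text \<open>The function is multiplied by a cut-off that is \<open>1\<close> near \<open>p\<close>.\<close>

lemma function_extension:
  fixes f :: "'m \<Rightarrow> 'b::real_normed_vector"
  assumes f: "smooth_fun_on \<A> W f" and W: "open W" "p \<in> W"
  obtains g N where "smooth_fun_on \<A> UNIV g" "open N" "p \<in> N" "N \<subseteq> W" "\<forall>q\<in>N. g q = f q"
proof -
  obtain \<kappa> :: "'m \<Rightarrow> real" and N K where \<kappa>: "smooth_fun_on \<A> UNIV \<kappa>" "open N" "p \<in> N" "N \<subseteq> K" "closed K" "K \<subseteq> W"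
      "\<forall>q\<in>N. \<kappa> q = 1" "\<forall>q. q \<notin> K \<longrightarrow> \<kappa> q = 0"
    by (rule bump_manifold[OF W]) blast
  let ?g = "\<lambda>q. \<kappa> q *\<^sub>R f q"
  have "smooth_fun_on \<A> UNIV ?g"
  proof (rule smooth_fun_on_locallyI)
    fix q
    show "\<exists>N. open N \<and> q \<in> N \<and> smooth_fun_on \<A> N ?g"
    proof (cases "q \<in> W")
      case True
      have "smooth_fun_on \<A> W ?g"
        by (rule smooth_fun_on_scaleR[OF W(1) smooth_fun_on_subset[OF \<kappa>(1)] f]) simp
      then show ?thesis using True W by blast
    next
      case False
      have o: "open (- K)" using \<kappa>(5) by blast
      have "smooth_fun_on \<A> (- K) (\<lambda>q. 0 :: 'b)" by (rule smooth_fun_on_const[OF o])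
      then have "smooth_fun_on \<A> (- K) ?g"
        by (rule smooth_fun_on_cong[OF o, rotated]) (use \<kappa>(8) in simp)
      then show ?thesis using o False \<kappa>(6) by blast
    qed
  qed
  then show thesis using that[of ?g N] \<kappa> by auto
qed

lemma sections_sum:
  assumes "open W" "finite I" "\<And>i. i \<in> I \<Longrightarrow> s i \<in> sections \<A> F W"
  shows "(\<lambda>p. \<Sum>i\<in>I. s i p) \<in> sections \<A> F W"
  using assms(2,3)
  by (induction I rule: finite_induct) (simp_all add: sections_zero sections_add assms(1))

end

text \<open>A connection acts on sections over the whole of \<open>S\<close>; its locality is a consequence of the Leibniz rules.\<close>

locale connection_operator = smooth_bundle \<A> F
  for \<A> :: "('m::{t2_space, second_countable_topology}, 'n::finite) chart set"
    and F :: "('m, 'e::real_vector, 'n) vbundle" +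
  fixes S :: "'m set" and D :: "('m, 'e) connection"
  assumes S: "open S" and conn: "connection_on \<A> F S D"
begin

lemma D_section: "X \<in> vector_fields \<A> S \<Longrightarrow> \<eta> \<in> sections \<A> F S \<Longrightarrow> D X \<eta> \<in> sections \<A> F S"
  and D_add_left: "X \<in> vector_fields \<A> S \<Longrightarrow> Y \<in> vector_fields \<A> S \<Longrightarrow> \<eta> \<in> sections \<A> F S \<Longrightarrow>
    D (\<lambda>p. X p + Y p) \<eta> = (\<lambda>p. D X \<eta> p + D Y \<eta> p)"
  and D_scale_left: "X \<in> vector_fields \<A> S \<Longrightarrow> \<eta> \<in> sections \<A> F S \<Longrightarrow> smooth_fun_on \<A> S f \<Longrightarrow>
    D (\<lambda>p. f p *\<^sub>R X p) \<eta> = (\<lambda>p. f p *\<^sub>R D X \<eta> p)"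
  and D_add: "X \<in> vector_fields \<A> S \<Longrightarrow> \<eta> \<in> sections \<A> F S \<Longrightarrow> \<zeta> \<in> sections \<A> F S \<Longrightarrow>
    D X (\<lambda>p. \<eta> p + \<zeta> p) = (\<lambda>p. D X \<eta> p + D X \<zeta> p)"
  and D_scale: "X \<in> vector_fields \<A> S \<Longrightarrow> \<eta> \<in> sections \<A> F S \<Longrightarrow> smooth_fun_on \<A> S f \<Longrightarrow>
    D X (\<lambda>p. f p *\<^sub>R \<eta> p) = (\<lambda>p. X p f *\<^sub>R \<eta> p + f p *\<^sub>R D X \<eta> p)"
  using conn unfolding connection_on_def by blast+

lemma smooth_const: "smooth_fun_on \<A> S (\<lambda>p. c)" by (rule smooth_fun_on_const[OF S])

lemma D_zero_left: "\<eta> \<in> sections \<A> F S \<Longrightarrow> D (\<lambda>p. 0) \<eta> = (\<lambda>p. 0)"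
  using D_scale_left[OF TM.sections_zero[OF S], of \<eta> "\<lambda>p. 0"] smooth_const[of "0 :: real"] by simp

lemma D_zero: "X \<in> vector_fields \<A> S \<Longrightarrow> D X (\<lambda>p. 0) = (\<lambda>p. 0)"
  using D_scale[OF _ sections_zero[OF S], of X "\<lambda>p. 0"] smooth_const[of "0 :: real"]
    tangent_const[OF vf_tangent, of X] by simp

lemma D_sum:
  assumes X: "X \<in> vector_fields \<A> S" and "finite I" "\<And>i. i \<in> I \<Longrightarrow> s i \<in> sections \<A> F S"
  shows "D X (\<lambda>p. \<Sum>i\<in>I. s i p) = (\<lambda>p. \<Sum>i\<in>I. D X (s i) p)"
  using assms(2,3)
proof (induction I rule: finite_induct)
  case empty
  show ?case unfolding sum.empty by (rule D_zero[OF X])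
next
  case (insert i I)
  have "D X (\<lambda>p. s i p + (\<Sum>i\<in>I. s i p)) = (\<lambda>p. D X (s i) p + D X (\<lambda>p. \<Sum>i\<in>I. s i p) p)"
  proof (rule D_add[OF X])
    show "(\<lambda>p. \<Sum>i\<in>I. s i p) \<in> sections \<A> F S" by (rule sections_sum[OF S insert.hyps(1) insert.prems]) simp
  qed (rule insert.prems, simp)
  then show ?case using insert by simp
qed

lemma D_sum_left:
  assumes \<eta>: "\<eta> \<in> sections \<A> F S" and "finite I" "\<And>i. i \<in> I \<Longrightarrow> X i \<in> vector_fields \<A> S"
  shows "D (\<lambda>p. \<Sum>i\<in>I. X i p) \<eta> = (\<lambda>p. \<Sum>i\<in>I. D (X i) \<eta> p)"
  using assms(2,3)
proof (induction I rule: finite_induct)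
  case empty
  show ?case unfolding sum.empty by (rule D_zero_left[OF \<eta>])
next
  case (insert i I)
  have IH: "D (\<lambda>p. \<Sum>i\<in>I. X i p) \<eta> = (\<lambda>p. \<Sum>i\<in>I. D (X i) \<eta> p)"
    by (rule insert.IH) (rule insert.prems, simp)
  have "D (\<lambda>p. X i p + (\<Sum>i\<in>I. X i p)) \<eta> = (\<lambda>p. D (X i) \<eta> p + D (\<lambda>p. \<Sum>i\<in>I. X i p) \<eta> p)"
  proof (rule D_add_left[OF _ _ \<eta>])
    show "(\<lambda>p. \<Sum>i\<in>I. X i p) \<in> vector_fields \<A> S" by (rule TM.sections_sum[OF S insert.hyps(1) insert.prems]) simp
  qed (rule insert.prems, simp)
  then show ?case by (simp only: sum.insert[OF insert.hyps] IH)
qed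

text \<open>If two sections agree near \<open>p\<close>, a cut-off with value \<open>1\<close> at \<open>p\<close> annihilates their difference.\<close>

lemma D_local:
  assumes X: "X \<in> vector_fields \<A> S" and \<eta>: "\<eta> \<in> sections \<A> F S" and \<zeta>: "\<zeta> \<in> sections \<A> F S"
    and N: "open N" "p \<in> N" "\<forall>q\<in>N. \<eta> q = \<zeta> q"
  shows "D X \<eta> p = D X \<zeta> p"
proof -
  obtain \<kappa> :: "'m \<Rightarrow> real" and M K where \<kappa>: "smooth_fun_on \<A> UNIV \<kappa>" "open M" "p \<in> M" "M \<subseteq> K" "closed K" "K \<subseteq> N"
      "\<forall>q\<in>M. \<kappa> q = 1" "\<forall>q. q \<notin> K \<longrightarrow> \<kappa> q = 0"
    by (rule bump_manifold[OF N(1,2)]) blast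
  have \<kappa>S: "smooth_fun_on \<A> S \<kappa>" by (rule smooth_fun_on_subset[OF \<kappa>(1)]) simp
  have "(\<lambda>q. \<kappa> q *\<^sub>R \<eta> q) = (\<lambda>q. \<kappa> q *\<^sub>R \<zeta> q)"
  proof
    fix q show "\<kappa> q *\<^sub>R \<eta> q = \<kappa> q *\<^sub>R \<zeta> q" using N(3) \<kappa>(6,8) by (cases "q \<in> K") auto
  qed
  then have "(\<lambda>q. X q \<kappa> *\<^sub>R \<eta> q + \<kappa> q *\<^sub>R D X \<eta> q) = (\<lambda>q. X q \<kappa> *\<^sub>R \<zeta> q + \<kappa> q *\<^sub>R D X \<zeta> q)"
    using D_scale[OF X \<eta> \<kappa>S] D_scale[OF X \<zeta> \<kappa>S] by simp
  from fun_cong[OF this, of p] show ?thesis using N \<kappa>(3,7) by simp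
qed

lemma D_local_left:
  assumes X: "X \<in> vector_fields \<A> S" and Y: "Y \<in> vector_fields \<A> S" and \<eta>: "\<eta> \<in> sections \<A> F S"
    and N: "open N" "p \<in> N" "\<forall>q\<in>N. X q = Y q"
  shows "D X \<eta> p = D Y \<eta> p"
proof -
  obtain \<kappa> :: "'m \<Rightarrow> real" and M K where \<kappa>: "smooth_fun_on \<A> UNIV \<kappa>" "open M" "p \<in> M" "M \<subseteq> K" "closed K" "K \<subseteq> N"
      "\<forall>q\<in>M. \<kappa> q = 1" "\<forall>q. q \<notin> K \<longrightarrow> \<kappa> q = 0"
    by (rule bump_manifold[OF N(1,2)]) blast
  have \<kappa>S: "smooth_fun_on \<A> S \<kappa>" by (rule smooth_fun_on_subset[OF \<kappa>(1)]) simp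
  have "(\<lambda>q. \<kappa> q *\<^sub>R X q) = (\<lambda>q. \<kappa> q *\<^sub>R Y q)"
  proof
    fix q show "\<kappa> q *\<^sub>R X q = \<kappa> q *\<^sub>R Y q" using N(3) \<kappa>(6,8) by (cases "q \<in> K") auto
  qed
  then have "(\<lambda>q. \<kappa> q *\<^sub>R D X \<eta> q) = (\<lambda>q. \<kappa> q *\<^sub>R D Y \<eta> q)"
    using D_scale_left[OF X \<eta> \<kappa>S] D_scale_left[OF Y \<eta> \<kappa>S] by simp
  from fun_cong[OF this, of p] show ?thesis using \<kappa>(3,7) by simp
qed

end

locale coord_nbhd = smooth_bundle \<A> F
  for \<A> :: "('m::{t2_space, second_countable_topology}, 'n::finite) chart set"
    and F :: "('m, 'e::real_vector, 'n) vbundle" +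
  fixes U :: "'m set" and x :: "'m \<Rightarrow> real ^ 'n" and V :: "'m set" and \<theta> :: "'m \<Rightarrow> 'e \<Rightarrow> real ^ 'n"
    and W :: "'m set"
  assumes U: "(U, x) \<in> \<A>" and V: "(V, \<theta>) \<in> trivs F" and W: "open W" "W \<subseteq> U" "W \<subseteq> V"
begin

abbreviation pt :: "real ^ 'n \<Rightarrow> 'm" where "pt \<equiv> inv_into U x"

abbreviation \<Omega> :: "(real ^ 'n) set" where "\<Omega> \<equiv> x ` W"

definition scoord :: "('m \<Rightarrow> 'e) \<Rightarrow> real ^ 'n \<Rightarrow> real ^ 'n" where "scoord s z = \<theta> (pt z) (s (pt z))"

definition vcoord :: "('m \<Rightarrow> 'm tangent) \<Rightarrow> real ^ 'n \<Rightarrow> real ^ 'n" where "vcoord X z = comps x (X (pt z))"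

lemma \<Omega>_open: "open \<Omega>" by (rule chart_open_image[OF U W(1,2)])

lemma pt_x: "p \<in> W \<Longrightarrow> pt (x p) = p" using chart_inv[OF U] W by blast

lemma pt_W: "z \<in> \<Omega> \<Longrightarrow> pt z \<in> W" "z \<in> \<Omega> \<Longrightarrow> x (pt z) = z"
  using pt_x by auto

lemma pt_U: "z \<in> \<Omega> \<Longrightarrow> pt z \<in> U" "z \<in> \<Omega> \<Longrightarrow> pt z \<in> V"
  using pt_W W by auto

lemma smooth_fun_onW: "smooth_fun_on \<A> N f \<Longrightarrow> W \<subseteq> N \<Longrightarrow> smooth_on \<Omega> (\<lambda>z. f (pt z))"
  by (rule smooth_fun_onD[OF _ U]) (use W in auto)

lemma smooth_fun_onW_I:
  assumes "smooth_on \<Omega> g" shows "smooth_fun_on \<A> W (\<lambda>p. g (x p))"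
proof (rule smooth_fun_on_chartI[OF U W(1,2)])
  show "smooth_on \<Omega> (\<lambda>z. g (x (pt z)))"
    by (rule smooth_on_cong[OF \<Omega>_open, THEN iffD1, OF _ assms]) (simp add: pt_W)
qed

context
  fixes S assumes WS: "W \<subseteq> S"
begin

lemma scoord_smooth: "s \<in> sections \<A> F S \<Longrightarrow> smooth_on \<Omega> (scoord s)"
  unfolding scoord_def[abs_def] by (rule smooth_fun_onW[OF sec_smooth[OF _ V, of s S W]]) (use W WS in auto)

lemma vcoord_smooth: "X \<in> vector_fields \<A> S \<Longrightarrow> smooth_on \<Omega> (vcoord X)"
  unfolding vcoord_def[abs_def] by (rule smooth_fun_onW[OF vf_comps_smooth[OF _ U, of X S W]]) (use W WS in auto)

lemma vcoord_lie_bracket: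
  assumes "open S" "X \<in> vector_fields \<A> S" "Y \<in> vector_fields \<A> S" "z \<in> \<Omega>"
  shows "vcoord (lie_bracket \<A> X Y) z = dd (vcoord Y) z (vcoord X z) - dd (vcoord X) z (vcoord Y z)"
  using comps_lie_bracket[OF assms(2,3,1) _ U, of "pt z"] assms(4) WS pt_W[OF assms(4)] pt_U[OF assms(4)]
  by (auto simp: vcoord_def[abs_def] chart_deriv_def)

lemma vf_apply_coords:
  fixes f :: "'m \<Rightarrow> real"
  assumes "X \<in> vector_fields \<A> S" "z \<in> \<Omega>" "smooth_near \<A> (pt z) f"
  shows "X (pt z) f = dd (\<lambda>z. f (pt z)) z (vcoord X z)"
  using vf_apply[OF assms(1) U pt_U(1)[OF assms(2)] assms(3)] pt_W(2)[OF assms(2)]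
  by (simp add: vcoord_def chart_deriv_def)

lemma vf_with_comps:
  assumes "open S" "z \<in> \<Omega>"
  obtains X N where "X \<in> vector_fields \<A> S" "open N" "z \<in> N" "N \<subseteq> \<Omega>" "\<forall>y\<in>N. vcoord X y = u"
proof -
  have p: "pt z \<in> S" "pt z \<in> U" using pt_W(1)[OF assms(2)] pt_U(1)[OF assms(2)] WS by auto
  obtain X M where X: "X \<in> vector_fields \<A> S" "open M" "pt z \<in> M" "M \<subseteq> S \<inter> U" "\<forall>q\<in>M. comps x (X q) = u"
    by (rule TM.section_through[OF tangent_bundle_simps(2)[OF U] assms(1) p, of u])
  show thesis
  proof (rule that[OF X(1), of "x ` (M \<inter> W)"])
    show "open (x ` (M \<inter> W))" using X(2) W by (intro chart_open_image[OF U]) auto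
    show "z \<in> x ` (M \<inter> W)" using X(3) pt_W[OF assms(2)] by (intro image_eqI[of _ _ "pt z"]) auto
    show "\<forall>y\<in>x ` (M \<inter> W). vcoord X y = u" using X(5) pt_x by (auto simp: vcoord_def)
  qed auto
qed

lemma section_with_comps:
  assumes "open S" "z \<in> \<Omega>"
  obtains s N where "s \<in> sections \<A> F S" "open N" "z \<in> N" "N \<subseteq> \<Omega>" "\<forall>y\<in>N. scoord s y = e"
proof -
  have p: "pt z \<in> S" "pt z \<in> V" using pt_W(1)[OF assms(2)] pt_U(2)[OF assms(2)] WS by auto
  obtain s M where s: "s \<in> sections \<A> F S" "open M" "pt z \<in> M" "M \<subseteq> S \<inter> V" "\<forall>q\<in>M. \<theta> q (s q) = e"
    by (rule section_through[OF V assms(1) p, of e])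
  show thesis
  proof (rule that[OF s(1), of "x ` (M \<inter> W)"])
    show "open (x ` (M \<inter> W))" using s(2) W by (intro chart_open_image[OF U]) auto
    show "z \<in> x ` (M \<inter> W)" using s(3) pt_W[OF assms(2)] by (intro image_eqI[of _ _ "pt z"]) auto
    show "\<forall>y\<in>x ` (M \<inter> W). scoord s y = e" using s(5) pt_x by (auto simp: scoord_def)
  qed auto
qed

end

lemma scoord_eqI:
  assumes "s \<in> sections \<A> F S" "t \<in> sections \<A> F S'" "p \<in> W" "scoord s (x p) = scoord t (x p)"
  shows "s p = t p"
  using triv_inject[OF V _ sec_fibre'[OF assms(1)] sec_fibre'[OF assms(2)]] assms(3,4) W pt_x[OF assms(3)]
  by (auto simp: scoord_def)

lemma scoord_diff:
  assumes "s \<in> sections \<A> F S" "t \<in> sections \<A> F S'" "z \<in> \<Omega>"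
  shows "scoord (\<lambda>p. s p - t p) z = scoord s z - scoord t z"
  using triv_diff[OF V pt_U(2)[OF assms(3)] sec_fibre'[OF assms(1)] sec_fibre'[OF assms(2)]] by (simp add: scoord_def)

lemma scoord_add:
  assumes "s \<in> sections \<A> F S" "t \<in> sections \<A> F S'" "z \<in> \<Omega>"
  shows "scoord (\<lambda>p. s p + t p) z = scoord s z + scoord t z"
  using triv_add[OF V pt_U(2)[OF assms(3)] sec_fibre'[OF assms(1)] sec_fibre'[OF assms(2)]] by (simp add: scoord_def)

lemma scoord_scale:
  assumes "s \<in> sections \<A> F S" "z \<in> \<Omega>"
  shows "scoord (\<lambda>p. f p *\<^sub>R s p) z = f (pt z) *\<^sub>R scoord s z"
  using triv_scaleR[OF V pt_U(2)[OF assms(2)] sec_fibre'[OF assms(1)]] by (simp add: scoord_def)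

lemma scoord_sum:
  assumes "finite I" "\<And>i. i \<in> I \<Longrightarrow> s i \<in> sections \<A> F S" "z \<in> \<Omega>" "open S"
  shows "scoord (\<lambda>p. \<Sum>i\<in>I. s i p) z = (\<Sum>i\<in>I. scoord (s i) z)"
  using assms(1,2)
proof (induction I rule: finite_induct)
  case empty
  show ?case using triv_zero[OF V pt_U(2)[OF assms(3)]] by (simp add: scoord_def)
next
  case (insert i I)
  then show ?case using scoord_add[OF _ sections_sum[OF assms(4), of I s] assms(3), of "s i" S] by simp
qed

lemma vcoord_add: "X \<in> vector_fields \<A> S \<Longrightarrow> Y \<in> vector_fields \<A> S' \<Longrightarrow> vcoord (\<lambda>p. X p + Y p) z = vcoord X z + vcoord Y z"
  by (simp add: vcoord_def comps_def plus_fun_def vec_eq_iff)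

lemma vcoord_scale: "vcoord (\<lambda>p. f p *\<^sub>R X p) z = f (pt z) *\<^sub>R vcoord X z"
  by (simp add: vcoord_def comps_def scaleR_fun_def vec_eq_iff)

lemma comps_sum: "comps x (\<Sum>i\<in>I. X i) = (\<Sum>i\<in>I. comps x (X i))"
  by (induction I rule: infinite_finite_induct)
    (simp_all add: comps_def plus_fun_def zero_fun_def vec_eq_iff)

definition represents :: "'m set \<Rightarrow> ('m, 'e) connection \<Rightarrow> (real ^ 'n \<Rightarrow> real ^ 'n \<Rightarrow> real ^ 'n \<Rightarrow> real ^ 'n) \<Rightarrow> bool"
  where "represents S D \<Gamma> \<longleftrightarrow> smooth_bilinear \<Omega> \<Gamma> \<and>
    (\<forall>X\<in>vector_fields \<A> S. \<forall>\<eta>\<in>sections \<A> F S. \<forall>z\<in>\<Omega>. scoord (D X \<eta>) z = cov \<Gamma> (vcoord X) (scoord \<eta>) z)"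

lemma representsD:
  assumes "represents S D \<Gamma>"
  shows "smooth_bilinear \<Omega> \<Gamma>"
    and "X \<in> vector_fields \<A> S \<Longrightarrow> \<eta> \<in> sections \<A> F S \<Longrightarrow> z \<in> \<Omega> \<Longrightarrow> scoord (D X \<eta>) z = cov \<Gamma> (vcoord X) (scoord \<eta>) z"
  using assms unfolding represents_def by blast+

text \<open>The connection form collects the components of \<open>D\<close> applied to frames that are constant in
  coordinates near the point; the frames are cut off, so they have to be chosen anew for each point.\<close>

theorem exists_representation:
  assumes SW: "open S" "W \<subseteq> S" and conn: "connection_on \<A> F S D"
  obtains \<Gamma> where "represents S D \<Gamma>"
proof -
  interpret connection_operator \<A> F S D by unfold_locales (use SW conn in auto)
  define XX where "XX = (\<lambda>z u. SOME s. s \<in> vector_fields \<A> S \<and> (\<exists>N. open N \<and> z \<in> N \<and> N \<subseteq> \<Omega> \<and> (\<forall>y\<in>N. vcoord s y = u)))"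
  define MM where "MM = (\<lambda>z u. SOME N. open N \<and> z \<in> N \<and> N \<subseteq> \<Omega> \<and> (\<forall>y\<in>N. vcoord (XX z u) y = u))"
  have XX: "XX z u \<in> vector_fields \<A> S \<and> open (MM z u) \<and> z \<in> MM z u \<and>
      MM z u \<subseteq> \<Omega> \<and> (\<forall>y\<in>MM z u. vcoord (XX z u) y = u)" if z: "z \<in> \<Omega>" for z u
  proof -
    obtain s N where "s \<in> vector_fields \<A> S" "open N" "z \<in> N" "N \<subseteq> \<Omega>" "\<forall>y\<in>N. vcoord s y = u"
      by (rule vf_with_comps[OF SW(2,1) z, of u])
    then have "\<exists>s. s \<in> vector_fields \<A> S \<and> (\<exists>N. open N \<and> z \<in> N \<and> N \<subseteq> \<Omega> \<and> (\<forall>y\<in>N. vcoord s y = u))" by blast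
    then have *: "XX z u \<in> vector_fields \<A> S \<and> (\<exists>N. open N \<and> z \<in> N \<and> N \<subseteq> \<Omega> \<and> (\<forall>y\<in>N. vcoord (XX z u) y = u))"
      unfolding XX_def by (rule someI_ex)
    then have "\<exists>N. open N \<and> z \<in> N \<and> N \<subseteq> \<Omega> \<and> (\<forall>y\<in>N. vcoord (XX z u) y = u)" by blast
    then have "open (MM z u) \<and> z \<in> MM z u \<and> MM z u \<subseteq> \<Omega> \<and> (\<forall>y\<in>MM z u. vcoord (XX z u) y = u)"
      unfolding MM_def by (rule someI_ex)
    then show ?thesis using * by simp
  qed
  define EE where "EE = (\<lambda>z e. SOME s. s \<in> sections \<A> F S \<and> (\<exists>N. open N \<and> z \<in> N \<and> N \<subseteq> \<Omega> \<and> (\<forall>y\<in>N. scoord s y = e)))"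
  define NN where "NN = (\<lambda>z e. SOME N. open N \<and> z \<in> N \<and> N \<subseteq> \<Omega> \<and> (\<forall>y\<in>N. scoord (EE z e) y = e))"
  have EE: "EE z e \<in> sections \<A> F S \<and> open (NN z e) \<and> z \<in> NN z e \<and>
      NN z e \<subseteq> \<Omega> \<and> (\<forall>y\<in>NN z e. scoord (EE z e) y = e)" if z: "z \<in> \<Omega>" for z e
  proof -
    obtain s N where "s \<in> sections \<A> F S" "open N" "z \<in> N" "N \<subseteq> \<Omega>" "\<forall>y\<in>N. scoord s y = e"
      by (rule section_with_comps[OF SW(2,1) z, of e])
    then have "\<exists>s. s \<in> sections \<A> F S \<and> (\<exists>N. open N \<and> z \<in> N \<and> N \<subseteq> \<Omega> \<and> (\<forall>y\<in>N. scoord s y = e))" by blast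
    then have *: "EE z e \<in> sections \<A> F S \<and> (\<exists>N. open N \<and> z \<in> N \<and> N \<subseteq> \<Omega> \<and> (\<forall>y\<in>N. scoord (EE z e) y = e))"
      unfolding EE_def by (rule someI_ex)
    then have "\<exists>N. open N \<and> z \<in> N \<and> N \<subseteq> \<Omega> \<and> (\<forall>y\<in>N. scoord (EE z e) y = e)" by blast
    then have "open (NN z e) \<and> z \<in> NN z e \<and> NN z e \<subseteq> \<Omega> \<and> (\<forall>y\<in>NN z e. scoord (EE z e) y = e)"
      unfolding NN_def by (rule someI_ex)
    then show ?thesis using * by simp
  qed
  define \<Gamma> where "\<Gamma> = (\<lambda>z u e. \<Sum>c\<in>Basis. \<Sum>b\<in>Basis. ((u \<bullet> c) * (e \<bullet> b)) *\<^sub>R scoord (D (XX z c) (EE z b)) z)"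
  have pull: "open (W \<inter> x -` N)" if "open N" for N
  proof -
    have "continuous_on W x"
      by (rule continuous_on_subset[OF homeomorphism_cont1[OF chart_homeomorphism[OF U]] W(2)])
    then show ?thesis by (rule continuous_open_preimage[OF _ W(1) that])
  qed
  have frame: "scoord (D X \<eta>) z = dd (scoord \<eta>) z (vcoord X z) + (\<Sum>b\<in>Basis. (scoord \<eta> z \<bullet> b) *\<^sub>R scoord (D X (EE z b)) z)"
    if X: "X \<in> vector_fields \<A> S" and \<eta>: "\<eta> \<in> sections \<A> F S" and z: "z \<in> \<Omega>" for X \<eta> z
  proof -
    let ?p = "pt z"
    have p: "?p \<in> W" "x ?p = z" using pt_W[OF z] by auto
    have sm: "smooth_fun_on \<A> W (\<lambda>q. \<theta> q (\<eta> q) \<bullet> b)" for b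
      by (rule smooth_fun_on_bounded_linear[where L="\<lambda>y. y \<bullet> b", OF W(1) bounded_linear_inner_left
          sec_smooth[OF \<eta> V]]) (use W SW in auto)
    have "\<forall>b. \<exists>r. smooth_fun_on \<A> UNIV (fst r) \<and> open (snd r) \<and> ?p \<in> snd r \<and> snd r \<subseteq> W \<and>
      (\<forall>q\<in>snd r. fst r q = \<theta> q (\<eta> q) \<bullet> b)"
    proof
      fix b
      obtain g N where "smooth_fun_on \<A> UNIV g" "open N" "?p \<in> N" "N \<subseteq> W" "\<forall>q\<in>N. g q = \<theta> q (\<eta> q) \<bullet> b"
        by (rule function_extension[OF sm[of b] W(1) p(1)])
      then show "\<exists>r. smooth_fun_on \<A> UNIV (fst r) \<and> open (snd r) \<and> ?p \<in> snd r \<and> snd r \<subseteq> W \<and>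
        (\<forall>q\<in>snd r. fst r q = \<theta> q (\<eta> q) \<bullet> b)" by (intro exI[of _ "(g, N)"]) simp
    qed
    from choice[OF this] obtain r where r: "\<forall>b. smooth_fun_on \<A> UNIV (fst (r b)) \<and> open (snd (r b)) \<and> ?p \<in> snd (r b) \<and>
      snd (r b) \<subseteq> W \<and> (\<forall>q\<in>snd (r b). fst (r b) q = \<theta> q (\<eta> q) \<bullet> b)" ..
    define g where "g = (\<lambda>b. fst (r b))"
    define N where "N = (\<lambda>b. snd (r b))"
    have g: "smooth_fun_on \<A> UNIV (g b) \<and> open (N b) \<and> ?p \<in> N b \<and> N b \<subseteq> W \<and>
      (\<forall>q\<in>N b. g b q = \<theta> q (\<eta> q) \<bullet> b)" for b
      using r unfolding g_def N_def by blast
    have gS: "smooth_fun_on \<A> S (g b)" for b using smooth_fun_on_subset[of UNIV "g b" S] g[of b] by simp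
    have E: "EE z b \<in> sections \<A> F S" for b using EE[OF z] by blast
    have gE: "(\<lambda>q. g b q *\<^sub>R EE z b q) \<in> sections \<A> F S" for b by (rule sections_scaleR[OF SW(1) E gS])
    define \<eta>' where "\<eta>' = (\<lambda>q. \<Sum>b\<in>Basis. g b q *\<^sub>R EE z b q)"
    have \<eta>': "\<eta>' \<in> sections \<A> F S" unfolding \<eta>'_def by (rule sections_sum[OF SW(1) finite_Basis gE])
    let ?N = "\<Inter>b\<in>Basis. N b \<inter> (W \<inter> x -` NN z b)"
    have N: "open ?N" "?p \<in> ?N"
      using g EE[OF z] pull p by (auto intro!: open_INT)
    have eq: "\<eta>' q = \<eta> q" if q: "q \<in> ?N" for q
    proof (rule scoord_eqI[OF \<eta>' \<eta>])
      show qW: "q \<in> W" using q nonempty_Basis by blast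
      then have xq: "x q \<in> \<Omega>" by blast
      have "scoord \<eta>' (x q) = (\<Sum>b\<in>Basis. g b q *\<^sub>R scoord (EE z b) (x q))"
        unfolding \<eta>'_def scoord_sum[OF finite_Basis gE xq SW(1)] by (simp add: scoord_scale[OF E xq] pt_x[OF qW])
      also have "\<dots> = (\<Sum>b\<in>Basis. (scoord \<eta> (x q) \<bullet> b) *\<^sub>R b)"
      proof (rule sum.cong[OF refl])
        fix b :: "real ^ 'n" assume "b \<in> Basis"
        then have "q \<in> N b" "x q \<in> NN z b" using q by auto
        then show "g b q *\<^sub>R scoord (EE z b) (x q) = (scoord \<eta> (x q) \<bullet> b) *\<^sub>R b"
          using g[of b] bspec[of "NN z b" "\<lambda>y. scoord (EE z b) y = b" "x q"] EE[OF z, of b] by (simp add: scoord_def pt_x[OF qW])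
      qed
      finally show "scoord \<eta>' (x q) = scoord \<eta> (x q)" by (simp add: euclidean_representation)
    qed
    have "D X \<eta> ?p = D X \<eta>' ?p" by (rule D_local[OF X \<eta> \<eta>' N]) (simp add: eq)
    then have "scoord (D X \<eta>) z = scoord (D X \<eta>') z" by (simp add: scoord_def)
    also have "D X \<eta>' = (\<lambda>q. \<Sum>b\<in>Basis. X q (g b) *\<^sub>R EE z b q + g b q *\<^sub>R D X (EE z b) q)"
      unfolding \<eta>'_def D_sum[OF X finite_Basis gE] D_scale[OF X E gS] ..
    also have "scoord \<dots> z = (\<Sum>b\<in>Basis. dd (\<lambda>y. scoord \<eta> y \<bullet> b) z (vcoord X z) *\<^sub>R b + (scoord \<eta> z \<bullet> b) *\<^sub>R scoord (D X (EE z b)) z)"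
    proof -
      have Xg: "X ?p (g b) = dd (\<lambda>y. scoord \<eta> y \<bullet> b) z (vcoord X z)" for b
      proof -
        have sn: "smooth_near \<A> ?p (g b)" by (rule smooth_nearI[of UNIV]) (use g in auto)
        have o: "open (x ` N b)" using g[of b] W by (intro chart_open_image[OF U]) auto
        have zN: "z \<in> x ` N b" using g[of b] p by (intro image_eqI[of _ _ ?p]) auto
        have "X ?p (g b) = dd (\<lambda>z. g b (pt z)) z (vcoord X z)" by (rule vf_apply_coords[OF SW(2) X z sn])
        also have "\<dots> = dd (\<lambda>y. scoord \<eta> y \<bullet> b) z (vcoord X z)"
        proof (rule dd_cong[OF o zN])
          fix y assume "y \<in> x ` N b"
          then obtain q where "q \<in> N b" "y = x q" by blast
          then show "g b (pt y) = scoord \<eta> y \<bullet> b" using g[of b] pt_x by (auto simp: scoord_def)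
        qed
        finally show ?thesis .
      qed
      have t: "scoord (\<lambda>q. \<Sum>b\<in>Basis. X q (g b) *\<^sub>R EE z b q + g b q *\<^sub>R D X (EE z b) q) z =
         (\<Sum>b\<in>Basis. X ?p (g b) *\<^sub>R scoord (EE z b) z + g b ?p *\<^sub>R scoord (D X (EE z b)) z)"
      proof -
        have l: "linear_on_space (fibre F ?p) (\<theta> ?p)" by (rule triv_props(2)[OF V pt_U(2)[OF z]])
        have f1: "EE z b ?p \<in> fibre F ?p" for b by (rule sec_fibre'[OF E])
        have f2: "D X (EE z b) ?p \<in> fibre F ?p" for b by (rule sec_fibre'[OF D_section[OF X E]])
        have "\<theta> ?p (\<Sum>b\<in>B. X ?p (g b) *\<^sub>R EE z b ?p + g b ?p *\<^sub>R D X (EE z b) ?p) =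
          (\<Sum>b\<in>B. X ?p (g b) *\<^sub>R \<theta> ?p (EE z b ?p) + g b ?p *\<^sub>R \<theta> ?p (D X (EE z b) ?p))" if "finite B" for B
          using that
        proof (induction B rule: finite_induct)
          case empty
          show ?case by (simp add: triv_zero[OF V pt_U(2)[OF z]])
        next
          case (insert b B)
          have "(\<Sum>b\<in>B. X ?p (g b) *\<^sub>R EE z b ?p + g b ?p *\<^sub>R D X (EE z b) ?p) \<in> fibre F ?p"
            by (intro subspace_sum subspace_add subspace_scale fibre_subspace f1 f2)
          then show ?case
            by (simp add: insert triv_add[OF V pt_U(2)[OF z]] triv_scaleR[OF V pt_U(2)[OF z]] f1 f2
                subspace_add[OF fibre_subspace] subspace_scale[OF fibre_subspace])
        qed
        then show ?thesis by (simp add: scoord_def)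
      qed
      show ?thesis unfolding t
      proof (rule sum.cong[OF refl])
        fix b :: "real ^ 'n" assume "b \<in> Basis"
        have "scoord (EE z b) z = b" using EE[OF z, of b] by blast
        moreover have "g b ?p = scoord \<eta> z \<bullet> b" using g[of b] by (simp add: scoord_def)
        ultimately show "X ?p (g b) *\<^sub>R scoord (EE z b) z + g b ?p *\<^sub>R scoord (D X (EE z b)) z =
           dd (\<lambda>y. scoord \<eta> y \<bullet> b) z (vcoord X z) *\<^sub>R b + (scoord \<eta> z \<bullet> b) *\<^sub>R scoord (D X (EE z b)) z"
          by (simp add: Xg)
      qed
    qed
    also have "\<dots> = (\<Sum>b\<in>Basis. (dd (scoord \<eta>) z (vcoord X z) \<bullet> b) *\<^sub>R b) + (\<Sum>b\<in>Basis. (scoord \<eta> z \<bullet> b) *\<^sub>R scoord (D X (EE z b)) z)"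
    proof -
      have "dd (\<lambda>y. scoord \<eta> y \<bullet> b) z (vcoord X z) = dd (scoord \<eta>) z (vcoord X z) \<bullet> b" for b
        by (rule dd_eqI[OF has_derivative_inner_left[OF smooth_on_has_derivative[OF scoord_smooth[OF SW(2) \<eta>] z]]])
      then show ?thesis by (simp add: sum.distrib)
    qed
    finally show ?thesis by (simp add: euclidean_representation)
  qed
  have tens: "scoord (D X \<eta>) z = (\<Sum>c\<in>Basis. (vcoord X z \<bullet> c) *\<^sub>R scoord (D (XX z c) \<eta>) z)"
    if X: "X \<in> vector_fields \<A> S" and \<eta>: "\<eta> \<in> sections \<A> F S" and z: "z \<in> \<Omega>" for X \<eta> z
  proof -
    let ?p = "pt z"
    have p: "?p \<in> W" "x ?p = z" using pt_W[OF z] by auto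
    have sm: "smooth_fun_on \<A> W (\<lambda>q. comps x (X q) \<bullet> c)" for c
      by (rule smooth_fun_on_bounded_linear[where L="\<lambda>y. y \<bullet> c", OF W(1) bounded_linear_inner_left
          vf_comps_smooth[OF X U]]) (use W SW in auto)
    have "\<forall>c. \<exists>r. smooth_fun_on \<A> UNIV (fst r) \<and> open (snd r) \<and> ?p \<in> snd r \<and> snd r \<subseteq> W \<and>
      (\<forall>q\<in>snd r. fst r q = comps x (X q) \<bullet> c)"
    proof
      fix c
      obtain g N where "smooth_fun_on \<A> UNIV g" "open N" "?p \<in> N" "N \<subseteq> W" "\<forall>q\<in>N. g q = comps x (X q) \<bullet> c"
        by (rule function_extension[OF sm[of c] W(1) p(1)])
      then show "\<exists>r. smooth_fun_on \<A> UNIV (fst r) \<and> open (snd r) \<and> ?p \<in> snd r \<and> snd r \<subseteq> W \<and>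
        (\<forall>q\<in>snd r. fst r q = comps x (X q) \<bullet> c)" by (intro exI[of _ "(g, N)"]) simp
    qed
    from choice[OF this] obtain r where r: "\<forall>c. smooth_fun_on \<A> UNIV (fst (r c)) \<and> open (snd (r c)) \<and> ?p \<in> snd (r c) \<and>
      snd (r c) \<subseteq> W \<and> (\<forall>q\<in>snd (r c). fst (r c) q = comps x (X q) \<bullet> c)" ..
    define g where "g = (\<lambda>c. fst (r c))"
    define N where "N = (\<lambda>c. snd (r c))"
    have g: "smooth_fun_on \<A> UNIV (g c) \<and> open (N c) \<and> ?p \<in> N c \<and> N c \<subseteq> W \<and>
      (\<forall>q\<in>N c. g c q = comps x (X q) \<bullet> c)" for c
      using r unfolding g_def N_def by blast
    have gS: "smooth_fun_on \<A> S (g c)" for c using smooth_fun_on_subset[of UNIV "g c" S] g[of c] by simp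
    have E: "XX z c \<in> vector_fields \<A> S" for c using XX[OF z] by blast
    have gE: "(\<lambda>q. g c q *\<^sub>R XX z c q) \<in> vector_fields \<A> S" for c by (rule TM.sections_scaleR[OF SW(1) E gS])
    define X' where "X' = (\<lambda>q. \<Sum>c\<in>Basis. g c q *\<^sub>R XX z c q)"
    have X': "X' \<in> vector_fields \<A> S" unfolding X'_def by (rule TM.sections_sum[OF SW(1) finite_Basis gE])
    let ?N = "\<Inter>c\<in>Basis. N c \<inter> (W \<inter> x -` MM z c)"
    have N: "open ?N" "?p \<in> ?N"
      using g XX[OF z] pull p by (auto intro!: open_INT)
    have eq: "X q = X' q" if q: "q \<in> ?N" for q
    proof -
      have qW: "q \<in> W" using q nonempty_Basis by blast
      then have qU: "q \<in> U" using W by blast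
      have "comps x (X' q) = (\<Sum>c\<in>Basis. g c q *\<^sub>R comps x (XX z c q))"
        by (simp add: X'_def comps_sum) (simp add: comps_def scaleR_fun_def vec_eq_iff)
      also have "\<dots> = (\<Sum>c\<in>Basis. (comps x (X q) \<bullet> c) *\<^sub>R c)"
      proof (rule sum.cong[OF refl])
        fix c :: "real ^ 'n" assume "c \<in> Basis"
        then have "q \<in> N c" "x q \<in> MM z c" using q by auto
        then show "g c q *\<^sub>R comps x (XX z c q) = (comps x (X q) \<bullet> c) *\<^sub>R c"
          using g[of c] bspec[of "MM z c" "\<lambda>y. vcoord (XX z c) y = c" "x q"] XX[OF z, of c] by (simp add: vcoord_def pt_x[OF qW])
      qed
      finally have "comps x (X' q) = comps x (X q)" by (simp add: euclidean_representation)
      then show ?thesis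
        using chart_vector_comps[OF U qU vf_tangent[OF X]] chart_vector_comps[OF U qU vf_tangent[OF X']] by metis
    qed
    have "D X \<eta> ?p = D X' \<eta> ?p" by (rule D_local_left[OF X X' \<eta> N]) (simp add: eq)
    then have "scoord (D X \<eta>) z = scoord (D X' \<eta>) z" by (simp add: scoord_def)
    also have "D X' \<eta> = (\<lambda>q. \<Sum>c\<in>Basis. g c q *\<^sub>R D (XX z c) \<eta> q)"
      unfolding X'_def D_sum_left[OF \<eta> finite_Basis gE] D_scale_left[OF E \<eta> gS] ..
    also have "scoord \<dots> z = (\<Sum>c\<in>Basis. g c ?p *\<^sub>R scoord (D (XX z c) \<eta>) z)"
      unfolding scoord_sum[OF finite_Basis sections_scaleR[OF SW(1) D_section[OF E \<eta>] gS] z SW(1)]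
      by (simp add: scoord_scale[OF D_section[OF E \<eta>] z])
    also have "\<dots> = (\<Sum>c\<in>Basis. (vcoord X z \<bullet> c) *\<^sub>R scoord (D (XX z c) \<eta>) z)"
      using g by (simp add: vcoord_def)
    finally show ?thesis .
  qed
  have form: "scoord (D X \<eta>) z = cov \<Gamma> (vcoord X) (scoord \<eta>) z"
    if X: "X \<in> vector_fields \<A> S" and \<eta>: "\<eta> \<in> sections \<A> F S" and z: "z \<in> \<Omega>" for X \<eta> z
  proof -
    have E: "EE z b \<in> sections \<A> F S" for b using EE[OF z] by blast
    have "(\<Sum>b\<in>Basis. (scoord \<eta> z \<bullet> b) *\<^sub>R scoord (D X (EE z b)) z) =
      (\<Sum>b\<in>Basis. \<Sum>c\<in>Basis. ((vcoord X z \<bullet> c) * (scoord \<eta> z \<bullet> b)) *\<^sub>R scoord (D (XX z c) (EE z b)) z)"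
      unfolding tens[OF X E z] by (simp add: scaleR_sum_right mult.commute)
    also have "\<dots> = \<Gamma> z (vcoord X z) (scoord \<eta> z)" unfolding \<Gamma>_def by (rule sum.swap)
    finally show ?thesis using frame[OF X \<eta> z] by (simp add: cov_def)
  qed
  have bil: "bilinear (\<Gamma> z)" for z
    unfolding bilinear_def \<Gamma>_def
    by (intro conjI allI linearI)
      (simp_all add: inner_add_left algebra_simps sum.distrib scaleR_sum_right)
  have sm0: "smooth_on \<Omega> (\<lambda>z. \<Gamma> z c b)" for c b
  proof (rule smooth_on_locallyI)
    fix z assume z: "z \<in> \<Omega>"
    let ?N = "MM z c \<inter> NN z b"
    have N: "open ?N" "z \<in> ?N" "?N \<subseteq> \<Omega>" using XX[OF z, of c] EE[OF z, of b] by auto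
    have X: "XX z c \<in> vector_fields \<A> S" and E: "EE z b \<in> sections \<A> F S" using XX[OF z] EE[OF z] by auto
    have "smooth_on ?N (scoord (D (XX z c) (EE z b)))"
      by (rule smooth_on_subset[OF scoord_smooth[OF SW(2) D_section[OF X E]] N(3)])
    moreover have "scoord (D (XX z c) (EE z b)) y = \<Gamma> y c b" if y: "y \<in> ?N" for y
    proof -
      have y\<Omega>: "y \<in> \<Omega>" using y N by blast
      have "dd (scoord (EE z b)) y w = dd (\<lambda>y. b) y w" for w
        by (rule dd_cong[OF N(1) y]) (use EE[OF z, of b] in blast)
      then have "dd (scoord (EE z b)) y w = 0" for w using dd_const[OF N(1) y] by simp
      moreover have "vcoord (XX z c) y = c" "scoord (EE z b) y = b" using y XX[OF z, of c] EE[OF z, of b] by auto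
      ultimately show ?thesis using form[OF X E y\<Omega>] by (simp add: cov_def)
    qed
    ultimately have "smooth_on ?N (\<lambda>y. \<Gamma> y c b)"
      using smooth_on_cong[OF N(1), of "scoord (D (XX z c) (EE z b))" "\<lambda>y. \<Gamma> y c b"] by blast
    then show "\<exists>N. open N \<and> z \<in> N \<and> smooth_on N (\<lambda>y. \<Gamma> y c b)" using N by blast
  qed
  then have "represents S D \<Gamma>" unfolding represents_def smooth_bilinear_def using bil form by blast
  then show thesis by (rule that)
qed

end

context smooth_bundle
begin

lemma bundle_map_fibre:
  assumes "bundle_map \<A> (tangent_bundle \<A>) F \<phi>" "v \<in> tangent_space \<A> p"
  shows "\<phi> p v \<in> fibre F p"
  using assms unfolding bundle_map_def by (auto simp: tangent_bundle_simps)

lemma bundle_map_linear: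
  assumes "bundle_map \<A> (tangent_bundle \<A>) F \<phi>"
  shows "v \<in> tangent_space \<A> p \<Longrightarrow> w \<in> tangent_space \<A> p \<Longrightarrow> \<phi> p (v + w) = \<phi> p v + \<phi> p w"
    and "v \<in> tangent_space \<A> p \<Longrightarrow> \<phi> p (c *\<^sub>R v) = c *\<^sub>R \<phi> p v"
  using assms unfolding bundle_map_def linear_on_space_def by (auto simp: tangent_bundle_simps)

lemma linear_chart_vector:
  assumes "(U, x) \<in> \<A>" "p \<in> U" shows "linear (chart_vector U x p)"
proof -
  have "inv_into (tangent_space \<A> p) (comps x) = chart_vector U x p"
    by (rule ext) (rule comps_inv[OF assms])
  then show ?thesis
    using TM.linear_lift[OF tangent_bundle_simps(2)[OF assms(1)] assms(2)] by (simp add: tangent_bundle_simps(1))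
qed

lemma bundle_map_smooth:
  assumes "bundle_map \<A> (tangent_bundle \<A>) F \<phi>" "(U, x) \<in> \<A>" "(V, \<theta>) \<in> trivs F"
  shows "smooth_fun_on \<A> (U \<inter> V) (\<lambda>p. \<theta> p (\<phi> p (inv_into (tangent_space \<A> p) (comps x) w)))"
proof -
  have "\<forall>(U, \<tau>)\<in>trivs (tangent_bundle \<A>). \<forall>(V, \<theta>)\<in>trivs F. \<forall>w.
      smooth_fun_on \<A> (U \<inter> V) (\<lambda>p. \<theta> p (\<phi> p (inv_into (tangent_space \<A> p) (\<tau> p) w)))"
    using assms(1) unfolding bundle_map_def tangent_bundle_simps(1) by (rule conjunct2)
  from bspec[OF this tangent_bundle_simps(2)[OF assms(2)]]
  have "\<forall>(V, \<theta>)\<in>trivs F. \<forall>w. smooth_fun_on \<A> (U \<inter> V) (\<lambda>p. \<theta> p (\<phi> p (inv_into (tangent_space \<A> p) (comps x) w)))"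
    by (simp only: prod.case)
  from bspec[OF this assms(3)] show ?thesis by (simp only: prod.case)
qed

end

context coord_nbhd
begin

lemma cov_cong:
  assumes "\<And>y. y \<in> \<Omega> \<Longrightarrow> X y = X' y" "\<And>y. y \<in> \<Omega> \<Longrightarrow> \<eta> y = \<eta>' y" "z \<in> \<Omega>"
  shows "cov \<Gamma> X \<eta> z = cov \<Gamma> X' \<eta>' z"
  unfolding cov_def using dd_cong[OF \<Omega>_open assms(3), of \<eta> \<eta>'] assms by simp

lemma section_eqI:
  assumes s: "s \<in> sections \<A> F W" and t: "t \<in> sections \<A> F W" and eq: "\<And>z. z \<in> \<Omega> \<Longrightarrow> scoord s z = scoord t z"
  shows "s = t"
proof
  fix p show "s p = t p"
  proof (cases "p \<in> W")
    case True
    show ?thesis by (rule scoord_eqI[OF s t True eq]) (use True in blast)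
  qed (simp add: sec_off[OF s] sec_off[OF t])
qed

section \<open>The connection defined by a connection form\<close>

definition conn_of :: "(real ^ 'n \<Rightarrow> real ^ 'n \<Rightarrow> real ^ 'n \<Rightarrow> real ^ 'n) \<Rightarrow> ('m, 'e) connection"
  where "conn_of \<Gamma> X \<eta> = restrict_section W (\<lambda>p. lift \<theta> p (cov \<Gamma> (vcoord X) (scoord \<eta>) (x p)))"

lemma scoord_conn_of: "z \<in> \<Omega> \<Longrightarrow> scoord (conn_of \<Gamma> X \<eta>) z = cov \<Gamma> (vcoord X) (scoord \<eta>) z"
  using pt_W[of z] pt_U[of z] triv_lift[OF V] by (simp add: scoord_def conn_of_def restrict_section_def)

lemma conn_of_section:
  assumes \<Gamma>: "smooth_bilinear \<Omega> \<Gamma>" and X: "X \<in> vector_fields \<A> W" and \<eta>: "\<eta> \<in> sections \<A> F W"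
  shows "conn_of \<Gamma> X \<eta> \<in> sections \<A> F W"
proof -
  have "smooth_on \<Omega> (cov \<Gamma> (vcoord X) (scoord \<eta>))"
    by (rule smooth_cov[OF \<Omega>_open \<Gamma> vcoord_smooth[OF subset_refl X] scoord_smooth[OF subset_refl \<eta>]])
  then show ?thesis unfolding conn_of_def[abs_def]
    by (rule sections_of_coords[OF V W(1,3) smooth_fun_onW_I])
qed

lemma connection_on_conn_of:
  assumes \<Gamma>: "smooth_bilinear \<Omega> \<Gamma>" shows "connection_on \<A> F W (conn_of \<Gamma>)"
proof -
  note sec = conn_of_section[OF \<Gamma>]
  have b: "bilinear (\<Gamma> z)" if "z \<in> \<Omega>" for z by (rule smooth_bilinearD(1)[OF \<Gamma> that])
  have l: "linear (dd (scoord \<eta>) z)" if "\<eta> \<in> sections \<A> F W" "z \<in> \<Omega>" for \<eta> z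
    by (rule linear_dd[OF \<Omega>_open that(2) scoord_smooth[OF subset_refl that(1)]])
  have 1: "conn_of \<Gamma> (\<lambda>p. X p + Y p) \<eta> = (\<lambda>p. conn_of \<Gamma> X \<eta> p + conn_of \<Gamma> Y \<eta> p)"
    if X: "X \<in> vector_fields \<A> W" and Y: "Y \<in> vector_fields \<A> W" and \<eta>: "\<eta> \<in> sections \<A> F W" for X Y \<eta>
  proof (rule section_eqI[OF sec[OF TM.sections_add[OF W(1) X Y] \<eta>] sections_add[OF W(1) sec[OF X \<eta>] sec[OF Y \<eta>]]])
    fix z assume z: "z \<in> \<Omega>"
    show "scoord (conn_of \<Gamma> (\<lambda>p. X p + Y p) \<eta>) z = scoord (\<lambda>p. conn_of \<Gamma> X \<eta> p + conn_of \<Gamma> Y \<eta> p) z"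
      unfolding scoord_add[OF sec[OF X \<eta>] sec[OF Y \<eta>] z] scoord_conn_of[OF z] cov_def vcoord_add[OF X Y]
      by (simp add: linear_add[OF l[OF \<eta> z]] bilinear_ladd[OF b[OF z]])
  qed
  have 2: "conn_of \<Gamma> (\<lambda>p. f p *\<^sub>R X p) \<eta> = (\<lambda>p. f p *\<^sub>R conn_of \<Gamma> X \<eta> p)"
    if X: "X \<in> vector_fields \<A> W" and \<eta>: "\<eta> \<in> sections \<A> F W" and f: "smooth_fun_on \<A> W f" for f X \<eta>
  proof (rule section_eqI[OF sec[OF TM.sections_scaleR[OF W(1) X f] \<eta>] sections_scaleR[OF W(1) sec[OF X \<eta>] f]])
    fix z assume z: "z \<in> \<Omega>"
    show "scoord (conn_of \<Gamma> (\<lambda>p. f p *\<^sub>R X p) \<eta>) z = scoord (\<lambda>p. f p *\<^sub>R conn_of \<Gamma> X \<eta> p) z"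
      unfolding scoord_scale[OF sec[OF X \<eta>] z] scoord_conn_of[OF z] cov_def vcoord_scale
      by (simp add: linear_cmul[OF l[OF \<eta> z]] bilinear_lmul[OF b[OF z]] scaleR_add_right)
  qed
  have 3: "conn_of \<Gamma> X (\<lambda>p. \<eta> p + \<zeta> p) = (\<lambda>p. conn_of \<Gamma> X \<eta> p + conn_of \<Gamma> X \<zeta> p)"
    if X: "X \<in> vector_fields \<A> W" and \<eta>: "\<eta> \<in> sections \<A> F W" and \<zeta>: "\<zeta> \<in> sections \<A> F W" for X \<eta> \<zeta>
  proof (rule section_eqI[OF sec[OF X sections_add[OF W(1) \<eta> \<zeta>]] sections_add[OF W(1) sec[OF X \<eta>] sec[OF X \<zeta>]]])
    fix z assume z: "z \<in> \<Omega>"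
    have "dd (scoord (\<lambda>p. \<eta> p + \<zeta> p)) z w = dd (\<lambda>y. scoord \<eta> y + scoord \<zeta> y) z w" for w
      by (rule dd_cong[OF \<Omega>_open z]) (rule scoord_add[OF \<eta> \<zeta>])
    also have "dd (\<lambda>y. scoord \<eta> y + scoord \<zeta> y) z w = dd (scoord \<eta>) z w + dd (scoord \<zeta>) z w" for w
      by (rule dd_add[OF \<Omega>_open z scoord_smooth[OF subset_refl \<eta>] scoord_smooth[OF subset_refl \<zeta>]])
    finally show "scoord (conn_of \<Gamma> X (\<lambda>p. \<eta> p + \<zeta> p)) z = scoord (\<lambda>p. conn_of \<Gamma> X \<eta> p + conn_of \<Gamma> X \<zeta> p) z"
      unfolding scoord_add[OF sec[OF X \<eta>] sec[OF X \<zeta>] z] scoord_conn_of[OF z] cov_def scoord_add[OF \<eta> \<zeta> z]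
      by (simp add: bilinear_radd[OF b[OF z]])
  qed
  have 4: "conn_of \<Gamma> X (\<lambda>p. f p *\<^sub>R \<eta> p) = (\<lambda>p. X p f *\<^sub>R \<eta> p + f p *\<^sub>R conn_of \<Gamma> X \<eta> p)"
    if X: "X \<in> vector_fields \<A> W" and \<eta>: "\<eta> \<in> sections \<A> F W" and f: "smooth_fun_on \<A> W f" for f X \<eta>
  proof -
    note Xf = sections_scaleR[OF W(1) \<eta> vf_apply_smooth[OF X W(1) subset_refl f]]
    note fD = sections_scaleR[OF W(1) sec[OF X \<eta>] f]
    show ?thesis
    proof (rule section_eqI[OF sec[OF X sections_scaleR[OF W(1) \<eta> f]] sections_add[OF W(1) Xf fD]])
      fix z assume z: "z \<in> \<Omega>"
      have fs: "smooth_on \<Omega> (\<lambda>z. f (pt z))" by (rule smooth_fun_onW[OF f subset_refl])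
      have "dd (scoord (\<lambda>p. f p *\<^sub>R \<eta> p)) z w = dd (\<lambda>y. f (pt y) *\<^sub>R scoord \<eta> y) z w" for w
        by (rule dd_cong[OF \<Omega>_open z]) (rule scoord_scale[OF \<eta>])
      also have "dd (\<lambda>y. f (pt y) *\<^sub>R scoord \<eta> y) z w = f (pt z) *\<^sub>R dd (scoord \<eta>) z w + dd (\<lambda>y. f (pt y)) z w *\<^sub>R scoord \<eta> z" for w
        by (rule dd_scaleR[OF \<Omega>_open z fs scoord_smooth[OF subset_refl \<eta>]])
      finally have d: "dd (scoord (\<lambda>p. f p *\<^sub>R \<eta> p)) z w = f (pt z) *\<^sub>R dd (scoord \<eta>) z w + dd (\<lambda>y. f (pt y)) z w *\<^sub>R scoord \<eta> z" for w .
      have "X (pt z) f = dd (\<lambda>y. f (pt y)) z (vcoord X z)"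
        by (rule vf_apply_coords[OF subset_refl X z smooth_nearI[OF f W(1) pt_W(1)[OF z]]])
      then show "scoord (conn_of \<Gamma> X (\<lambda>p. f p *\<^sub>R \<eta> p)) z = scoord (\<lambda>p. X p f *\<^sub>R \<eta> p + f p *\<^sub>R conn_of \<Gamma> X \<eta> p) z"
        unfolding scoord_add[OF Xf fD z] scoord_scale[OF \<eta> z] scoord_scale[OF sec[OF X \<eta>] z] scoord_conn_of[OF z] cov_def d
        by (simp add: bilinear_rmul[OF b[OF z]] algebra_simps)
    qed
  qed
  show ?thesis unfolding connection_on_def using sec 1 2 3 4 by blast
qed

lemma represents_conn_of: "smooth_bilinear \<Omega> \<Gamma> \<Longrightarrow> represents W (conn_of \<Gamma>) \<Gamma>"
  unfolding represents_def using scoord_conn_of by blast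

section \<open>Curvature and torsion in coordinates\<close>

lemma curvature_section:
  assumes "open S" "connection_on \<A> F S D" "X \<in> vector_fields \<A> S" "Y \<in> vector_fields \<A> S" "\<eta> \<in> sections \<A> F S"
  shows "curvature \<A> D X Y \<eta> \<in> sections \<A> F S"
proof -
  interpret C: connection_operator \<A> F S D by unfold_locales (use assms in auto)
  show ?thesis unfolding curvature_def
    by (intro sections_diff assms C.D_section lie_bracket_vf)
qed

lemma scoord_curvature:
  assumes S: "open S" "W \<subseteq> S" and conn: "connection_on \<A> F S D" and rep: "represents S D \<Gamma>"
    and X: "X \<in> vector_fields \<A> S" and Y: "Y \<in> vector_fields \<A> S" and \<eta>: "\<eta> \<in> sections \<A> F S" and z: "z \<in> \<Omega>"
  shows "scoord (curvature \<A> D X Y \<eta>) z = curv \<Gamma> z (vcoord X z) (vcoord Y z) (scoord \<eta> z)"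
proof -
  interpret C: connection_operator \<A> F S D by unfold_locales (use S conn in auto)
  have L: "lie_bracket \<A> X Y \<in> vector_fields \<A> S" by (rule lie_bracket_vf[OF X Y S(1)])
  note sD = C.D_section
  have two: "scoord (D X (D Y \<eta>)) z = cov \<Gamma> (vcoord X) (cov \<Gamma> (vcoord Y) (scoord \<eta>)) z"
    if X: "X \<in> vector_fields \<A> S" and Y: "Y \<in> vector_fields \<A> S" for X Y
    unfolding representsD(2)[OF rep X sD[OF Y \<eta>] z]
    by (rule cov_cong[OF refl _ z]) (rule representsD(2)[OF rep Y \<eta>])
  have "scoord (curvature \<A> D X Y \<eta>) z = scoord (D X (D Y \<eta>)) z - scoord (D Y (D X \<eta>)) z - scoord (D (lie_bracket \<A> X Y) \<eta>) z"
    unfolding curvature_def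
    using scoord_diff[OF sections_diff[OF S(1) sD[OF X sD[OF Y \<eta>]] sD[OF Y sD[OF X \<eta>]]] sD[OF L \<eta>] z]
      scoord_diff[OF sD[OF X sD[OF Y \<eta>]] sD[OF Y sD[OF X \<eta>]] z] by simp
  also have "\<dots> = curv \<Gamma> z (vcoord X z) (vcoord Y z) (scoord \<eta> z)"
    unfolding two[OF X Y] two[OF Y X] representsD(2)[OF rep L \<eta> z]
    by (rule cov_curvature[where L="vcoord (lie_bracket \<A> X Y)", OF \<Omega>_open representsD(1)[OF rep] vcoord_smooth[OF S(2) X] vcoord_smooth[OF S(2) Y]
          scoord_smooth[OF S(2) \<eta>] z vcoord_lie_bracket[OF S(2,1) X Y z]])
  finally show ?thesis .
qed

lemma vf_through: 
  assumes "open S" "W \<subseteq> S" "z \<in> \<Omega>"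
  obtains X where "X \<in> vector_fields \<A> S" "vcoord X z = u"
proof -
  obtain X N where "X \<in> vector_fields \<A> S" "open N" "z \<in> N" "N \<subseteq> \<Omega>" "\<forall>y\<in>N. vcoord X y = u"
    by (rule vf_with_comps[OF assms(2,1,3)])
  then show thesis using that[of X] by blast
qed

lemma sec_through:
  assumes "open S" "W \<subseteq> S" "z \<in> \<Omega>"
  obtains s where "s \<in> sections \<A> F S" "scoord s z = e"
proof -
  obtain s N where "s \<in> sections \<A> F S" "open N" "z \<in> N" "N \<subseteq> \<Omega>" "\<forall>y\<in>N. scoord s y = e"
    by (rule section_with_comps[OF assms(2,1,3)])
  then show thesis using that[of s] by blast
qed

lemma flat_on_coords:
  assumes S: "open S" "W \<subseteq> S" and conn: "connection_on \<A> F S D" and rep: "represents S D \<Gamma>"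
    and flat: "flat_on \<A> F S D" and z: "z \<in> \<Omega>"
  shows "curv \<Gamma> z u v e = 0"
proof -
  obtain X where X: "X \<in> vector_fields \<A> S" "vcoord X z = u" by (rule vf_through[OF S z])
  obtain Y where Y: "Y \<in> vector_fields \<A> S" "vcoord Y z = v" by (rule vf_through[OF S z])
  obtain \<eta> where \<eta>: "\<eta> \<in> sections \<A> F S" "scoord \<eta> z = e" by (rule sec_through[OF S z])
  have "curvature \<A> D X Y \<eta> = (\<lambda>p. 0)" using flat X Y \<eta> unfolding flat_on_def by blast
  then have "scoord (curvature \<A> D X Y \<eta>) z = 0" using triv_zero[OF V pt_U(2)[OF z]] by (simp add: scoord_def)
  then show ?thesis using scoord_curvature[OF S conn rep X(1) Y(1) \<eta>(1) z] X Y \<eta> by simp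
qed

lemma flat_onI:
  assumes \<Gamma>: "smooth_bilinear \<Omega> \<Gamma>" and flat: "\<And>z u v e. z \<in> \<Omega> \<Longrightarrow> curv \<Gamma> z u v e = 0"
  shows "flat_on \<A> F W (conn_of \<Gamma>)"
  unfolding flat_on_def
proof (intro ballI)
  fix X Y \<eta> assume X: "X \<in> vector_fields \<A> W" and Y: "Y \<in> vector_fields \<A> W" and \<eta>: "\<eta> \<in> sections \<A> F W"
  note conn = connection_on_conn_of[OF \<Gamma>]
  show "curvature \<A> (conn_of \<Gamma>) X Y \<eta> = (\<lambda>p. 0)"
  proof (rule section_eqI[OF curvature_section[OF W(1) conn X Y \<eta>] sections_zero[OF W(1)]])
    fix z assume z: "z \<in> \<Omega>"
    show "scoord (curvature \<A> (conn_of \<Gamma>) X Y \<eta>) z = scoord (\<lambda>p. 0) z"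
      using scoord_curvature[OF W(1) subset_refl conn represents_conn_of[OF \<Gamma>] X Y \<eta> z] flat[OF z]
        triv_zero[OF V pt_U(2)[OF z]] by (simp add: scoord_def[of "\<lambda>p. 0"])
  qed
qed

definition map_coord :: "('m \<Rightarrow> 'm tangent \<Rightarrow> 'e) \<Rightarrow> real ^ 'n \<Rightarrow> real ^ 'n \<Rightarrow> real ^ 'n"
  where "map_coord \<phi> z u = \<theta> (pt z) (\<phi> (pt z) (chart_vector U x (pt z) u))"

context
  fixes \<phi> assumes \<phi>: "bundle_map \<A> (tangent_bundle \<A>) F \<phi>"
begin

lemma smooth_linear_map_coord: "smooth_linear \<Omega> (map_coord \<phi>)"
  unfolding smooth_linear_def
proof safe
  fix p assume p: "p \<in> W"
  then have pU: "p \<in> U" "p \<in> V" using W by auto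
  have cv: "chart_vector U x p w \<in> tangent_space \<A> p" for w by (rule chart_vector_tangent[OF U pU(1)])
  show "linear (map_coord \<phi> (x p))"
    unfolding map_coord_def pt_x[OF p]
    by (rule linearI) (simp_all add: linear_add[OF linear_chart_vector[OF U pU(1)]]
      linear_cmul[OF linear_chart_vector[OF U pU(1)]] bundle_map_linear[OF \<phi>] cv
      triv_add[OF V pU(2)] triv_scaleR[OF V pU(2)] bundle_map_fibre[OF \<phi>])
next
  fix w
  have "smooth_fun_on \<A> (U \<inter> V) (\<lambda>p. \<theta> p (\<phi> p (inv_into (tangent_space \<A> p) (comps x) w)))"
    by (rule bundle_map_smooth[OF \<phi> U V])
  then have "smooth_on \<Omega> (\<lambda>z. \<theta> (pt z) (\<phi> (pt z) (inv_into (tangent_space \<A> (pt z)) (comps x) w)))"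
    by (rule smooth_fun_onW) (use W in blast)
  then show "smooth_on \<Omega> (\<lambda>z. map_coord \<phi> z w)"
    by (rule smooth_on_cong[OF \<Omega>_open, THEN iffD1, rotated]) (simp only: map_coord_def comps_inv[OF U pt_U(1)])
qed

lemma scoord_bundle_map:
  assumes "X \<in> vector_fields \<A> S" "z \<in> \<Omega>"
  shows "scoord (\<lambda>p. \<phi> p (X p)) z = map_coord \<phi> z (vcoord X z)"
  using chart_vector_comps[OF U pt_U(1)[OF assms(2)] vf_tangent[OF assms(1)]] by (simp add: scoord_def map_coord_def vcoord_def)

end

end

context smooth_bundle
begin

lemma coord_nbhd_at:
  assumes "open S" "p \<in> S"
  obtains U x V \<theta> W where "coord_nbhd \<A> F U x V \<theta> W" "p \<in> W" "W \<subseteq> S"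
proof -
  obtain U x where U: "(U, x) \<in> \<A>" "p \<in> U" by (rule chart_cover)
  obtain V \<theta> where V: "(V, \<theta>) \<in> trivs F" "p \<in> V" by (rule triv_cover)
  have "coord_nbhd \<A> F U x V \<theta> (U \<inter> V \<inter> S)"
    by unfold_locales (use U V assms chart_open triv_props(1) in \<open>auto intro!: open_Int\<close>)
  then show thesis using that[of U x V \<theta> "U \<inter> V \<inter> S"] U V assms by blast
qed

lemma bundle_map_section:
  assumes \<phi>: "bundle_map \<A> (tangent_bundle \<A>) F \<phi>" and X: "X \<in> vector_fields \<A> S" and S: "open S"
  shows "(\<lambda>p. \<phi> p (X p)) \<in> sections \<A> F S"
proof (rule sectionsI)
  show "\<phi> p (X p) \<in> fibre F p" for p by (rule bundle_map_fibre[OF \<phi> vf_tangent[OF X]])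
  have "\<phi> p 0 = 0" for p
    using bundle_map_linear(2)[OF \<phi> subspace_0[OF subspace_tangent_space], of p 0] by simp
  then show "\<phi> p (X p) = 0" if "p \<notin> S" for p using TM.sec_off[OF X that] by simp
  fix p assume "p \<in> S"
  then obtain U x V \<theta> W where C: "coord_nbhd \<A> F U x V \<theta> W" and p: "p \<in> W" and WS: "W \<subseteq> S"
    using coord_nbhd_at[OF S] by metis
  interpret C: coord_nbhd \<A> F U x V \<theta> W by (rule C)
  have "smooth_on C.\<Omega> (\<lambda>z. C.map_coord \<phi> z (C.vcoord X z))"
    by (rule smooth_linear_apply(1)[OF C.\<Omega>_open C.smooth_linear_map_coord[OF \<phi>] C.vcoord_smooth[OF WS X]])
  then have "smooth_fun_on \<A> W (\<lambda>q. C.map_coord \<phi> (x q) (C.vcoord X (x q)))" by (rule C.smooth_fun_onW_I)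
  then have "smooth_fun_on \<A> W (\<lambda>q. \<theta> q (\<phi> q (X q)))"
  proof (rule smooth_fun_on_cong[OF C.W(1), rotated])
    fix q assume q: "q \<in> W"
    then have "x q \<in> C.\<Omega>" by blast
    then show "C.map_coord \<phi> (x q) (C.vcoord X (x q)) = \<theta> q (\<phi> q (X q))"
      using C.scoord_bundle_map[OF \<phi> X, of "x q"] C.pt_x[OF q] by (simp add: C.scoord_def)
  qed
  then show "\<exists>N V \<theta>. open N \<and> p \<in> N \<and> (V, \<theta>) \<in> trivs F \<and> N \<subseteq> V \<inter> S \<and> smooth_fun_on \<A> N (\<lambda>q. \<theta> q (\<phi> q (X q)))"
    using C.W C.V p WS by blast
qed

end

context coord_nbhd
begin

context
  fixes \<phi> assumes \<phi>: "bundle_map \<A> (tangent_bundle \<A>) F \<phi>"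
begin

text \<open>The derivatives of the components of \<open>X\<close> and \<open>Y\<close> cancel against the bracket, so the torsion is tensorial.\<close>

lemma scoord_torsion:
  assumes S: "open S" "W \<subseteq> S" and conn: "connection_on \<A> F S D" and rep: "represents S D \<Gamma>"
    and X: "X \<in> vector_fields \<A> S" and Y: "Y \<in> vector_fields \<A> S"
  shows "(\<lambda>p. D X (\<lambda>q. \<phi> q (Y q)) p - D Y (\<lambda>q. \<phi> q (X q)) p - \<phi> p (lie_bracket \<A> X Y p)) \<in> sections \<A> F S"
    and "z \<in> \<Omega> \<Longrightarrow> scoord (\<lambda>p. D X (\<lambda>q. \<phi> q (Y q)) p - D Y (\<lambda>q. \<phi> q (X q)) p - \<phi> p (lie_bracket \<A> X Y p)) z =
    dd (\<lambda>y. map_coord \<phi> y (vcoord Y z)) z (vcoord X z) + \<Gamma> z (vcoord X z) (map_coord \<phi> z (vcoord Y z))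
    - (dd (\<lambda>y. map_coord \<phi> y (vcoord X z)) z (vcoord Y z) + \<Gamma> z (vcoord Y z) (map_coord \<phi> z (vcoord X z)))"
proof -
  interpret C: connection_operator \<A> F S D by unfold_locales (use S conn in auto)
  have L: "lie_bracket \<A> X Y \<in> vector_fields \<A> S" by (rule lie_bracket_vf[OF X Y S(1)])
  have fX: "(\<lambda>p. \<phi> p (Z p)) \<in> sections \<A> F S" if "Z \<in> vector_fields \<A> S" for Z
    by (rule bundle_map_section[OF \<phi> that S(1)])
  note s1 = C.D_section[OF X fX[OF Y]] and s2 = C.D_section[OF Y fX[OF X]]
  show "(\<lambda>p. D X (\<lambda>q. \<phi> q (Y q)) p - D Y (\<lambda>q. \<phi> q (X q)) p - \<phi> p (lie_bracket \<A> X Y p)) \<in> sections \<A> F S"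
    by (rule sections_diff[OF S(1) sections_diff[OF S(1) s1 s2] fX[OF L]])
  assume z: "z \<in> \<Omega>"
  have *: "scoord (D X (\<lambda>q. \<phi> q (Y q))) z = dd (\<lambda>y. map_coord \<phi> y (vcoord Y z)) z (vcoord X z) + map_coord \<phi> z (dd (vcoord Y) z (vcoord X z))
      + \<Gamma> z (vcoord X z) (map_coord \<phi> z (vcoord Y z))"
    if X: "X \<in> vector_fields \<A> S" and Y: "Y \<in> vector_fields \<A> S" for X Y
  proof -
    have "scoord (D X (\<lambda>q. \<phi> q (Y q))) z = cov \<Gamma> (vcoord X) (scoord (\<lambda>q. \<phi> q (Y q))) z"
      by (rule representsD(2)[OF rep X fX[OF Y] z])
    also have "\<dots> = cov \<Gamma> (vcoord X) (\<lambda>y. map_coord \<phi> y (vcoord Y y)) z"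
      by (rule cov_cong[OF refl scoord_bundle_map[OF \<phi> Y] z])
    finally show ?thesis
      using smooth_linear_apply(2)[OF \<Omega>_open smooth_linear_map_coord[OF \<phi>] vcoord_smooth[OF S(2) Y] z, of "vcoord X z"]
      by (simp add: cov_def)
  qed
  show "scoord (\<lambda>p. D X (\<lambda>q. \<phi> q (Y q)) p - D Y (\<lambda>q. \<phi> q (X q)) p - \<phi> p (lie_bracket \<A> X Y p)) z =
    dd (\<lambda>y. map_coord \<phi> y (vcoord Y z)) z (vcoord X z) + \<Gamma> z (vcoord X z) (map_coord \<phi> z (vcoord Y z))
    - (dd (\<lambda>y. map_coord \<phi> y (vcoord X z)) z (vcoord Y z) + \<Gamma> z (vcoord Y z) (map_coord \<phi> z (vcoord X z)))"
    unfolding scoord_diff[OF sections_diff[OF S(1) s1 s2] fX[OF L] z] scoord_diff[OF s1 s2 z] *[OF X Y] *[OF Y X]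
      scoord_bundle_map[OF \<phi> L z] vcoord_lie_bracket[OF S(2,1) X Y z]
      linear_diff[OF smooth_linearD(1)[OF smooth_linear_map_coord[OF \<phi>] z]]
    by (simp add: algebra_simps)
qed

lemma torsion_free_coords:
  assumes S: "open S" "W \<subseteq> S" and conn: "connection_on \<A> F S D" and rep: "represents S D \<Gamma>"
    and tf: "rel_torsion_free_on \<A> S \<phi> D"
  shows "torsion_free \<Omega> (map_coord \<phi>) \<Gamma>"
  unfolding torsion_free_def
proof (intro ballI allI)
  fix z u v assume z: "z \<in> \<Omega>"
  obtain X where X: "X \<in> vector_fields \<A> S" "vcoord X z = u" by (rule vf_through[OF S z])
  obtain Y where Y: "Y \<in> vector_fields \<A> S" "vcoord Y z = v" by (rule vf_through[OF S z])
  have "(\<lambda>p. D X (\<lambda>q. \<phi> q (Y q)) p - D Y (\<lambda>q. \<phi> q (X q)) p - \<phi> p (lie_bracket \<A> X Y p)) = (\<lambda>p. 0)"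
    using tf X Y unfolding rel_torsion_free_on_def by blast
  then have "scoord (\<lambda>p. D X (\<lambda>q. \<phi> q (Y q)) p - D Y (\<lambda>q. \<phi> q (X q)) p - \<phi> p (lie_bracket \<A> X Y p)) z = 0"
    using triv_zero[OF V pt_U(2)[OF z]] by (simp add: scoord_def)
  then show "dd (\<lambda>y. map_coord \<phi> y v) z u + \<Gamma> z u (map_coord \<phi> z v) = dd (\<lambda>y. map_coord \<phi> y u) z v + \<Gamma> z v (map_coord \<phi> z u)"
    using scoord_torsion(2)[OF S conn rep X(1) Y(1) z] X Y by simp
qed

lemma rel_torsion_free_conn_of:
  assumes \<Gamma>: "smooth_bilinear \<Omega> \<Gamma>" and tf: "torsion_free \<Omega> (map_coord \<phi>) \<Gamma>"
  shows "rel_torsion_free_on \<A> W \<phi> (conn_of \<Gamma>)"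
  unfolding rel_torsion_free_on_def
proof (intro ballI)
  fix X Y assume X: "X \<in> vector_fields \<A> W" and Y: "Y \<in> vector_fields \<A> W"
  let ?D = "conn_of \<Gamma>"
  note t = scoord_torsion[OF W(1) subset_refl connection_on_conn_of[OF \<Gamma>] represents_conn_of[OF \<Gamma>] X Y]
  show "(\<lambda>p. ?D X (\<lambda>q. \<phi> q (Y q)) p - ?D Y (\<lambda>q. \<phi> q (X q)) p - \<phi> p (lie_bracket \<A> X Y p)) = (\<lambda>p. 0)"
  proof (rule section_eqI[OF t(1) sections_zero[OF W(1)]])
    fix z assume z: "z \<in> \<Omega>"
    show "scoord (\<lambda>p. ?D X (\<lambda>q. \<phi> q (Y q)) p - ?D Y (\<lambda>q. \<phi> q (X q)) p - \<phi> p (lie_bracket \<A> X Y p)) z = scoord (\<lambda>p. 0) z"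
      unfolding t(2)[OF z]
      using tf[unfolded torsion_free_def, rule_format, OF z, of "vcoord Y z" "vcoord X z"] triv_zero[OF V pt_U(2)[OF z]]
      by (simp add: scoord_def)
  qed
qed

lemma dual_section_coords:
  assumes \<rho>: "dual_section \<A> F S \<rho>" and S: "W \<subseteq> S"
  shows "smooth_linear \<Omega> (\<lambda>z e. \<rho> (pt z) (lift \<theta> (pt z) e))"
  unfolding smooth_linear_def
proof safe
  fix p assume p: "p \<in> W"
  have "linear_on_space (fibre F p) (\<rho> p)" using \<rho> S p unfolding dual_section_def by blast
  then show "linear (\<lambda>e. \<rho> (pt (x p)) (lift \<theta> (pt (x p)) e))"
    unfolding pt_x[OF p] using p W lift_in[OF V] lift_add[OF V] lift_scaleR[OF V]
    by (intro linearI) (auto simp: linear_on_space_def)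
next
  fix e
  have "smooth_fun_on \<A> (V \<inter> S) (\<lambda>p. \<rho> p (lift \<theta> p e))" using \<rho> V unfolding dual_section_def by blast
  then show "smooth_on \<Omega> (\<lambda>z. \<rho> (pt z) (lift \<theta> (pt z) e))"
    by (rule smooth_fun_onW) (use S W in blast)
qed

lemma dual_section_of_coords:
  assumes \<rho>: "smooth_linear \<Omega> \<rho>" shows "dual_section \<A> F W (\<lambda>p a. \<rho> (x p) (\<theta> p a))"
  unfolding dual_section_def
proof safe
  fix p assume p: "p \<in> W"
  then have "linear (\<rho> (x p))" by (intro smooth_linearD(1)[OF \<rho>]) blast
  then show "linear_on_space (fibre F p) (\<lambda>a. \<rho> (x p) (\<theta> p a))"
    using p W triv_add[OF V] triv_scaleR[OF V] by (auto simp: linear_on_space_def linear_add linear_cmul)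
next
  fix V' \<theta>' w assume V': "(V', \<theta>') \<in> trivs F"
  let ?N = "V' \<inter> W"
  have o: "open ?N" and NU: "?N \<subseteq> U" using triv_props(1)[OF V'] W by auto
  have \<rho>N: "smooth_linear (x ` ?N) \<rho>" by (rule smooth_linear_subset[OF \<rho>]) blast
  have "smooth_fun_on \<A> ?N (\<lambda>p. \<theta> p (lift \<theta>' p w))"
    by (rule smooth_fun_on_subset[OF transition_smooth[OF V' V]]) (use W in blast)
  then have "smooth_on (x ` ?N) (\<lambda>z. \<theta> (pt z) (lift \<theta>' (pt z) w))"
    by (rule smooth_fun_onD[OF _ U]) (use NU in blast)
  from smooth_linear_apply(1)[OF chart_open_image[OF U o NU] \<rho>N this]
  have "smooth_on (x ` ?N) (\<lambda>z. \<rho> z (\<theta> (pt z) (lift \<theta>' (pt z) w)))" .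
  then have "smooth_on (x ` ?N) (\<lambda>z. \<rho> (x (pt z)) (\<theta> (pt z) (lift \<theta>' (pt z) w)))"
    by (rule smooth_on_cong[OF chart_open_image[OF U o NU], THEN iffD1, rotated]) (auto simp: pt_x)
  then show "smooth_fun_on \<A> ?N (\<lambda>p. \<rho> (x p) (\<theta> p (lift \<theta>' p w)))"
    by (rule smooth_fun_on_chartI[OF U o NU])
qed

lemma represents_proj_change:
  assumes S: "open S" "W \<subseteq> S" and conn: "connection_on \<A> F S D" and rep: "represents S D \<Gamma>"
    and tf: "torsion_free \<Omega> (map_coord \<phi>) \<Gamma>"
    and conn': "connection_on \<A> F S D'" and \<rho>: "dual_section \<A> F S \<rho>"
    and D': "\<forall>X\<in>vector_fields \<A> S. \<forall>\<eta>\<in>sections \<A> F S. \<forall>p\<in>S.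
         D' X \<eta> p = D X \<eta> p + \<rho> p (\<phi> p (X p)) *\<^sub>R \<eta> p + \<rho> p (\<eta> p) *\<^sub>R \<phi> p (X p)"
  shows "represents S D' (proj_change (map_coord \<phi>) (\<lambda>z e. \<rho> (pt z) (lift \<theta> (pt z) e)) \<Gamma>)"
  unfolding represents_def
proof (intro conjI ballI)
  show "smooth_bilinear \<Omega> (proj_change (map_coord \<phi>) (\<lambda>z e. \<rho> (pt z) (lift \<theta> (pt z) e)) \<Gamma>)"
    by (rule smooth_bilinear_proj_change[OF \<Omega>_open representsD(1)[OF rep] smooth_linear_map_coord[OF \<phi>] tf
          dual_section_coords[OF \<rho> S(2)]])
  fix X \<eta> z assume X: "X \<in> vector_fields \<A> S" and \<eta>: "\<eta> \<in> sections \<A> F S" and z: "z \<in> \<Omega>"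
  interpret C: connection_operator \<A> F S D by unfold_locales (use S conn in auto)
  let ?p = "pt z"
  have p: "?p \<in> W" "?p \<in> V" "?p \<in> S" using pt_W(1)[OF z] W S by auto
  have f1: "D X \<eta> ?p \<in> fibre F ?p" by (rule sec_fibre'[OF C.D_section[OF X \<eta>]])
  have f2: "\<eta> ?p \<in> fibre F ?p" by (rule sec_fibre'[OF \<eta>])
  have f3: "\<phi> ?p (X ?p) \<in> fibre F ?p" by (rule bundle_map_fibre[OF \<phi> vf_tangent[OF X]])
  have "lift \<theta> ?p (map_coord \<phi> z (vcoord X z)) = \<phi> ?p (X ?p)" "lift \<theta> ?p (scoord \<eta> z) = \<eta> ?p"
    using scoord_bundle_map[OF \<phi> X z] lift_triv[OF V p(2) f3] lift_triv[OF V p(2) f2] by (auto simp: scoord_def)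
  moreover have "scoord (D' X \<eta>) z = scoord (D X \<eta>) z + \<rho> ?p (\<phi> ?p (X ?p)) *\<^sub>R scoord \<eta> z + \<rho> ?p (\<eta> ?p) *\<^sub>R scoord (\<lambda>p. \<phi> p (X p)) z"
    using D' X \<eta> p(3) f1 f2 f3 by (simp add: scoord_def triv_add[OF V p(2)] triv_scaleR[OF V p(2)]
        subspace_add[OF fibre_subspace] subspace_scale[OF fibre_subspace])
  ultimately show "scoord (D' X \<eta>) z = cov (proj_change (map_coord \<phi>) (\<lambda>z e. \<rho> (pt z) (lift \<theta> (pt z) e)) \<Gamma>) (vcoord X) (scoord \<eta>) z"
    using representsD(2)[OF rep X \<eta> z] scoord_bundle_map[OF \<phi> X z] by (simp add: cov_def proj_change_def)
qed

lemma projectively_equivalent_conn_of: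
  assumes \<Gamma>: "smooth_bilinear \<Omega> \<Gamma>" and tf: "torsion_free \<Omega> (map_coord \<phi>) \<Gamma>" and \<rho>: "smooth_linear \<Omega> \<rho>"
  shows "projectively_equivalent_on \<A> F W \<phi> (conn_of \<Gamma>) (conn_of (proj_change (map_coord \<phi>) \<rho> \<Gamma>))"
proof -
  note lin = smooth_linear_map_coord[OF \<phi>]
  note \<Gamma>' = smooth_bilinear_proj_change[OF \<Omega>_open \<Gamma> lin tf \<rho>]
  note tf' = torsion_free_proj_change[OF \<Omega>_open \<Gamma> lin tf]
  have "conn_of (proj_change (map_coord \<phi>) \<rho> \<Gamma>) X \<eta> p = conn_of \<Gamma> X \<eta> p +
      \<rho> (x p) (\<theta> p (\<phi> p (X p))) *\<^sub>R \<eta> p + \<rho> (x p) (\<theta> p (\<eta> p)) *\<^sub>R \<phi> p (X p)"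
    if X: "X \<in> vector_fields \<A> W" and \<eta>: "\<eta> \<in> sections \<A> F W" and p: "p \<in> W" for X \<eta> p
  proof -
    have z: "x p \<in> \<Omega>" and pV: "p \<in> V" using p W by auto
    have f1: "conn_of \<Gamma> X \<eta> p \<in> fibre F p" by (rule sec_fibre'[OF conn_of_section[OF \<Gamma> X \<eta>]])
    have f2: "\<eta> p \<in> fibre F p" by (rule sec_fibre'[OF \<eta>])
    have f3: "\<phi> p (X p) \<in> fibre F p" by (rule bundle_map_fibre[OF \<phi> vf_tangent[OF X]])
    have f4: "conn_of (proj_change (map_coord \<phi>) \<rho> \<Gamma>) X \<eta> p \<in> fibre F p" by (rule sec_fibre'[OF conn_of_section[OF \<Gamma>' X \<eta>]])
    have e: "\<theta> p (conn_of G X \<eta> p) = cov G (vcoord X) (scoord \<eta>) (x p)" for G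
      using scoord_conn_of[OF z, of G X \<eta>] pt_x[OF p] by (simp add: scoord_def)
    have e1: "scoord \<eta> (x p) = \<theta> p (\<eta> p)" and e2: "map_coord \<phi> (x p) (vcoord X (x p)) = \<theta> p (\<phi> p (X p))"
      using pt_x[OF p] scoord_bundle_map[OF \<phi> X z] by (auto simp: scoord_def)
    show ?thesis
    proof (rule triv_inject[OF V pV f4])
      show "conn_of \<Gamma> X \<eta> p + \<rho> (x p) (\<theta> p (\<phi> p (X p))) *\<^sub>R \<eta> p + \<rho> (x p) (\<theta> p (\<eta> p)) *\<^sub>R \<phi> p (X p) \<in> fibre F p"
        by (intro subspace_add subspace_scale fibre_subspace f1 f2 f3)
      show "\<theta> p (conn_of (proj_change (map_coord \<phi>) \<rho> \<Gamma>) X \<eta> p) =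
        \<theta> p (conn_of \<Gamma> X \<eta> p + \<rho> (x p) (\<theta> p (\<phi> p (X p))) *\<^sub>R \<eta> p + \<rho> (x p) (\<theta> p (\<eta> p)) *\<^sub>R \<phi> p (X p))"
        using f1 f2 f3 by (simp add: e triv_add[OF V pV] triv_scaleR[OF V pV] cov_def proj_change_def e1 e2
          subspace_add[OF fibre_subspace] subspace_scale[OF fibre_subspace])
    qed
  qed
  then show ?thesis
    unfolding projectively_equivalent_on_def
    using connection_on_conn_of[OF \<Gamma>] connection_on_conn_of[OF \<Gamma>'] rel_torsion_free_conn_of[OF \<Gamma> tf]
      rel_torsion_free_conn_of[OF \<Gamma>' tf'] dual_section_of_coords[OF \<rho>] by blast
qed

end

end

section \<open>Tensors, traces and ranks in coordinates\<close>

context smooth_bundle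
begin

lemma dual_tensor_section_subset:
  assumes "dual_tensor_section \<A> (tangent_bundle \<A>) F S A" "N \<subseteq> S"
  shows "dual_tensor_section \<A> (tangent_bundle \<A>) F N A"
  unfolding dual_tensor_section_def
proof (intro conjI ballI, goal_cases)
  case (1 p v)
  then show ?case using assms unfolding dual_tensor_section_def by blast
next
  case (2 p e)
  then show ?case using assms unfolding dual_tensor_section_def by blast
next
  case (3 t)
  obtain U \<tau> where t: "t = (U, \<tau>)" by (cases t)
  show ?case unfolding t prod.case
  proof (intro ballI)
    fix s assume s': "s \<in> trivs F"
    obtain V \<theta> where s: "s = (V, \<theta>)" by (cases s)
    show "case s of (V, \<theta>) \<Rightarrow> \<forall>w z. smooth_fun_on \<A> (U \<inter> V \<inter> N)
        (\<lambda>p. A p (inv_into (fibre (tangent_bundle \<A>) p) (\<tau> p) w) (inv_into (fibre F p) (\<theta> p) z))"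
      unfolding s prod.case
    proof (intro allI)
      fix w z
      have *: "\<forall>(U, \<tau>)\<in>trivs (tangent_bundle \<A>). \<forall>(V, \<theta>)\<in>trivs F. \<forall>w z. smooth_fun_on \<A> (U \<inter> V \<inter> S)
        (\<lambda>p. A p (inv_into (fibre (tangent_bundle \<A>) p) (\<tau> p) w) (inv_into (fibre F p) (\<theta> p) z))"
        using assms(1) unfolding dual_tensor_section_def by (rule conjunct2)
      from bspec[OF bspec[OF *[unfolded split_def] 3] s'] t s
      have "smooth_fun_on \<A> (U \<inter> V \<inter> S)
        (\<lambda>p. A p (inv_into (fibre (tangent_bundle \<A>) p) (\<tau> p) w) (inv_into (fibre F p) (\<theta> p) z))" by simp
      then show "smooth_fun_on \<A> (U \<inter> V \<inter> N)
        (\<lambda>p. A p (inv_into (fibre (tangent_bundle \<A>) p) (\<tau> p) w) (inv_into (fibre F p) (\<theta> p) z))"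
        by (rule smooth_fun_on_subset) (use assms(2) in blast)
    qed
  qed
qed

lemma dual_tensor_sectionD:
  assumes "dual_tensor_section \<A> (tangent_bundle \<A>) F S A"
  shows "p \<in> S \<Longrightarrow> v \<in> tangent_space \<A> p \<Longrightarrow> linear_on_space (fibre F p) (A p v)"
    and "p \<in> S \<Longrightarrow> a \<in> fibre F p \<Longrightarrow> linear_on_space (tangent_space \<A> p) (\<lambda>v. A p v a)"
    and "(U, \<tau>) \<in> trivs (tangent_bundle \<A>) \<Longrightarrow> (V, \<theta>) \<in> trivs F \<Longrightarrow>
      smooth_fun_on \<A> (U \<inter> V \<inter> S) (\<lambda>p. A p (inv_into (tangent_space \<A> p) (\<tau> p) w) (lift \<theta> p z))"
proof -
  show "p \<in> S \<Longrightarrow> v \<in> tangent_space \<A> p \<Longrightarrow> linear_on_space (fibre F p) (A p v)"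
    and "p \<in> S \<Longrightarrow> a \<in> fibre F p \<Longrightarrow> linear_on_space (tangent_space \<A> p) (\<lambda>v. A p v a)"
    using assms unfolding dual_tensor_section_def tangent_bundle_simps(1) by blast+
  assume t: "(U, \<tau>) \<in> trivs (tangent_bundle \<A>)" and s: "(V, \<theta>) \<in> trivs F"
  have "\<forall>(U, \<tau>)\<in>trivs (tangent_bundle \<A>). \<forall>(V, \<theta>)\<in>trivs F. \<forall>w z. smooth_fun_on \<A> (U \<inter> V \<inter> S)
      (\<lambda>p. A p (inv_into (tangent_space \<A> p) (\<tau> p) w) (lift \<theta> p z))"
    using assms unfolding dual_tensor_section_def tangent_bundle_simps(1) by (rule conjunct2)
  from bspec[OF bspec[OF this[unfolded split_def] t] s]
  show "smooth_fun_on \<A> (U \<inter> V \<inter> S) (\<lambda>p. A p (inv_into (tangent_space \<A> p) (\<tau> p) w) (lift \<theta> p z))" by simp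
qed

lemma dual_tensor_sectionI:
  assumes "\<And>p v. p \<in> S \<Longrightarrow> v \<in> tangent_space \<A> p \<Longrightarrow> linear_on_space (fibre F p) (A p v)"
    and "\<And>p a. p \<in> S \<Longrightarrow> a \<in> fibre F p \<Longrightarrow> linear_on_space (tangent_space \<A> p) (\<lambda>v. A p v a)"
    and "\<And>U \<tau> V \<theta> w z. (U, \<tau>) \<in> trivs (tangent_bundle \<A>) \<Longrightarrow> (V, \<theta>) \<in> trivs F \<Longrightarrow>
      smooth_fun_on \<A> (U \<inter> V \<inter> S) (\<lambda>p. A p (inv_into (tangent_space \<A> p) (\<tau> p) w) (lift \<theta> p z))"
  shows "dual_tensor_section \<A> (tangent_bundle \<A>) F S A"
  unfolding dual_tensor_section_def tangent_bundle_simps(1) split_def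
  using assms by simp

text \<open>The curvature identity on a set \<open>N\<close> of points only, since tensors \<open>A\<close> are first found locally; the constant
  \<open>k\<close> stands for \<open>1 / (n - 1)\<close>.\<close>

definition curvature_identity ::
  "real \<Rightarrow> ('m \<Rightarrow> 'm tangent \<Rightarrow> 'e) \<Rightarrow> ('m, 'e) connection \<Rightarrow> 'm set \<Rightarrow> ('m \<Rightarrow> 'm tangent \<Rightarrow> 'e \<Rightarrow> real) \<Rightarrow> bool"
  where "curvature_identity k \<phi> D N A \<longleftrightarrow>
    (\<forall>X\<in>vector_fields \<A> UNIV. \<forall>Y\<in>vector_fields \<A> UNIV. \<forall>\<eta>\<in>sections \<A> F UNIV. \<forall>p\<in>N.
       curvature \<A> D X Y \<eta> p = k *\<^sub>R (A p (Y p) (\<eta> p) *\<^sub>R \<phi> p (X p) - A p (X p) (\<eta> p) *\<^sub>R \<phi> p (Y p)))"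

end

context coord_nbhd
begin

definition tensor_coords :: "('m \<Rightarrow> 'm tangent \<Rightarrow> 'e \<Rightarrow> real) \<Rightarrow> real ^ 'n \<Rightarrow> real ^ 'n \<Rightarrow> real ^ 'n \<Rightarrow> real"
  where "tensor_coords A z u e = A (pt z) (chart_vector U x (pt z) u) (lift \<theta> (pt z) e)"

lemma smooth_bilinear_tensor_coords:
  assumes A: "dual_tensor_section \<A> (tangent_bundle \<A>) F S A" and S: "W \<subseteq> S"
  shows "smooth_bilinear \<Omega> (tensor_coords A)"
  unfolding smooth_bilinear_def
proof safe
  fix p assume p: "p \<in> W"
  then have pU: "p \<in> U" "p \<in> V" "p \<in> S" using W S by auto
  have cv: "chart_vector U x p w \<in> tangent_space \<A> p" for w by (rule chart_vector_tangent[OF U pU(1)])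
  have l: "lift \<theta> p w \<in> fibre F p" for w by (rule lift_in[OF V pU(2)])
  note 1 = dual_tensor_sectionD(1)[OF A pU(3) cv, unfolded linear_on_space_def]
  note 2 = dual_tensor_sectionD(2)[OF A pU(3) l, unfolded linear_on_space_def]
  show "bilinear (tensor_coords A (x p))"
    unfolding bilinear_def tensor_coords_def pt_x[OF p]
    by (intro conjI allI linearI) (use 1 2 cv l in \<open>simp_all add: linear_add[OF linear_chart_vector[OF U pU(1)]]
      linear_cmul[OF linear_chart_vector[OF U pU(1)]] lift_add[OF V pU(2)] lift_scaleR[OF V pU(2)]\<close>)
next
  fix w e
  have "smooth_fun_on \<A> (U \<inter> V \<inter> S) (\<lambda>p. A p (inv_into (tangent_space \<A> p) (comps x) w) (lift \<theta> p e))"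
    by (rule dual_tensor_sectionD(3)[OF A tangent_bundle_simps(2)[OF U] V])
  then have "smooth_on \<Omega> (\<lambda>z. A (pt z) (inv_into (tangent_space \<A> (pt z)) (comps x) w) (lift \<theta> (pt z) e))"
    by (rule smooth_fun_onW) (use W S in blast)
  then show "smooth_on \<Omega> (\<lambda>z. tensor_coords A z w e)"
    by (rule smooth_on_cong[OF \<Omega>_open, THEN iffD1, rotated]) (simp only: tensor_coords_def comps_inv[OF U pt_U(1)])
qed

lemma dual_tensor_section_of_coords:
  assumes B: "smooth_bilinear \<Omega> B"
  shows "dual_tensor_section \<A> (tangent_bundle \<A>) F W (\<lambda>p v a. B (x p) (comps x v) (\<theta> p a))"
proof (rule dual_tensor_sectionI)
  have b: "bilinear (B (x p))" if "p \<in> W" for p by (rule smooth_bilinearD(1)[OF B]) (use that in blast)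
  show "linear_on_space (fibre F p) (\<lambda>a. B (x p) (comps x v) (\<theta> p a))" if p: "p \<in> W" for p v
    using p W triv_add[OF V] triv_scaleR[OF V]
    by (auto simp: linear_on_space_def bilinear_radd[OF b[OF p]] bilinear_rmul[OF b[OF p]])
  show "linear_on_space (tangent_space \<A> p) (\<lambda>v. B (x p) (comps x v) (\<theta> p a))" if p: "p \<in> W" for p a
  proof -
    have "comps x (v + w) = comps x v + comps x w" "comps x (c *\<^sub>R v) = c *\<^sub>R comps x v" for v w c
      by (simp_all add: comps_def plus_fun_def scaleR_fun_def vec_eq_iff)
    then show ?thesis by (simp add: linear_on_space_def bilinear_ladd[OF b[OF p]] bilinear_lmul[OF b[OF p]])
  qed
  fix U' \<tau> V' \<theta>' w e assume U': "(U', \<tau>) \<in> trivs (tangent_bundle \<A>)" and V': "(V', \<theta>') \<in> trivs F"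
  let ?N = "U' \<inter> V' \<inter> W"
  have o: "open ?N" and NU: "?N \<subseteq> U" using triv_props(1)[OF V'] TM.triv_props(1)[OF U'] W by auto
  note oN = chart_open_image[OF U o NU]
  have BN: "smooth_bilinear (x ` ?N) B" by (rule smooth_bilinear_subset[OF B]) blast
  have "smooth_fun_on \<A> ?N (\<lambda>p. comps x (inv_into (tangent_space \<A> p) (\<tau> p) w))"
    by (rule smooth_fun_on_subset[OF TM.transition_smooth[OF U' tangent_bundle_simps(2)[OF U], unfolded tangent_bundle_simps(1)]])
      (use W in blast)
  then have 1: "smooth_on (x ` ?N) (\<lambda>z. comps x (inv_into (tangent_space \<A> (pt z)) (\<tau> (pt z)) w))"
    by (rule smooth_fun_onD[OF _ U]) (use NU in blast)
  have "smooth_fun_on \<A> ?N (\<lambda>p. \<theta> p (lift \<theta>' p e))"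
    by (rule smooth_fun_on_subset[OF transition_smooth[OF V' V]]) (use W in blast)
  then have 2: "smooth_on (x ` ?N) (\<lambda>z. \<theta> (pt z) (lift \<theta>' (pt z) e))"
    by (rule smooth_fun_onD[OF _ U]) (use NU in blast)
  from smooth_bilinear_apply(1)[OF oN BN 1 2]
  have "smooth_on (x ` ?N) (\<lambda>z. B (x (pt z)) (comps x (inv_into (tangent_space \<A> (pt z)) (\<tau> (pt z)) w)) (\<theta> (pt z) (lift \<theta>' (pt z) e)))"
    by (rule smooth_on_cong[OF oN, THEN iffD1, rotated]) (auto simp: pt_x)
  then show "smooth_fun_on \<A> ?N (\<lambda>p. B (x p) (comps x (inv_into (tangent_space \<A> p) (\<tau> p) w)) (\<theta> p (lift \<theta>' p e)))"
    by (rule smooth_fun_on_chartI[OF U o NU])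
qed

lemma tensor_coords_of_coords:
  "z \<in> \<Omega> \<Longrightarrow> tensor_coords (\<lambda>p v a. B (x p) (comps x v) (\<theta> p a)) z u e = B z u e"
  using comps_chart_vector[OF U pt_U(1)] triv_lift[OF V pt_U(2)] pt_W(2) by (simp add: tensor_coords_def)

context
  fixes \<phi> D \<Gamma>
  assumes \<phi>: "bundle_map \<A> (tangent_bundle \<A>) F \<phi>" and conn: "connection_on \<A> F UNIV D"
    and rep: "represents UNIV D \<Gamma>"
begin

lemma curvature_identity_coords:
  "curvature_identity k \<phi> D W A \<longleftrightarrow> (\<forall>z\<in>\<Omega>. \<forall>u v e. curv \<Gamma> z u v e =
     k *\<^sub>R (tensor_coords A z v e *\<^sub>R map_coord \<phi> z u - tensor_coords A z u e *\<^sub>R map_coord \<phi> z v))"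
proof -
  have eq: "curvature \<A> D X Y \<eta> (pt z) = k *\<^sub>R (A (pt z) (Y (pt z)) (\<eta> (pt z)) *\<^sub>R \<phi> (pt z) (X (pt z))
       - A (pt z) (X (pt z)) (\<eta> (pt z)) *\<^sub>R \<phi> (pt z) (Y (pt z))) \<longleftrightarrow>
     curv \<Gamma> z (vcoord X z) (vcoord Y z) (scoord \<eta> z) =
     k *\<^sub>R (tensor_coords A z (vcoord Y z) (scoord \<eta> z) *\<^sub>R map_coord \<phi> z (vcoord X z) - tensor_coords A z (vcoord X z) (scoord \<eta> z) *\<^sub>R map_coord \<phi> z (vcoord Y z))"
    if X: "X \<in> vector_fields \<A> UNIV" and Y: "Y \<in> vector_fields \<A> UNIV" and \<eta>: "\<eta> \<in> sections \<A> F UNIV" and z: "z \<in> \<Omega>"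
    for X Y \<eta> z
  proof -
    let ?p = "pt z"
    have pV: "?p \<in> V" and pU: "?p \<in> U" using pt_U[OF z] by auto
    have t: "tensor_coords A z (vcoord Z z) (scoord \<eta> z) = A ?p (Z ?p) (\<eta> ?p)" if Z: "Z \<in> vector_fields \<A> UNIV" for Z
      using chart_vector_comps[OF U pU vf_tangent[OF Z]] lift_triv[OF V pV sec_fibre'[OF \<eta>]]
      by (simp add: tensor_coords_def vcoord_def scoord_def)
    have f: "\<phi> ?p (Z ?p) \<in> fibre F ?p" if "Z \<in> vector_fields \<A> UNIV" for Z
      by (rule bundle_map_fibre[OF \<phi> vf_tangent[OF that]])
    have c: "curvature \<A> D X Y \<eta> ?p \<in> fibre F ?p"
      by (rule sec_fibre'[OF curvature_section[OF open_UNIV conn X Y \<eta>]])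
    let ?r = "k *\<^sub>R (A ?p (Y ?p) (\<eta> ?p) *\<^sub>R \<phi> ?p (X ?p) - A ?p (X ?p) (\<eta> ?p) *\<^sub>R \<phi> ?p (Y ?p))"
    have r: "?r \<in> fibre F ?p" by (intro subspace_scale subspace_diff fibre_subspace f X Y)
    have "\<theta> ?p ?r = k *\<^sub>R (tensor_coords A z (vcoord Y z) (scoord \<eta> z) *\<^sub>R map_coord \<phi> z (vcoord X z)
        - tensor_coords A z (vcoord X z) (scoord \<eta> z) *\<^sub>R map_coord \<phi> z (vcoord Y z))"
      unfolding t[OF X] t[OF Y]
      using scoord_bundle_map[OF \<phi> X z] scoord_bundle_map[OF \<phi> Y z] f[OF X] f[OF Y]
      by (simp add: scoord_def triv_scaleR[OF V pV] triv_diff[OF V pV]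
          subspace_diff[OF fibre_subspace] subspace_scale[OF fibre_subspace])
    moreover have "\<theta> ?p (curvature \<A> D X Y \<eta> ?p) = curv \<Gamma> z (vcoord X z) (vcoord Y z) (scoord \<eta> z)"
      using scoord_curvature[OF open_UNIV subset_UNIV conn rep X Y \<eta> z] by (simp add: scoord_def)
    ultimately show ?thesis using triv_inject[OF V pV c r] by metis
  qed
  show ?thesis
  proof
    assume id: "curvature_identity k \<phi> D W A"
    show "\<forall>z\<in>\<Omega>. \<forall>u v e. curv \<Gamma> z u v e =
     k *\<^sub>R (tensor_coords A z v e *\<^sub>R map_coord \<phi> z u - tensor_coords A z u e *\<^sub>R map_coord \<phi> z v)"
    proof (intro ballI allI)
      fix z u v e assume z: "z \<in> \<Omega>"
      obtain X where X: "X \<in> vector_fields \<A> UNIV" "vcoord X z = u" by (rule vf_through[OF open_UNIV subset_UNIV z])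
      obtain Y where Y: "Y \<in> vector_fields \<A> UNIV" "vcoord Y z = v" by (rule vf_through[OF open_UNIV subset_UNIV z])
      obtain \<eta> where \<eta>: "\<eta> \<in> sections \<A> F UNIV" "scoord \<eta> z = e" by (rule sec_through[OF open_UNIV subset_UNIV z])
      show "curv \<Gamma> z u v e = k *\<^sub>R (tensor_coords A z v e *\<^sub>R map_coord \<phi> z u - tensor_coords A z u e *\<^sub>R map_coord \<phi> z v)"
        using eq[OF X(1) Y(1) \<eta>(1) z] id[unfolded curvature_identity_def, rule_format, OF X(1) Y(1) \<eta>(1) pt_W(1)[OF z]]
        unfolding X(2) Y(2) \<eta>(2) by blast
    qed
  next
    assume c: "\<forall>z\<in>\<Omega>. \<forall>u v e. curv \<Gamma> z u v e =
     k *\<^sub>R (tensor_coords A z v e *\<^sub>R map_coord \<phi> z u - tensor_coords A z u e *\<^sub>R map_coord \<phi> z v)"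
    show "curvature_identity k \<phi> D W A"
      unfolding curvature_identity_def
    proof (intro ballI)
      fix X Y \<eta> p assume X: "X \<in> vector_fields \<A> UNIV" and Y: "Y \<in> vector_fields \<A> UNIV"
        and \<eta>: "\<eta> \<in> sections \<A> F UNIV" and p: "p \<in> W"
      have z: "x p \<in> \<Omega>" using p by blast
      show "curvature \<A> D X Y \<eta> p = k *\<^sub>R (A p (Y p) (\<eta> p) *\<^sub>R \<phi> p (X p) - A p (X p) (\<eta> p) *\<^sub>R \<phi> p (Y p))"
        using iffD2[OF eq[OF X Y \<eta> z] c[rule_format, OF z]] unfolding pt_x[OF p] .
    qed
  qed
qed

text \<open>The trivialization that defines the trace is an arbitrary one around \<open>p\<close>; passing to the given one conjugates
  the matrix.\<close>

lemma fibre_trace_coords: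
  assumes p: "p \<in> W" and T: "linear T"
    and L: "\<And>w. L (lift \<theta> p w) \<in> fibre F p" "\<And>w. \<theta> p (L (lift \<theta> p w)) = T w"
  shows "fibre_trace F p L = (\<Sum>b\<in>Basis. T b \<bullet> b)"
proof -
  have pV: "p \<in> V" using p W by blast
  define t where "t = (SOME t. t \<in> trivs F \<and> p \<in> fst t)"
  obtain V' \<theta>' where t': "t = (V', \<theta>')" by (cases t)
  have "\<exists>t. t \<in> trivs F \<and> p \<in> fst t" using V pV by (intro exI[of _ "(V, \<theta>)"]) simp
  then have "t \<in> trivs F \<and> p \<in> fst t" unfolding t_def by (rule someI_ex)
  then have V': "(V', \<theta>') \<in> trivs F" and pV': "p \<in> V'" unfolding t' by auto
  define g where "g = (\<lambda>w. \<theta>' p (lift \<theta> p w))"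
  define h where "h = (\<lambda>w. \<theta> p (lift \<theta>' p w))"
  have g: "linear g" unfolding g_def
    by (rule linearI) (simp_all add: lift_add[OF V pV] lift_scaleR[OF V pV] triv_add[OF V' pV'] triv_scaleR[OF V' pV'] lift_in[OF V pV])
  have h: "linear h" unfolding h_def
    by (rule linearI) (simp_all add: lift_add[OF V' pV'] lift_scaleR[OF V' pV'] triv_add[OF V pV] triv_scaleR[OF V pV] lift_in[OF V' pV'])
  have hg: "h (g w) = w" for w
    by (simp add: g_def h_def lift_triv[OF V' pV' lift_in[OF V pV]] triv_lift[OF V pV])
  have L': "\<theta>' p (L (lift \<theta>' p w)) = g (T (h w))" for w
  proof -
    have "lift \<theta> p (h w) = lift \<theta>' p w" unfolding h_def by (rule lift_triv[OF V pV lift_in[OF V' pV']])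
    moreover have "lift \<theta> p (T (h w)) = L (lift \<theta> p (h w))"
      unfolding L(2)[of "h w", symmetric] by (rule lift_triv[OF V pV L(1)])
    ultimately show ?thesis unfolding g_def by simp
  qed
  have "fibre_trace F p L = trace (matrix (\<lambda>w. \<theta>' p (L (lift \<theta>' p w))))"
    unfolding fibre_trace_def t_def[symmetric] t' by simp
  also have "\<dots> = trace (matrix ((g \<circ> T) \<circ> h))" unfolding L' o_def ..
  also have "\<dots> = trace (matrix (g \<circ> T) ** matrix h)"
    using matrix_compose[OF h linear_compose[OF T g]] by simp
  also have "\<dots> = trace (matrix h ** matrix (g \<circ> T))" by (rule trace_mul_sym)
  also have "\<dots> = trace (matrix (h \<circ> (g \<circ> T)))"
    using matrix_compose[OF linear_compose[OF T g] h] by simp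
  also have "h \<circ> (g \<circ> T) = T" by (simp add: fun_eq_iff hg)
  also have "trace (matrix T) = (\<Sum>i\<in>UNIV. T (axis i 1) \<bullet> axis i 1)"
    by (simp add: trace_def matrix_def inner_axis)
  also have "\<dots> = (\<Sum>b\<in>Basis. T b \<bullet> b)"
    by (rule sum.reindex_cong[of "\<lambda>i. axis i 1", symmetric])
      (auto simp: Basis_vec_def inj_on_def axis_eq_axis)
  finally show ?thesis .
qed

text \<open>The curvature endomorphism is evaluated on an arbitrary extension of a vector to a section; the value is that of
  the coordinate curvature, which depends on the vector alone.\<close>

lemma trace_coords:
  assumes X: "X \<in> vector_fields \<A> UNIV" and Y: "Y \<in> vector_fields \<A> UNIV" and p: "p \<in> W"
  shows "fibre_trace F p (curvature_endo \<A> F D X Y p) = (\<Sum>b\<in>Basis. curv \<Gamma> (x p) (vcoord X (x p)) (vcoord Y (x p)) b \<bullet> b)"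
proof (rule fibre_trace_coords[OF p])
  have z: "x p \<in> \<Omega>" and pV: "p \<in> V" using p W by auto
  note \<Gamma> = representsD(1)[OF rep]
  have g: "smooth_linear \<Omega> (\<lambda>y. \<Gamma> y u)" for u by (rule smooth_bilinear_linear(2)[OF \<Gamma>])
  have l: "linear (\<lambda>e. dd (\<lambda>y. \<Gamma> y u e) (x p) v)" for u v
    using smooth_linearD(1)[OF smooth_linear_dd_family[OF \<Omega>_open g] z] .
  have b: "bilinear (\<Gamma> (x p))" by (rule smooth_bilinearD(1)[OF \<Gamma> z])
  show "linear (curv \<Gamma> (x p) (vcoord X (x p)) (vcoord Y (x p)))"
    unfolding curv_def
    by (rule linearI) (simp_all add: bilinear_simps[OF b] linear_add[OF l] linear_cmul[OF l] algebra_simps)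
  fix w
  define \<eta> where "\<eta> = (SOME \<eta>. \<eta> \<in> sections \<A> F UNIV \<and> \<eta> p = lift \<theta> p w)"
  have "\<exists>\<eta>. \<eta> \<in> sections \<A> F UNIV \<and> \<eta> p = lift \<theta> p w"
  proof -
    obtain s where s: "s \<in> sections \<A> F UNIV" "scoord s (x p) = w" by (rule sec_through[OF open_UNIV subset_UNIV z])
    have "s p = lift \<theta> p w"
      using lift_triv[OF V pV sec_fibre'[OF s(1)]] s(2) pt_x[OF p] by (simp add: scoord_def)
    then show ?thesis using s by blast
  qed
  then have \<eta>: "\<eta> \<in> sections \<A> F UNIV" "\<eta> p = lift \<theta> p w" unfolding \<eta>_def by (metis (mono_tags, lifting) someI_ex)+
  have e: "curvature_endo \<A> F D X Y p (lift \<theta> p w) = curvature \<A> D X Y \<eta> p"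
    unfolding curvature_endo_def \<eta>_def ..
  show "curvature_endo \<A> F D X Y p (lift \<theta> p w) \<in> fibre F p"
    unfolding e by (rule sec_fibre'[OF curvature_section[OF open_UNIV conn X Y \<eta>(1)]])
  show "\<theta> p (curvature_endo \<A> F D X Y p (lift \<theta> p w)) = curv \<Gamma> (x p) (vcoord X (x p)) (vcoord Y (x p)) w"
    unfolding e using scoord_curvature[OF open_UNIV subset_UNIV conn rep X Y \<eta>(1) z] \<eta>(2) triv_lift[OF V pV] pt_x[OF p]
    by (simp add: scoord_def)
qed

lemma trace_free_coords:
  assumes tr: "\<forall>X\<in>vector_fields \<A> UNIV. \<forall>Y\<in>vector_fields \<A> UNIV. \<forall>p. fibre_trace F p (curvature_endo \<A> F D X Y p) = 0"
    and z: "z \<in> \<Omega>"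
  shows "(\<Sum>b\<in>Basis. curv \<Gamma> z u v b \<bullet> b) = 0"
proof -
  obtain X where X: "X \<in> vector_fields \<A> UNIV" "vcoord X z = u" by (rule vf_through[OF open_UNIV subset_UNIV z])
  obtain Y where Y: "Y \<in> vector_fields \<A> UNIV" "vcoord Y z = v" by (rule vf_through[OF open_UNIV subset_UNIV z])
  show ?thesis
    using trace_coords[OF X(1) Y(1) pt_W(1)[OF z]] tr X(1) Y(1) unfolding pt_W(2)[OF z] X(2) Y(2) by simp
qed

end

context
  fixes \<phi> assumes \<phi>: "bundle_map \<A> (tangent_bundle \<A>) F \<phi>"
begin

text \<open>In coordinates the image of \<open>\<phi>\<close> at \<open>p\<close> is carried isomorphically onto the range of a linear map, and a spanning
  set bounds the dimension.\<close>

lemma rank_le_card_of_span: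
  assumes p: "p \<in> W" and K: "finite K" "range (map_coord \<phi> (x p)) \<subseteq> span K"
  shows "rank_at \<A> \<phi> p \<le> card K"
proof -
  have pV: "p \<in> V" and pU: "p \<in> U" using p W by auto
  have "\<phi> p ` tangent_space \<A> p \<subseteq> lift \<theta> p ` span K"
  proof safe
    fix v assume v: "v \<in> tangent_space \<A> p"
    have "map_coord \<phi> (x p) (comps x v) = \<theta> p (\<phi> p v)"
      using chart_vector_comps[OF U pU v] by (simp add: map_coord_def pt_x[OF p])
    then have "lift \<theta> p (map_coord \<phi> (x p) (comps x v)) = \<phi> p v"
      using lift_triv[OF V pV bundle_map_fibre[OF \<phi> v]] by simp
    then show "\<phi> p v \<in> lift \<theta> p ` span K" using K(2) by (metis imageI rangeI subsetD)
  qed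
  also have "lift \<theta> p ` span K = span (lift \<theta> p ` K)"
    by (rule linear_span_image[OF linear_lift[OF V pV], symmetric])
  finally have "rank_at \<A> \<phi> p \<le> card (lift \<theta> p ` K)"
    unfolding rank_at_def using K(1) by (intro real_vector.dim_le_card) auto
  also have "\<dots> \<le> card K" by (rule card_image_le[OF K(1)])
  finally show ?thesis .
qed

lemma rank_at_le: "p \<in> W \<Longrightarrow> rank_at \<A> \<phi> p \<le> CARD('n)"
  using rank_le_card_of_span[of p Basis] by simp

lemma rank_three_independent:
  assumes "p \<in> W" "rank_at \<A> \<phi> p \<ge> 3"
  shows "\<exists>w. map_coord \<phi> (x p) w \<notin> span {map_coord \<phi> (x p) u, map_coord \<phi> (x p) v}"
proof (rule ccontr)
  assume "\<nexists>w. map_coord \<phi> (x p) w \<notin> span {map_coord \<phi> (x p) u, map_coord \<phi> (x p) v}"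
  then have "rank_at \<A> \<phi> p \<le> card {map_coord \<phi> (x p) u, map_coord \<phi> (x p) v}"
    by (intro rank_le_card_of_span[OF assms(1)]) auto
  also have "\<dots> \<le> 2" by (simp add: card_insert_if)
  finally show False using assms(2) by simp
qed

text \<open>A nonempty open set is not negligible, so it cannot consist of exceptional points.\<close>

lemma ae_dense:
  assumes "manifold_ae \<A> P"
  shows "\<Omega> \<subseteq> closure (x ` {p \<in> W. P p})"
proof
  fix z assume z: "z \<in> \<Omega>"
  show "z \<in> closure (x ` {p \<in> W. P p})"
  proof (rule ccontr)
    let ?N = "\<Omega> - closure (x ` {p \<in> W. P p})"
    assume "z \<notin> closure (x ` {p \<in> W. P p})"
    then have "?N \<noteq> {}" using z by blast
    moreover have "open ?N" using \<Omega>_open by (intro open_Diff) auto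
    ultimately have "\<not> negligible ?N" using open_not_negligible[of ?N] by simp
    moreover have "?N \<subseteq> x ` {p \<in> U. \<not> P p}"
    proof
      fix y assume y: "y \<in> ?N"
      then obtain p where p: "p \<in> W" "y = x p" by blast
      have "\<not> P p"
      proof
        assume "P p"
        then have "y \<in> closure (x ` {p \<in> W. P p})" using p by (intro subsetD[OF closure_subset]) auto
        then show False using y by blast
      qed
      then show "y \<in> x ` {p \<in> U. \<not> P p}" using p W by blast
    qed
    moreover have "negligible (x ` {p \<in> U. \<not> P p})" using assms U unfolding manifold_ae_def by blast
    ultimately show False using negligible_subset by blast
  qed
qed

end

end

section \<open>Coherent tangent bundles\<close>

locale coherent_bundle = smooth_bundle \<A> F
  for \<A> :: "('m::{t2_space, second_countable_topology}, 'n::finite) chart set"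
    and F :: "('m, 'e::real_vector, 'n) vbundle" +
  fixes \<phi> :: "'m \<Rightarrow> 'm tangent \<Rightarrow> 'e" and D :: "('m, 'e) connection" and k :: real
  assumes \<phi>: "bundle_map \<A> (tangent_bundle \<A>) F \<phi>"
    and conn: "connection_on \<A> F UNIV D"
    and tf: "rel_torsion_free_on \<A> UNIV \<phi> D"
    and rank: "manifold_ae \<A> (\<lambda>p. rank_at \<A> \<phi> p \<ge> 3)"
    and tr: "\<forall>X\<in>vector_fields \<A> UNIV. \<forall>Y\<in>vector_fields \<A> UNIV. \<forall>p. fibre_trace F p (curvature_endo \<A> F D X Y p) = 0"
    and k: "k = 1 / (real CARD('n) - 1)"
begin

lemma dense_rank_three:
  assumes "coord_nbhd \<A> F U x V \<theta> W"
  obtains G where "x ` W \<subseteq> closure G" "G \<subseteq> x ` W"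
    "\<forall>z\<in>G. \<forall>u v. \<exists>w. coord_nbhd.map_coord \<A> U x \<theta> \<phi> z w \<notin> span {coord_nbhd.map_coord \<A> U x \<theta> \<phi> z u, coord_nbhd.map_coord \<A> U x \<theta> \<phi> z v}"
proof -
  interpret C: coord_nbhd \<A> F U x V \<theta> W by (rule assms)
  show thesis
  proof (rule that[of "x ` {p \<in> W. rank_at \<A> \<phi> p \<ge> 3}"])
    show "x ` W \<subseteq> closure (x ` {p \<in> W. rank_at \<A> \<phi> p \<ge> 3})" by (rule C.ae_dense[OF \<phi> rank])
    show "\<forall>z\<in>x ` {p \<in> W. rank_at \<A> \<phi> p \<ge> 3}. \<forall>u v. \<exists>w. C.map_coord \<phi> z w \<notin> span {C.map_coord \<phi> z u, C.map_coord \<phi> z v}"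
      using C.rank_three_independent[OF \<phi>] by blast
  qed auto
qed

text \<open>The hypothesis on the rank forces \<open>n \<ge> 3\<close>, since there are points at which it holds.\<close>

lemma k_nonzero: "k \<noteq> 0"
proof -
  fix p :: 'm
  obtain U x V \<theta> W where C: "coord_nbhd \<A> F U x V \<theta> W" and p: "p \<in> W"
    using coord_nbhd_at[OF open_UNIV UNIV_I, of p] by metis
  interpret C: coord_nbhd \<A> F U x V \<theta> W by (rule C)
  have "x p \<in> closure (x ` {q \<in> W. rank_at \<A> \<phi> q \<ge> 3})"
    by (rule subsetD[OF C.ae_dense[OF \<phi> rank]]) (use p in blast)
  then have "x ` {q \<in> W. rank_at \<A> \<phi> q \<ge> 3} \<noteq> {}" using closure_empty by (metis empty_iff)
  then obtain q where q: "q \<in> W" "rank_at \<A> \<phi> q \<ge> 3" by blast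
  then have "CARD('n) \<ge> 3" using C.rank_at_le[OF \<phi> q(1)] by simp
  then show ?thesis by (simp add: k)
qed

text \<open>The tensor \<open>A\<close> is unique: the difference \<open>B\<close> of two of them satisfies \<open>B(v,e) \<phi>(w) = B(w,e) \<phi>(v)\<close>.  Where the
  rank is at least \<open>2\<close>, some \<open>\<phi>(w)\<close> is no multiple of \<open>\<phi>(v)\<close>, so \<open>B(v,e) = 0\<close>; such points are dense.\<close>

lemma tensor_unique:
  assumes N: "open N" "p \<in> N"
    and A: "dual_tensor_section \<A> (tangent_bundle \<A>) F N A" "curvature_identity k \<phi> D N A"
    and A': "dual_tensor_section \<A> (tangent_bundle \<A>) F N A'" "curvature_identity k \<phi> D N A'"
    and v: "v \<in> tangent_space \<A> p" and a: "a \<in> fibre F p"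
  shows "A p v a = A' p v a"
proof -
  obtain U x V \<theta> W where C: "coord_nbhd \<A> F U x V \<theta> W" and p: "p \<in> W" and WN: "W \<subseteq> N"
    using coord_nbhd_at[OF N] by metis
  interpret C: coord_nbhd \<A> F U x V \<theta> W by (rule C)
  obtain \<Gamma> where rep: "C.represents UNIV D \<Gamma>" by (rule C.exists_representation[OF open_UNIV subset_UNIV conn])
  let ?B = "C.tensor_coords A" and ?B' = "C.tensor_coords A'" and ?f = "C.map_coord \<phi>"
  have B: "smooth_bilinear C.\<Omega> ?B" "smooth_bilinear C.\<Omega> ?B'"
    by (rule C.smooth_bilinear_tensor_coords[OF A(1) WN], rule C.smooth_bilinear_tensor_coords[OF A'(1) WN])
  have "curvature_identity k \<phi> D W A" "curvature_identity k \<phi> D W A'"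
    using A(2) A'(2) WN unfolding curvature_identity_def by blast+
  then have R: "\<forall>z\<in>C.\<Omega>. \<forall>u v e. curv \<Gamma> z u v e = k *\<^sub>R (?B z v e *\<^sub>R ?f z u - ?B z u e *\<^sub>R ?f z v)"
    and R': "\<forall>z\<in>C.\<Omega>. \<forall>u v e. curv \<Gamma> z u v e = k *\<^sub>R (?B' z v e *\<^sub>R ?f z u - ?B' z u e *\<^sub>R ?f z v)"
    unfolding C.curvature_identity_coords[OF \<phi> conn rep] by blast+
  have rel: "(?B z v e - ?B' z v e) *\<^sub>R ?f z u = (?B z u e - ?B' z u e) *\<^sub>R ?f z v" if z: "z \<in> C.\<Omega>" for z u v e
  proof -
    have "k *\<^sub>R (?B z v e *\<^sub>R ?f z u - ?B z u e *\<^sub>R ?f z v) = k *\<^sub>R (?B' z v e *\<^sub>R ?f z u - ?B' z u e *\<^sub>R ?f z v)"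
      using R R' z by metis
    then have "?B z v e *\<^sub>R ?f z u - ?B z u e *\<^sub>R ?f z v = ?B' z v e *\<^sub>R ?f z u - ?B' z u e *\<^sub>R ?f z v"
      unfolding scaleR_cancel_left using k_nonzero by blast
    then show ?thesis by (simp add: algebra_simps)
  qed
  obtain G where G: "C.\<Omega> \<subseteq> closure G" "G \<subseteq> C.\<Omega>" "\<forall>z\<in>G. \<forall>u v. \<exists>w. ?f z w \<notin> span {?f z u, ?f z v}"
    by (rule dense_rank_three[OF C])
  have zero: "?B z v e - ?B' z v e = 0" if z: "z \<in> C.\<Omega>" for z v e
  proof (rule zero_of_dense_zero[OF C.\<Omega>_open _ G(1) _ z])
    show "continuous_on C.\<Omega> (\<lambda>z. ?B z v e - ?B' z v e)"
      by (intro continuous_on_diff smooth_on_continuous_on smooth_bilinearD(2)[OF B(1)] smooth_bilinearD(2)[OF B(2)])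
    fix y assume y: "y \<in> G"
    obtain w where w: "?f y w \<notin> span {?f y v, ?f y v}" using G(3) y by blast
    show "?B y v e - ?B' y v e = 0"
    proof (rule ccontr)
      let ?d = "?B y v e - ?B' y v e"
      assume d: "?d \<noteq> 0"
      have "?d *\<^sub>R ?f y w = (?B y w e - ?B' y w e) *\<^sub>R ?f y v" by (rule rel) (use G(2) y in blast)
      then have "(1 / ?d) *\<^sub>R (?d *\<^sub>R ?f y w) = (1 / ?d) *\<^sub>R ((?B y w e - ?B' y w e) *\<^sub>R ?f y v)" by (rule arg_cong)
      then have "?f y w = (1 / ?d) *\<^sub>R ((?B y w e - ?B' y w e) *\<^sub>R ?f y v)" using d by simp
      also have "\<dots> \<in> span {?f y v, ?f y v}" by (intro span_scale span_base) simp
      finally show False using w by blast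
    qed
  qed
  have z: "x p \<in> C.\<Omega>" and pU: "p \<in> U" "p \<in> V" using p C.W by auto
  have "C.tensor_coords T (x p) (comps x v) (\<theta> p a) = T p v a" for T
    using chart_vector_comps[OF C.U pU(1) v] lift_triv[OF C.V pU(2) a]
    by (simp add: C.tensor_coords_def C.pt_x[OF p])
  then show ?thesis using zero[OF z, of "comps x v" "\<theta> p a"] by simp
qed

text \<open>A flat connection projectively equivalent to \<open>D\<close> determines the curvature of \<open>D\<close> up to the scalar part, which is removed
  by the trace condition; the tensor is \<open>n - 1\<close> times the Schouten tensor of \<open>\<rho>\<close>.\<close>

lemma local_tensor:
  assumes "projectively_flat \<A> F \<phi> D"
  obtains N A where "open N" "p \<in> N" "dual_tensor_section \<A> (tangent_bundle \<A>) F N A" "curvature_identity k \<phi> D N A"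
proof -
  obtain S DS D' where S: "open S" "p \<in> S" and restr: "restricts_to \<A> F S D DS"
    and pe: "projectively_equivalent_on \<A> F S \<phi> DS D'" and flat: "flat_on \<A> F S D'"
    using assms unfolding projectively_flat_def by blast
  have connS: "connection_on \<A> F S DS" and tfS: "rel_torsion_free_on \<A> S \<phi> DS" and conn': "connection_on \<A> F S D'"
    using pe unfolding projectively_equivalent_on_def by blast+
  obtain \<rho> where \<rho>: "dual_section \<A> F S \<rho>" and D': "\<forall>X\<in>vector_fields \<A> S. \<forall>\<eta>\<in>sections \<A> F S. \<forall>p\<in>S.
         D' X \<eta> p = DS X \<eta> p + \<rho> p (\<phi> p (X p)) *\<^sub>R \<eta> p + \<rho> p (\<eta> p) *\<^sub>R \<phi> p (X p)"
    using pe unfolding projectively_equivalent_on_def by blast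
  obtain U x V \<theta> W where C: "coord_nbhd \<A> F U x V \<theta> W" and p: "p \<in> W" and WS: "W \<subseteq> S"
    using coord_nbhd_at[OF S] by metis
  interpret C: coord_nbhd \<A> F U x V \<theta> W by (rule C)
  obtain \<Gamma> where rep: "C.represents S DS \<Gamma>" by (rule C.exists_representation[OF S(1) WS connS])
  note \<Gamma> = C.representsD(1)[OF rep]
  have repD: "C.represents UNIV D \<Gamma>"
    unfolding C.represents_def
  proof (intro conjI ballI \<Gamma>)
    fix X \<eta> z assume X: "X \<in> vector_fields \<A> UNIV" and \<eta>: "\<eta> \<in> sections \<A> F UNIV" and z: "z \<in> C.\<Omega>"
    have zW: "C.pt y \<in> S" if "y \<in> C.\<Omega>" for y using C.pt_W(1)[OF that] WS by blast
    have "C.scoord (D X \<eta>) z = C.scoord (restrict_section S (D X \<eta>)) z"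
      using zW[OF z] by (simp add: C.scoord_def restrict_section_def)
    also have "restrict_section S (D X \<eta>) = DS (restrict_section S X) (restrict_section S \<eta>)"
      using restr X \<eta> unfolding restricts_to_def by simp
    also have "C.scoord \<dots> z = cov \<Gamma> (C.vcoord (restrict_section S X)) (C.scoord (restrict_section S \<eta>)) z"
      by (rule C.representsD(2)[OF rep TM.sections_restrict[OF X S(1)] sections_restrict[OF \<eta> S(1)] z]) auto
    also have "\<dots> = cov \<Gamma> (C.vcoord X) (C.scoord \<eta>) z"
      by (rule C.cov_cong[OF _ _ z]) (use zW in \<open>simp_all add: C.scoord_def C.vcoord_def restrict_section_def\<close>)
    finally show "C.scoord (D X \<eta>) z = cov \<Gamma> (C.vcoord X) (C.scoord \<eta>) z" .
  qed
  note tfc = C.torsion_free_coords[OF \<phi> S(1) WS connS rep tfS]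
  let ?r = "\<lambda>z e. \<rho> (C.pt z) (lift \<theta> (C.pt z) e)"
  note rc = C.dual_section_coords[OF \<phi> \<rho> WS]
  note rep' = C.represents_proj_change[OF \<phi> S(1) WS connS rep tfc conn' \<rho> D']
  let ?P = "schouten (C.map_coord \<phi>) ?r \<Gamma>"
  note lin = C.smooth_linear_map_coord[OF \<phi>]
  have R: "curv \<Gamma> z u v e = ?P z v e *\<^sub>R C.map_coord \<phi> z u - ?P z u e *\<^sub>R C.map_coord \<phi> z v" if z: "z \<in> C.\<Omega>" for z u v e
    by (rule curv_of_flat_proj_change[OF C.\<Omega>_open \<Gamma> lin tfc rc z C.flat_on_coords[OF S(1) WS conn' rep' flat z]
          C.trace_free_coords[OF \<phi> conn repD tr z]])
  note P = smooth_bilinear_schouten[OF C.\<Omega>_open \<Gamma> lin tfc rc]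
  define B where "B = (\<lambda>z u e. inverse k * ?P z u e)"
  have B: "smooth_bilinear C.\<Omega> B"
    unfolding smooth_bilinear_def
  proof (intro conjI ballI allI)
    fix z assume "z \<in> C.\<Omega>"
    then have b: "bilinear (?P z)" by (rule smooth_bilinearD(1)[OF P])
    show "bilinear (B z)" unfolding B_def bilinear_def
      by (intro conjI allI linearI) (simp_all add: bilinear_simps[OF b] algebra_simps)
  next
    have c: "smooth_on C.\<Omega> (\<lambda>z. inverse k)" by (rule smooth_on_const[OF C.\<Omega>_open])
    show "smooth_on C.\<Omega> (\<lambda>z. B z v w)" for v w unfolding B_def
      by (rule smooth_on_mult[OF C.\<Omega>_open c smooth_bilinearD(2)[OF P]])
  qed
  let ?A = "\<lambda>p v a. B (x p) (comps x v) (\<theta> p a)"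
  have kB: "k * B z u e = ?P z u e" for z u e
    unfolding B_def mult.assoc[symmetric] using right_inverse[OF k_nonzero] by simp
  have "curvature_identity k \<phi> D W ?A"
    unfolding C.curvature_identity_coords[OF \<phi> conn repD]
  proof (intro ballI allI)
    fix z u v e assume z: "z \<in> C.\<Omega>"
    show "curv \<Gamma> z u v e = k *\<^sub>R (C.tensor_coords ?A z v e *\<^sub>R C.map_coord \<phi> z u - C.tensor_coords ?A z u e *\<^sub>R C.map_coord \<phi> z v)"
      unfolding C.tensor_coords_of_coords[OF z] R[OF z] scaleR_diff_right scaleR_scaleR kB ..
  qed
  then show thesis by (rule that[OF C.W(1) p C.dual_tensor_section_of_coords[OF B]])
qed

text \<open>By uniqueness the local tensors agree on overlaps and define a global one.\<close>

lemma tensor_of_projectively_flat: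
  assumes "projectively_flat \<A> F \<phi> D"
  obtains A where "dual_tensor_section \<A> (tangent_bundle \<A>) F UNIV A" "curvature_identity k \<phi> D UNIV A"
proof -
  have "\<forall>p. \<exists>r. open (fst r) \<and> p \<in> fst r \<and> dual_tensor_section \<A> (tangent_bundle \<A>) F (fst r) (snd r) \<and>
      curvature_identity k \<phi> D (fst r) (snd r)"
  proof
    fix p
    obtain N A where "open N" "p \<in> N" "dual_tensor_section \<A> (tangent_bundle \<A>) F N A" "curvature_identity k \<phi> D N A"
      by (rule local_tensor[OF assms])
    then show "\<exists>r. open (fst r) \<and> p \<in> fst r \<and> dual_tensor_section \<A> (tangent_bundle \<A>) F (fst r) (snd r) \<and>
      curvature_identity k \<phi> D (fst r) (snd r)" by (intro exI[of _ "(N, A)"]) simp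
  qed
  from choice[OF this] obtain r where r: "\<forall>p. open (fst (r p)) \<and> p \<in> fst (r p) \<and>
    dual_tensor_section \<A> (tangent_bundle \<A>) F (fst (r p)) (snd (r p)) \<and> curvature_identity k \<phi> D (fst (r p)) (snd (r p))" ..
  define N where "N = (\<lambda>p. fst (r p))"
  define L where "L = (\<lambda>p. snd (r p))"
  have N: "open (N p)" "p \<in> N p" "dual_tensor_section \<A> (tangent_bundle \<A>) F (N p) (L p)"
    "curvature_identity k \<phi> D (N p) (L p)" for p using r unfolding N_def L_def by auto
  define A where "A = (\<lambda>p. L p p)"
  have A: "A q v a = L p q v a" if q: "q \<in> N p" and v: "v \<in> tangent_space \<A> q" and a: "a \<in> fibre F q" for p q v a
    unfolding A_def
  proof (rule tensor_unique[of "N p \<inter> N q" q "L q" "L p" v a])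
    show "open (N p \<inter> N q)" by (rule open_Int[OF N(1) N(1)])
    show "q \<in> N p \<inter> N q" using q N(2) by blast
    show "dual_tensor_section \<A> (tangent_bundle \<A>) F (N p \<inter> N q) (L q)" by (rule dual_tensor_section_subset[OF N(3)]) blast
    show "dual_tensor_section \<A> (tangent_bundle \<A>) F (N p \<inter> N q) (L p)" by (rule dual_tensor_section_subset[OF N(3)]) blast
    show "curvature_identity k \<phi> D (N p \<inter> N q) (L q)" "curvature_identity k \<phi> D (N p \<inter> N q) (L p)"
      using N(4) unfolding curvature_identity_def by blast+
  qed (rule v a)+
  have "dual_tensor_section \<A> (tangent_bundle \<A>) F UNIV A"
  proof (rule dual_tensor_sectionI)
    show "linear_on_space (fibre F p) (A p v)" if "v \<in> tangent_space \<A> p" for p v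
      unfolding A_def by (rule dual_tensor_sectionD(1)[OF N(3,2) that])
    show "linear_on_space (tangent_space \<A> p) (\<lambda>v. A p v a)" if "a \<in> fibre F p" for p a
      unfolding A_def by (rule dual_tensor_sectionD(2)[OF N(3,2) that])
    fix U \<tau> V \<theta> w z assume U: "(U, \<tau>) \<in> trivs (tangent_bundle \<A>)" and V: "(V, \<theta>) \<in> trivs F"
    show "smooth_fun_on \<A> (U \<inter> V \<inter> UNIV) (\<lambda>p. A p (inv_into (tangent_space \<A> p) (\<tau> p) w) (lift \<theta> p z))"
    proof (rule smooth_fun_on_locallyI)
      fix p assume p: "p \<in> U \<inter> V \<inter> UNIV"
      let ?M = "U \<inter> V \<inter> N p"
      have o: "open ?M" using triv_props(1)[OF V] TM.triv_props(1)[OF U] N(1) by (intro open_Int)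
      have "smooth_fun_on \<A> ?M (\<lambda>q. L p q (inv_into (tangent_space \<A> q) (\<tau> q) w) (lift \<theta> q z))"
        by (rule dual_tensor_sectionD(3)[OF N(3) U V])
      then have "smooth_fun_on \<A> ?M (\<lambda>q. A q (inv_into (tangent_space \<A> q) (\<tau> q) w) (lift \<theta> q z))"
      proof (rule smooth_fun_on_cong[OF o, rotated])
        fix q assume q: "q \<in> ?M"
        have "inv_into (tangent_space \<A> q) (\<tau> q) w \<in> tangent_space \<A> q"
          using TM.lift_in[OF U, of q w] q by (simp add: tangent_bundle_simps(1))
        moreover have "lift \<theta> q z \<in> fibre F q" using lift_in[OF V] q by blast
        ultimately show "L p q (inv_into (tangent_space \<A> q) (\<tau> q) w) (lift \<theta> q z) =
          A q (inv_into (tangent_space \<A> q) (\<tau> q) w) (lift \<theta> q z)" using A[of q p] q by simp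
      qed
      moreover have "p \<in> ?M" using p N(2) by blast
      ultimately show "\<exists>M. open M \<and> p \<in> M \<and> smooth_fun_on \<A> M (\<lambda>p. A p (inv_into (tangent_space \<A> p) (\<tau> p) w) (lift \<theta> p z))"
        using o by blast
    qed
  qed
  moreover have "curvature_identity k \<phi> D UNIV A"
    using N(2,4) unfolding curvature_identity_def A_def by blast
  ultimately show thesis by (rule that)
qed

text \<open>The trace condition makes \<open>A(u, \<phi>(v))\<close> symmetric, the Bianchi identity with the rank condition gives the Codazzi
  equation on a dense set and hence everywhere, and both together integrate to the form \<open>\<rho>\<close> on a small ball.\<close>

lemma projectively_flat_of_tensor:
  assumes A: "dual_tensor_section \<A> (tangent_bundle \<A>) F UNIV A" and id: "curvature_identity k \<phi> D UNIV A"
  shows "projectively_flat \<A> F \<phi> D"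
  unfolding projectively_flat_def
proof
  fix p
  obtain U x V \<theta> W where C: "coord_nbhd \<A> F U x V \<theta> W" and p: "p \<in> W"
    using coord_nbhd_at[OF open_UNIV UNIV_I, of p] by metis
  interpret C: coord_nbhd \<A> F U x V \<theta> W by (rule C)
  obtain \<Gamma> where rep: "C.represents UNIV D \<Gamma>" by (rule C.exists_representation[OF open_UNIV subset_UNIV conn])
  note \<Gamma> = C.representsD(1)[OF rep]
  note lin = C.smooth_linear_map_coord[OF \<phi>]
  note tfc = C.torsion_free_coords[OF \<phi> open_UNIV subset_UNIV conn rep tf]
  let ?f = "C.map_coord \<phi>"
  define B where "B = (\<lambda>z u e. k * C.tensor_coords A z u e)"
  note T = C.smooth_bilinear_tensor_coords[OF A subset_UNIV]
  have B: "smooth_bilinear C.\<Omega> B"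
    unfolding smooth_bilinear_def
  proof (intro conjI ballI allI)
    fix z assume "z \<in> C.\<Omega>"
    then have b: "bilinear (C.tensor_coords A z)" by (rule smooth_bilinearD(1)[OF T])
    show "bilinear (B z)" unfolding B_def bilinear_def
      by (intro conjI allI linearI) (simp_all add: bilinear_simps[OF b] algebra_simps add_divide_distrib)
  next
    have c: "smooth_on C.\<Omega> (\<lambda>z. k)" by (rule smooth_on_const[OF C.\<Omega>_open])
    show "smooth_on C.\<Omega> (\<lambda>z. B z v w)" for v w unfolding B_def
      by (rule smooth_on_mult[OF C.\<Omega>_open c smooth_bilinearD(2)[OF T]])
  qed
  have "curvature_identity k \<phi> D W A" using id unfolding curvature_identity_def by blast
  then have R: "curv \<Gamma> z u v e = B z v e *\<^sub>R ?f z u - B z u e *\<^sub>R ?f z v" if "z \<in> C.\<Omega>" for z u v e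
    unfolding C.curvature_identity_coords[OF \<phi> conn rep] B_def scaleR_scaleR[symmetric] scaleR_diff_right[symmetric]
    using that by blast
  \<comment> \<open>The trace of \<open>e \<mapsto> R(u,v)e\<close> is \<open>B(v,\<phi>(u)) - B(u,\<phi>(v))\<close>.\<close>
  have sym: "B z u (?f z v) = B z v (?f z u)" if z: "z \<in> C.\<Omega>" for z u v
  proof -
    have l: "linear (B z u)" for u using smooth_bilinearD(1)[OF B z] by (simp add: bilinear_def)
    have "0 = (\<Sum>b\<in>Basis. curv \<Gamma> z u v b \<bullet> b)" using C.trace_free_coords[OF \<phi> conn rep tr z] by simp
    also have "\<dots> = (\<Sum>b\<in>Basis. B z v b * (?f z u \<bullet> b) - B z u b * (?f z v \<bullet> b))"
      by (simp add: R[OF z] inner_diff_left)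
    also have "\<dots> = B z v (?f z u) - B z u (?f z v)"
      by (simp add: sum_subtractf sum_linear_form[OF l])
    finally show ?thesis by simp
  qed
  obtain G where G: "C.\<Omega> \<subseteq> closure G" "G \<subseteq> C.\<Omega>" "\<forall>z\<in>G. \<forall>u v. \<exists>w. ?f z w \<notin> span {?f z u, ?f z v}"
    by (rule dense_rank_three[OF C])
  have cod: "codazzi \<Gamma> B z u v e = 0" if z: "z \<in> C.\<Omega>" for z u v e
    by (rule codazzi_zero[OF C.\<Omega>_open \<Gamma> lin tfc B R G(1,2) _ z]) (use G(3) in blast)+
  have xp: "x p \<in> C.\<Omega>" using p by blast
  obtain r \<rho> where r: "r > 0" "ball (x p) r \<subseteq> C.\<Omega>" and \<rho>: "smooth_linear (ball (x p) r) \<rho>"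
    and flat: "\<forall>z\<in>ball (x p) r. \<forall>u v e. curv (proj_change ?f \<rho> \<Gamma>) z u v e = 0"
    by (rule exists_flat_proj_change[OF C.\<Omega>_open \<Gamma> lin tfc B R sym cod xp])
  define W' where "W' = C.pt ` ball (x p) r"
  have xW': "x ` W' = ball (x p) r"
  proof -
    have "x (C.pt z) = z" if "z \<in> ball (x p) r" for z using C.pt_W(2) r(2) that by blast
    then show ?thesis unfolding W'_def image_image by simp
  qed
  have W'W: "W' \<subseteq> W" unfolding W'_def using C.pt_W(1) r(2) by blast
  have pW': "p \<in> W'" unfolding W'_def using C.pt_x[OF p] r(1) by (intro image_eqI[of _ _ "x p"]) auto
  have oW': "open W'"
  proof -
    have "continuous_on W x"
      by (rule continuous_on_subset[OF homeomorphism_cont1[OF chart_homeomorphism[OF C.U]] C.W(2)])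
    then have "open (W \<inter> x -` ball (x p) r)" by (rule continuous_open_preimage[OF _ C.W(1) open_ball])
    moreover have "W \<inter> x -` ball (x p) r = W'"
      unfolding W'_def using C.pt_x C.pt_W r(2) by force
    ultimately show ?thesis by simp
  qed
  interpret C': coord_nbhd \<A> F U x V \<theta> W'
    by unfold_locales (use C.U C.V C.W oW' W'W in auto)
  have \<Gamma>': "smooth_bilinear C'.\<Omega> \<Gamma>" unfolding xW' by (rule smooth_bilinear_subset[OF \<Gamma> r(2)])
  have tf': "torsion_free C'.\<Omega> ?f \<Gamma>" unfolding xW' using tfc r(2) unfolding torsion_free_def by blast
  have \<rho>': "smooth_linear C'.\<Omega> \<rho>" unfolding xW' by (rule \<rho>)
  let ?\<Gamma>' = "proj_change ?f \<rho> \<Gamma>"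
  note b' = smooth_bilinear_proj_change[OF C'.\<Omega>_open \<Gamma>' C'.smooth_linear_map_coord[OF \<phi>] tf' \<rho>']
  have "restricts_to \<A> F W' D (C'.conn_of \<Gamma>)"
    unfolding restricts_to_def
  proof (intro conjI ballI C'.connection_on_conn_of[OF \<Gamma>'])
    fix X \<eta> assume X: "X \<in> vector_fields \<A> UNIV" and \<eta>: "\<eta> \<in> sections \<A> F UNIV"
    have X': "restrict_section W' X \<in> vector_fields \<A> W'" by (rule TM.sections_restrict[OF X oW']) simp
    have \<eta>': "restrict_section W' \<eta> \<in> sections \<A> F W'" by (rule sections_restrict[OF \<eta> oW']) simp
    interpret O: connection_operator \<A> F UNIV D by unfold_locales (use conn in auto)
    have D': "restrict_section W' (D X \<eta>) \<in> sections \<A> F W'" by (rule sections_restrict[OF O.D_section[OF X \<eta>] oW']) simp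
    show "C'.conn_of \<Gamma> (restrict_section W' X) (restrict_section W' \<eta>) = restrict_section W' (D X \<eta>)"
    proof (rule C'.section_eqI[OF C'.conn_of_section[OF \<Gamma>' X' \<eta>'] D'])
      fix z assume z: "z \<in> C'.\<Omega>"
      have zW: "C.pt y \<in> W'" if "y \<in> C'.\<Omega>" for y by (rule C'.pt_W(1)[OF that])
      have "C'.scoord (C'.conn_of \<Gamma> (restrict_section W' X) (restrict_section W' \<eta>)) z =
        cov \<Gamma> (C'.vcoord (restrict_section W' X)) (C'.scoord (restrict_section W' \<eta>)) z" by (rule C'.scoord_conn_of[OF z])
      also have "\<dots> = cov \<Gamma> (C'.vcoord X) (C'.scoord \<eta>) z"
        by (rule C'.cov_cong[OF _ _ z]) (use zW in \<open>simp_all add: C'.scoord_def C'.vcoord_def restrict_section_def\<close>)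
      also have "\<dots> = C.scoord (D X \<eta>) z"
        by (rule C.representsD(2)[OF rep X \<eta>, symmetric]) (use z r(2) xW' in blast)
      also have "\<dots> = C'.scoord (restrict_section W' (D X \<eta>)) z"
        using zW[OF z] by (simp add: C'.scoord_def restrict_section_def)
      finally show "C'.scoord (C'.conn_of \<Gamma> (restrict_section W' X) (restrict_section W' \<eta>)) z =
        C'.scoord (restrict_section W' (D X \<eta>)) z" .
    qed
  qed
  moreover have "projectively_equivalent_on \<A> F W' \<phi> (C'.conn_of \<Gamma>) (C'.conn_of ?\<Gamma>')"
    by (rule C'.projectively_equivalent_conn_of[OF \<phi> \<Gamma>' tf' \<rho>'])
  moreover have "flat_on \<A> F W' (C'.conn_of ?\<Gamma>')"
    by (rule C'.flat_onI[OF b']) (use flat xW' in blast)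
  ultimately show "\<exists>U. open U \<and> p \<in> U \<and> (\<exists>DU D'. restricts_to \<A> F U D DU \<and>
      projectively_equivalent_on \<A> F U \<phi> DU D' \<and> flat_on \<A> F U D')"
    using oW' pW' by blast
qed

end

theorem theorem3p13:
  fixes \<A> :: "('m::{t2_space, second_countable_topology}, 'n::finite) chart set"
    and E :: "('m, 'e::real_vector, 'n) vbundle"
    and \<phi> :: "'m \<Rightarrow> 'm tangent \<Rightarrow> 'e"
    and D :: "('m, 'e) connection"
  assumes "smooth_manifold \<A>"
    and "coherent_tangent_bundle \<A> E \<phi> D"
    and "manifold_ae \<A> (\<lambda>p. rank_at \<A> \<phi> p \<ge> 3)"
    and "\<forall>X\<in>vector_fields \<A> UNIV. \<forall>Y\<in>vector_fields \<A> UNIV. \<forall>p.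
           fibre_trace E p (curvature_endo \<A> E D X Y p) = 0"
  shows "projectively_flat \<A> E \<phi> D \<longleftrightarrow>
    (\<exists>A. dual_tensor_section \<A> (tangent_bundle \<A>) E UNIV A \<and>
      (\<forall>X\<in>vector_fields \<A> UNIV. \<forall>Y\<in>vector_fields \<A> UNIV. \<forall>\<eta>\<in>sections \<A> E UNIV. \<forall>p.
         curvature \<A> D X Y \<eta> p =
           (1 / (real CARD('n) - 1)) *\<^sub>R
             (A p (Y p) (\<eta> p) *\<^sub>R \<phi> p (X p) - A p (X p) (\<eta> p) *\<^sub>R \<phi> p (Y p))))"
proof -
  interpret coherent_bundle \<A> E \<phi> D "1 / (real CARD('n) - 1)"
    using assms by unfold_locales (simp_all add: coherent_tangent_bundle_def)
  have "projectively_flat \<A> E \<phi> D \<longleftrightarrow>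
    (\<exists>A. dual_tensor_section \<A> (tangent_bundle \<A>) E UNIV A \<and> curvature_identity (1 / (real CARD('n) - 1)) \<phi> D UNIV A)"
  proof
    assume "projectively_flat \<A> E \<phi> D"
    then obtain A where "dual_tensor_section \<A> (tangent_bundle \<A>) E UNIV A"
      "curvature_identity (1 / (real CARD('n) - 1)) \<phi> D UNIV A" by (rule tensor_of_projectively_flat)
    then show "\<exists>A. dual_tensor_section \<A> (tangent_bundle \<A>) E UNIV A \<and>
      curvature_identity (1 / (real CARD('n) - 1)) \<phi> D UNIV A" by blast
  next
    assume "\<exists>A. dual_tensor_section \<A> (tangent_bundle \<A>) E UNIV A \<and>
      curvature_identity (1 / (real CARD('n) - 1)) \<phi> D UNIV A"
    then obtain A where "dual_tensor_section \<A> (tangent_bundle \<A>) E UNIV A"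
      "curvature_identity (1 / (real CARD('n) - 1)) \<phi> D UNIV A" by blast
    then show "projectively_flat \<A> E \<phi> D" by (rule projectively_flat_of_tensor)
  qed
  then show ?thesis by (simp only: curvature_identity_def ball_UNIV)
qed

end
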